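(* Let $H$ be a coquasitriangular Hopf $*$-algebra of real type over $\mathbb{C}$. If $(V,* )$ is a unitary right $H$-comodule then $B_+(V)$ is a $*$-algebra and $\Omega=\oplus_{p,q}\Omega^{p,q}$, $\Omega^{p,q}=\Lambda^p(V)\underline\otimes B_+(V)\underline\otimes\Lambda^q(V)$, with $\mathrm{d}=\partial+\bar\partial$, is a $*$-differential calculus over $B_+(V)$. Moreover, this is the factorisable Dolbeault double complex of a quantum complex structure.
   Context: A Hopf $*$-algebra has an antilinear antimultiplicative involution $*$ commuting with $\Delta,\epsilon$. A coquasitriangular structure is a convolution-invertible $\mathcal R:H\otimes H\to\mathbb{C}$ with $h_1g_1\mathcal R(g_2,h_2)=\mathcal R(g_1,h_1)g_2h_2$, $\mathcal R(fg,h)=\mathcal R(f,h_1)\mathcal R(g,h_2)$, $\mathcal R(f,gh)=\mathcal R(f_1,h)\mathcal R(f_2,g)$; real type means $\overline{\mathcal R(g,h)}=\mathcal R(h^*,g^* )$. Right $H$-comodules are braided by $\Psi_{V,W}(v\otimes w)=w_0\otimes v_0\,\mathcal R(v_1,w_1)$. A unitary comodule is a comodule with antilinear involution $*$ such that $( *\otimes * )\Delta_Vv=\Delta_V(v^* )$. Write $\dagger(x\otimes y)=y^*\otimes x^*$. Braided factorial: $[n,\Psi]!=\sum_{\sigma\in S_n}\Psi_\sigma$ on $V^{\otimes n}$, with $\Psi_\sigma$ obtained from a reduced expression of $\sigma$ by replacing simple transpositions by $\Psi_{V,V}$ in adjacent positions. $B=B_+(V)=TV/\oplus_n\ker[n,\Psi]!$,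 a braided Hopf algebra with $\Delta v=v\otimes1+1\otimes v$ on $V$; $\varpi:B\to V$ is projection to degree 1. $\Lambda(V)=TV/\langle\mathrm{Im}(\mathrm{id}+\Psi_{V,V})\rangle$. The braided super tensor product has product $(b\otimes c)(b'\otimes c')=(-1)^{|c||b'|}b\,\Psi(c\otimes b')\,c'$, with $B$ in degree 0. On $\Omega^{p,q}$: $\partial=(-1)^p((\wedge\otimes\mathrm{id})(\mathrm{id}\otimes\varpi\otimes\mathrm{id})(\mathrm{id}\otimes\Delta))\otimes\mathrm{id}$ and $\bar\partial=(-1)^p\mathrm{id}\otimes((\mathrm{id}\otimes\wedge)(\mathrm{id}\otimes\varpi\otimes\mathrm{id})(\Delta\otimes\mathrm{id}))$. The $*$-operation on $B$ is the antimultiplicative extension of $*$ on $V$; on $\Lambda(V)$ it is the graded-antimultiplicative extension, $(v\wedge w)^*=-w^*\wedge v^*$; on $\Omega$ it is $(\omega\otimes b\otimes\eta)^*=(-1)^{|\omega||\eta|}\eta^*\otimes b^*\otimes\omega^*$. A $*$-differential calculus here is a $*$-DGA: a DGA $(\Omega,\mathrm{d})$ with $\Omega^0=B$ and an antilinear degree-preserving involution with $(\xi\wedge\eta)^*=(-1)^{|\xi||\eta|}\eta^*\wedge\xi^*$ and $\mathrm{d}(\xi^* )=(\mathrm{d}\xi)^*$. It is the Dolbeault double complex of a quantum complex structure if $\Omega^m=\oplus_{p+q=m}\Omega^{p,q}$ as $B$-bimodules, $\wedge$ respects the bigrading, $\mathrm{d}=\partial+\bar\partial$ with $\partial:\Omega^{p,q}\to\Omega^{p+1,q}$,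 $\bar\partial:\Omega^{p,q}\to\Omega^{p,q+1}$ graded derivations, $\partial^2=\bar\partial^2=\partial\bar\partial+\bar\partial\partial=0$, $(\Omega^{p,q})^*=\Omega^{q,p}$, and $(\partial\xi)^*=\bar\partial(\xi^* )$. It is factorisable if $\wedge:\Omega^{p,0}\otimes_B\Omega^{0,q}\to\Omega^{p,q}$ and $\wedge:\Omega^{0,q}\otimes_B\Omega^{p,0}\to\Omega^{p,q}$ are bimodule isomorphisms for all $p,q$. *)

theory Defs
  imports Complex_Main "HOL-Library.Poly_Mapping" "HOL-Combinatorics.Permutations"
begin

section \<open>Complex vector spaces, tensor products, tensor algebra, quotients\<close>

class complex_vector = ab_group_add +
  fixes scaleC :: "complex \<Rightarrow> 'a \<Rightarrow> 'a" (infixr "*\<^sub>C" 75)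
  assumes scaleC_add_right: "c *\<^sub>C (x + y) = c *\<^sub>C x + c *\<^sub>C y"
    and scaleC_add_left: "(c + d) *\<^sub>C x = c *\<^sub>C x + d *\<^sub>C x"
    and scaleC_scaleC: "c *\<^sub>C (d *\<^sub>C x) = (c * d) *\<^sub>C x"
    and scaleC_one: "1 *\<^sub>C x = x"

global_interpretation cvec: vector_space "scaleC :: complex \<Rightarrow> 'a \<Rightarrow> 'a::complex_vector"
  by unfold_locales (simp_all add: scaleC_add_right scaleC_add_left scaleC_scaleC scaleC_one)

class complex_algebra_1 = complex_vector + ring_1 +
  assumes mult_scaleC_left: "(c *\<^sub>C x) * y = c *\<^sub>C (x * y)"
    and mult_scaleC_right: "x * (c *\<^sub>C y) = c *\<^sub>C (x * y)"

abbreviation clinear :: "('a::complex_vector \<Rightarrow> 'b::complex_vector) \<Rightarrow> bool"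
  where "clinear \<equiv> Vector_Spaces.linear scaleC scaleC"

definition cbilinear :: "('a::complex_vector \<Rightarrow> 'b::complex_vector \<Rightarrow> 'c::complex_vector) \<Rightarrow> bool"
  where "cbilinear f \<longleftrightarrow> (\<forall>x. clinear (f x)) \<and> (\<forall>y. clinear (\<lambda>x. f x y))"

definition antilinear :: "('a::complex_vector \<Rightarrow> 'b::complex_vector) \<Rightarrow> bool"
  where "antilinear f \<longleftrightarrow> (\<forall>x y. f (x + y) = f x + f y) \<and> (\<forall>c x. f (c *\<^sub>C x) = cnj c *\<^sub>C f x)"

lemma clinearI:
  assumes "\<And>x y. f (x + y) = f x + f y" "\<And>c x. f (c *\<^sub>C x) = c *\<^sub>C f x"
  shows "clinear f"
  using assms
  by (simp add: Vector_Spaces.linear_def module_hom_def module_hom_axioms_def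
      cvec.vector_space_axioms cvec.module_axioms)

lemma clinear_iff:
  "clinear f \<longleftrightarrow> (\<forall>x y. f (x + y) = f x + f y) \<and> (\<forall>c x. f (c *\<^sub>C x) = c *\<^sub>C f x)"
  using clinearI by (auto simp: Vector_Spaces.linear_def module_hom_def module_hom_axioms_def)

lemma clinear_zero: "clinear f \<Longrightarrow> f 0 = 0"
  by (metis clinear_iff add_cancel_right_right)

lemma clinear_diff: "clinear f \<Longrightarrow> f (x - y) = f x - f y"
  by (metis clinear_iff diff_add_cancel add_diff_cancel_right')

lemma clinear_vanishes_on_span:
  assumes "clinear f" "\<And>x. x \<in> S \<Longrightarrow> f x = 0" "y \<in> cvec.span S"
  shows "f y = 0"
  using assms(3)
  by (induction rule: cvec.span_induct_alt)
    (use assms in \<open>auto simp: clinear_iff clinear_zero\<close>)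

instantiation complex :: complex_algebra_1
begin
definition scaleC_complex :: "complex \<Rightarrow> complex \<Rightarrow> complex" where "scaleC_complex = (*)"
instance by standard (auto simp: scaleC_complex_def algebra_simps)
end

instantiation poly_mapping :: (type, complex_vector) complex_vector
begin
lift_definition scaleC_poly_mapping :: "complex \<Rightarrow> ('a \<Rightarrow>\<^sub>0 'b) \<Rightarrow> ('a \<Rightarrow>\<^sub>0 'b)"
  is "\<lambda>c f k. c *\<^sub>C f k"
  by (erule finite_subset[rotated]) auto
instance
  by standard (transfer; auto simp: fun_eq_iff scaleC_add_right scaleC_add_left scaleC_scaleC scaleC_one)+
end

text \<open>\<open>'k \<Rightarrow>\<^sub>0 complex\<close> is the vector space with basis \<open>'k\<close>.\<close>

abbreviation basis_vec :: "'k \<Rightarrow> ('k \<Rightarrow>\<^sub>0 complex)"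
  where "basis_vec k \<equiv> Poly_Mapping.single k 1"

lemma free_universal: "\<exists>g. clinear g \<and> (\<forall>k. g (basis_vec k) = f k)"
  for f :: "'k \<Rightarrow> 'a::complex_vector"
proof -
  define g where "g p = (\<Sum>k\<in>Poly_Mapping.keys p. Poly_Mapping.lookup p k *\<^sub>C f k)" for p
  have g: "g p = (\<Sum>k\<in>S. Poly_Mapping.lookup p k *\<^sub>C f k)"
    if "finite S" "Poly_Mapping.keys p \<subseteq> S" for p S
    unfolding g_def using that
    by (intro sum.mono_neutral_left) (auto simp: in_keys_iff)
  have "g (p + q) = g p + g q" for p q
  proof -
    let ?S = "Poly_Mapping.keys p \<union> Poly_Mapping.keys q"
    have "g (p + q) = (\<Sum>k\<in>?S. Poly_Mapping.lookup (p + q) k *\<^sub>C f k)"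
      by (intro g) (auto simp: Poly_Mapping.keys_add)
    also have "\<dots> = (\<Sum>k\<in>?S. Poly_Mapping.lookup p k *\<^sub>C f k) + (\<Sum>k\<in>?S. Poly_Mapping.lookup q k *\<^sub>C f k)"
      by (simp add: lookup_add scaleC_add_left sum.distrib)
    also have "\<dots> = g p + g q"
      by (subst (1 2) g[of ?S]) auto
    finally show ?thesis .
  qed
  moreover have "g (c *\<^sub>C p) = c *\<^sub>C g p" for c p
  proof -
    have l: "Poly_Mapping.lookup (c *\<^sub>C p) k = c * Poly_Mapping.lookup p k" for k
      by (simp add: scaleC_poly_mapping.rep_eq scaleC_complex_def)
    have "g (c *\<^sub>C p) = (\<Sum>k\<in>Poly_Mapping.keys p. Poly_Mapping.lookup (c *\<^sub>C p) k *\<^sub>C f k)"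
      by (intro g) (auto simp: in_keys_iff l)
    then show ?thesis
      by (simp add: l g_def cvec.scale_sum_right)
  qed
  moreover have "g (basis_vec k) = f k" for k
    by (simp add: g_def scaleC_one)
  ultimately show ?thesis using clinearI by blast
qed

lemma free_span: "p \<in> cvec.span (range basis_vec)" for p :: "'k \<Rightarrow>\<^sub>0 complex"
proof -
  have "p = (\<Sum>k\<in>Poly_Mapping.keys p. Poly_Mapping.lookup p k *\<^sub>C basis_vec k)"
    by (rule poly_mapping_eqI)
      (simp add: lookup_sum lookup_single scaleC_poly_mapping.rep_eq scaleC_complex_def in_keys_iff when_def
        if_distrib[of "(*) _"] cong: if_cong)
  then show ?thesis
    by (metis (no_types, lifting) cvec.span_sum cvec.span_scale cvec.span_base rangeI)
qed

lemma clinear_eq_on_span: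
  assumes "clinear f" "clinear g" "\<And>x. x \<in> S \<Longrightarrow> f x = g x" "y \<in> cvec.span S"
  shows "f y = g y"
proof -
  have "clinear (\<lambda>x. f x - g x)"
    using assms(1,2) by (intro clinearI) (auto simp: clinear_iff cvec.scale_right_diff_distrib)
  from clinear_vanishes_on_span[OF this _ assms(4)] assms(3) show ?thesis by simp
qed


subsection \<open>Tensor product over the complex numbers\<close>

definition tensor_relations :: "('a::complex_vector \<times> 'b::complex_vector \<Rightarrow>\<^sub>0 complex) set"
  where "tensor_relations =
    {basis_vec (x + y, z) - basis_vec (x, z) - basis_vec (y, z) | x y z. True} \<union>
    {basis_vec (x, y + z) - basis_vec (x, y) - basis_vec (x, z) | x y z. True} \<union>
    {basis_vec (c *\<^sub>C x, y) - c *\<^sub>C basis_vec (x, y) | c x y. True} \<union>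
    {basis_vec (x, c *\<^sub>C y) - c *\<^sub>C basis_vec (x, y) | c x y. True}"

lemma equivp_span: "equivp (\<lambda>x y. x - y \<in> cvec.span S)"
proof (rule equivpI)
  show "reflp (\<lambda>x y. x - y \<in> cvec.span S)"
    by (simp add: reflp_def cvec.span_zero)
  show "symp (\<lambda>x y. x - y \<in> cvec.span S)"
    by (auto simp: symp_def dest: cvec.span_neg)
  show "transp (\<lambda>x y. x - y \<in> cvec.span S)"
    unfolding transp_def by (metis cvec.span_add diff_add_cancel add_diff_eq)
qed

lemma span_congs:
  "x - y \<in> cvec.span S \<Longrightarrow> x' - y' \<in> cvec.span S \<Longrightarrow> (x + x') - (y + y') \<in> cvec.span S"
  "x - y \<in> cvec.span S \<Longrightarrow> x' - y' \<in> cvec.span S \<Longrightarrow> (x - x') - (y - y') \<in> cvec.span S"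
  "x - y \<in> cvec.span S \<Longrightarrow> (- x) - (- y) \<in> cvec.span S"
  "x - y \<in> cvec.span S \<Longrightarrow> c *\<^sub>C x - c *\<^sub>C y \<in> cvec.span S"
     apply (metis cvec.span_add add_diff_add)
    apply (metis cvec.span_diff diff_diff_eq2 add.commute diff_add_eq add_diff_eq diff_diff_eq)
   apply (metis cvec.span_neg minus_diff_minus)
  by (metis cvec.span_scale cvec.scale_right_diff_distrib)

quotient_type (overloaded) ('a, 'b) tensor =
  "('a::complex_vector \<times> 'b::complex_vector) \<Rightarrow>\<^sub>0 complex" / "\<lambda>s t. s - t \<in> cvec.span tensor_relations"
  by (rule equivp_span)

type_notation tensor (infixr "\<otimes>" 22)

instantiation tensor :: (complex_vector, complex_vector) complex_vector
begin
lift_definition zero_tensor :: "'a \<otimes> 'b" is 0 .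
lift_definition plus_tensor :: "'a \<otimes> 'b \<Rightarrow> 'a \<otimes> 'b \<Rightarrow> 'a \<otimes> 'b" is "(+)" by (rule span_congs)
lift_definition minus_tensor :: "'a \<otimes> 'b \<Rightarrow> 'a \<otimes> 'b \<Rightarrow> 'a \<otimes> 'b" is "(-)" by (rule span_congs)
lift_definition uminus_tensor :: "'a \<otimes> 'b \<Rightarrow> 'a \<otimes> 'b" is uminus by (rule span_congs)
lift_definition scaleC_tensor :: "complex \<Rightarrow> 'a \<otimes> 'b \<Rightarrow> 'a \<otimes> 'b" is scaleC by (rule span_congs)
instance
  by standard
    (transfer; simp add: algebra_simps scaleC_add_right scaleC_add_left scaleC_scaleC scaleC_one cvec.span_zero)+
end

lift_definition tens :: "'a::complex_vector \<Rightarrow> 'b::complex_vector \<Rightarrow> 'a \<otimes> 'b" (infixr "\<otimes>" 74)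
  is "\<lambda>x y. basis_vec (x, y)" .

text \<open>The linear, respectively antilinear, extension of a map given on pure tensors.\<close>

definition tlift :: "('a::complex_vector \<Rightarrow> 'b::complex_vector \<Rightarrow> 'c::complex_vector) \<Rightarrow> 'a \<otimes> 'b \<Rightarrow> 'c"
  where "tlift f = (SOME g. clinear g \<and> (\<forall>x y. g (x \<otimes> y) = f x y))"

definition tlift_anti :: "('a::complex_vector \<Rightarrow> 'b::complex_vector \<Rightarrow> 'c::complex_vector) \<Rightarrow> 'a \<otimes> 'b \<Rightarrow> 'c"
  where "tlift_anti f = (SOME g. antilinear g \<and> (\<forall>x y. g (x \<otimes> y) = f x y))"

lemma cbilinear_tens: "cbilinear (\<lambda>x y. x \<otimes> y)"
proof -
  have gen: "r \<in> cvec.span tensor_relations" if "r \<in> tensor_relations"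
    for r :: "('a \<times> 'b) \<Rightarrow>\<^sub>0 complex"
    using that by (rule cvec.span_base)
  have "x \<otimes> (y + z) = x \<otimes> y + x \<otimes> z" for x :: 'a and y z :: 'b
    by transfer (rule gen, unfold tensor_relations_def diff_diff_eq[symmetric], blast)
  moreover have "(x + y) \<otimes> z = x \<otimes> z + y \<otimes> z" for x y :: 'a and z :: 'b
    by transfer (rule gen, unfold tensor_relations_def diff_diff_eq[symmetric], blast)
  moreover have "(c *\<^sub>C x) \<otimes> y = c *\<^sub>C (x \<otimes> y)" for c and x :: 'a and y :: 'b
    by transfer (rule gen, unfold tensor_relations_def, blast)
  moreover have "x \<otimes> (c *\<^sub>C y) = c *\<^sub>C (x \<otimes> y)" for c and x :: 'a and y :: 'b
    by transfer (rule gen, unfold tensor_relations_def, blast)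
  ultimately show ?thesis
    unfolding cbilinear_def clinear_iff by auto
qed

lemma tensor_span: "z \<in> cvec.span {x \<otimes> y | x y. True}"
proof -
  obtain p where p: "z = abs_tensor p" by (metis Quotient_abs_rep[OF Quotient_tensor])
  have lin: "abs_tensor (q + r) = abs_tensor q + abs_tensor r" "abs_tensor (c *\<^sub>C q) = c *\<^sub>C abs_tensor q"
    for q r :: "('a \<times> 'b) \<Rightarrow>\<^sub>0 complex" and c
    by (simp_all add: plus_tensor.abs_eq scaleC_tensor.abs_eq)
  have "abs_tensor p \<in> cvec.span {x \<otimes> y | x y. True}"
    using free_span[of p]
  proof (induction rule: cvec.span_induct_alt)
    case base
    then show ?case by (simp add: zero_tensor.abs_eq[symmetric] cvec.span_zero)
  next
    case (step c k q)
    then obtain x y where "k = basis_vec (x, y)" by auto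
    then have "abs_tensor k = x \<otimes> y" by (simp add: tens.abs_eq)
    then show ?case using step
      by (metis (mono_tags, lifting) lin cvec.span_add cvec.span_scale cvec.span_base mem_Collect_eq)
  qed
  then show ?thesis by (simp add: p)
qed

lemma tensor_universal:
  assumes "cbilinear f"
  shows "\<exists>!g. clinear g \<and> (\<forall>x y. g (x \<otimes> y) = f x y)"
proof (rule ex_ex1I)
  obtain g where g: "clinear g" "\<And>x y. g (basis_vec (x, y)) = f x y"
    using free_universal[of "\<lambda>(x, y). f x y"] by auto
  have g0: "g r = 0" if "r \<in> cvec.span tensor_relations" for r
    by (rule clinear_vanishes_on_span[OF g(1) _ that])
      (use assms g in \<open>auto simp: tensor_relations_def clinear_diff cbilinear_def clinear_iff\<close>)
  define h where "h z = g (rep_tensor z)" for z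
  have h: "h (abs_tensor p) = g p" for p
  proof -
    have "rep_tensor (abs_tensor p) - p \<in> cvec.span tensor_relations"
      using Quotient_rep_abs[OF Quotient_tensor, of p] by (simp add: cvec.span_zero)
    from g0[OF this] show ?thesis by (simp add: h_def clinear_diff[OF g(1)])
  qed
  have "h (x + y) = h x + h y" "h (c *\<^sub>C x) = c *\<^sub>C h x" for x y c
  proof -
    obtain p q where "x = abs_tensor p" "y = abs_tensor q"
      by (metis Quotient_abs_rep[OF Quotient_tensor])
    then show "h (x + y) = h x + h y" "h (c *\<^sub>C x) = c *\<^sub>C h x"
      using g(1) by (simp_all add: h plus_tensor.abs_eq scaleC_tensor.abs_eq clinear_iff)
  qed
  moreover have "h (x \<otimes> y) = f x y" for x y
    by (simp add: tens.abs_eq h g)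
  ultimately show "\<exists>g. clinear g \<and> (\<forall>x y. g (x \<otimes> y) = f x y)"
    using clinearI by blast
next
  fix g h assume *: "clinear g \<and> (\<forall>x y. g (x \<otimes> y) = f x y)" "clinear h \<and> (\<forall>x y. h (x \<otimes> y) = f x y)"
  show "g = h"
  proof
    fix z
    show "g z = h z"
      by (rule clinear_eq_on_span[OF _ _ _ tensor_span]) (use * in auto)
  qed
qed

definition tmap :: "('a::complex_vector \<Rightarrow> 'c::complex_vector) \<Rightarrow> ('b::complex_vector \<Rightarrow> 'd::complex_vector)
    \<Rightarrow> 'a \<otimes> 'b \<Rightarrow> 'c \<otimes> 'd"
  where "tmap f g = tlift (\<lambda>x y. f x \<otimes> g y)"

definition tmap_anti :: "('a::complex_vector \<Rightarrow> 'c::complex_vector) \<Rightarrow> ('b::complex_vector \<Rightarrow> 'd::complex_vector)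
    \<Rightarrow> 'a \<otimes> 'b \<Rightarrow> 'c \<otimes> 'd"
  where "tmap_anti f g = tlift_anti (\<lambda>x y. f x \<otimes> g y)"

definition tassoc :: "('a::complex_vector \<otimes> 'b::complex_vector) \<otimes> 'c::complex_vector \<Rightarrow> 'a \<otimes> 'b \<otimes> 'c"
  where "tassoc = tlift (\<lambda>u z. tlift (\<lambda>x y. x \<otimes> y \<otimes> z) u)"


subsection \<open>Tensor algebra\<close>

text \<open>The free algebra on the set \<open>'v\<close> (with basis the words in \<open>'v\<close>) modulo linearity in each letter.\<close>

definition tensor_algebra_relations :: "('v::complex_vector list \<Rightarrow>\<^sub>0 complex) set"
  where "tensor_algebra_relations =
    {basis_vec (xs @ [v + w] @ ys) - basis_vec (xs @ [v] @ ys) - basis_vec (xs @ [w] @ ys) | xs v w ys. True} \<union>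
    {basis_vec (xs @ [c *\<^sub>C v] @ ys) - c *\<^sub>C basis_vec (xs @ [v] @ ys) | xs c v ys. True}"

quotient_type (overloaded) 'v tensor_algebra =
  "'v::complex_vector list \<Rightarrow>\<^sub>0 complex" / "\<lambda>s t. s - t \<in> cvec.span tensor_algebra_relations"
  by (rule equivp_span)

instantiation tensor_algebra :: (complex_vector) complex_vector
begin
lift_definition zero_tensor_algebra :: "'a tensor_algebra" is 0 .
lift_definition plus_tensor_algebra :: "'a tensor_algebra \<Rightarrow> 'a tensor_algebra \<Rightarrow> 'a tensor_algebra"
  is "(+)" by (rule span_congs)
lift_definition minus_tensor_algebra :: "'a tensor_algebra \<Rightarrow> 'a tensor_algebra \<Rightarrow> 'a tensor_algebra"
  is "(-)" by (rule span_congs)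
lift_definition uminus_tensor_algebra :: "'a tensor_algebra \<Rightarrow> 'a tensor_algebra"
  is uminus by (rule span_congs)
lift_definition scaleC_tensor_algebra :: "complex \<Rightarrow> 'a tensor_algebra \<Rightarrow> 'a tensor_algebra"
  is scaleC by (rule span_congs)
instance
  by standard
    (transfer; simp add: algebra_simps scaleC_add_right scaleC_add_left scaleC_scaleC scaleC_one cvec.span_zero)+
end

text \<open>\<open>tword [v\<^sub>1, \<dots>, v\<^sub>n]\<close> is \<open>v\<^sub>1 \<otimes> \<dots> \<otimes> v\<^sub>n\<close>.\<close>

lift_definition tword :: "'v::complex_vector list \<Rightarrow> 'v tensor_algebra"
  is "\<lambda>xs. basis_vec xs" .

definition multilinear :: "('v::complex_vector list \<Rightarrow> 'c::complex_vector) \<Rightarrow> bool"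
  where "multilinear f \<longleftrightarrow> (\<forall>xs ys. clinear (\<lambda>v. f (xs @ [v] @ ys)))"

definition talift :: "('v::complex_vector list \<Rightarrow> 'c::complex_vector) \<Rightarrow> 'v tensor_algebra \<Rightarrow> 'c"
  where "talift f = (SOME g. clinear g \<and> (\<forall>xs. g (tword xs) = f xs))"

definition talift_anti :: "('v::complex_vector list \<Rightarrow> 'c::complex_vector) \<Rightarrow> 'v tensor_algebra \<Rightarrow> 'c"
  where "talift_anti f = (SOME g. antilinear g \<and> (\<forall>xs. g (tword xs) = f xs))"

lemma multilinear_tword: "multilinear (tword :: 'v::complex_vector list \<Rightarrow> _)"
proof -
  have gen: "r \<in> cvec.span tensor_algebra_relations" if "r \<in> tensor_algebra_relations"
    for r :: "'v::complex_vector list \<Rightarrow>\<^sub>0 complex"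
    using that by (rule cvec.span_base)
  have "tword (xs @ [v + w] @ ys) = tword (xs @ [v] @ ys) + tword (xs @ [w] @ ys)" for xs ys and v w :: "'v::complex_vector"
    by transfer (rule gen, unfold tensor_algebra_relations_def diff_diff_eq[symmetric], blast)
  moreover have "tword (xs @ [c *\<^sub>C v] @ ys) = c *\<^sub>C tword (xs @ [v] @ ys)" for xs ys c and v :: "'v::complex_vector"
    by transfer (rule gen, unfold tensor_algebra_relations_def, blast)
  ultimately show ?thesis
    unfolding multilinear_def clinear_iff by auto
qed

lemma tensor_algebra_span: "z \<in> cvec.span (range tword)"
proof -
  obtain p where p: "z = abs_tensor_algebra p" by (metis Quotient_abs_rep[OF Quotient_tensor_algebra])
  have lin: "abs_tensor_algebra (q + r) = abs_tensor_algebra q + abs_tensor_algebra r"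
    "abs_tensor_algebra (c *\<^sub>C q) = c *\<^sub>C abs_tensor_algebra q"
    for q r :: "'a list \<Rightarrow>\<^sub>0 complex" and c
    by (simp_all add: plus_tensor_algebra.abs_eq scaleC_tensor_algebra.abs_eq)
  have "abs_tensor_algebra p \<in> cvec.span (range tword)"
    using free_span[of p]
  proof (induction rule: cvec.span_induct_alt)
    case base
    then show ?case by (simp add: zero_tensor_algebra.abs_eq[symmetric] cvec.span_zero)
  next
    case (step c k q)
    then obtain xs where "k = basis_vec xs" by auto
    then have "abs_tensor_algebra k = tword xs" by (simp add: tword.abs_eq)
    then show ?case using step
      by (metis lin cvec.span_add cvec.span_scale cvec.span_base rangeI)
  qed
  then show ?thesis by (simp add: p)
qed

lemma tensor_algebra_universal:
  assumes "multilinear f"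
  shows "\<exists>!g. clinear g \<and> (\<forall>xs. g (tword xs) = f xs)"
proof (rule ex_ex1I)
  obtain g where g: "clinear g" "\<And>xs. g (basis_vec xs) = f xs"
    using free_universal[of f] by auto
  have g0: "g r = 0" if "r \<in> cvec.span tensor_algebra_relations" for r
    by (rule clinear_vanishes_on_span[OF g(1) _ that])
      (use assms g in \<open>auto simp: tensor_algebra_relations_def clinear_diff multilinear_def clinear_iff\<close>)
  define h where "h z = g (rep_tensor_algebra z)" for z
  have h: "h (abs_tensor_algebra p) = g p" for p
  proof -
    have "rep_tensor_algebra (abs_tensor_algebra p) - p \<in> cvec.span tensor_algebra_relations"
      using Quotient_rep_abs[OF Quotient_tensor_algebra, of p] by (simp add: cvec.span_zero)
    from g0[OF this] show ?thesis by (simp add: h_def clinear_diff[OF g(1)])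
  qed
  have "h (x + y) = h x + h y" "h (c *\<^sub>C x) = c *\<^sub>C h x" for x y c
  proof -
    obtain p q where "x = abs_tensor_algebra p" "y = abs_tensor_algebra q"
      by (metis Quotient_abs_rep[OF Quotient_tensor_algebra])
    then show "h (x + y) = h x + h y" "h (c *\<^sub>C x) = c *\<^sub>C h x"
      using g(1) by (simp_all add: h plus_tensor_algebra.abs_eq scaleC_tensor_algebra.abs_eq clinear_iff)
  qed
  moreover have "h (tword xs) = f xs" for xs
    by (simp add: tword.abs_eq h g)
  ultimately show "\<exists>g. clinear g \<and> (\<forall>xs. g (tword xs) = f xs)"
    using clinearI by blast
next
  fix g h assume *: "clinear g \<and> (\<forall>xs. g (tword xs) = f xs)" "clinear h \<and> (\<forall>xs. h (tword xs) = f xs)"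
  show "g = h"
  proof
    fix z
    show "g z = h z"
      by (rule clinear_eq_on_span[OF _ _ _ tensor_algebra_span]) (use * in auto)
  qed
qed

definition tmul :: "'v::complex_vector tensor_algebra \<Rightarrow> 'v tensor_algebra \<Rightarrow> 'v tensor_algebra"
  where "tmul x y = talift (\<lambda>xs. talift (\<lambda>ys. tword (xs @ ys)) y) x"

definition tdeg :: "nat \<Rightarrow> 'v::complex_vector tensor_algebra set"
  where "tdeg n = cvec.span {tword xs | xs. length xs = n}"


subsection \<open>Quotient spaces\<close>

text \<open>A HOL type cannot depend on the subspace one divides by. Therefore all quotients of
  \<open>'a\<close> are placed side by side in one vector space, \<open>'a quotients\<close>, the product of the spaces
  \<open>'a / span J\<close> over all \<open>J :: 'a set\<close>. The quotient \<open>'a / span I\<close> is the \<open>I\<close>-th factor: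
  it is the subspace \<open>range (qcls I)\<close>, and \<open>qcls I x\<close> is the class of \<open>x\<close>.\<close>

lemma equivp_quotients:
  "equivp (\<lambda>(f :: 'a::complex_vector set \<Rightarrow> 'a) g. \<forall>J. f J - g J \<in> cvec.span J)"
proof (rule equivpI)
  show "reflp (\<lambda>(f :: 'a set \<Rightarrow> 'a) g. \<forall>J. f J - g J \<in> cvec.span J)"
    by (simp add: reflp_def cvec.span_zero)
  show "symp (\<lambda>(f :: 'a set \<Rightarrow> 'a) g. \<forall>J. f J - g J \<in> cvec.span J)"
    unfolding symp_def by (metis minus_diff_eq cvec.span_neg)
  show "transp (\<lambda>(f :: 'a set \<Rightarrow> 'a) g. \<forall>J. f J - g J \<in> cvec.span J)"
    unfolding transp_def by (metis cvec.span_add diff_add_cancel add_diff_eq)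
qed

quotient_type (overloaded) 'a quotients =
  "'a::complex_vector set \<Rightarrow> 'a" / "\<lambda>f g. \<forall>J. f J - g J \<in> cvec.span J"
  by (rule equivp_quotients)

instantiation quotients :: (complex_vector) complex_vector
begin
lift_definition zero_quotients :: "'a quotients" is "\<lambda>J. 0" .
lift_definition plus_quotients :: "'a quotients \<Rightarrow> 'a quotients \<Rightarrow> 'a quotients"
  is "\<lambda>f g J. f J + g J" by (simp add: span_congs)
lift_definition minus_quotients :: "'a quotients \<Rightarrow> 'a quotients \<Rightarrow> 'a quotients"
  is "\<lambda>f g J. f J - g J" by (blast intro: span_congs)
lift_definition uminus_quotients :: "'a quotients \<Rightarrow> 'a quotients"
  is "\<lambda>f J. - f J" by (blast intro: span_congs)
lift_definition scaleC_quotients :: "complex \<Rightarrow> 'a quotients \<Rightarrow> 'a quotients"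
  is "\<lambda>c f J. c *\<^sub>C f J" by (blast intro: span_congs)
instance
  by standard
    (transfer; simp add: algebra_simps scaleC_add_right scaleC_add_left scaleC_scaleC scaleC_one cvec.span_zero)+
end

lift_definition qcls :: "'a::complex_vector set \<Rightarrow> 'a \<Rightarrow> 'a quotients"
  is "\<lambda>I x J. if J = I then x else 0" .

lemma clinear_qcls: "clinear (qcls I)"
proof (rule clinearI)
  show "qcls I (x + y) = qcls I x + qcls I y" for x y
    by transfer (simp add: cvec.span_zero)
  show "qcls I (c *\<^sub>C x) = c *\<^sub>C qcls I x" for c x
    by transfer (simp add: cvec.span_zero)
qed

lemma qcls_eq_iff: "qcls I x = qcls I y \<longleftrightarrow> x - y \<in> cvec.span I"
  by transfer (auto simp: cvec.span_zero)

text \<open>Maps induced on a quotient by a map on representatives; their values are determined on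
  (pairs from) \<open>range (qcls I)\<close> only, which is where they are used.\<close>

definition qlift :: "'a::complex_vector set \<Rightarrow> ('a \<Rightarrow> 'c::complex_vector) \<Rightarrow> 'a quotients \<Rightarrow> 'c"
  where "qlift I f = (SOME g. clinear g \<and> (\<forall>x. g (qcls I x) = f x))"

definition qlift_anti :: "'a::complex_vector set \<Rightarrow> ('a \<Rightarrow> 'c::complex_vector) \<Rightarrow> 'a quotients \<Rightarrow> 'c"
  where "qlift_anti I f = (SOME g. antilinear g \<and> (\<forall>x. g (qcls I x) = f x))"

definition qlift2 :: "'a::complex_vector set \<Rightarrow> ('a \<Rightarrow> 'a \<Rightarrow> 'c::complex_vector)
    \<Rightarrow> 'a quotients \<Rightarrow> 'a quotients \<Rightarrow> 'c"
  where "qlift2 I f = (SOME m. cbilinear m \<and> (\<forall>x y. m (qcls I x) (qcls I y) = f x y))"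


section \<open>Coquasitriangular Hopf *-algebras of real type and unitary comodules\<close>

text \<open>Sweedler sums are written with \<open>tlift\<close>: \<open>tlift (\<lambda>x y. f x y) (\<Delta> h)\<close> is \<open>f h\<^sub>1 h\<^sub>2\<close>.\<close>

locale hopf_algebra =
  fixes comult :: "'h::complex_algebra_1 \<Rightarrow> 'h \<otimes> 'h"
    and counit :: "'h \<Rightarrow> complex"
    and antipode :: "'h \<Rightarrow> 'h"
  assumes comult_linear: "clinear comult"
    and counit_linear: "clinear counit"
    and antipode_linear: "clinear antipode"
    and coassoc: "tassoc (tmap comult id (comult h)) = tmap id comult (comult h)"
    and counit_left: "tlift (\<lambda>x y. counit x *\<^sub>C y) (comult h) = h"
    and counit_right: "tlift (\<lambda>x y. counit y *\<^sub>C x) (comult h) = h"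
    and comult_mult: "comult (g * h) =
      tlift (\<lambda>g1 g2. tlift (\<lambda>h1 h2. (g1 * h1) \<otimes> (g2 * h2)) (comult h)) (comult g)"
    and comult_one: "comult 1 = 1 \<otimes> 1"
    and counit_mult: "counit (g * h) = counit g * counit h"
    and counit_one: "counit 1 = 1"
    and antipode_left: "tlift (\<lambda>x y. antipode x * y) (comult h) = counit h *\<^sub>C 1"
    and antipode_right: "tlift (\<lambda>x y. x * antipode y) (comult h) = counit h *\<^sub>C 1"

locale hopf_star_algebra = hopf_algebra comult counit antipode
  for comult :: "'h::complex_algebra_1 \<Rightarrow> 'h \<otimes> 'h" and counit antipode +
  fixes star :: "'h \<Rightarrow> 'h"
  assumes star_antilinear: "antilinear star"
    and star_mult: "star (g * h) = star h * star g"
    and star_star: "star (star h) = h"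
    and star_comult: "comult (star h) = tmap_anti star star (comult h)"
    and star_counit: "counit (star h) = cnj (counit h)"

locale coquasitriangular_hopf_algebra = hopf_algebra comult counit antipode
  for comult :: "'h::complex_algebra_1 \<Rightarrow> 'h \<otimes> 'h" and counit antipode +
  fixes R :: "'h \<otimes> 'h \<Rightarrow> complex"
  assumes R_linear: "clinear R"
    and R_convolution_invertible: "\<exists>R'. clinear R' \<and> (\<forall>g h.
      tlift (\<lambda>g1 g2. tlift (\<lambda>h1 h2. R (g1 \<otimes> h1) * R' (g2 \<otimes> h2)) (comult h)) (comult g) = counit g * counit h \<and>
      tlift (\<lambda>g1 g2. tlift (\<lambda>h1 h2. R' (g1 \<otimes> h1) * R (g2 \<otimes> h2)) (comult h)) (comult g) = counit g * counit h)"
    and R_commute: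
      "tlift (\<lambda>g1 g2. tlift (\<lambda>h1 h2. R (g2 \<otimes> h2) *\<^sub>C (h1 * g1)) (comult h)) (comult g) =
       tlift (\<lambda>g1 g2. tlift (\<lambda>h1 h2. R (g1 \<otimes> h1) *\<^sub>C (g2 * h2)) (comult h)) (comult g)"
    and R_mult_left: "R ((f * g) \<otimes> h) = tlift (\<lambda>h1 h2. R (f \<otimes> h1) * R (g \<otimes> h2)) (comult h)"
    and R_mult_right: "R (f \<otimes> (g * h)) = tlift (\<lambda>f1 f2. R (f1 \<otimes> h) * R (f2 \<otimes> g)) (comult f)"

locale real_coquasitriangular_hopf_star_algebra =
  hopf_star_algebra comult counit antipode star + coquasitriangular_hopf_algebra comult counit antipode R
  for comult :: "'h::complex_algebra_1 \<Rightarrow> 'h \<otimes> 'h" and counit antipode star R +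
  assumes real_type: "cnj (R (g \<otimes> h)) = R (star h \<otimes> star g)"

definition right_comodule ::
  "('h::complex_algebra_1 \<Rightarrow> 'h \<otimes> 'h) \<Rightarrow> ('h \<Rightarrow> complex) \<Rightarrow> ('v::complex_vector \<Rightarrow> 'v \<otimes> 'h) \<Rightarrow> bool"
  where "right_comodule comult counit \<delta> \<longleftrightarrow> clinear \<delta> \<and>
    (\<forall>v. tassoc (tmap \<delta> id (\<delta> v)) = tmap id comult (\<delta> v)) \<and>
    (\<forall>v. tlift (\<lambda>v0 v1. counit v1 *\<^sub>C v0) (\<delta> v) = v)"

definition unitary_comodule ::
  "('h::complex_algebra_1 \<Rightarrow> 'h \<otimes> 'h) \<Rightarrow> ('h \<Rightarrow> complex) \<Rightarrow> ('h \<Rightarrow> 'h)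
    \<Rightarrow> ('v::complex_vector \<Rightarrow> 'v \<otimes> 'h) \<Rightarrow> ('v \<Rightarrow> 'v) \<Rightarrow> bool"
  where "unitary_comodule comult counit starH \<delta> starV \<longleftrightarrow>
    right_comodule comult counit \<delta> \<and> antilinear starV \<and> (\<forall>v. starV (starV v) = v) \<and>
    (\<forall>v. tmap_anti starV starH (\<delta> v) = \<delta> (starV v))"


section \<open>Braidings and braided super tensor products\<close>

definition braiding :: "('h::complex_vector \<otimes> 'h \<Rightarrow> complex) \<Rightarrow> ('v::complex_vector \<Rightarrow> 'v \<otimes> 'h)
    \<Rightarrow> ('w::complex_vector \<Rightarrow> 'w \<otimes> 'h) \<Rightarrow> 'v \<otimes> 'w \<Rightarrow> 'w \<otimes> 'v"
  where "braiding R \<delta>V \<delta>W = tlift (\<lambda>v w.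
    tlift (\<lambda>v0 v1. tlift (\<lambda>w0 w1. R (v1 \<otimes> w1) *\<^sub>C (w0 \<otimes> v0)) (\<delta>W w)) (\<delta>V v))"

definition tensor_coaction :: "('v::complex_vector \<Rightarrow> 'v \<otimes> 'h::complex_algebra_1)
    \<Rightarrow> ('w::complex_vector \<Rightarrow> 'w \<otimes> 'h) \<Rightarrow> 'v \<otimes> 'w \<Rightarrow> ('v \<otimes> 'w) \<otimes> 'h"
  where "tensor_coaction \<delta>V \<delta>W = tlift (\<lambda>v w.
    tlift (\<lambda>v0 v1. tlift (\<lambda>w0 w1. (v0 \<otimes> w0) \<otimes> (v1 * w1)) (\<delta>W w)) (\<delta>V v))"

text \<open>Graded algebras live on the subspace spanned by their homogeneous components \<open>deg A n\<close>
  of the ambient type; outside of that subspace \<open>mul A\<close> and \<open>coact A\<close> are irrelevant.\<close>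

record 'a graded_algebra =
  deg :: "nat \<Rightarrow> 'a set"
  mul :: "'a \<Rightarrow> 'a \<Rightarrow> 'a"
  unit :: 'a

record (overloaded) ('a::complex_vector, 'h::complex_vector) graded_comodule_algebra = "'a graded_algebra" +
  coact :: "'a \<Rightarrow> 'a \<otimes> 'h"

definition total_space :: "('a::complex_vector, 'm) graded_algebra_scheme \<Rightarrow> 'a set"
  where "total_space A = cvec.span (\<Union>n. deg A n)"

text \<open>The bilinear product determined on homogeneous elements by \<open>(b \<otimes> c)(b' \<otimes> c') = (-1)\<^bsup>|c||b'|\<^esup> b \<Psi>(c \<otimes> b') c'\<close>.\<close>

definition super_mul :: "('h::complex_vector \<otimes> 'h \<Rightarrow> complex)
    \<Rightarrow> ('a::complex_vector, 'h) graded_comodule_algebra \<Rightarrow> ('c::complex_vector, 'h) graded_comodule_algebra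
    \<Rightarrow> 'a \<otimes> 'c \<Rightarrow> 'a \<otimes> 'c \<Rightarrow> 'a \<otimes> 'c"
  where "super_mul R A C = (SOME m. cbilinear m \<and>
    (\<forall>i j k l. \<forall>b\<in>deg A i. \<forall>c\<in>deg C j. \<forall>b'\<in>deg A k. \<forall>c'\<in>deg C l.
      m (b \<otimes> c) (b' \<otimes> c') = (-1) ^ (j * k) *\<^sub>C
        tlift (\<lambda>x y. mul A b x \<otimes> mul C y c') (braiding R (coact C) (coact A) (c \<otimes> b'))))"

definition super_tensor :: "('h::complex_algebra_1 \<otimes> 'h \<Rightarrow> complex)
    \<Rightarrow> ('a::complex_vector, 'h) graded_comodule_algebra \<Rightarrow> ('c::complex_vector, 'h) graded_comodule_algebra
    \<Rightarrow> ('a \<otimes> 'c, 'h) graded_comodule_algebra"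
  where "super_tensor R A C =
    \<lparr>deg = \<lambda>n. cvec.span (\<Union>i\<le>n. {b \<otimes> c | b c. b \<in> deg A i \<and> c \<in> deg C (n - i)}),
     mul = super_mul R A C,
     unit = unit A \<otimes> unit C,
     coact = tensor_coaction (coact A) (coact C)\<rparr>"


section \<open>Braided factorials, \<open>B\<^sub>+(V)\<close> and \<open>\<Lambda>(V)\<close>\<close>

text \<open>\<open>\<Psi>\<close> in tensor positions \<open>i\<close>, \<open>i + 1\<close>, counted from 0.\<close>

definition braid_at :: "('v::complex_vector \<otimes> 'v \<Rightarrow> 'v \<otimes> 'v) \<Rightarrow> nat \<Rightarrow> 'v tensor_algebra \<Rightarrow> 'v tensor_algebra"
  where "braid_at \<Psi> i = talift (\<lambda>xs. if Suc i < length xs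
    then tlift (\<lambda>a b. tword (take i xs @ [a, b] @ drop (i + 2) xs)) (\<Psi> (xs ! i \<otimes> xs ! Suc i))
    else 0)"

definition word_perm :: "nat list \<Rightarrow> nat \<Rightarrow> nat"
  where "word_perm is = foldr (\<lambda>i f. transpose i (Suc i) \<circ> f) is id"

definition reduced_expression :: "nat \<Rightarrow> (nat \<Rightarrow> nat) \<Rightarrow> nat list \<Rightarrow> bool"
  where "reduced_expression n \<sigma> is \<longleftrightarrow> (\<forall>i\<in>set is. Suc i < n) \<and> word_perm is = \<sigma> \<and>
    (\<forall>js. (\<forall>j\<in>set js. Suc j < n) \<and> word_perm js = \<sigma> \<longrightarrow> length is \<le> length js)"

definition braid_perm :: "('v::complex_vector \<otimes> 'v \<Rightarrow> 'v \<otimes> 'v) \<Rightarrow> nat \<Rightarrow> (nat \<Rightarrow> nat)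
    \<Rightarrow> 'v tensor_algebra \<Rightarrow> 'v tensor_algebra"
  where "braid_perm \<Psi> n \<sigma> = foldr (\<lambda>i f. braid_at \<Psi> i \<circ> f) (SOME is. reduced_expression n \<sigma> is) id"

definition braided_factorial :: "('v::complex_vector \<otimes> 'v \<Rightarrow> 'v \<otimes> 'v) \<Rightarrow> nat
    \<Rightarrow> 'v tensor_algebra \<Rightarrow> 'v tensor_algebra"
  where "braided_factorial \<Psi> n x = (\<Sum>\<sigma> | \<sigma> permutes {..<n}. braid_perm \<Psi> n \<sigma> x)"

definition nichols_relations :: "('v::complex_vector \<otimes> 'v \<Rightarrow> 'v \<otimes> 'v) \<Rightarrow> 'v tensor_algebra set"
  where "nichols_relations \<Psi> = cvec.span (\<Union>n. {x \<in> tdeg n. braided_factorial \<Psi> n x = 0})"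

definition exterior_relations :: "('v::complex_vector \<otimes> 'v \<Rightarrow> 'v \<otimes> 'v) \<Rightarrow> 'v tensor_algebra set"
  where "exterior_relations \<Psi> =
    cvec.span {tmul (tmul x (tlift (\<lambda>v w. tword [v, w]) (z + \<Psi> z))) y | x y z. True}"

primrec word_coaction :: "('v::complex_vector \<Rightarrow> 'v \<otimes> 'h::complex_algebra_1) \<Rightarrow> 'v list \<Rightarrow> 'v tensor_algebra \<otimes> 'h"
  where
    "word_coaction \<delta> [] = tword [] \<otimes> 1"
  | "word_coaction \<delta> (v # vs) =
      tlift (\<lambda>v0 v1. tlift (\<lambda>x h. tmul (tword [v0]) x \<otimes> (v1 * h)) (word_coaction \<delta> vs)) (\<delta> v)"

definition quotient_comodule_algebra :: "'v tensor_algebra set \<Rightarrow> (nat \<Rightarrow> 'v tensor_algebra set)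
    \<Rightarrow> ('v::complex_vector \<Rightarrow> 'v \<otimes> 'h::complex_algebra_1)
    \<Rightarrow> ('v tensor_algebra quotients, 'h) graded_comodule_algebra"
  where "quotient_comodule_algebra I G \<delta> =
    \<lparr>deg = \<lambda>n. qcls I ` G n,
     mul = qlift2 I (\<lambda>x y. qcls I (tmul x y)),
     unit = qcls I (tword []),
     coact = qlift I (\<lambda>x. tmap (qcls I) id (talift (word_coaction \<delta>) x))\<rparr>"

text \<open>\<open>B\<^sub>+(V)\<close>, with all of it placed in degree 0 as required for the braided super tensor products.\<close>

definition nichols_algebra :: "('h::complex_algebra_1 \<otimes> 'h \<Rightarrow> complex)
    \<Rightarrow> ('v::complex_vector \<Rightarrow> 'v \<otimes> 'h) \<Rightarrow> ('v tensor_algebra quotients, 'h) graded_comodule_algebra"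
  where "nichols_algebra R \<delta> = quotient_comodule_algebra (nichols_relations (braiding R \<delta> \<delta>))
    (\<lambda>n. if n = 0 then UNIV else {0}) \<delta>"

definition exterior_algebra :: "('h::complex_algebra_1 \<otimes> 'h \<Rightarrow> complex)
    \<Rightarrow> ('v::complex_vector \<Rightarrow> 'v \<otimes> 'h) \<Rightarrow> ('v tensor_algebra quotients, 'h) graded_comodule_algebra"
  where "exterior_algebra R \<delta> = quotient_comodule_algebra (exterior_relations (braiding R \<delta> \<delta>)) tdeg \<delta>"

definition nichols_gen :: "('h::complex_algebra_1 \<otimes> 'h \<Rightarrow> complex) \<Rightarrow> ('v::complex_vector \<Rightarrow> 'v \<otimes> 'h)
    \<Rightarrow> 'v \<Rightarrow> 'v tensor_algebra quotients"
  where "nichols_gen R \<delta> v = qcls (nichols_relations (braiding R \<delta> \<delta>)) (tword [v])"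

definition exterior_gen :: "('h::complex_algebra_1 \<otimes> 'h \<Rightarrow> complex) \<Rightarrow> ('v::complex_vector \<Rightarrow> 'v \<otimes> 'h)
    \<Rightarrow> 'v \<Rightarrow> 'v tensor_algebra quotients"
  where "exterior_gen R \<delta> v = qcls (exterior_relations (braiding R \<delta> \<delta>)) (tword [v])"

text \<open>The multiplicative extension to \<open>B \<rightarrow> B \<otimes> B\<close> (braided tensor product algebra) of
  \<open>\<Delta> v = v \<otimes> 1 + 1 \<otimes> v\<close>.\<close>

definition nichols_comult :: "('h::complex_algebra_1 \<otimes> 'h \<Rightarrow> complex) \<Rightarrow> ('v::complex_vector \<Rightarrow> 'v \<otimes> 'h)
    \<Rightarrow> 'v tensor_algebra quotients \<Rightarrow> 'v tensor_algebra quotients \<otimes> 'v tensor_algebra quotients"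
  where "nichols_comult R \<delta> =
   (let B = nichols_algebra R \<delta>; BB = super_tensor R B B; \<iota> = nichols_gen R \<delta> in
    qlift (nichols_relations (braiding R \<delta> \<delta>)) (talift (\<lambda>vs.
      foldr (\<lambda>v z. mul BB (\<iota> v \<otimes> unit B + unit B \<otimes> \<iota> v) z) vs (unit BB))))"

definition nichols_proj1 :: "('h::complex_algebra_1 \<otimes> 'h \<Rightarrow> complex) \<Rightarrow> ('v::complex_vector \<Rightarrow> 'v \<otimes> 'h)
    \<Rightarrow> 'v tensor_algebra quotients \<Rightarrow> 'v"
  where "nichols_proj1 R \<delta> = qlift (nichols_relations (braiding R \<delta> \<delta>))
    (talift (\<lambda>vs. if length vs = 1 then hd vs else 0))"

definition nichols_star :: "('h::complex_algebra_1 \<otimes> 'h \<Rightarrow> complex) \<Rightarrow> ('v::complex_vector \<Rightarrow> 'v \<otimes> 'h)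
    \<Rightarrow> ('v \<Rightarrow> 'v) \<Rightarrow> 'v tensor_algebra quotients \<Rightarrow> 'v tensor_algebra quotients"
  where "nichols_star R \<delta> starV =
   (let I = nichols_relations (braiding R \<delta> \<delta>) in
    qlift_anti I (\<lambda>x. qcls I (talift_anti (\<lambda>vs. tword (rev (map starV vs))) x)))"

text \<open>Reversing \<open>n\<close> factors of degree 1 produces the sign \<open>(-1)\<^bsup>n(n-1)/2\<^esup>\<close>.\<close>

definition exterior_star :: "('h::complex_algebra_1 \<otimes> 'h \<Rightarrow> complex) \<Rightarrow> ('v::complex_vector \<Rightarrow> 'v \<otimes> 'h)
    \<Rightarrow> ('v \<Rightarrow> 'v) \<Rightarrow> 'v tensor_algebra quotients \<Rightarrow> 'v tensor_algebra quotients"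
  where "exterior_star R \<delta> starV =
   (let I = exterior_relations (braiding R \<delta> \<delta>) in
    qlift_anti I (\<lambda>x. qcls I (talift_anti
      (\<lambda>vs. (-1) ^ (length vs choose 2) *\<^sub>C tword (rev (map starV vs))) x)))"


section \<open>The double complex \<open>\<Omega> = \<Lambda>(V) \<otimes> B\<^sub>+(V) \<otimes> \<Lambda>(V)\<close>\<close>

text \<open>The operations below are the (anti)linear maps with the given values on the spanning elements
  \<open>\<omega> \<otimes> b \<otimes> \<eta>\<close> of \<open>\<Omega>\<close>; outside of \<open>\<Omega>\<close> they are irrelevant.\<close>

type_synonym 'v forms =
  "('v tensor_algebra quotients \<otimes> 'v tensor_algebra quotients) \<otimes> 'v tensor_algebra quotients"

definition Omega :: "('h::complex_algebra_1 \<otimes> 'h \<Rightarrow> complex) \<Rightarrow> ('v::complex_vector \<Rightarrow> 'v \<otimes> 'h)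
    \<Rightarrow> ('v forms, 'h) graded_comodule_algebra"
  where "Omega R \<delta> =
    super_tensor R (super_tensor R (exterior_algebra R \<delta>) (nichols_algebra R \<delta>)) (exterior_algebra R \<delta>)"

definition Omega_bideg :: "('h::complex_algebra_1 \<otimes> 'h \<Rightarrow> complex) \<Rightarrow> ('v::complex_vector \<Rightarrow> 'v \<otimes> 'h)
    \<Rightarrow> nat \<Rightarrow> nat \<Rightarrow> 'v forms set"
  where "Omega_bideg R \<delta> p q = cvec.span {(\<omega> \<otimes> b) \<otimes> \<eta> | \<omega> b \<eta>.
    \<omega> \<in> deg (exterior_algebra R \<delta>) p \<and> b \<in> total_space (nichols_algebra R \<delta>) \<and> \<eta> \<in> deg (exterior_algebra R \<delta>) q}"

definition Omega_incl :: "('h::complex_algebra_1 \<otimes> 'h \<Rightarrow> complex) \<Rightarrow> ('v::complex_vector \<Rightarrow> 'v \<otimes> 'h)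
    \<Rightarrow> 'v tensor_algebra quotients \<Rightarrow> 'v forms"
  where "Omega_incl R \<delta> b = (unit (exterior_algebra R \<delta>) \<otimes> b) \<otimes> unit (exterior_algebra R \<delta>)"

text \<open>\<open>\<partial>(\<omega> \<otimes> b \<otimes> \<eta>) = (-1)\<^sup>p (\<omega> \<and> \<varpi>(b\<^sub>1)) \<otimes> b\<^sub>2 \<otimes> \<eta>\<close>.\<close>

definition del :: "('h::complex_algebra_1 \<otimes> 'h \<Rightarrow> complex) \<Rightarrow> ('v::complex_vector \<Rightarrow> 'v \<otimes> 'h)
    \<Rightarrow> 'v forms \<Rightarrow> 'v forms"
  where "del R \<delta> =
   (let L = exterior_algebra R \<delta>; B = nichols_algebra R \<delta> in
    SOME D. clinear D \<and> (\<forall>p q. \<forall>\<omega>\<in>deg L p. \<forall>b\<in>total_space B. \<forall>\<eta>\<in>deg L q.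
      D ((\<omega> \<otimes> b) \<otimes> \<eta>) = (-1) ^ p *\<^sub>C tlift (\<lambda>b1 b2.
        (mul L \<omega> (exterior_gen R \<delta> (nichols_proj1 R \<delta> b1)) \<otimes> b2) \<otimes> \<eta>) (nichols_comult R \<delta> b)))"

text \<open>\<open>\<partial>\<^sup>-(\<omega> \<otimes> b \<otimes> \<eta>) = (-1)\<^sup>p \<omega> \<otimes> b\<^sub>1 \<otimes> (\<varpi>(b\<^sub>2) \<and> \<eta>)\<close>.\<close>

definition delbar :: "('h::complex_algebra_1 \<otimes> 'h \<Rightarrow> complex) \<Rightarrow> ('v::complex_vector \<Rightarrow> 'v \<otimes> 'h)
    \<Rightarrow> 'v forms \<Rightarrow> 'v forms"
  where "delbar R \<delta> =
   (let L = exterior_algebra R \<delta>; B = nichols_algebra R \<delta> in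
    SOME D. clinear D \<and> (\<forall>p q. \<forall>\<omega>\<in>deg L p. \<forall>b\<in>total_space B. \<forall>\<eta>\<in>deg L q.
      D ((\<omega> \<otimes> b) \<otimes> \<eta>) = (-1) ^ p *\<^sub>C tlift (\<lambda>b1 b2.
        (\<omega> \<otimes> b1) \<otimes> mul L (exterior_gen R \<delta> (nichols_proj1 R \<delta> b2)) \<eta>) (nichols_comult R \<delta> b)))"

definition Omega_d :: "('h::complex_algebra_1 \<otimes> 'h \<Rightarrow> complex) \<Rightarrow> ('v::complex_vector \<Rightarrow> 'v \<otimes> 'h)
    \<Rightarrow> 'v forms \<Rightarrow> 'v forms"
  where "Omega_d R \<delta> \<xi> = del R \<delta> \<xi> + delbar R \<delta> \<xi>"

definition Omega_star :: "('h::complex_algebra_1 \<otimes> 'h \<Rightarrow> complex) \<Rightarrow> ('v::complex_vector \<Rightarrow> 'v \<otimes> 'h)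
    \<Rightarrow> ('v \<Rightarrow> 'v) \<Rightarrow> 'v forms \<Rightarrow> 'v forms"
  where "Omega_star R \<delta> starV =
   (let L = exterior_algebra R \<delta>; B = nichols_algebra R \<delta> in
    SOME s. antilinear s \<and> (\<forall>p q. \<forall>\<omega>\<in>deg L p. \<forall>b\<in>total_space B. \<forall>\<eta>\<in>deg L q.
      s ((\<omega> \<otimes> b) \<otimes> \<eta>) = (-1) ^ (p * q) *\<^sub>C
        ((exterior_star R \<delta> starV \<eta> \<otimes> nichols_star R \<delta> starV b) \<otimes> exterior_star R \<delta> starV \<omega>)))"


section \<open>*-differential calculi and factorisable Dolbeault double complexes\<close>

definition direct_sum :: "'i set \<Rightarrow> ('i \<Rightarrow> 'a::complex_vector set) \<Rightarrow> 'a set \<Rightarrow> bool"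
  where "direct_sum I F W \<longleftrightarrow> (\<forall>i\<in>I. cvec.subspace (F i)) \<and> W = cvec.span (\<Union>i\<in>I. F i) \<and>
    (\<forall>J f. finite J \<longrightarrow> J \<subseteq> I \<longrightarrow> (\<forall>i\<in>J. f i \<in> F i) \<longrightarrow> (\<Sum>i\<in>J. f i) = 0 \<longrightarrow> (\<forall>i\<in>J. f i = 0))"

definition is_algebra :: "('a::complex_vector, 'm) graded_algebra_scheme \<Rightarrow> bool"
  where "is_algebra A \<longleftrightarrow> unit A \<in> total_space A \<and>
    (\<forall>x\<in>total_space A. mul A (unit A) x = x \<and> mul A x (unit A) = x) \<and>
    (\<forall>x\<in>total_space A. \<forall>y\<in>total_space A. mul A x y \<in> total_space A \<and>
      (\<forall>c. mul A (c *\<^sub>C x) y = c *\<^sub>C mul A x y \<and> mul A x (c *\<^sub>C y) = c *\<^sub>C mul A x y) \<and>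
      (\<forall>z\<in>total_space A. mul A (mul A x y) z = mul A x (mul A y z) \<and>
        mul A (x + y) z = mul A x z + mul A y z \<and> mul A x (y + z) = mul A x y + mul A x z))"

definition is_graded_algebra :: "('a::complex_vector, 'm) graded_algebra_scheme \<Rightarrow> bool"
  where "is_graded_algebra A \<longleftrightarrow> is_algebra A \<and> direct_sum UNIV (deg A) (total_space A) \<and> unit A \<in> deg A 0 \<and>
    (\<forall>m n. \<forall>x\<in>deg A m. \<forall>y\<in>deg A n. mul A x y \<in> deg A (m + n))"

definition linear_on :: "'a::complex_vector set \<Rightarrow> ('a \<Rightarrow> 'b::complex_vector) \<Rightarrow> bool"
  where "linear_on W f \<longleftrightarrow> (\<forall>x\<in>W. \<forall>y\<in>W. f (x + y) = f x + f y) \<and> (\<forall>c. \<forall>x\<in>W. f (c *\<^sub>C x) = c *\<^sub>C f x)"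

definition antilinear_involution_on :: "'a::complex_vector set \<Rightarrow> ('a \<Rightarrow> 'a) \<Rightarrow> bool"
  where "antilinear_involution_on W s \<longleftrightarrow> (\<forall>x\<in>W. s x \<in> W \<and> s (s x) = x) \<and>
    (\<forall>x\<in>W. \<forall>y\<in>W. s (x + y) = s x + s y) \<and> (\<forall>c. \<forall>x\<in>W. s (c *\<^sub>C x) = cnj c *\<^sub>C s x)"

definition star_algebra :: "('a::complex_vector, 'm) graded_algebra_scheme \<Rightarrow> ('a \<Rightarrow> 'a) \<Rightarrow> bool"
  where "star_algebra A s \<longleftrightarrow> is_algebra A \<and> antilinear_involution_on (total_space A) s \<and>
    (\<forall>x\<in>total_space A. \<forall>y\<in>total_space A. s (mul A x y) = mul A (s y) (s x))"

definition graded_derivation :: "('a::complex_vector, 'm) graded_algebra_scheme \<Rightarrow> ('a \<Rightarrow> 'a) \<Rightarrow> bool"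
  where "graded_derivation A D \<longleftrightarrow> linear_on (total_space A) D \<and> (\<forall>n. D ` deg A n \<subseteq> deg A (Suc n)) \<and>
    (\<forall>n. \<forall>x\<in>deg A n. \<forall>y\<in>total_space A. D (mul A x y) = mul A (D x) y + (-1) ^ n *\<^sub>C mul A x (D y))"

definition DGA :: "('a::complex_vector, 'm) graded_algebra_scheme \<Rightarrow> ('a \<Rightarrow> 'a) \<Rightarrow> bool"
  where "DGA A d \<longleftrightarrow> is_graded_algebra A \<and> graded_derivation A d \<and> (\<forall>x\<in>total_space A. d (d x) = 0)"

text \<open>\<open>j\<close> is the identification of \<open>B\<close> with \<open>\<Omega>\<^sup>0\<close>.\<close>

definition star_differential_calculus ::
  "('b::complex_vector, 'm) graded_algebra_scheme \<Rightarrow> ('b \<Rightarrow> 'b) \<Rightarrow> ('b \<Rightarrow> 'a)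
    \<Rightarrow> ('a::complex_vector, 'n) graded_algebra_scheme \<Rightarrow> ('a \<Rightarrow> 'a) \<Rightarrow> ('a \<Rightarrow> 'a) \<Rightarrow> bool"
  where "star_differential_calculus B sB j \<Omega> d s \<longleftrightarrow>
    star_algebra B sB \<and> DGA \<Omega> d \<and>
    bij_betw j (total_space B) (deg \<Omega> 0) \<and> linear_on (total_space B) j \<and> j (unit B) = unit \<Omega> \<and>
    (\<forall>x\<in>total_space B. \<forall>y\<in>total_space B. j (mul B x y) = mul \<Omega> (j x) (j y)) \<and>
    (\<forall>x\<in>total_space B. j (sB x) = s (j x)) \<and>
    antilinear_involution_on (total_space \<Omega>) s \<and> (\<forall>n. s ` deg \<Omega> n \<subseteq> deg \<Omega> n) \<and>
    (\<forall>m n. \<forall>x\<in>deg \<Omega> m. \<forall>y\<in>deg \<Omega> n. s (mul \<Omega> x y) = (-1) ^ (m * n) *\<^sub>C mul \<Omega> (s y) (s x)) \<and>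
    (\<forall>x\<in>total_space \<Omega>. d (s x) = s (d x))"

definition dolbeault_double_complex ::
  "('a::complex_vector, 'n) graded_algebra_scheme \<Rightarrow> (nat \<Rightarrow> nat \<Rightarrow> 'a set)
    \<Rightarrow> ('a \<Rightarrow> 'a) \<Rightarrow> ('a \<Rightarrow> 'a) \<Rightarrow> ('a \<Rightarrow> 'a) \<Rightarrow> ('a \<Rightarrow> 'a) \<Rightarrow> bool"
  where "dolbeault_double_complex \<Omega> P d D Db s \<longleftrightarrow>
    (\<forall>m. direct_sum {(p, q). p + q = m} (\<lambda>(p, q). P p q) (deg \<Omega> m)) \<and>
    (\<forall>p q. \<forall>b\<in>deg \<Omega> 0. \<forall>x\<in>P p q. mul \<Omega> b x \<in> P p q \<and> mul \<Omega> x b \<in> P p q) \<and>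
    (\<forall>p q p' q'. \<forall>x\<in>P p q. \<forall>y\<in>P p' q'. mul \<Omega> x y \<in> P (p + p') (q + q')) \<and>
    (\<forall>x\<in>total_space \<Omega>. d x = D x + Db x) \<and>
    (\<forall>p q. D ` P p q \<subseteq> P (Suc p) q \<and> Db ` P p q \<subseteq> P p (Suc q)) \<and>
    graded_derivation \<Omega> D \<and> graded_derivation \<Omega> Db \<and>
    (\<forall>x\<in>total_space \<Omega>. D (D x) = 0 \<and> Db (Db x) = 0 \<and> D (Db x) + Db (D x) = 0) \<and>
    (\<forall>p q. s ` P p q = P q p) \<and>
    (\<forall>x\<in>total_space \<Omega>. s (D x) = Db (s x))"

text \<open>The product over \<open>B = \<Omega>\<^sup>0\<close> of sub-bimodules \<open>M\<close>, \<open>N\<close> of \<open>\<Omega>\<close>.\<close>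

definition balanced_relations :: "('a::complex_vector, 'n) graded_algebra_scheme \<Rightarrow> 'a set \<Rightarrow> 'a set \<Rightarrow> ('a \<otimes> 'a) set"
  where "balanced_relations \<Omega> M N =
    {mul \<Omega> x b \<otimes> y - x \<otimes> mul \<Omega> b y | x b y. x \<in> M \<and> b \<in> deg \<Omega> 0 \<and> y \<in> N}"

definition balanced_tensor :: "('a::complex_vector, 'n) graded_algebra_scheme \<Rightarrow> 'a set \<Rightarrow> 'a set \<Rightarrow> ('a \<otimes> 'a) quotients set"
  where "balanced_tensor \<Omega> M N =
    qcls (balanced_relations \<Omega> M N) ` cvec.span {x \<otimes> y | x y. x \<in> M \<and> y \<in> N}"

text \<open>The bimodule structure of \<open>balanced_tensor \<Omega> M N\<close> is \<open>b (x \<otimes> y) b' = b x \<otimes> y b'\<close>.\<close>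

definition wedge_is_bimodule_iso ::
  "('a::complex_vector, 'n) graded_algebra_scheme \<Rightarrow> 'a set \<Rightarrow> 'a set \<Rightarrow> 'a set \<Rightarrow> bool"
  where "wedge_is_bimodule_iso \<Omega> M N P \<longleftrightarrow>
   (let cls = qcls (balanced_relations \<Omega> M N) in
    \<exists>\<phi>. clinear \<phi> \<and> (\<forall>x\<in>M. \<forall>y\<in>N. \<phi> (cls (x \<otimes> y)) = mul \<Omega> x y) \<and>
      (\<forall>b\<in>deg \<Omega> 0. \<forall>x\<in>M. \<forall>y\<in>N.
        \<phi> (cls (mul \<Omega> b x \<otimes> y)) = mul \<Omega> b (\<phi> (cls (x \<otimes> y))) \<and>
        \<phi> (cls (x \<otimes> mul \<Omega> y b)) = mul \<Omega> (\<phi> (cls (x \<otimes> y))) b) \<and>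
      bij_betw \<phi> (balanced_tensor \<Omega> M N) P)"

definition factorisable :: "('a::complex_vector, 'n) graded_algebra_scheme \<Rightarrow> (nat \<Rightarrow> nat \<Rightarrow> 'a set) \<Rightarrow> bool"
  where "factorisable \<Omega> P \<longleftrightarrow> (\<forall>p q.
    wedge_is_bimodule_iso \<Omega> (P p 0) (P 0 q) (P p q) \<and>
    wedge_is_bimodule_iso \<Omega> (P 0 q) (P p 0) (P p q))"

end

theory Submission
  imports Defs
begin

text \<open>A form in \<open>\<Omega>\<^bsup>p,q\<^esup>\<close> is represented by tensors \<open>z\<close> in \<open>V\<^bsup>\<otimes>(p+m+q)\<^esup>\<close>. On representatives every
  operation is, up to sign, the action of an element of the braid group ring: the product of forms is a
  crossing of blocks of strands, and \<open>\<partial>\<close>, respectively \<open>\<partial>\<^sup>-\<close>, moves each of the \<open>m\<close> middle strands in turn to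
  the left, respectively right, end of the middle block. Reversal of tensors turns the braid diagrams
  around; this is where real type and unitarity enter, as they say that \<open>\<Psi>\<close> commutes with \<open>\<dagger>\<close>.

  The axioms become identities between braids, modulo the images of \<open>id + \<Psi>\<close> on the outer strands and the
  kernel of the braided factorial on the middle ones. Two strands split off one after the other by \<open>\<partial>\<close>
  produce a left factor \<open>id + \<Psi>\<close>, so \<open>\<partial>\<^sup>2 = 0\<close>; the composites of \<open>\<partial>\<close> and \<open>\<partial>\<^sup>-\<close> in the two orders agree up to
  sign after multiplication with the braided factorial of the remaining \<open>m - 2\<close> strands, both being equal to
  that of all \<open>m\<close> strands; and \<open>\<partial>\<^sup>-\<close> is the conjugate of \<open>\<partial>\<close> by \<open>*\<close>. For the factorisation in the opposite
  order one moves the right factors to the left with the inverse of \<open>\<Psi>\<close>.\<close>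

section \<open>Universal constructions for linear and antilinear maps\<close>

section \<open>Linear algebra\<close>

text \<open>The objects of the statement are choices by \<open>SOME\<close> among (anti)linear maps
  with prescribed values, on types that contain the relevant space only as a subspace, so each has
  to be shown to exist. Signs such as (-1)^p are prescribed on homogeneous elements only and are
  realised by parity operators. The operators in \<open>braided_factorial\<close> come from
  unspecified reduced expressions; Matsumoto's theorem makes the choice immaterial. The relations of
  \<open>B\<close> are known only as kernels, so nothing can be checked on explicit generators of
  the ideal. What replaces them is the factorisation of the factorial of n strands into the
  factorials of a and n - a strands and the sum of shuffles. It makes the coproduct descend to
  \<open>B\<close>, and since \<open>dl\<close> and \<open>dr\<close> are the shuffles for a = 1 and
  a = n - 1, it also gives the anticommutation of the two differentials. The Leibniz rule and the
  vanishing square are computed for \<open>del\<close> only and carried to \<open>delbar\<close> by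
  the involution. The Yang-Baxter equation is not postulated; it is naturality of the braiding of
  comodules.\<close>

named_theorems clin

lemma clinear_add: "clinear f \<Longrightarrow> f (x + y) = f x + f y"
  and clinear_scale: "clinear f \<Longrightarrow> f (c *\<^sub>C x) = c *\<^sub>C f x"
  by (auto simp: clinear_iff)

lemma clinear_sum: "clinear f \<Longrightarrow> f (sum g A) = (\<Sum>i\<in>A. f (g i))"
  by (induction A rule: infinite_finite_induct) (auto simp: clinear_zero clinear_add)

lemma clinear_compose: "clinear f \<Longrightarrow> clinear g \<Longrightarrow> clinear (\<lambda>x. f (g x))"
  by (auto simp: clinear_iff)

lemma cbilinearI:
  "(\<And>x. clinear (f x)) \<Longrightarrow> (\<And>y. clinear (\<lambda>x. f x y)) \<Longrightarrow> cbilinear f"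
  by (simp add: cbilinear_def)

lemma cbilinear_left: "cbilinear f \<Longrightarrow> clinear (\<lambda>x. f x y)"
  and cbilinear_right: "cbilinear f \<Longrightarrow> clinear (f x)"
  by (simp_all add: cbilinear_def)

lemma clin_id [clin]: "clinear (\<lambda>x. x)"
  and clin_id' [clin]: "clinear id"
  and clin_zero [clin]: "clinear (\<lambda>x. 0)"
  by (auto simp: clinear_iff)

lemma clin_add [clin]: "clinear f \<Longrightarrow> clinear g \<Longrightarrow> clinear (\<lambda>x. f x + g x)"
  and clin_diff [clin]: "clinear f \<Longrightarrow> clinear g \<Longrightarrow> clinear (\<lambda>x. f x - g x)"
  and clin_uminus [clin]: "clinear f \<Longrightarrow> clinear (\<lambda>x. - f x)"
  by (auto simp: clinear_iff scaleC_add_right cvec.scale_right_diff_distrib)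

lemma clin_scale [clin]: "clinear f \<Longrightarrow> clinear (\<lambda>x. c *\<^sub>C f x)"
  by (auto simp: clinear_iff scaleC_add_right scaleC_scaleC mult.commute)

lemma clin_scale_left [clin]: "clinear f \<Longrightarrow> clinear (\<lambda>x. f x *\<^sub>C y)"
proof (rule clinearI)
  assume f: "clinear f"
  show "f (a + b) *\<^sub>C y = f a *\<^sub>C y + f b *\<^sub>C y" for a b
    by (simp add: clinear_add[OF f] scaleC_add_left)
  show "f (c *\<^sub>C a) *\<^sub>C y = c *\<^sub>C f a *\<^sub>C y" for c a
    unfolding clinear_scale[OF f] by (simp add: scaleC_scaleC scaleC_complex_def)
qed

lemma clin_sum [clin]: "(\<And>i. i \<in> A \<Longrightarrow> clinear (f i)) \<Longrightarrow> clinear (\<lambda>x. \<Sum>i\<in>A. f i x)"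
  by (auto simp: clinear_iff sum.distrib cvec.scale_sum_right intro!: sum.cong)

lemma clin_if [clin]: "(b \<Longrightarrow> clinear f) \<Longrightarrow> (\<not> b \<Longrightarrow> clinear g) \<Longrightarrow> clinear (\<lambda>x. if b then f x else g x)"
  by (cases b) simp_all

lemma clin_mult_left [clin]: "clinear f \<Longrightarrow> clinear (\<lambda>x. f x * (y :: 'a::complex_algebra_1))"
  and clin_mult_right [clin]: "clinear f \<Longrightarrow> clinear (\<lambda>x. (y :: 'a) * f x)"
  by (auto simp: clinear_iff distrib_left distrib_right mult_scaleC_left mult_scaleC_right)

lemma clin_tens_left [clin]: "clinear f \<Longrightarrow> clinear (\<lambda>x. f x \<otimes> y)"
  and clin_tens_right [clin]: "clinear f \<Longrightarrow> clinear (\<lambda>x. y \<otimes> f x)"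
  using cbilinear_tens
  by (auto intro: clinear_compose[of "\<lambda>x. x \<otimes> y" f] clinear_compose[of "\<lambda>x. y \<otimes> x" f]
      simp: cbilinear_def)

lemma tens_zero [simp]: "0 \<otimes> y = 0" "x \<otimes> 0 = 0"
  using clinear_zero[OF clin_tens_left[OF clin_id]] clinear_zero[OF clin_tens_right[OF clin_id]] by auto

lemma tens_scale: "(c *\<^sub>C x) \<otimes> y = c *\<^sub>C (x \<otimes> y)" "x \<otimes> (c *\<^sub>C y) = c *\<^sub>C (x \<otimes> y)"
  using clinear_scale[OF clin_tens_left[OF clin_id]] clinear_scale[OF clin_tens_right[OF clin_id]] by auto

lemma tens_add: "(x + x') \<otimes> y = x \<otimes> y + x' \<otimes> y" "x \<otimes> (y + y') = x \<otimes> y + x \<otimes> y'"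
  using clinear_add[OF clin_tens_left[OF clin_id]] clinear_add[OF clin_tens_right[OF clin_id]] by auto

lemma clinear_qcls' [clin]: "clinear f \<Longrightarrow> clinear (\<lambda>x. qcls I (f x))"
  by (rule clinear_compose[OF clinear_qcls])

lemma clinear_image_span: "clinear f \<Longrightarrow> f ` cvec.span S = cvec.span (f ` S)"
proof -
  assume "clinear f"
  then interpret Vector_Spaces.linear scaleC scaleC f .
  show ?thesis by (rule span_image[symmetric])
qed

lemma clinear_span_into:
  "clinear f \<Longrightarrow> (\<And>x. x \<in> S \<Longrightarrow> f x \<in> cvec.span T) \<Longrightarrow> y \<in> cvec.span S \<Longrightarrow> f y \<in> cvec.span T"
  by (metis clinear_image_span cvec.span_mono cvec.span_span image_eqI image_subsetI subsetD)


subsection \<open>Factorisation of linear maps\<close>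

text \<open>A basis of the image can be lifted, whatever the dimension. With such sections, maps
  factor through a projection without naming a complement.\<close>

lemma clinear_section:
  assumes "clinear q"
  obtains s where "clinear s" "\<And>x. q (s (q x)) = q x"
proof -
  interpret vector_space_pair "scaleC :: complex \<Rightarrow> 'a \<Rightarrow> 'a" "scaleC :: complex \<Rightarrow> 'b \<Rightarrow> 'b"
    by unfold_locales
  obtain s where "clinear s" "\<forall>v\<in>q ` UNIV. q (s v) = v"
    using linear_exists_right_inverse_on[OF assms cvec.subspace_UNIV] by blast
  with that show ?thesis by auto
qed

text \<open>\<open>f\<close> after a section of \<open>q\<close> is the factor, because the section
  changes an argument only by an element of the kernel of \<open>q\<close>. Off the range of
  \<open>q\<close> it is some linear extension, which is all that \<open>qlift\<close>
  promises.\<close>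

lemma clinear_factor:
  assumes "clinear q" "clinear f" "\<And>x. q x = 0 \<Longrightarrow> f x = 0"
  shows "\<exists>g. clinear g \<and> (\<forall>x. g (q x) = f x)"
proof -
  obtain s where s: "clinear s" "\<And>x. q (s (q x)) = q x"
    using clinear_section[OF assms(1)] by blast
  have "f (s (q x)) = f x" for x
    using assms(3)[of "s (q x) - x"] by (simp add: clinear_diff[OF assms(1)] clinear_diff[OF assms(2)] s)
  then show ?thesis using clinear_compose[OF assms(2) s(1)] by blast
qed

lemma cbilinear_factor:
  assumes "clinear q" "cbilinear f" "\<And>x y. q x = 0 \<Longrightarrow> f x y = 0" "\<And>x y. q y = 0 \<Longrightarrow> f x y = 0"
  shows "\<exists>g. cbilinear g \<and> (\<forall>x y. g (q x) (q y) = f x y)"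
proof -
  obtain s where s: "clinear s" "\<And>x. q (s (q x)) = q x"
    using clinear_section[OF assms(1)] by blast
  note l = cbilinear_left[OF assms(2)] and r = cbilinear_right[OF assms(2)]
  have 1: "f (s (q x)) y = f x y" for x y
    using assms(3)[of "s (q x) - x" y] clinear_diff[OF l, of "s (q x)" x y]
    by (simp add: clinear_diff[OF assms(1)] s)
  have 2: "f x (s (q y)) = f x y" for x y
    using assms(4)[of "s (q y) - y" x] clinear_diff[OF r, of x "s (q y)" y]
    by (simp add: clinear_diff[OF assms(1)] s)
  have "cbilinear (\<lambda>x y. f (s x) (s y))"
    by (intro cbilinearI clinear_compose[OF l s(1)] clinear_compose[OF r s(1)])
  then show ?thesis using 1 2 by (intro exI[of _ "\<lambda>x y. f (s x) (s y)"]) simp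
qed

lemma qcls_eq_0_iff: "qcls I x = 0 \<longleftrightarrow> x \<in> cvec.span I"
  using qcls_eq_iff[of I x 0] by (simp add: clinear_zero[OF clinear_qcls])

text \<open>Turns the choice in \<open>qlift\<close> into usable rules: once \<open>f\<close> kills
  the subspace divided by, the choice is among existing maps.\<close>

lemma qlift:
  assumes "clinear f" "\<And>x. x \<in> cvec.span I \<Longrightarrow> f x = 0"
  shows clinear_qlift: "clinear (qlift I f)" and qlift_qcls: "qlift I f (qcls I x) = f x"
  using someI_ex[OF clinear_factor[OF clinear_qcls assms(1), of I]] assms(2)
  by (auto simp: qlift_def qcls_eq_0_iff)

lemma qlift2:
  assumes "cbilinear f" "\<And>x y. x \<in> cvec.span I \<Longrightarrow> f x y = 0" "\<And>x y. y \<in> cvec.span I \<Longrightarrow> f x y = 0"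
  shows cbilinear_qlift2: "cbilinear (qlift2 I f)"
    and qlift2_qcls: "qlift2 I f (qcls I x) (qcls I y) = f x y"
  using someI_ex[OF cbilinear_factor[OF clinear_qcls assms(1), of I]] assms(2,3)
  by (auto simp: qlift2_def qcls_eq_0_iff)


subsection \<open>Maps on tensor products\<close>

lemma tlift:
  assumes "cbilinear f"
  shows clinear_tlift: "clinear (tlift f)" and tlift_tens: "tlift f (x \<otimes> y) = f x y"
  using someI_ex[OF ex1_implies_ex[OF tensor_universal[OF assms]]] by (auto simp: tlift_def)

lemma tlift_eq [simp]:
  "(\<And>a. clinear (f a)) \<Longrightarrow> (\<And>b. clinear (\<lambda>a. f a b)) \<Longrightarrow> tlift f (x \<otimes> y) = f x y"
  by (rule tlift_tens, rule cbilinearI)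

lemma clin_tlift_arg [clin]:
  "(\<And>a. clinear (f a)) \<Longrightarrow> (\<And>b. clinear (\<lambda>a. f a b)) \<Longrightarrow> clinear g \<Longrightarrow> clinear (\<lambda>x. tlift f (g x))"
  by (rule clinear_compose[OF clinear_tlift], rule cbilinearI)

lemma tensor_ext:
  assumes "clinear f" "clinear g" "\<And>x y. f (x \<otimes> y) = g (x \<otimes> y)"
  shows "\<forall>z. f z = g z"
  using clinear_eq_on_span[OF assms(1,2) _ tensor_span] assms(3) by auto

text \<open>The main device for identities in Sweedler notation: the coactions of two elements are
  replaced by arbitrary tensors, and linearity in each reduces the claim to pure tensors.\<close>

lemma tensor_ext2:
  assumes "\<And>w. clinear (\<lambda>z. f z w)" "\<And>z. clinear (f z)" "\<And>w. clinear (\<lambda>z. g z w)" "\<And>z. clinear (g z)"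
    and "\<And>x y x' y'. f (x \<otimes> y) (x' \<otimes> y') = g (x \<otimes> y) (x' \<otimes> y')"
  shows "\<forall>z w. f z w = g z w"
proof (intro allI)
  fix z w
  have "\<forall>w. f (x \<otimes> y) w = g (x \<otimes> y) w" for x y
    using assms(2,4,5) by (rule tensor_ext)
  then have "\<forall>z. f z w = g z w"
    by (intro tensor_ext assms) auto
  then show "f z w = g z w" ..
qed

lemma clin_tlift_fun [clin]:
  assumes "\<And>x a. clinear (f x a)" "\<And>x b. clinear (\<lambda>a. f x a b)" "\<And>a b. clinear (\<lambda>x. f x a b)"
  shows "clinear (\<lambda>x. tlift (f x) t)"
proof (rule clinearI)
  have c: "cbilinear (f x)" for x by (intro cbilinearI assms)
  have "\<forall>t. tlift (f (x + y)) t = tlift (f x) t + tlift (f y) t" for x y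
    by (rule tensor_ext) (auto intro!: clin_add clinear_tlift c simp: tlift_tens[OF c] clinear_add[OF assms(3)])
  then show "tlift (f (x + y)) t = tlift (f x) t + tlift (f y) t" for x y by blast
  have "\<forall>t. tlift (f (k *\<^sub>C x)) t = k *\<^sub>C tlift (f x) t" for k x
    by (rule tensor_ext) (auto intro!: clin_scale clinear_tlift c simp: tlift_tens[OF c] clinear_scale[OF assms(3)])
  then show "tlift (f (k *\<^sub>C x)) t = k *\<^sub>C tlift (f x) t" for k x by blast
qed

lemma clinear_tlift_commute:
  assumes "clinear g" "\<And>a. clinear (f a)" "\<And>b. clinear (\<lambda>a. f a b)"
  shows "g (tlift f t) = tlift (\<lambda>a b. g (f a b)) t"
proof -
  note l = clinear_compose[OF assms(1) assms(2)] clinear_compose[OF assms(1) assms(3)]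
  have "\<forall>t. g (tlift f t) = tlift (\<lambda>a b. g (f a b)) t"
    by (rule tensor_ext)
      (use l in \<open>auto intro!: clinear_compose[OF assms(1)] clinear_tlift cbilinearI assms(2,3) simp: assms\<close>)
  then show ?thesis ..
qed

lemma clinear_tmap: "clinear f \<Longrightarrow> clinear g \<Longrightarrow> clinear (tmap f g)"
  and tmap_tens: "clinear f \<Longrightarrow> clinear g \<Longrightarrow> tmap f g (x \<otimes> y) = f x \<otimes> g y"
  unfolding tmap_def by (auto intro!: clinear_tlift cbilinearI clin simp: clin)

lemma clin_tmap [clin]: "clinear f \<Longrightarrow> clinear g \<Longrightarrow> clinear h \<Longrightarrow> clinear (\<lambda>x. tmap f g (h x))"
  by (rule clinear_compose[OF clinear_tmap])

lemma tmap_tmap: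
  assumes "clinear f" "clinear g" "clinear f'" "clinear g'"
  shows "tmap f g (tmap f' g' t) = tmap (\<lambda>x. f (f' x)) (\<lambda>x. g (g' x)) t"
proof -
  have "\<forall>t. tmap f g (tmap f' g' t) = tmap (\<lambda>x. f (f' x)) (\<lambda>x. g (g' x)) t"
    by (rule tensor_ext)
      (simp_all add: tmap_tens assms clinear_compose clinear_tmap clinear_compose[OF clinear_tmap clinear_tmap])
  then show ?thesis ..
qed

lemma tlift_tmap:
  assumes "clinear f" "clinear g" "\<And>a. clinear (h a)" "\<And>b. clinear (\<lambda>a. h a b)"
  shows "tlift h (tmap f g t) = tlift (\<lambda>a b. h (f a) (g b)) t"
proof -
  have l: "clinear (\<lambda>b. h (f a) (g b))" "clinear (\<lambda>a. h (f a) (g b))" for a b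
    using clinear_compose[OF assms(3) assms(2)] clinear_compose[OF assms(4) assms(1)] by auto
  have "\<forall>t. tlift h (tmap f g t) = tlift (\<lambda>a b. h (f a) (g b)) t"
    by (rule tensor_ext) (auto intro!: clin clinear_tmap clinear_tlift cbilinearI assms l simp: tmap_tens assms l)
  then show ?thesis ..
qed

lemma tmap_id: "tmap (\<lambda>x. x) (\<lambda>x. x) t = t"
proof -
  have "\<forall>t. tmap (\<lambda>x. x) (\<lambda>x. x) t = t" by (rule tensor_ext) (auto intro!: clin clinear_tmap simp: tmap_tens clin)
  then show ?thesis ..
qed

lemma clinear_tassoc: "clinear tassoc" and tassoc_tens: "tassoc ((x \<otimes> y) \<otimes> z) = x \<otimes> y \<otimes> z"
  unfolding tassoc_def by (auto intro!: clinear_tlift cbilinearI clin simp: clin)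

lemma clin_tassoc [clin]: "clinear f \<Longrightarrow> clinear (\<lambda>x. tassoc (f x))"
  by (rule clinear_compose[OF clinear_tassoc])


subsection \<open>Maps on the tensor algebra\<close>

lemma talift:
  assumes "multilinear f"
  shows clinear_talift: "clinear (talift f)" and talift_tword: "talift f (tword xs) = f xs"
  using someI_ex[OF ex1_implies_ex[OF tensor_algebra_universal[OF assms]]] by (auto simp: talift_def)

lemma tword_ext:
  assumes "clinear f" "clinear g" "\<And>xs. f (tword xs) = g (tword xs)"
  shows "\<forall>z. f z = g z"
  using clinear_eq_on_span[OF assms(1,2) _ tensor_algebra_span] assms(3) by auto

lemma tdeg_ext:
  assumes "clinear f" "clinear g" "\<And>xs. length xs = n \<Longrightarrow> f (tword xs) = g (tword xs)"
  shows "\<forall>z\<in>tdeg n. f z = g z"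
proof
  fix z :: "'a tensor_algebra" assume "z \<in> tdeg n"
  then show "f z = g z"
    unfolding tdeg_def by (rule clinear_eq_on_span[OF assms(1,2), rotated]) (use assms(3) in auto)
qed

lemma multilinearI: "(\<And>xs ys. clinear (\<lambda>v. f (xs @ [v] @ ys))) \<Longrightarrow> multilinear f"
  by (simp add: multilinear_def)

lemma multilinearD: "multilinear f \<Longrightarrow> clinear (\<lambda>v. f (xs @ v # ys))"
  by (simp add: multilinear_def)

lemma multilinearD0: "multilinear f \<Longrightarrow> clinear (\<lambda>v. f (v # ys))"
  using multilinearD[of f "[]"] by simp

lemma clin_tword [clin]: "clinear f \<Longrightarrow> clinear (\<lambda>v. tword (xs @ f v # ys))"
  and clin_tword0 [clin]: "clinear f \<Longrightarrow> clinear (\<lambda>v. tword (f v # ys))"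
  using clinear_compose[OF multilinearD[OF multilinear_tword]]
    clinear_compose[OF multilinearD0[OF multilinear_tword]] by auto

lemma multilinear_app:
  assumes "multilinear f" shows "multilinear (\<lambda>xs. f (us @ xs @ vs))"
proof (rule multilinearI)
  show "clinear (\<lambda>v. f (us @ (xs @ [v] @ ys) @ vs))" for xs ys
    using multilinearD[OF assms, of "us @ xs" "ys @ vs"] by simp
qed

lemma clin_talift_arg [clin]: "multilinear f \<Longrightarrow> clinear g \<Longrightarrow> clinear (\<lambda>x. talift f (g x))"
  by (rule clinear_compose[OF clinear_talift])

lemma clin_talift_fun [clin]:
  assumes "\<And>x. multilinear (f x)" "\<And>xs. clinear (\<lambda>x. f x xs)"
  shows "clinear (\<lambda>x. talift (f x) t)"
proof (rule clinearI)
  have "\<forall>t. talift (f (x + y)) t = talift (f x) t + talift (f y) t" for x y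
    by (rule tword_ext) (auto intro!: clin clinear_talift assms simp: talift_tword assms clinear_add[OF assms(2)])
  then show "talift (f (x + y)) t = talift (f x) t + talift (f y) t" for x y by blast
  have "\<forall>t. talift (f (k *\<^sub>C x)) t = k *\<^sub>C talift (f x) t" for k x
    by (rule tword_ext) (auto intro!: clin clinear_talift assms simp: talift_tword assms clinear_scale[OF assms(2)])
  then show "talift (f (k *\<^sub>C x)) t = k *\<^sub>C talift (f x) t" for k x by blast
qed

lemma tword_tdeg: "length xs = n \<Longrightarrow> tword xs \<in> tdeg n"
  unfolding tdeg_def by (rule cvec.span_base) auto

lemma multilinear_tmul_aux: "multilinear (\<lambda>xs. talift (\<lambda>ys. tword (xs @ ys)) y)"
proof (rule multilinearI)
  show "clinear (\<lambda>v. talift (\<lambda>zs. tword ((xs @ [v] @ ys) @ zs)) y)" for xs ys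
    using multilinear_app[OF multilinear_tword, of "xs @ [v] @ ys" "[]" for v]
    by (intro clin) (auto intro: clin)
qed

lemma clinear_tmul_left: "clinear (\<lambda>x. tmul x y)" and tmul_tword_left: "tmul (tword xs) y = talift (\<lambda>ys. tword (xs @ ys)) y"
  unfolding tmul_def using multilinear_tmul_aux by (auto intro!: clinear_talift talift_tword)

lemma tmul_tword [simp]: "tmul (tword xs) (tword ys) = tword (xs @ ys)"
  using multilinear_app[OF multilinear_tword, of xs "[]"]
  by (simp add: tmul_tword_left talift_tword)

lemma clinear_tmul_right: "clinear (tmul x)"
  unfolding tmul_def using multilinear_app[OF multilinear_tword, of xs "[]" for xs]
  by (intro clin_talift_fun multilinear_tmul_aux) (auto intro!: clinear_talift)

lemma clin_tmul_left [clin]: "clinear f \<Longrightarrow> clinear (\<lambda>x. tmul (f x) y)"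
  and clin_tmul_right [clin]: "clinear f \<Longrightarrow> clinear (\<lambda>x. tmul y (f x))"
  using clinear_compose[OF clinear_tmul_left] clinear_compose[OF clinear_tmul_right] by auto

lemma tdeg_ext2:
  fixes f g :: "'a::complex_vector tensor_algebra \<Rightarrow> 'b::complex_vector tensor_algebra \<Rightarrow> 'c::complex_vector"
  assumes "\<And>w. clinear (\<lambda>z. f z w)" "\<And>z. clinear (f z)" "\<And>w. clinear (\<lambda>z. g z w)" "\<And>z. clinear (g z)"
    and "\<And>xs ys. length xs = m \<Longrightarrow> length ys = n \<Longrightarrow> f (tword xs) (tword ys) = g (tword xs) (tword ys)"
  shows "\<forall>z\<in>tdeg m. \<forall>w\<in>tdeg n. f z w = g z w"
proof (intro ballI)
  fix z :: "'a tensor_algebra" and w :: "'b tensor_algebra"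
  assume z: "z \<in> tdeg m" and w: "w \<in> tdeg n"
  have "\<forall>w\<in>tdeg n. f (tword xs) w = g (tword xs) w" if "length xs = m" for xs :: "'a list"
    by (rule tdeg_ext[OF assms(2,4)]) (use assms(5) that in auto)
  with w have "\<forall>z\<in>tdeg m. f z w = g z w"
    by (intro tdeg_ext assms) auto
  with z show "f z w = g z w" by blast
qed

lemma tmul_assoc: "tmul (tmul x y) z = tmul x (tmul y z)"
proof -
  have "\<forall>z. tmul (tmul (tword xs) (tword ys)) z = tmul (tword xs) (tmul (tword ys) z)" for xs ys
    by (rule tword_ext) (auto intro!: clin simp del: tmul_tword simp: tmul_tword[of "_ @ _"] tmul_tword[of xs ys] tmul_tword[of ys] tmul_tword[of xs "_ @ _"])
  then have "\<forall>y. tmul (tmul (tword xs) y) z = tmul (tword xs) (tmul y z)" for xs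
    by (intro tword_ext) (auto intro!: clin)
  then have "\<forall>x. tmul (tmul x y) z = tmul x (tmul y z)"
    by (intro tword_ext) (auto intro!: clin)
  then show ?thesis ..
qed

lemma tmul_one_left [simp]: "tmul (tword []) x = x"
proof -
  have "\<forall>x. tmul (tword []) x = x" by (rule tword_ext) (auto intro!: clin clinear_tmul_right)
  then show ?thesis ..
qed

lemma tmul_one_right [simp]: "tmul x (tword []) = x"
proof -
  have "\<forall>x. tmul x (tword []) = x" by (rule tword_ext) (auto intro!: clin clinear_tmul_left)
  then show ?thesis ..
qed

lemma subspace_tdeg: "cvec.subspace (tdeg n)"
  by (simp add: tdeg_def)

lemma tdeg_map:
  assumes "clinear f" "\<And>xs. length xs = m \<Longrightarrow> f (tword xs) \<in> tdeg n" "x \<in> tdeg m"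
  shows "f x \<in> tdeg n"
  using clinear_span_into[OF assms(1), of "{tword xs |xs. length xs = m}" "{tword xs |xs. length xs = n}" x] assms(2,3)
  unfolding tdeg_def by auto

lemma tmul_tdeg:
  assumes x: "x \<in> tdeg m" and y: "y \<in> tdeg n"
  shows "tmul x y \<in> tdeg (m + n)"
proof (rule tdeg_map[OF clinear_tmul_left _ x])
  show "tmul (tword xs) y \<in> tdeg (m + n)" if "length xs = m" for xs
    by (rule tdeg_map[OF clinear_tmul_right _ y]) (simp add: tword_tdeg that)
qed

text \<open>Besides giving the homogeneous components, this expresses degree inside tensor products:
  that the first leg of a tensor has degree n is stated as invariance under
  \<open>tmap (tproj n) id\<close>.\<close>

definition tproj :: "nat \<Rightarrow> 'v::complex_vector tensor_algebra \<Rightarrow> 'v tensor_algebra"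
  where "tproj n = talift (\<lambda>xs. if length xs = n then tword xs else 0)"

lemma multilinear_if_length:
  "(\<And>xs ys. P (length xs + Suc (length ys)) \<Longrightarrow> clinear (\<lambda>v. f (xs @ v # ys))) \<Longrightarrow> multilinear (\<lambda>xs. if P (length xs) then f xs else 0)"
  by (rule multilinearI) (auto intro: clin)

lemma multilinear_tproj: "multilinear (\<lambda>xs. if length xs = n then tword xs else 0)"
  by (rule multilinear_if_length) (intro clin)

lemma clinear_tproj: "clinear (tproj n)"
  and tproj_tword: "tproj n (tword xs) = (if length xs = n then tword xs else 0)"
  unfolding tproj_def by (rule clinear_talift talift_tword, rule multilinear_tproj)+

lemma clin_tproj [clin]: "clinear f \<Longrightarrow> clinear (\<lambda>x. tproj n (f x))"
  by (rule clinear_compose[OF clinear_tproj])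

lemma tproj_tdeg: "x \<in> tdeg m \<Longrightarrow> tproj n x = (if m = n then x else 0)"
proof -
  have "\<forall>x\<in>tdeg m. tproj n x = (if m = n then x else 0)"
    by (rule tdeg_ext) (auto intro!: clin simp: tproj_tword clinear_tproj)
  then show "x \<in> tdeg m \<Longrightarrow> tproj n x = (if m = n then x else 0)" by blast
qed

lemma tproj_in_tdeg: "tproj n x \<in> tdeg n"
proof -
  have "tproj n x \<in> cvec.span (tdeg n)"
    by (rule clinear_span_into[OF clinear_tproj _ tensor_algebra_span])
      (auto simp: tproj_tword cvec.span_zero intro: cvec.span_base[OF tword_tdeg])
  then show ?thesis by (simp add: tdeg_def cvec.span_span)
qed

lemma tensor_algebra_span_tdeg: "x \<in> cvec.span (\<Union>n. tdeg n)"
proof -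
  have "range tword \<subseteq> (\<Union>n. tdeg n)" by (auto intro: tword_tdeg)
  then show ?thesis using tensor_algebra_span[of x] cvec.span_mono by blast
qed


subsection \<open>Antilinear maps\<close>

text \<open>An antilinear map is a linear map into the conjugate space.\<close>

typedef (overloaded) 'a conj = "UNIV :: 'a set" morphisms unconj conj ..

setup_lifting type_definition_conj

instantiation conj :: (complex_vector) complex_vector
begin
lift_definition zero_conj :: "'a conj" is 0 .
lift_definition plus_conj :: "'a conj \<Rightarrow> 'a conj \<Rightarrow> 'a conj" is "(+)" .
lift_definition minus_conj :: "'a conj \<Rightarrow> 'a conj \<Rightarrow> 'a conj" is "(-)" .
lift_definition uminus_conj :: "'a conj \<Rightarrow> 'a conj" is uminus .
lift_definition scaleC_conj :: "complex \<Rightarrow> 'a conj \<Rightarrow> 'a conj" is "\<lambda>c x. cnj c *\<^sub>C x" .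
instance
  by standard (transfer; simp add: scaleC_add_right scaleC_add_left scaleC_scaleC scaleC_one)+
end

lemma clinear_conj_iff: "clinear (\<lambda>x. conj (f x)) \<longleftrightarrow> antilinear f"
proof -
  have "conj (f (x + y)) = conj (f x) + conj (f y) \<longleftrightarrow> f (x + y) = f x + f y" for x y
    by (metis conj_inject UNIV_I plus_conj.abs_eq)
  moreover have "conj (f (c *\<^sub>C x)) = c *\<^sub>C conj (f x) \<longleftrightarrow> f (c *\<^sub>C x) = cnj c *\<^sub>C f x" for c x
    by (metis conj_inject UNIV_I scaleC_conj.abs_eq)
  ultimately show ?thesis by (simp add: clinear_iff antilinear_def)
qed

lemma antilinear_unconj: "clinear f \<Longrightarrow> antilinear (\<lambda>x. unconj (f x))"
  by (simp add: clinear_conj_iff[symmetric] unconj_inverse)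

lemma antilinear_add: "antilinear f \<Longrightarrow> f (x + y) = f x + f y"
  and antilinear_scale: "antilinear f \<Longrightarrow> f (c *\<^sub>C x) = cnj c *\<^sub>C f x"
  by (auto simp: antilinear_def)

lemma antilinear_zero: "antilinear f \<Longrightarrow> f 0 = 0"
  using antilinear_scale[of f 0 0] by simp

lemma antilinear_sum: "antilinear f \<Longrightarrow> f (sum g A) = (\<Sum>i\<in>A. f (g i))"
  by (induction A rule: infinite_finite_induct) (auto simp: antilinear_zero antilinear_add)

lemma antilinear_clinear: "antilinear f \<Longrightarrow> clinear g \<Longrightarrow> antilinear (\<lambda>x. f (g x))"
  by (simp add: antilinear_def clinear_iff)

lemma clinear_antilinear: "clinear g \<Longrightarrow> antilinear f \<Longrightarrow> antilinear (\<lambda>x. g (f x))"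
  by (simp add: antilinear_def clinear_iff)

lemma antilinear_antilinear: "antilinear f \<Longrightarrow> antilinear g \<Longrightarrow> clinear (\<lambda>x. f (g x))"
  by (simp add: antilinear_def clinear_iff)

lemma antilinear_on_span:
  assumes "antilinear f" "antilinear g" "\<And>x. x \<in> S \<Longrightarrow> f x = g x" "y \<in> cvec.span S"
  shows "f y = g y"
proof -
  have "conj (f y) = conj (g y)"
    by (rule clinear_eq_on_span[OF _ _ _ assms(4)]) (use assms in \<open>auto simp: clinear_conj_iff\<close>)
  then show ?thesis by (simp add: conj_inject)
qed

lemma antilinear_tensor_ext:
  assumes "antilinear f" "antilinear g" "\<And>x y. f (x \<otimes> y) = g (x \<otimes> y)"
  shows "\<forall>z. f z = g z"
  using antilinear_on_span[OF assms(1,2) _ tensor_span] assms(3) by auto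

lemma antilinear_tword_ext:
  assumes "antilinear f" "antilinear g" "\<And>xs. f (tword xs) = g (tword xs)"
  shows "\<forall>z. f z = g z"
  using antilinear_on_span[OF assms(1,2) _ tensor_algebra_span] assms(3) by auto

lemma antilinear_tdeg_ext:
  assumes "antilinear f" "antilinear g" "\<And>xs. length xs = n \<Longrightarrow> f (tword xs) = g (tword xs)"
  shows "\<forall>z\<in>tdeg n. f z = g z"
proof
  fix z :: "'a tensor_algebra" assume "z \<in> tdeg n"
  then show "f z = g z"
    unfolding tdeg_def by (rule antilinear_on_span[OF assms(1,2), rotated]) (use assms(3) in auto)
qed

lemma tlift_anti:
  assumes "\<And>a. antilinear (f a)" "\<And>b. antilinear (\<lambda>a. f a b)"
  shows antilinear_tlift_anti: "antilinear (tlift_anti f)" and tlift_anti_tens: "tlift_anti f (x \<otimes> y) = f x y"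
proof -
  have c: "cbilinear (\<lambda>a b. conj (f a b))"
    by (rule cbilinearI) (simp_all add: clinear_conj_iff assms)
  have "antilinear (\<lambda>t. unconj (tlift (\<lambda>a b. conj (f a b)) t))"
    by (rule antilinear_unconj, rule clinear_tlift, rule c)
  moreover have "unconj (tlift (\<lambda>a b. conj (f a b)) (x \<otimes> y)) = f x y" for x y
    by (simp add: tlift_tens[OF c] conj_inverse)
  ultimately have "\<exists>g. antilinear g \<and> (\<forall>x y. g (x \<otimes> y) = f x y)" by blast
  from someI_ex[OF this] show "antilinear (tlift_anti f)" "tlift_anti f (x \<otimes> y) = f x y"
    by (auto simp: tlift_anti_def)
qed

lemma antilinear_tens_left: "antilinear f \<Longrightarrow> antilinear (\<lambda>x. f x \<otimes> y)"
  and antilinear_tens_right: "antilinear f \<Longrightarrow> antilinear (\<lambda>x. y \<otimes> f x)"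
  by (simp_all add: antilinear_def tens_add tens_scale)

lemma tmap_anti:
  assumes "antilinear f" "antilinear g"
  shows antilinear_tmap_anti: "antilinear (tmap_anti f g)"
    and tmap_anti_tens: "tmap_anti f g (x \<otimes> y) = f x \<otimes> g y"
  unfolding tmap_anti_def using assms
  by (auto intro!: antilinear_tlift_anti tlift_anti_tens antilinear_tens_left antilinear_tens_right)

lemma talift_anti:
  assumes "\<And>xs ys. antilinear (\<lambda>v. f (xs @ v # ys))"
  shows antilinear_talift_anti: "antilinear (talift_anti f)" and talift_anti_tword: "talift_anti f (tword xs) = f xs"
proof -
  have c: "multilinear (\<lambda>xs. conj (f xs))"
    by (rule multilinearI) (simp add: clinear_conj_iff assms)
  have "antilinear (\<lambda>t. unconj (talift (\<lambda>xs. conj (f xs)) t))"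
    by (rule antilinear_unconj, rule clinear_talift, rule c)
  moreover have "unconj (talift (\<lambda>xs. conj (f xs)) (tword xs)) = f xs" for xs
    by (simp add: talift_tword[OF c] conj_inverse)
  ultimately have "\<exists>g. antilinear g \<and> (\<forall>xs. g (tword xs) = f xs)" by blast
  from someI_ex[OF this] show "antilinear (talift_anti f)" "talift_anti f (tword xs) = f xs"
    by (auto simp: talift_anti_def)
qed

lemma qlift_anti:
  assumes "antilinear f" "\<And>x. x \<in> cvec.span I \<Longrightarrow> f x = 0"
  shows antilinear_qlift_anti: "antilinear (qlift_anti I f)" and qlift_anti_qcls: "qlift_anti I f (qcls I x) = f x"
proof -
  have c: "clinear (\<lambda>x. conj (f x))" by (simp add: clinear_conj_iff assms)
  have z: "conj (f x) = 0" if "x \<in> cvec.span I" for x by (simp add: assms(2) that zero_conj_def)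
  have "antilinear (\<lambda>t. unconj (qlift I (\<lambda>x. conj (f x)) t))"
    by (rule antilinear_unconj, rule clinear_qlift[OF c z])
  moreover have "unconj (qlift I (\<lambda>x. conj (f x)) (qcls I x)) = f x" for x
    by (simp add: qlift_qcls[OF c z] conj_inverse)
  ultimately have "\<exists>g. antilinear g \<and> (\<forall>x. g (qcls I x) = f x)" by blast
  from someI_ex[OF this] show "antilinear (qlift_anti I f)" "qlift_anti I f (qcls I x) = f x"
    by (auto simp: qlift_anti_def)
qed

section \<open>Positive braid words and Matsumoto's theorem for symmetric groups\<close>

section \<open>Words in the braid generators\<close>

text \<open>The congruence of the positive braid monoid. The relation that a generator squares to 1
  is absent, so equivalent words have equal length and act in the same way for every Yang-Baxter
  operator.\<close>

inductive braid_equiv :: "nat list \<Rightarrow> nat list \<Rightarrow> bool" where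
  braid_refl: "braid_equiv xs xs"
| braid_sym: "braid_equiv xs ys \<Longrightarrow> braid_equiv ys xs"
| braid_trans [trans]: "braid_equiv xs ys \<Longrightarrow> braid_equiv ys zs \<Longrightarrow> braid_equiv xs zs"
| braid_far: "Suc i < j \<Longrightarrow> braid_equiv (xs @ [i, j] @ ys) (xs @ [j, i] @ ys)"
| braid_braid: "braid_equiv (xs @ [i, Suc i, i] @ ys) (xs @ [Suc i, i, Suc i] @ ys)"

lemma braid_equiv_context: "braid_equiv xs ys \<Longrightarrow> braid_equiv (us @ xs @ vs) (us @ ys @ vs)"
proof (induction rule: braid_equiv.induct)
  case (braid_far i j xs ys)
  then show ?case using braid_equiv.braid_far[of i j "us @ xs" "ys @ vs"] by simp
next
  case (braid_braid xs i ys)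
  then show ?case using braid_equiv.braid_braid[of "us @ xs" i "ys @ vs"] by simp
qed (auto intro: braid_refl braid_sym braid_trans)

lemma braid_equiv_Cons: "braid_equiv xs ys \<Longrightarrow> braid_equiv (i # xs) (i # ys)"
  using braid_equiv_context[of xs ys "[i]" "[]"] by simp

lemma braid_equiv_prefix: "braid_equiv xs ys \<Longrightarrow> braid_equiv (us @ xs) (us @ ys)"
  using braid_equiv_context[of xs ys us "[]"] by simp

lemma braid_equiv_suffix: "braid_equiv xs ys \<Longrightarrow> braid_equiv (xs @ vs) (ys @ vs)"
  using braid_equiv_context[of xs ys "[]" vs] by simp

lemma braid_equiv_move:
  "(\<And>j. j \<in> set xs \<Longrightarrow> Suc i < j \<or> Suc j < i) \<Longrightarrow> braid_equiv (i # xs) (xs @ [i])"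
proof (induction xs)
  case (Cons j xs)
  have "braid_equiv (i # j # xs) (j # i # xs)"
    using Cons.prems[of j] braid_equiv.braid_far[of i j "[]" xs] braid_equiv.braid_far[of j i "[]" xs]
    by (auto intro: braid_sym)
  also have "braid_equiv \<dots> (j # xs @ [i])"
    using Cons by (intro braid_equiv_Cons) auto
  finally show ?case by simp
qed (simp add: braid_refl)

lemma word_perm_append: "word_perm (xs @ ys) = word_perm xs \<circ> word_perm ys"
  by (induction xs) (auto simp: word_perm_def comp_assoc)

lemma word_perm_Nil [simp]: "word_perm [] = id"
  and word_perm_Cons: "word_perm (i # xs) = transpose i (Suc i) \<circ> word_perm xs"
  by (simp_all add: word_perm_def)

lemma transpose_far: "Suc i < j \<Longrightarrow> transpose i (Suc i) \<circ> transpose j (Suc j) = transpose j (Suc j) \<circ> transpose i (Suc i)"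
  by (auto simp: transpose_def fun_eq_iff)

lemma transpose_braid: "transpose i (Suc i) \<circ> (transpose (Suc i) (Suc (Suc i)) \<circ> transpose i (Suc i)) =
    transpose (Suc i) (Suc (Suc i)) \<circ> (transpose i (Suc i) \<circ> transpose (Suc i) (Suc (Suc i)))"
  by (auto simp: transpose_def fun_eq_iff)

lemma braid_equiv_word_perm: "braid_equiv xs ys \<Longrightarrow> word_perm xs = word_perm ys"
proof (induction rule: braid_equiv.induct)
  case (braid_far i j xs ys)
  then show ?case
    using transpose_far[of i j] by (simp add: word_perm_append word_perm_Cons comp_assoc[symmetric])
next
  case (braid_braid xs i ys)
  show ?case
    using arg_cong[OF transpose_braid[of i], of "\<lambda>f. f \<circ> word_perm ys"]
    by (simp add: word_perm_append word_perm_Cons comp_assoc)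
qed auto

lemma braid_equiv_length: "braid_equiv xs ys \<Longrightarrow> length xs = length ys"
  by (induction rule: braid_equiv.induct) auto


subsection \<open>Normal forms and reduced expressions\<close>

text \<open>The normal forms for \<open>n + 1\<close> strands first permute the first \<open>n\<close> strands and then move the
  last strand to the left; words act like composed functions, the rightmost letter first.\<close>

primrec normal_words :: "nat \<Rightarrow> nat list set" where
  "normal_words 0 = {[]}"
| "normal_words (Suc n) = (\<lambda>(j, v). [n - j..<n] @ v) ` ({..n} \<times> normal_words n)"

lemma normal_words_letters: "v \<in> normal_words n \<Longrightarrow> i \<in> set v \<Longrightarrow> Suc i < n"
  by (induction n arbitrary: v) (force)+

lemma upt_append_upt: "a \<le> b \<Longrightarrow> b \<le> c \<Longrightarrow> [a..<b] @ [b..<c] = [a..<c]"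
  by (metis upt_add_eq_append le_add_diff_inverse)

text \<open>The letter i + 1 commutes with a, ..., i - 1; one braid relation turns i + 1, i, i + 1
  into i, i + 1, i; and the last i commutes with the letters from i + 2 on.\<close>

lemma upt_slide:
  assumes "a \<le> i" "Suc i < m"
  shows "braid_equiv (Suc i # [a..<m]) ([a..<m] @ [i])"
proof -
  have m: "[a..<m] = [a..<i] @ [i, Suc i] @ [Suc (Suc i)..<m]"
    using assms upt_append_upt[of a i m] by (simp add: upt_conv_Cons)
  have "braid_equiv (Suc i # [a..<m]) ((Suc i # [a..<i]) @ [i, Suc i] @ [Suc (Suc i)..<m])"
    by (simp add: m braid_refl)
  also have "braid_equiv \<dots> (([a..<i] @ [Suc i]) @ [i, Suc i] @ [Suc (Suc i)..<m])"
    by (intro braid_equiv_suffix braid_equiv_move) auto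
  also have "braid_equiv \<dots> (([a..<i] @ [i, Suc i]) @ (i # [Suc (Suc i)..<m]))"
    using braid_sym[OF braid_equiv.braid_braid[of "[a..<i]" i "[Suc (Suc i)..<m]"]] by simp
  also have "braid_equiv \<dots> (([a..<i] @ [i, Suc i]) @ ([Suc (Suc i)..<m] @ [i]))"
    by (intro braid_equiv_prefix braid_equiv_move) auto
  finally show ?thesis by (simp add: m)
qed

text \<open>An exchange condition: a generator times a normal word is either a normal word up to
  braid relations or has the permutation of a shorter normal word. The letter i is compared with the
  first run [m - j..<m]: far below, it commutes with the run; just below, it lengthens the run;
  equal to its head, it cancels in the permutation; above the head, it slides through and becomes i
  - 1.\<close>

lemma normal_words_step:
  assumes "v \<in> normal_words n" "Suc i < n"
  shows "(\<exists>u\<in>normal_words n. braid_equiv (i # v) u) \<or>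
    (\<exists>u\<in>normal_words n. length u < Suc (length v) \<and> word_perm u = word_perm (i # v))"
  using assms
proof (induction n arbitrary: v i)
  case (Suc m)
  then obtain j v' where v: "v = [m - j..<m] @ v'" "j \<le> m" "v' \<in> normal_words m" by auto
  have nf: "[m - j..<m] @ u \<in> normal_words (Suc m)" if "u \<in> normal_words m" for u
    using that v(2) by auto
  \<comment> \<open>In two of the four cases the letter passes the run and comes out as i'; the
    induction hypothesis then treats i' in front of the remaining word.\<close>
  have push: ?case if e: "braid_equiv (i # [m - j..<m]) ([m - j..<m] @ [i'])" and i': "Suc i' < m" for i'
  proof -
    have e': "braid_equiv (i # v) ([m - j..<m] @ i' # v')"
      using braid_equiv_suffix[OF e, of v'] by (simp add: v(1))
    from Suc.IH[OF v(3) i'] show ?thesis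
    proof (elim disjE bexE conjE)
      fix u assume u: "u \<in> normal_words m" "braid_equiv (i' # v') u"
      have "braid_equiv (i # v) ([m - j..<m] @ u)"
        using e' braid_equiv_prefix[OF u(2)] by (rule braid_trans)
      with nf[OF u(1)] show ?thesis by blast
    next
      fix u assume u: "u \<in> normal_words m" "length u < Suc (length v')" "word_perm u = word_perm (i' # v')"
      have "word_perm ([m - j..<m] @ u) = word_perm (i # v)"
        using braid_equiv_word_perm[OF e'] u(3) by (simp add: word_perm_append)
      with nf[OF u(1)] u(2) show ?thesis by (intro disjI2 bexI[of _ "[m - j..<m] @ u"]) (auto simp: v(1))
    qed
  qed
  consider "Suc i < m - j" | "Suc i = m - j" | "i = m - j" | "m - j < i" by linarith
  then show ?case
  proof cases
    case 1
    then show ?thesis by (intro push[of i] braid_equiv_move) auto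
  next
    case 2
    then have "i = m - Suc j" "Suc j \<le> m" "[m - Suc j..<m] = (m - Suc j) # [m - j..<m]"
      by (auto simp: upt_conv_Cons Suc_diff_Suc)
    then have "i # v = [m - Suc j..<m] @ v'" "Suc j \<le> m" by (simp_all add: v(1))
    then have "i # v \<in> normal_words (Suc m)" using v(3) by force
    then show ?thesis using braid_refl by blast
  next
    case 3
    with Suc.prems v(2) have j: "j = Suc (j - 1)" "[m - j..<m] = i # [m - (j - 1)..<m]"
      by (auto simp: upt_conv_Cons Suc_diff_le)
    have "word_perm ([m - (j - 1)..<m] @ v') = word_perm (i # v)"
      by (simp add: v(1) j(2) word_perm_append word_perm_Cons fun_eq_iff)
    moreover have "[m - (j - 1)..<m] @ v' \<in> normal_words (Suc m)"
      using v by (auto intro!: image_eqI[of _ _ "(j - 1, v')"])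
    moreover have "length ([m - (j - 1)..<m] @ v') < Suc (length v)"
      unfolding v(1) j(2) by simp
    ultimately show ?thesis by blast
  next
    case 4
    then have "braid_equiv (i # [m - j..<m]) ([m - j..<m] @ [i - 1])"
      using upt_slide[of "m - j" "i - 1" m] Suc.prems by simp
    then show ?thesis using push[of "i - 1"] 4 Suc.prems by simp
  qed
qed simp

lemma word_perm_permutes: "\<forall>i\<in>set xs. Suc i < n \<Longrightarrow> word_perm xs permutes {..<n}"
  by (induction xs) (auto simp: word_perm_Cons permutes_id intro!: permutes_compose permutes_swap_id)

lemma word_perm_upt: "word_perm [n - j..<n] n = n - j" if "j \<le> n"
  using that
proof (induction j)
  case (Suc j)
  then have "[n - Suc j..<n] = (n - Suc j) # [n - j..<n]"
    by (simp add: upt_conv_Cons Suc_diff_Suc)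
  with Suc show ?case by (simp add: word_perm_Cons transpose_def Suc_diff_Suc)
qed simp

text \<open>The length of the run can be read off the permutation: normal words on n strands fix the
  position n, and the run sends it to n - j. Then the injective permutation of the run can be
  cancelled.\<close>

lemma word_perm_inj_aux:
  assumes "j \<le> n" "j' \<le> n" "v \<in> normal_words n" "v' \<in> normal_words n"
    and "word_perm ([n - j..<n] @ v) = word_perm ([n - j'..<n] @ v')"
  shows "j = j' \<and> word_perm v = word_perm v'"
proof -
  have fix_n: "word_perm u n = n" if "u \<in> normal_words n" for u
    using word_perm_permutes[of u n] normal_words_letters[OF that] by (auto simp: permutes_def)
  have "word_perm ([n - j..<n] @ v) n = n - j" if "j \<le> n" "v \<in> normal_words n" for j v
    using that by (simp add: word_perm_append fix_n word_perm_upt)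
  with assms have "n - j = n - j'" by metis
  with assms(1,2) have j: "j = j'" by simp
  have "inj (word_perm [n - j..<n])"
    by (rule permutes_inj[OF word_perm_permutes[of _ "Suc n"]]) auto
  with assms(5) j show ?thesis by (auto simp: word_perm_append fun_eq_iff inj_def)
qed

lemma inj_on_word_perm: "inj_on word_perm (normal_words n)"
proof (induction n)
  case (Suc n)
  show ?case
  proof (rule inj_onI)
    fix x y assume "x \<in> normal_words (Suc n)" "y \<in> normal_words (Suc n)" and eq: "word_perm x = word_perm y"
    then obtain j v j' v' where *: "x = [n - j..<n] @ v" "j \<le> n" "v \<in> normal_words n"
      "y = [n - j'..<n] @ v'" "j' \<le> n" "v' \<in> normal_words n" by auto
    with word_perm_inj_aux[of j n j' v v'] eq have "j = j' \<and> word_perm v = word_perm v'" by simp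
    with inj_onD[OF Suc _ *(3,6)] * show "x = y" by simp
  qed
qed simp

lemma inj_on_normal_words: "inj_on (\<lambda>(j, v). [n - j..<n] @ v) ({..n} \<times> normal_words n)"
proof -
  have inj: "j = j' \<and> v = v'"
    if *: "j \<le> n" "v \<in> normal_words n" "j' \<le> n" "v' \<in> normal_words n" "[n - j..<n] @ v = [n - j'..<n] @ v'"
    for j v j' v'
  proof -
    have "j = j'" "word_perm v = word_perm v'"
      using word_perm_inj_aux[of j n j' v v'] * by auto
    with inj_onD[OF inj_on_word_perm _ *(2,4)] show ?thesis by simp
  qed
  show ?thesis
  proof (rule inj_onI)
    fix p p' :: "nat \<times> nat list"
    assume "p \<in> {..n} \<times> normal_words n" "p' \<in> {..n} \<times> normal_words n"
      and "(\<lambda>(j, v). [n - j..<n] @ v) p = (\<lambda>(j, v). [n - j..<n] @ v) p'"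
    then show "p = p'"
      using inj[of "fst p" "snd p" "fst p'" "snd p'"] by (simp add: case_prod_beta mem_Times_iff prod_eq_iff)
  qed
qed

lemma card_normal_words: "card (normal_words n) = fact n"
  by (induction n) (simp_all add: card_image[OF inj_on_normal_words] card_cartesian_product)

text \<open>Injectivity suffices, as there are n! normal words and n! permutations.\<close>

lemma bij_betw_word_perm: "bij_betw word_perm (normal_words n) {\<sigma>. \<sigma> permutes {..<n}}"
proof -
  have sub: "word_perm ` normal_words n \<subseteq> {\<sigma>. \<sigma> permutes {..<n}}"
    using word_perm_permutes normal_words_letters by blast
  have fin: "finite {\<sigma>. \<sigma> permutes {..<n}}"
    by (rule finite_permutations) simp
  have "card (word_perm ` normal_words n) = card {\<sigma>. \<sigma> permutes {..<n}}"
    by (simp add: card_image[OF inj_on_word_perm] card_normal_words card_permutations[of "{..<n}" n])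
  with sub fin inj_on_word_perm show ?thesis
    by (auto simp: bij_betw_def card_subset_eq)
qed

text \<open>The tail of a reduced expression is reduced and so has a normal form. Of the two
  alternatives for one more letter, the shortening one would contradict minimality of the
  length.\<close>

lemma reduced_expression_normal:
  "reduced_expression n (word_perm xs) xs \<Longrightarrow> \<exists>u\<in>normal_words n. braid_equiv xs u"
proof (induction xs)
  case Nil
  have "[] \<in> normal_words n" by (induction n) (auto intro!: image_eqI[of _ _ "(0, [])"])
  then show ?case using braid_refl by blast
next
  case (Cons i xs)
  have "length xs \<le> length js" if "\<forall>j\<in>set js. Suc j < n" "word_perm js = word_perm xs" for js
    using Cons.prems that unfolding reduced_expression_def
    by (auto simp: word_perm_Cons dest!: spec[of _ "i # js"])
  then have "reduced_expression n (word_perm xs) xs"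
    using Cons.prems by (auto simp: reduced_expression_def)
  then obtain v where v: "v \<in> normal_words n" "braid_equiv xs v" using Cons.IH by blast
  have i: "Suc i < n" using Cons.prems by (simp add: reduced_expression_def)
  have e: "braid_equiv (i # xs) (i # v)" using v(2) by (rule braid_equiv_Cons)
  from normal_words_step[OF v(1) i] show ?case
  proof (elim disjE bexE conjE)
    fix u assume "u \<in> normal_words n" "braid_equiv (i # v) u"
    with e show ?thesis using braid_trans by blast
  next
    fix u assume u: "u \<in> normal_words n" "length u < Suc (length v)" "word_perm u = word_perm (i # v)"
    then have "length (i # xs) \<le> length u"
      using Cons.prems normal_words_letters[OF u(1)] braid_equiv_word_perm[OF e]
      by (auto simp: reduced_expression_def)
    with u(2) braid_equiv_length[OF e] show ?thesis by simp
  qed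
qed

text \<open>Matsumoto's theorem in the form needed for \<open>braid_perm\<close>: whichever reduced
  expression the choice returns, braid relations turn it into the normal word of the same
  permutation.\<close>

lemma some_reduced_expression:
  assumes "u \<in> normal_words n"
  shows "braid_equiv (SOME xs. reduced_expression n (word_perm u) xs) u"
proof -
  define P where "P xs \<longleftrightarrow> (\<forall>i\<in>set xs. Suc i < n) \<and> word_perm xs = word_perm u" for xs
  have "P u" using normal_words_letters[OF assms] by (auto simp: P_def)
  then have "\<exists>xs. P xs \<and> (\<forall>ys. P ys \<longrightarrow> length xs \<le> length ys)"
    by (rule ex_has_least_nat)
  then obtain xs where "P xs \<and> (\<forall>ys. P ys \<longrightarrow> length xs \<le> length ys)" ..
  then have "reduced_expression n (word_perm u) xs" by (simp add: reduced_expression_def P_def)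
  then have r: "reduced_expression n (word_perm u) (SOME xs. reduced_expression n (word_perm u) xs)"
    (is "reduced_expression _ _ ?xs") by (rule someI)
  then have e: "word_perm ?xs = word_perm u" by (simp add: reduced_expression_def)
  with r obtain v where v: "v \<in> normal_words n" "braid_equiv ?xs v"
    using reduced_expression_normal[of n ?xs] by (metis (no_types))
  have "word_perm v = word_perm u"
    by (rule trans[OF braid_equiv_word_perm[OF v(2), symmetric] e])
  then have "v = u" by (rule inj_onD[OF inj_on_word_perm _ v(1) assms])
  show ?thesis using v(2) unfolding \<open>v = u\<close> .
qed

section \<open>Identities in the positive braid ring: crossings, factorials, shuffles\<close>

section \<open>Braided factorials in a ring with a braid group action\<close>

text \<open>The word for \<open>a\<close> strands from position k on crossing the next
  \<open>b\<close>. As the rightmost letter acts first, the last strand of the block is the first to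
  cross.\<close>

primrec crw :: "nat \<Rightarrow> nat \<Rightarrow> nat \<Rightarrow> nat list" where
  "crw k 0 b = []"
| "crw k (Suc a) b = rev [k..<k + b] @ crw (Suc k) a b"

lemma crw_letters: "i \<in> set (crw k a b) \<Longrightarrow> k \<le> i \<and> Suc i < k + a + b"
  by (induction a arbitrary: k) fastforce+

lemma crw_0 [simp]: "crw k a 0 = []"
  by (induction a arbitrary: k) auto

lemma crw_1: "crw k a (Suc 0) = [k..<k + a]"
  by (induction a arbitrary: k) (simp_all add: upt_conv_Cons)

lemma crw_shift: "crw (k + d) a b = map (\<lambda>i. i + d) (crw k a b)"
proof (induction a arbitrary: k)
  case (Suc a)
  have "[k + d..<k + d + b] = map (\<lambda>i. i + d) [k..<k + b]"
    by (induction b) auto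
  then show ?case using Suc[of "Suc k"] by (simp add: rev_map add.assoc)
qed simp

text \<open>Only the relations of the positive braid monoid are available: no quadratic relation and
  no inverses. The sort avoids \<open>ring_1\<close>, whose axiom 0 \<noteq> 1 fails for
  endomorphisms of a zero space.\<close>

locale braid_ring =
  fixes g :: "nat \<Rightarrow> 'm::{ring, monoid_mult}"
  assumes far: "Suc i < j \<Longrightarrow> g i * g j = g j * g i"
    and braid: "g i * g (Suc i) * g i = g (Suc i) * g i * g (Suc i)"
begin

lemma braid_assoc:
  "g i * (g (Suc i) * g i) = g (Suc i) * (g i * g (Suc i))"
  "g i * (g (Suc i) * (g i * z)) = g (Suc i) * (g i * (g (Suc i) * z))"
  using braid[of i] by (simp_all add: mult.assoc[symmetric])

definition bw :: "nat list \<Rightarrow> 'm" where "bw xs = prod_list (map g xs)"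

lemma bw_Nil [simp]: "bw [] = 1" and bw_Cons: "bw (i # xs) = g i * bw xs"
  and bw_append: "bw (xs @ ys) = bw xs * bw ys" and bw_single: "bw [i] = g i"
  by (simp_all add: bw_def)

lemma bw_braid_equiv: "braid_equiv xs ys \<Longrightarrow> bw xs = bw ys"
proof (induction rule: braid_equiv.induct)
  case (braid_far i j xs ys)
  then show ?case using braid_ring.far[OF braid_ring_axioms, of i j]
    by (simp add: bw_append bw_Cons mult.assoc[symmetric])
next
  case (braid_braid xs i ys)
  show ?case by (simp add: bw_append bw_Cons mult.assoc braid_assoc)
qed auto

text \<open>Records on which strands an element acts. Sums and products suffice, since only sums of
  positive braid words have to be localised. Commutation at a distance, preservation of degree and
  colinearity each become one induction over this set.\<close>

inductive_set gen :: "nat set \<Rightarrow> 'm set" for A where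
  one: "1 \<in> gen A"
| zero: "0 \<in> gen A"
| gen: "i \<in> A \<Longrightarrow> g i \<in> gen A"
| add: "x \<in> gen A \<Longrightarrow> y \<in> gen A \<Longrightarrow> x + y \<in> gen A"
| mult: "x \<in> gen A \<Longrightarrow> y \<in> gen A \<Longrightarrow> x * y \<in> gen A"

lemma gen_bw: "set xs \<subseteq> A \<Longrightarrow> bw xs \<in> gen A"
  by (induction xs) (auto simp: bw_Cons intro: gen.intros)

lemma gen_sum: "(\<And>i. i \<in> I \<Longrightarrow> f i \<in> gen A) \<Longrightarrow> sum f I \<in> gen A"
  by (induction I rule: infinite_finite_induct) (auto intro: gen.intros)

lemma gen_mono: "x \<in> gen A \<Longrightarrow> A \<subseteq> B \<Longrightarrow> x \<in> gen B"
  by (induction rule: gen.induct) (auto intro: gen.intros)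

lemma gen_commute:
  assumes "x \<in> gen A" "y \<in> gen B" "\<And>i j. i \<in> A \<Longrightarrow> j \<in> B \<Longrightarrow> Suc i < j \<or> Suc j < i"
  shows "x * y = y * x"
proof -
  have 1: "g i * y = y * g i" if "i \<in> A" for i
    using assms(2)
  proof (induction rule: gen.induct)
    case (gen j)
    then show ?case using assms(3)[OF that, of j] far[of i j] far[of j i] by auto
  next
    case (mult x y)
    then show ?case by (metis mult.assoc)
  qed (auto simp: algebra_simps)
  show ?thesis using assms(1)
  proof (induction rule: gen.induct)
    case (mult x y)
    then show ?case by (metis mult.assoc)
  qed (auto simp: algebra_simps 1)
qed


subsection \<open>Block crossings\<close>

text \<open>\<open>cr k a b\<close> moves the \<open>a\<close> strands from position \<open>k\<close> on past the \<open>b\<close> strands following them.\<close>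

definition cr :: "nat \<Rightarrow> nat \<Rightarrow> nat \<Rightarrow> 'm" where "cr k a b = bw (crw k a b)"

lemma gen_cr: "cr k a b \<in> gen {i. k \<le> i \<and> Suc i < k + a + b}"
  unfolding cr_def using crw_letters by (intro gen_bw) blast

lemma cr_0 [simp]: "cr k 0 b = 1" "cr k a 0 = 1"
  by (simp_all add: cr_def)

lemma cr_single_left: "cr k (Suc 0) b = bw (rev [k..<k + b])"
  and cr_single_right: "cr k a (Suc 0) = bw [k..<k + a]"
  by (simp_all add: cr_def crw_1)

lemma cr_Suc_left: "cr k (Suc a) b = cr k (Suc 0) b * cr (Suc k) a b"
  by (simp add: cr_def bw_append)

lemma cr_add_left: "cr k (a + a') b = cr k a b * cr (k + a) a' b"
proof (induction a arbitrary: k)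
  case (Suc a)
  then show ?case using cr_Suc_left[of k "a + a'" b] cr_Suc_left[of k a b] by (simp add: mult.assoc)
qed simp

lemma cr_add_right: "cr k a (b + b') = cr (k + b) a b' * cr k a b"
proof (induction a arbitrary: k)
  case (Suc a)
  have "rev [k..<k + (b + b')] = rev [k + b..<k + b + b'] @ rev [k..<k + b]"
    using upt_append_upt[of k "k + b" "k + b + b'"] by (metis add.assoc le_add1 rev_append)
  then have 1: "cr k (Suc 0) (b + b') = cr (k + b) (Suc 0) b' * cr k (Suc 0) b"
    by (simp add: cr_single_left bw_append)
  have "cr k (Suc 0) b * cr (Suc (k + b)) a b' = cr (Suc (k + b)) a b' * cr k (Suc 0) b"
    by (rule gen_commute[OF gen_cr gen_cr]) auto
  then show ?case
    using Suc[of "Suc k"]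
    by (simp add: 1 cr_Suc_left[of k a "b + b'"] cr_Suc_left[of k a b] cr_Suc_left[of "k + b" a b'])
      (metis mult.assoc)
qed simp

text \<open>Only the strands i and i + 1 of the moving block interact with the generator; the
  crossings of the other strands act at positions that commute with it, before or after its shift by
  b.\<close>

lemma cr_natural_left:
  assumes "k \<le> i" "Suc i < k + a"
  shows "cr k a b * g i = g (i + b) * cr k a b"
proof -
  \<comment> \<open>Each further strand passed by the two strands costs one braid relation.\<close>
  have two: "cr i 2 b * g i = g (i + b) * cr i 2 b" for i b
  proof (induction b arbitrary: i)
    case (Suc b)
    have c: "cr i 2 (Suc 0) = g i * g (Suc i)" by (simp add: cr_single_right bw_Cons numeral_2_eq_2)
    have s: "cr i 2 (Suc b) = cr (Suc i) 2 b * cr i 2 (Suc 0)" using cr_add_right[of i 2 "Suc 0" b] by simp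
    have "cr i 2 (Suc b) * g i = cr (Suc i) 2 b * (g i * g (Suc i) * g i)" by (simp add: s c mult.assoc)
    also have "\<dots> = (cr (Suc i) 2 b * g (Suc i)) * (g i * g (Suc i))" by (simp add: braid_assoc mult.assoc)
    also have "\<dots> = g (i + Suc b) * cr i 2 (Suc b)" using Suc[of "Suc i"] by (simp add: s c mult.assoc)
    finally show ?case .
  qed simp
  define r where "r = k + a - i - 2"
  have a: "a = (i - k) + (2 + r)" using assms by (simp add: r_def)
  have s: "cr k a b = cr k (i - k) b * cr i 2 b * cr (Suc (Suc i)) r b"
    unfolding a cr_add_left using assms by (simp add: mult.assoc)
  have 1: "cr (Suc (Suc i)) r b * g i = g i * cr (Suc (Suc i)) r b"
    by (rule gen_commute[OF gen_cr gen.gen[of i "{i}"]]) auto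
  have 2: "cr k (i - k) b * g (i + b) = g (i + b) * cr k (i - k) b"
    by (rule gen_commute[OF gen_cr gen.gen[of "i + b" "{i + b}"]]) (use assms in auto)
  have "cr k a b * g i = cr k (i - k) b * (cr i 2 b * g i) * cr (Suc (Suc i)) r b"
    by (simp add: s mult.assoc 1)
  also have "\<dots> = (cr k (i - k) b * g (i + b)) * cr i 2 b * cr (Suc (Suc i)) r b"
    by (simp add: two mult.assoc)
  finally show ?thesis by (simp add: 2 s mult.assoc)
qed

text \<open>Induction over the moving strands. For one strand, the part of its path at positions j
  and j + 1 lets the generator through by a single braid relation.\<close>

lemma cr_natural_right:
  assumes "k \<le> j" "Suc j < k + b"
  shows "cr k a b * g (j + a) = g j * cr k a b"
  using assms
proof (induction a arbitrary: k j)
  case (Suc a)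
  define r where "r = k + b - j - 2"
  have b: "b = (j - k) + (2 + r)" using Suc.prems by (simp add: r_def)
  have s: "cr k (Suc 0) b = cr (Suc (Suc j)) (Suc 0) r * cr j (Suc 0) 2 * cr k (Suc 0) (j - k)"
    unfolding b cr_add_right using Suc.prems by simp
  have c: "cr j (Suc 0) 2 = g (Suc j) * g j"
    by (simp add: cr_single_left bw_Cons upt_conv_Cons bw_append numeral_2_eq_2)
  have 1: "cr k (Suc 0) (j - k) * g (Suc j) = g (Suc j) * cr k (Suc 0) (j - k)"
    by (rule gen_commute[OF gen_cr gen.gen[of "Suc j" "{Suc j}"]]) (use Suc.prems in auto)
  have 2: "cr (Suc (Suc j)) (Suc 0) r * g j = g j * cr (Suc (Suc j)) (Suc 0) r"
    by (rule gen_commute[OF gen_cr gen.gen[of j "{j}"]]) auto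
  have "cr k (Suc 0) b * g (Suc j) = cr (Suc (Suc j)) (Suc 0) r * (g (Suc j) * g j * g (Suc j)) * cr k (Suc 0) (j - k)"
    by (simp add: s c mult.assoc 1)
  also have "\<dots> = (cr (Suc (Suc j)) (Suc 0) r * g j) * (g (Suc j) * g j) * cr k (Suc 0) (j - k)"
    by (simp add: braid_assoc mult.assoc)
  finally have one: "cr k (Suc 0) b * g (Suc j) = g j * cr k (Suc 0) b"
    by (simp add: 2 s c mult.assoc)
  have "cr k (Suc a) b * g (j + Suc a) = cr k (Suc 0) b * (cr (Suc k) a b * g (Suc j + a))"
    by (simp add: cr_Suc_left[of k a] mult.assoc)
  also have "\<dots> = cr k (Suc 0) b * g (Suc j) * cr (Suc k) a b"
    using Suc.IH[of "Suc k" "Suc j"] Suc.prems by (simp add: mult.assoc)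
  finally show ?case by (simp add: one cr_Suc_left[of k a] mult.assoc)
qed simp

lemma bw_intertwine:
  "(\<And>i. i \<in> set xs \<Longrightarrow> c * g (f i) = g (h i) * c) \<Longrightarrow> c * bw (map f xs) = bw (map h xs) * c"
proof (induction xs)
  case (Cons i xs)
  have "c * bw (map f (i # xs)) = (c * g (f i)) * bw (map f xs)" by (simp add: bw_Cons mult.assoc)
  also have "\<dots> = g (h i) * (c * bw (map f xs))" using Cons.prems by (simp add: mult.assoc)
  finally show ?case using Cons by (simp add: bw_Cons mult.assoc)
qed simp

lemma cr_cr_right:
  assumes "k \<le> p" "p + a + b \<le> k + d"
  shows "cr k c d * cr (p + c) a b = cr p a b * cr k c d"
proof -
  have "cr k c d * bw (map (\<lambda>i. i + c) (crw p a b)) = bw (map (\<lambda>i. i) (crw p a b)) * cr k c d"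
    by (rule bw_intertwine, rule cr_natural_right) (use assms crw_letters[of _ p a b] in fastforce)+
  then show ?thesis by (simp add: cr_def[of "p + c"] cr_def[of p] crw_shift)
qed

text \<open>The braid identity behind associativity of the product of forms: l, m, n are the sizes
  of the left, middle and right block of a factor, with primes for the second and third factor. Both
  bracketings draw the same diagram. The exchanges are between disjoint positions, except that the
  crossing \<open>E\<close> of m' with l'' slides through the crossing of the block n.\<close>

lemma cr_product_assoc:
  "cr (l + l') (m + m') l'' * cr (l + l' + m + m') (n + n') (l'' + m'') * (cr l m l' * cr (l + m) n (l' + m')) =
   cr l m (l' + l'') * cr (l + m) n (l' + m' + l'' + m'') *
     (cr (l + m + n + l') m' l'' * cr (l + m + n + l' + m') n' (l'' + m''))"
proof -
  define p where "p = l + l' + m + m'"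
  define A where "A = cr (l + m) n (l' + m')"
  define B where "B = cr l m l'"
  define C where "C = cr p n (l'' + m'')"
  define D where "D = cr (l + l') m l''"
  define E where "E = cr (l + m + l') m' l''"
  define F where "F = cr (p + n) n' (l'' + m'')"
  have 1: "cr (l + l') (m + m') l'' = D * E"
    using cr_add_left[of "l + l'" m m' l''] by (simp add: D_def E_def add_ac)
  have 2: "cr (l + l' + m + m') (n + n') (l'' + m'') = C * F"
    using cr_add_left[of "l + l' + m + m'" n n' "l'' + m''"] by (simp add: C_def F_def p_def)
  have 3: "cr l m (l' + l'') = D * B" using cr_add_right[of l m l' l''] by (simp add: D_def B_def)
  have 4: "cr (l + m) n (l' + m' + l'' + m'') = C * A"
    using cr_add_right[of "l + m" n "l' + m'" "l'' + m''"] by (simp add: C_def A_def p_def add_ac)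
  have "cr (l + m) n (l' + m' + l'' + m'') * cr (l + m + l' + n) m' l'' =
        cr (l + m + l') m' l'' * cr (l + m) n (l' + m' + l'' + m'')"
    by (rule cr_cr_right) auto
  then have 5: "(C * A) * cr (l + m + n + l') m' l'' = E * (C * A)"
    unfolding 4[symmetric] E_def by (simp add: add_ac)
  have 6: "cr (l + m + n + l' + m') n' (l'' + m'') = F" by (simp add: F_def p_def add_ac)
  have BE: "B * E = E * B" unfolding B_def E_def by (rule gen_commute[OF gen_cr gen_cr]) auto
  have BC: "B * C = C * B" unfolding B_def C_def p_def by (rule gen_commute[OF gen_cr gen_cr]) auto
  have BF: "B * F = F * B" unfolding B_def F_def p_def by (rule gen_commute[OF gen_cr gen_cr]) auto
  have AF: "A * F = F * A" unfolding A_def F_def p_def by (rule gen_commute[OF gen_cr gen_cr]) auto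
  have "D * B * (C * A) * (cr (l + m + n + l') m' l'' * F) = D * B * ((C * A) * cr (l + m + n + l') m' l'') * F"
    by (simp add: mult.assoc)
  also have "\<dots> = D * (B * E) * C * (A * F)" unfolding 5 by (simp add: mult.assoc)
  also have "\<dots> = D * E * (B * C) * F * A" by (simp add: BE AF mult.assoc)
  also have "\<dots> = D * E * C * (B * F) * A" by (simp add: BC mult.assoc)
  also have "\<dots> = D * E * (C * F) * (B * A)" by (simp add: BF mult.assoc)
  finally show ?thesis unfolding 1 2 3 4 6 A_def[symmetric] B_def[symmetric] by simp
qed


subsection \<open>Factorials and shuffles\<close>

text \<open>The factorial of the n strands from position k on. The recursion sorts permutations by
  the place to which the last strand goes, exactly as \<open>normal_words\<close> does.\<close>

primrec fac :: "nat \<Rightarrow> nat \<Rightarrow> 'm" where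
  "fac k 0 = 1"
| "fac k (Suc n) = (\<Sum>j\<le>n. bw [k + n - j..<k + n]) * fac k n"

text \<open>The dual ingredient: the first of the n strands is moved right to each possible place.
  It serves to rebuild the factorial from the first strand.\<close>

definition ins :: "nat \<Rightarrow> nat \<Rightarrow> 'm" where "ins k n = (\<Sum>i<n. bw (rev [k..<k + i]))"

text \<open>The braided binomial coefficient: the sum of the braids that bring \<open>a\<close> of
  the n strands to the front and keep the order within both groups. The first strand is either one
  of the \<open>a\<close>, or passes to the right of all of them.\<close>

primrec sh :: "nat \<Rightarrow> nat \<Rightarrow> nat \<Rightarrow> 'm" where
  "sh k 0 a = (if a = 0 then 1 else 0)"
| "sh k (Suc n) a = (case a of 0 \<Rightarrow> 0 | Suc a' \<Rightarrow> sh (Suc k) n a') + bw (rev [k..<k + a]) * sh (Suc k) n a"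

text \<open>\<open>dl k m\<close> and \<open>dr k m\<close> split off the first, respectively the last, of the \<open>m\<close> strands from position \<open>k\<close> on.\<close>

definition dl :: "nat \<Rightarrow> nat \<Rightarrow> 'm" where "dl k m = (\<Sum>j<m. bw [k..<k + j])"

definition dr :: "nat \<Rightarrow> nat \<Rightarrow> 'm" where "dr k m = (\<Sum>j<m. bw (rev [k + m - 1 - j..<k + m - 1]))"

lemma gen_fac: "fac k n \<in> gen {i. k \<le> i \<and> Suc i < k + n}"
proof (induction n)
  case (Suc n)
  have "(\<Sum>j\<le>n. bw [k + n - j..<k + n]) \<in> gen {i. k \<le> i \<and> Suc i < k + Suc n}"
    by (intro gen_sum gen_bw) auto
  moreover have "fac k n \<in> gen {i. k \<le> i \<and> Suc i < k + Suc n}"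
    using Suc by (rule gen_mono) auto
  ultimately show ?case by (simp add: gen.mult)
qed (simp add: gen.one)

lemma gen_ins: "ins k n \<in> gen {i. k \<le> i \<and> Suc i < k + n}"
  unfolding ins_def by (intro gen_sum gen_bw) auto

lemma gen_dl: "dl k n \<in> gen {i. k \<le> i \<and> Suc i < k + n}"
  unfolding dl_def by (intro gen_sum gen_bw) auto

lemma gen_dr: "dr k n \<in> gen {i. k \<le> i \<and> Suc i < k + n}"
  unfolding dr_def by (intro gen_sum gen_bw) auto

lemma gen_sh: "sh k n a \<in> gen {i. k \<le> i \<and> Suc i < k + n}"
proof (induction n arbitrary: k a)
  case (Suc n)
  have *: "sh (Suc k) n a \<in> gen {i. k \<le> i \<and> Suc i < k + Suc n}" for a
    using Suc by (rule gen_mono) auto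
  have "bw (rev [k..<k + a]) * sh (Suc k) n a \<in> gen {i. k \<le> i \<and> Suc i < k + Suc n}"
  proof (cases "a \<le> n")
    case True
    then show ?thesis by (intro gen.mult * gen_bw) auto
  next
    case False
    \<comment> \<open>The word leaves the allowed range of positions here, but the shuffle it
      multiplies is 0.\<close>
    have "a > n \<Longrightarrow> sh k n a = 0" for k
      by (induction n arbitrary: k a) (auto split: nat.split)
    with False show ?thesis by (simp add: gen.zero)
  qed
  with * show ?case by (auto split: nat.split intro: gen.intros)
qed (auto intro: gen.intros)

lemma sh_gt [simp]: "n < a \<Longrightarrow> sh k n a = 0"
  by (induction n arbitrary: k a) (auto split: nat.split)

text \<open>The first strand goes right to position k + i, then the last goes left to k + n - j,
  which lies at or before that position, and pushes it one place further. In the other order the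
  last strand stops one place earlier and is pushed to its place by the first strand on its way to k
  + i + 1.\<close>

lemma move_last_first:
  assumes "i + j \<ge> n" "i < n" "j \<le> n"
  shows "bw [k + n - j..<k + n] * bw (rev [k..<k + i]) = bw (rev [k..<k + Suc i]) * bw [k + n - (j - 1)..<k + n]"
proof -
  define a where "a = k + n - j"
  have j: "Suc 0 \<le> j" and a: "a \<le> k + i" "k \<le> a" "a < k + n" "a + j = k + n" using assms by (auto simp: a_def)
  define c where "c = bw [a..<k + n]"
  define c' where "c' = bw [Suc a..<k + n]"
  have c: "c = g a * c'" using a by (simp add: c_def c'_def upt_conv_Cons bw_Cons)
  have cr: "c = cr a j (Suc 0)" by (simp add: c_def cr_single_right a)
  have "c * bw (map (\<lambda>i. i) (rev [a..<k + i])) = bw (map Suc (rev [a..<k + i])) * c"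
    by (rule bw_intertwine) (use cr_natural_left[of a _ j "Suc 0"] assms a in \<open>auto simp: cr\<close>)
  then have 1: "c * bw (rev [a..<k + i]) = bw (rev [Suc a..<Suc (k + i)]) * c"
    by (simp add: rev_map[symmetric] map_Suc_upt)
  have 2: "c' * bw (rev [k..<a]) = bw (rev [k..<a]) * c'"
    unfolding c'_def by (rule gen_commute[OF gen_bw[OF subset_refl] gen_bw[OF subset_refl]]) auto
  have 3: "rev [k..<k + i] = rev [a..<k + i] @ rev [k..<a]"
    using upt_append_upt[OF a(2,1)] by (metis rev_append)
  have 4: "rev [k..<k + Suc i] = rev [Suc a..<Suc (k + i)] @ [a] @ rev [k..<a]"
  proof -
    have "[k..<k + Suc i] = [k..<a] @ [a..<Suc (k + i)]" using a upt_append_upt[of k a "Suc (k + i)"] by simp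
    also have "[a..<Suc (k + i)] = a # [Suc a..<Suc (k + i)]" using a by (simp add: upt_conv_Cons del: upt_Suc)
    finally show ?thesis by (simp del: upt_Suc)
  qed
  have "c * bw (rev [k..<k + i]) = (c * bw (rev [a..<k + i])) * bw (rev [k..<a])"
    by (simp add: 3 bw_append mult.assoc)
  also have "\<dots> = bw (rev [Suc a..<Suc (k + i)]) * g a * (c' * bw (rev [k..<a]))"
    by (simp only: 1) (simp add: c mult.assoc)
  also have "\<dots> = bw (rev [k..<k + Suc i]) * c'"
    by (simp only: 2 4 bw_append) (simp add: bw_single mult.assoc)
  finally show ?thesis using j a by (simp add: c_def c'_def a_def Suc_diff_le[symmetric] del: upt_Suc)
qed

text \<open>Let the last strand move j places left and the first i places right. If i + j < n the
  two moves do not meet and commute; otherwise \<open>move_last_first\<close> exchanges them and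
  replaces (i, j) by (i + 1, j - 1). Since i + j is unchanged, the two cases stay apart and the
  reindexing is bijective.\<close>

lemma ins_exchange:
  "(\<Sum>j\<le>n. bw [k + n - j..<k + n]) * ins k n = ins k (Suc n) * (\<Sum>j<n. bw [k + n - j..<k + n])"
proof -
  let ?c = "\<lambda>j. bw [k + n - j..<k + n]" and ?d = "\<lambda>i. bw (rev [k..<k + i])"
  let ?h = "\<lambda>(j, i). if i + j < n then (i, j) else (Suc i, j - 1)"
  let ?h' = "\<lambda>(i, j). if i + j < n then (j, i) else (Suc j, i - 1)"
  have "(\<Sum>j\<le>n. ?c j) * ins k n = (\<Sum>(j, i)\<in>{..n} \<times> {..<n}. ?c j * ?d i)"
    by (simp add: ins_def sum_product sum.cartesian_product)
  also have "\<dots> = (\<Sum>(i, j)\<in>{..n} \<times> {..<n}. ?d i * ?c j)"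
  proof (rule sum.reindex_bij_witness[of _ ?h' ?h])
    fix x assume "x \<in> {..n} \<times> {..<n}"
    then obtain j i where x: "x = (j, i)" "j \<le> n" "i < n" by auto
    have "?c j * ?d i = ?d i * ?c j" if "i + j < n"
      by (rule gen_commute[OF gen_bw[OF subset_refl] gen_bw[OF subset_refl]]) (use that in auto)
    moreover have "?c j * ?d i = ?d (Suc i) * ?c (j - 1)" if "\<not> i + j < n"
      using that x move_last_first[of n i j k] by (simp del: upt_Suc)
    ultimately show "(case ?h x of (i, j) \<Rightarrow> ?d i * ?c j) = (case x of (j, i) \<Rightarrow> ?c j * ?d i)"
      by (auto simp: x simp del: upt_Suc)
  qed auto
  also have "\<dots> = ins k (Suc n) * (\<Sum>j<n. ?c j)"
    by (simp add: ins_def sum_product sum.cartesian_product lessThan_Suc_atMost del: sum.lessThan_Suc)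
  finally show ?thesis .
qed

text \<open>The factorial may be built from the first strand instead of the last. This symmetry is
  used for the product with shuffles and for the compatibility of the factorial with
  reversal.\<close>

lemma fac_Suc_left: "fac k (Suc n) = ins k (Suc n) * fac (Suc k) n"
proof (induction n)
  case (Suc n)
  have "fac k (Suc (Suc n)) = (\<Sum>j\<le>Suc n. bw [k + Suc n - j..<k + Suc n]) * fac k (Suc n)"
    by (rule fac.simps)
  also have "\<dots> = (\<Sum>j\<le>Suc n. bw [k + Suc n - j..<k + Suc n]) * ins k (Suc n) * fac (Suc k) n"
    by (simp only: Suc mult.assoc)
  also have "\<dots> = ins k (Suc (Suc n)) * (\<Sum>j<Suc n. bw [k + Suc n - j..<k + Suc n]) * fac (Suc k) n"
    by (simp only: ins_exchange)
  also have "\<dots> = ins k (Suc (Suc n)) * fac (Suc k) (Suc n)"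
    by (simp add: mult.assoc lessThan_Suc_atMost del: sum.lessThan_Suc sum.atMost_Suc)
  finally show ?case .
qed (simp add: ins_def)

lemma cr_fac: "cr k (Suc 0) a * fac (Suc k) a = fac k a * cr k (Suc 0) a"
proof -
  have "n \<le> a \<Longrightarrow> cr k (Suc 0) a * fac (Suc k) n = fac k n * cr k (Suc 0) a" for n
  proof (induction n)
    case (Suc n)
    have "cr k (Suc 0) a * bw [Suc k + n - j..<Suc k + n] = bw [k + n - j..<k + n] * cr k (Suc 0) a" if "j \<le> n" for j
    proof -
      have "cr k (Suc 0) a * bw (map Suc [k + n - j..<k + n]) = bw (map (\<lambda>i. i) [k + n - j..<k + n]) * cr k (Suc 0) a"
        by (rule bw_intertwine) (use cr_natural_right[of k _ a "Suc 0"] Suc.prems that in auto)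
      then show ?thesis using that by (simp add: map_Suc_upt Suc_diff_le del: upt_Suc)
    qed
    then have "cr k (Suc 0) a * (\<Sum>j\<le>n. bw [Suc k + n - j..<Suc k + n]) =
        (\<Sum>j\<le>n. bw [k + n - j..<k + n]) * cr k (Suc 0) a"
      unfolding sum_distrib_left sum_distrib_right by (intro sum.cong) auto
    then show ?case using Suc by (simp add: mult.assoc[symmetric] del: sum.atMost_Suc) (simp add: mult.assoc del: sum.atMost_Suc)
  qed simp
  then show ?thesis by simp
qed

text \<open>The braided form of a! (n - a)! times the binomial coefficient equals n!, by induction
  along the recursion of \<open>sh\<close>. When the factorial of n + 1 strands is expanded from the
  first strand, the places before \<open>a\<close> come from the shuffles that select this strand
  and the remaining places from those that do not.\<close>

lemma fac_fac_sh: "a \<le> n \<Longrightarrow> fac k a * fac (k + a) (n - a) * sh k n a = fac k n"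
proof (induction n arbitrary: k a)
  case (Suc n)
  let ?F = "fac k a * fac (k + a) (Suc n - a)"
  have 1: "?F * (case a of 0 \<Rightarrow> 0 | Suc a' \<Rightarrow> sh (Suc k) n a') = ins k a * fac (Suc k) n"
  proof (cases a)
    case (Suc a')
    then show ?thesis using Suc.IH[of a' "Suc k"] Suc.prems by (simp add: fac_Suc_left[of k a'] mult.assoc del: fac.simps)
  qed (simp add: ins_def)
  have 2: "?F * (bw (rev [k..<k + a]) * sh (Suc k) n a) = (\<Sum>i<Suc n - a. bw (rev [k..<k + a + i])) * fac (Suc k) n"
  proof (cases "a \<le> n")
    case True
    define c where "c = cr k (Suc 0) a"
    have d: "bw (rev [k..<k + a]) = c" by (simp add: c_def cr_single_left)
    have f: "fac (k + a) (Suc n - a) = ins (k + a) (Suc n - a) * fac (Suc (k + a)) (n - a)"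
      using True by (simp add: Suc_diff_le fac_Suc_left del: fac.simps)
    have c1: "fac k a * ins (k + a) (Suc n - a) = ins (k + a) (Suc n - a) * fac k a"
      by (rule gen_commute[OF gen_fac gen_ins]) auto
    have c2: "fac (Suc (k + a)) (n - a) * c = c * fac (Suc (k + a)) (n - a)"
      unfolding c_def by (rule gen_commute[OF gen_fac gen_cr]) auto
    have "?F * (c * sh (Suc k) n a) = (fac k a * ins (k + a) (Suc n - a)) * (fac (Suc (k + a)) (n - a) * c) * sh (Suc k) n a"
      by (simp add: f mult.assoc)
    also have "\<dots> = ins (k + a) (Suc n - a) * (fac k a * c) * (fac (Suc (k + a)) (n - a) * sh (Suc k) n a)"
      by (simp add: c1 c2 mult.assoc)
    also have "fac k a * c = c * fac (Suc k) a" by (simp add: c_def cr_fac)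
    also have "ins (k + a) (Suc n - a) * (c * fac (Suc k) a) * (fac (Suc (k + a)) (n - a) * sh (Suc k) n a) =
        ins (k + a) (Suc n - a) * c * fac (Suc k) n"
      using Suc.IH[OF True, of "Suc k"] by (simp add: mult.assoc)
    also have "ins (k + a) (Suc n - a) * c = (\<Sum>i<Suc n - a. bw (rev [k..<k + a + i]))"
      unfolding ins_def sum_distrib_right d[symmetric] bw_append[symmetric] rev_append[symmetric]
      by (simp add: upt_append_upt del: upt_Suc)
    finally show ?thesis by (simp only: d)
  qed (use Suc.prems in simp)
  have "?F * sh k (Suc n) a = (ins k a + (\<Sum>i<Suc n - a. bw (rev [k..<k + a + i]))) * fac (Suc k) n"
    by (simp only: sh.simps distrib_left 1 2 distrib_right)
  also have "ins k a + (\<Sum>i<Suc n - a. bw (rev [k..<k + a + i])) = ins k (Suc n)"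
  proof -
    have "(\<Sum>i<Suc n - a. bw (rev [k..<k + (a + i)])) = (\<Sum>i\<in>{a..<Suc n}. bw (rev [k..<k + i]))"
      using Suc.prems by (intro sum.reindex_bij_witness[of _ "\<lambda>i. i - a" "\<lambda>i. a + i"]) auto
    moreover have "(\<Sum>i<a. bw (rev [k..<k + i])) + (\<Sum>i\<in>{a..<Suc n}. bw (rev [k..<k + i])) = ins k (Suc n)"
      using Suc.prems sum.atLeastLessThan_concat[of 0 a "Suc n" "\<lambda>i. bw (rev [k..<k + i])"]
      by (simp only: ins_def lessThan_atLeast0)
    ultimately show ?thesis by (simp add: ins_def add.assoc del: sum.lessThan_Suc upt_Suc)
  qed
  finally show ?case by (simp only: fac_Suc_left)
qed simp

lemma sh_0: "sh k n 0 = 1"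
  by (induction n arbitrary: k) auto

lemma sh_same: "sh k n n = 1"
  by (induction n arbitrary: k) auto

text \<open>Explains the origin of \<open>dl\<close>: it is the shuffle part of the component of the
  coproduct with one factor on the left. By \<open>sh_last\<close>, \<open>dr\<close> plays this
  role for one factor on the right.\<close>

lemma sh_1: "sh k n (Suc 0) = dl k n"
proof (induction n arbitrary: k)
  case (Suc n)
  have "dl k (Suc n) = 1 + (\<Sum>j<n. bw [k..<k + Suc j])"
    unfolding dl_def by (subst sum.lessThan_Suc_shift) simp
  also have "(\<Sum>j<n. bw [k..<k + Suc j]) = g k * dl (Suc k) n"
    unfolding dl_def sum_distrib_left by (intro sum.cong) (auto simp: upt_conv_Cons bw_Cons simp del: upt_Suc)
  finally show ?case using Suc by (simp add: sh_0 bw_single)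
qed (simp add: dl_def)

lemma sh_last: "sh k (Suc n) n = dr k (Suc n)"
proof (induction n arbitrary: k)
  case (Suc n)
  have "dr k (Suc (Suc n)) = dr (Suc k) (Suc n) + bw (rev [k..<k + Suc n])"
    by (simp add: dr_def del: upt_Suc)
  then show ?case using Suc[of "Suc k"] by (simp add: sh_same del: upt_Suc sh.simps) (simp add: sh_same del: upt_Suc)
qed (simp add: dr_def)

lemma fac_dl: "fac (Suc k) n * dl k (Suc n) = fac k (Suc n)"
  using fac_fac_sh[of "Suc 0" "Suc n" k] by (simp add: sh_1 del: sh.simps fac.simps(2)) simp

lemma fac_dr: "fac k n * dr k (Suc n) = fac k (Suc n)"
  using fac_fac_sh[of n "Suc n" k] by (simp add: sh_last Suc_diff_le del: sh.simps fac.simps(2)) simp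

text \<open>The Leibniz rule at the level of braids: the strand brought to the front is one of the
  first m, or it is brought to the front of the m' others and then crosses all m.\<close>

lemma dl_add: "dl k (m + m') = dl k m + cr k m (Suc 0) * dl (k + m) m'"
proof -
  have "(\<Sum>j<m'. bw [k..<k + (m + j)]) = cr k m (Suc 0) * dl (k + m) m'"
    unfolding dl_def sum_distrib_left cr_single_right bw_append[symmetric]
    by (intro sum.cong) (auto simp: upt_append_upt add.assoc)
  moreover have "dl k (m + m') = dl k m + (\<Sum>j<m'. bw [k..<k + (m + j)])"
    unfolding dl_def by (induction m') (auto simp: add.assoc)
  ultimately show ?thesis by simp
qed

lemma cr_dl: "cr l m l' * dl l m = dl (l + l') m * cr l m l'"
proof -
  have "cr l m l' * bw [l..<l + j] = bw [l + l'..<l + l' + j] * cr l m l'" if "j < m" for j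
  proof -
    have "cr l m l' * bw (map (\<lambda>i. i) [l..<l + j]) = bw (map (\<lambda>i. i + l') [l..<l + j]) * cr l m l'"
      by (rule bw_intertwine) (use that cr_natural_left[of l _ m l'] in auto)
    moreover have "map (\<lambda>i. i + l') [l..<l + j] = [l + l'..<l + l' + j]"
      by (induction j) auto
    ultimately show ?thesis by simp
  qed
  then show ?thesis
    unfolding dl_def sum_distrib_left sum_distrib_right by (intro sum.cong) auto
qed

lemma cr_dl_right: "p + m \<le> b + k \<Longrightarrow> k \<le> p \<Longrightarrow> cr k a b * dl (p + a) m = dl p m * cr k a b"
proof -
  assume p: "p + m \<le> b + k" "k \<le> p"
  have "cr k a b * bw [p + a..<p + a + j] = bw [p..<p + j] * cr k a b" if "j < m" for j
  proof -
    have "cr k a b * bw (map (\<lambda>i. i + a) [p..<p + j]) = bw (map (\<lambda>i. i) [p..<p + j]) * cr k a b"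
      by (rule bw_intertwine) (use that p cr_natural_right[of k _ b a] in auto)
    moreover have "map (\<lambda>i. i + a) [p..<p + j] = [p + a..<p + a + j]"
      by (induction j) auto
    ultimately show ?thesis by simp
  qed
  then show ?thesis
    unfolding dl_def sum_distrib_left sum_distrib_right by (intro sum.cong) auto
qed

text \<open>Each pair of strands is split off in either order, and the two terms differ by the
  generator g l on the left; pairing them produces the factor 1 + g l.\<close>

lemma dl_dl: "\<exists>x\<in>gen UNIV. dl (Suc l) m * dl l (Suc m) = (1 + g l) * x"
proof -
  let ?d = "\<lambda>j. bw [l..<l + j]" and ?e = "\<lambda>i. bw [Suc l..<Suc l + i]"
  have e: "?d (Suc i) = g l * ?e i" for i
    by (simp add: upt_conv_Cons bw_Cons del: upt_Suc)
  \<comment> \<open>\<open>?d (Suc i)\<close> carries one strand across i + 1 others, so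
    \<open>?d j\<close> with j \<le> i slides through it and comes out as \<open>?e j\<close>; then
    g l is split off from \<open>?d (Suc i)\<close>.\<close>
  have d: "?e j * ?d (Suc i) = g l * (?e i * ?d j)" if "j \<le> i" for i j
  proof -
    have "?d (Suc i) = cr l (Suc i) (Suc 0)" by (simp add: cr_single_right)
    moreover have "cr l (Suc i) (Suc 0) * bw (map (\<lambda>i. i) [l..<l + j]) = bw (map Suc [l..<l + j]) * cr l (Suc i) (Suc 0)"
      by (rule bw_intertwine) (use that cr_natural_left[of l _ "Suc i" "Suc 0"] in auto)
    ultimately have "?d (Suc i) * ?d j = ?e j * ?d (Suc i)" by (simp add: map_Suc_upt del: upt_Suc)
    then show ?thesis by (simp only: e mult.assoc)
  qed
  let ?A = "{(i, j). i < m \<and> j \<le> i}" and ?B = "{(i, j). i < j \<and> j \<le> m}"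
  have fin: "finite ?A" "finite ?B"
    by (auto intro: finite_subset[of _ "{..m} \<times> {..m}"])
  have "dl (Suc l) m * dl l (Suc m) = (\<Sum>(i, j)\<in>{..<m} \<times> {..<Suc m}. ?e i * ?d j)"
    unfolding dl_def sum_product sum.cartesian_product ..
  also have "{..<m} \<times> {..<Suc m} = ?A \<union> ?B" by auto
  also have "(\<Sum>(i, j)\<in>?A \<union> ?B. ?e i * ?d j) = (\<Sum>(i, j)\<in>?A. ?e i * ?d j) + (\<Sum>(i, j)\<in>?B. ?e i * ?d j)"
    by (rule sum.union_disjoint) (use fin in auto)
  also have "(\<Sum>(i, j)\<in>?B. ?e i * ?d j) = (\<Sum>(i, j)\<in>?A. g l * (?e i * ?d j))"
  proof (rule sum.reindex_bij_witness[of _ "\<lambda>(i, j). (j, Suc i)" "\<lambda>(i, j). (j - 1, i)"])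
    fix x assume "x \<in> ?B"
    then obtain j i where "x = (j, Suc i)" "j \<le> i" by (cases x, cases "snd x") auto
    then show "(case (case x of (i, j) \<Rightarrow> (j - 1, i)) of (i, j) \<Rightarrow> g l * (?e i * ?d j)) = (case x of (i, j) \<Rightarrow> ?e i * ?d j)"
      using d[of j i] by (simp del: upt_Suc)
  qed auto
  also have "\<dots> = g l * (\<Sum>(i, j)\<in>?A. ?e i * ?d j)"
    by (simp add: sum_distrib_left case_prod_beta)
  finally show ?thesis
    by (intro bexI[of _ "\<Sum>(i, j)\<in>?A. ?e i * ?d j"])
      (auto simp: distrib_right intro!: gen_sum gen.mult gen_bw)
qed

text \<open>Represents the sum over all permutations by \<open>fac\<close>, once each permutation
  acts through its normal word.\<close>

lemma sum_normal_words: "(\<Sum>u\<in>normal_words n. bw u) = fac 0 n"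
proof (induction n)
  case (Suc n)
  have "(\<Sum>u\<in>normal_words (Suc n). bw u) = (\<Sum>(j, v)\<in>{..n} \<times> normal_words n. bw ([n - j..<n] @ v))"
    unfolding normal_words.simps sum.reindex[OF inj_on_normal_words] by (simp add: comp_def case_prod_beta)
  also have "\<dots> = (\<Sum>j\<le>n. \<Sum>v\<in>normal_words n. bw [n - j..<n] * bw v)"
    by (simp add: sum.cartesian_product bw_append)
  also have "\<dots> = (\<Sum>j\<le>n. bw [n - j..<n]) * (\<Sum>v\<in>normal_words n. bw v)"
    by (simp add: sum_product)
  finally show ?case using Suc by simp
qed simp

end

subsection \<open>The ring of endomorphisms\<close>

text \<open>Linear maps form a type here so that identities of \<open>braid_ring\<close> can be
  applied to operators as ring identities.\<close>

typedef (overloaded) 'a endo = "{f :: 'a::complex_vector \<Rightarrow> 'a. clinear f}" morphisms app Endo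
  using clin_id by blast

setup_lifting type_definition_endo

instantiation endo :: (complex_vector) "{ring, monoid_mult}"
begin
lift_definition zero_endo :: "'a endo" is "\<lambda>x. 0" by (rule clin)
lift_definition one_endo :: "'a endo" is "\<lambda>x. x" by (rule clin)
lift_definition plus_endo :: "'a endo \<Rightarrow> 'a endo \<Rightarrow> 'a endo" is "\<lambda>f g x. f x + g x" by (rule clin)
lift_definition minus_endo :: "'a endo \<Rightarrow> 'a endo \<Rightarrow> 'a endo" is "\<lambda>f g x. f x - g x" by (rule clin)
lift_definition uminus_endo :: "'a endo \<Rightarrow> 'a endo" is "\<lambda>f x. - f x" by (rule clin)
lift_definition times_endo :: "'a endo \<Rightarrow> 'a endo \<Rightarrow> 'a endo" is "\<lambda>f g x. f (g x)" by (rule clinear_compose)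
instance
  by standard (transfer; auto simp: fun_eq_iff clinear_add algebra_simps)+
end

lemma clinear_app: "clinear (app e)"
  using app by auto

lemma clin_app [clin]: "clinear f \<Longrightarrow> clinear (\<lambda>x. app e (f x))"
  by (rule clinear_compose[OF clinear_app])

lemma app_simps [simp]: "app 0 x = 0" "app 1 x = x" "app (e + f) x = app e x + app f x"
  "app (e - f) x = app e x - app f x" "app (e * f) x = app e (app f x)"
  by (transfer, simp)+

lemma app_sum: "app (sum e A) x = (\<Sum>i\<in>A. app (e i) x)"
  by (induction A rule: infinite_finite_induct) auto

lemma app_Endo: "clinear f \<Longrightarrow> app (Endo f) = f"
  by (simp add: Endo_inverse)

lemma app_inject: "(\<And>x. app e x = app f x) \<Longrightarrow> e = f"
  by (transfer) auto


section \<open>Comodules over a coquasitriangular Hopf algebra\<close>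

section \<open>Comodules and their braidings\<close>

lemma tlift_swap:
  assumes "\<And>a b c. clinear (\<lambda>d. K a b c d)" "\<And>a b d. clinear (\<lambda>c. K a b c d)"
    "\<And>a c d. clinear (\<lambda>b. K a b c d)" "\<And>b c d. clinear (\<lambda>a. K a b c d)"
  shows "tlift (\<lambda>a b. tlift (\<lambda>c d. K a b c d) t) s = tlift (\<lambda>c d. tlift (\<lambda>a b. K a b c d) s) t"
proof -
  have "\<forall>s t. tlift (\<lambda>a b. tlift (\<lambda>c d. K a b c d) t) s = tlift (\<lambda>c d. tlift (\<lambda>a b. K a b c d) s) t"
    by (rule tensor_ext2) (intro clin assms | simp add: clin assms)+
  then show ?thesis by blast
qed

lemma tlift_cong: "(\<And>a b. f a b = g a b) \<Longrightarrow> tlift f t = tlift g t"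
  by presburger

lemma tlift_scale_left:
  assumes "\<And>a. clinear (r a)" "\<And>b. clinear (\<lambda>a. r a b)"
  shows "tlift r t *\<^sub>C y = tlift (\<lambda>a b. r a b *\<^sub>C y) t"
  by (rule clinear_tlift_commute[of "\<lambda>z. z *\<^sub>C y"]) (intro clin assms)+

lemma clinear_braiding:
  assumes "clinear R" "clinear \<delta>V" "clinear \<delta>W"
  shows "clinear (braiding R \<delta>V \<delta>W)"
    and braiding_tens: "braiding R \<delta>V \<delta>W (v \<otimes> w) =
      tlift (\<lambda>v0 v1. tlift (\<lambda>w0 w1. R (v1 \<otimes> w1) *\<^sub>C (w0 \<otimes> v0)) (\<delta>W w)) (\<delta>V v)"
proof -
  note R = clinear_compose[OF assms(1)] and V = clinear_compose[OF assms(2)] and W = clinear_compose[OF assms(3)]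
  have c: "cbilinear (\<lambda>v w. tlift (\<lambda>v0 v1. tlift (\<lambda>w0 w1. R (v1 \<otimes> w1) *\<^sub>C (w0 \<otimes> v0)) (\<delta>W w)) (\<delta>V v))"
    by (intro cbilinearI clin assms R)
  show "clinear (braiding R \<delta>V \<delta>W)" "braiding R \<delta>V \<delta>W (v \<otimes> w) =
      tlift (\<lambda>v0 v1. tlift (\<lambda>w0 w1. R (v1 \<otimes> w1) *\<^sub>C (w0 \<otimes> v0)) (\<delta>W w)) (\<delta>V v)"
    unfolding braiding_def by (rule clinear_tlift[OF c], rule tlift_tens[OF c])
qed

lemma clinear_tensor_coaction:
  assumes "clinear \<delta>V" "clinear \<delta>W"
  shows "clinear (tensor_coaction \<delta>V \<delta>W)"
    and tensor_coaction_tens: "tensor_coaction \<delta>V \<delta>W (v \<otimes> w) =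
      tlift (\<lambda>v0 v1. tlift (\<lambda>w0 w1. (v0 \<otimes> w0) \<otimes> (v1 * w1)) (\<delta>W w)) (\<delta>V v)"
proof -
  have c: "cbilinear (\<lambda>v w. tlift (\<lambda>v0 v1. tlift (\<lambda>w0 w1. (v0 \<otimes> w0) \<otimes> (v1 * w1)) (\<delta>W w)) (\<delta>V v))"
    by (intro cbilinearI clin assms)
  show "clinear (tensor_coaction \<delta>V \<delta>W)" "tensor_coaction \<delta>V \<delta>W (v \<otimes> w) =
      tlift (\<lambda>v0 v1. tlift (\<lambda>w0 w1. (v0 \<otimes> w0) \<otimes> (v1 * w1)) (\<delta>W w)) (\<delta>V v)"
    unfolding tensor_coaction_def by (rule clinear_tlift[OF c], rule tlift_tens[OF c])
qed

text \<open>Stated at a single element, because the coaction of a quotient is meaningful only on the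
  subspace of classes. \<open>coassoc_at\<close> and \<open>counit_at\<close> are pointwise for the
  same reason.\<close>

definition colinear_at :: "('a::complex_vector \<Rightarrow> 'a \<otimes> 'h::complex_vector) \<Rightarrow> ('b::complex_vector \<Rightarrow> 'b \<otimes> 'h) \<Rightarrow> ('a \<Rightarrow> 'b) \<Rightarrow> 'a \<Rightarrow> bool"
  where "colinear_at \<delta> \<delta>' f a \<longleftrightarrow> \<delta>' (f a) = tmap f id (\<delta> a)"

text \<open>The braiding is an expression in the two coactions, so maps that intertwine the
  coactions at \<open>a\<close> and \<open>b\<close> can be pulled out of it.\<close>

lemma braiding_natural:
  assumes R: "clinear R" and d: "clinear \<delta>A" "clinear \<delta>B" "clinear \<delta>A'" "clinear \<delta>B'" and fg: "clinear f" "clinear g"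
    and a: "colinear_at \<delta>A \<delta>A' f a" and b: "colinear_at \<delta>B \<delta>B' g b"
  shows "braiding R \<delta>A' \<delta>B' (f a \<otimes> g b) = tmap g f (braiding R \<delta>A \<delta>B (a \<otimes> b))"
proof -
  have "\<forall>s t. tlift (\<lambda>v0 v1. tlift (\<lambda>w0 w1. R (v1 \<otimes> w1) *\<^sub>C (w0 \<otimes> v0)) (tmap g id t)) (tmap f id s) =
      tmap g f (tlift (\<lambda>v0 v1. tlift (\<lambda>w0 w1. R (v1 \<otimes> w1) *\<^sub>C (w0 \<otimes> v0)) t) s)"
    by (rule tensor_ext2)
      (intro clin fg clinear_compose[OF R] | simp add: clin fg clinear_compose[OF R] tmap_tens clinear_scale[OF clinear_tmap[OF fg(2,1)]])+
  then show ?thesis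
    using a b by (simp add: braiding_tens[OF R] d colinear_at_def)
qed

lemma tensor_coaction_natural:
  fixes \<delta>A :: "'a::complex_vector \<Rightarrow> 'a \<otimes> 'h::complex_algebra_1"
  assumes d: "clinear \<delta>A" "clinear \<delta>B" "clinear \<delta>A'" "clinear \<delta>B'" and fg: "clinear f" "clinear g"
    and a: "colinear_at \<delta>A \<delta>A' f a" and b: "colinear_at \<delta>B \<delta>B' g b"
  shows "colinear_at (tensor_coaction \<delta>A \<delta>B) (tensor_coaction \<delta>A' \<delta>B') (tmap f g) (a \<otimes> b)"
proof -
  have "\<forall>s t. tlift (\<lambda>v0 v1. tlift (\<lambda>w0 w1. (v0 \<otimes> w0) \<otimes> (v1 * w1 :: 'h)) (tmap g id t)) (tmap f id s) =
      tmap (tmap f g) id (tlift (\<lambda>v0 v1. tlift (\<lambda>w0 w1. (v0 \<otimes> w0) \<otimes> (v1 * w1)) t) s)"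
    by (rule tensor_ext2)
      (intro clin fg clinear_tmap | simp add: clin fg tmap_tens clinear_tmap)+
  then show ?thesis
    using a b by (simp add: tensor_coaction_tens d colinear_at_def tmap_tens fg)
qed

context hopf_algebra
begin

lemma clin_comult [clin]: "clinear f \<Longrightarrow> clinear (\<lambda>x. comult (f x))"
  by (rule clinear_compose[OF comult_linear])

lemma clin_counit [clin]: "clinear f \<Longrightarrow> clinear (\<lambda>x. counit (f x))"
  by (rule clinear_compose[OF counit_linear])

definition coassoc_at :: "('a::complex_vector \<Rightarrow> 'a \<otimes> 'h) \<Rightarrow> 'a \<Rightarrow> bool"
  where "coassoc_at \<delta> x \<longleftrightarrow> tassoc (tmap \<delta> id (\<delta> x)) = tmap id comult (\<delta> x)"

definition counit_at :: "('a::complex_vector \<Rightarrow> 'a \<otimes> 'h) \<Rightarrow> 'a \<Rightarrow> bool"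
  where "counit_at \<delta> x \<longleftrightarrow> tlift (\<lambda>x0 x1. counit x1 *\<^sub>C x0) (\<delta> x) = x"

text \<open>Coassociativity as a rewrite rule inside an arbitrary trilinear expression
  \<open>f\<close>: the expression becomes one linear map on the triple tensor product, where
  \<open>coassoc_at\<close> applies.\<close>

lemma coassoc_sweedler:
  assumes d: "clinear \<delta>" and x: "coassoc_at \<delta> x"
    and f: "\<And>a g. clinear (f a g)" "\<And>a h. clinear (\<lambda>g. f a g h)" "\<And>g h. clinear (\<lambda>a. f a g h)"
  shows "tlift (\<lambda>x0 x1. tlift (\<lambda>x00 x01. f x00 x01 x1) (\<delta> x0)) (\<delta> x) =
    tlift (\<lambda>x0 x1. tlift (\<lambda>g h. f x0 g h) (comult x1)) (\<delta> x)"
proof -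
  let ?F = "tlift (\<lambda>a t. tlift (\<lambda>g h. f a g h) t)"
  have F: "clinear ?F" "\<And>a t. ?F (a \<otimes> t) = tlift (\<lambda>g h. f a g h) t"
    by (intro clin f clinear_tlift cbilinearI | simp add: clin f)+
  have "\<forall>u. ?F (tassoc (u \<otimes> z)) = tlift (\<lambda>a b. f a b z) u" for z
    by (rule tensor_ext) (intro clin f F clinear_compose[OF F(1)] | simp add: clin f F tassoc_tens)+
  then have "\<forall>s. ?F (tassoc (tmap \<delta> id s)) = tlift (\<lambda>x0 x1. tlift (\<lambda>x00 x01. f x00 x01 x1) (\<delta> x0)) s"
    by (intro tensor_ext) (intro clin f d clinear_compose[OF F(1)] clinear_compose[OF d] | simp add: tmap_tens d clin f clinear_compose[OF d])+
  moreover have "\<forall>s. ?F (tmap id comult s) = tlift (\<lambda>x0 x1. tlift (\<lambda>g h. f x0 g h) (comult x1)) s"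
    by (rule tensor_ext)
      (intro clin f clinear_compose[OF F(1)] comult_linear | simp add: tmap_tens comult_linear clin f F)+
  ultimately show ?thesis using x unfolding coassoc_at_def by metis
qed

lemma coassoc_sweedler2:
  assumes d: "clinear \<delta>" "clinear \<delta>'" and x: "coassoc_at \<delta> x" "coassoc_at \<delta>' y"
    and K: "\<And>b c d e f. clinear (\<lambda>a. K a b c d e f)" "\<And>a c d e f. clinear (\<lambda>b. K a b c d e f)"
      "\<And>a b d e f. clinear (\<lambda>c. K a b c d e f)" "\<And>a b c e f. clinear (\<lambda>d. K a b c d e f)"
      "\<And>a b c d f. clinear (\<lambda>e. K a b c d e f)" "\<And>a b c d e. clinear (\<lambda>f. K a b c d e f)"
  shows "tlift (\<lambda>x0 x1. tlift (\<lambda>y0 y1. tlift (\<lambda>x00 x01. tlift (\<lambda>y00 y01. K x00 x01 x1 y00 y01 y1) (\<delta>' y0)) (\<delta> x0)) (\<delta>' y)) (\<delta> x) =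
    tlift (\<lambda>x0 x1. tlift (\<lambda>y0 y1. tlift (\<lambda>g g'. tlift (\<lambda>h h'. K x0 g g' y0 h h') (comult y1)) (comult x1)) (\<delta>' y)) (\<delta> x)"
proof -
  note d' = clinear_compose[OF d(1)] clinear_compose[OF d(2)]
  have "tlift (\<lambda>x0 x1. tlift (\<lambda>y0 y1. tlift (\<lambda>x00 x01. tlift (\<lambda>y00 y01. K x00 x01 x1 y00 y01 y1) (\<delta>' y0)) (\<delta> x0)) (\<delta>' y)) (\<delta> x) =
      tlift (\<lambda>x0 x1. tlift (\<lambda>x00 x01. tlift (\<lambda>y0 y1. tlift (\<lambda>y00 y01. K x00 x01 x1 y00 y01 y1) (\<delta>' y0)) (\<delta>' y)) (\<delta> x0)) (\<delta> x)"
    by (rule tlift_cong, rule tlift_swap) (intro clin K d d')+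
  also have "\<dots> = tlift (\<lambda>x0 x1. tlift (\<lambda>g g'. tlift (\<lambda>y0 y1. tlift (\<lambda>y00 y01. K x0 g g' y00 y01 y1) (\<delta>' y0)) (\<delta>' y)) (comult x1)) (\<delta> x)"
    by (rule coassoc_sweedler[OF d(1) x(1)]) (intro clin K d d')+
  also have "\<dots> = tlift (\<lambda>x0 x1. tlift (\<lambda>g g'. tlift (\<lambda>y0 y1. tlift (\<lambda>h h'. K x0 g g' y0 h h') (comult y1)) (\<delta>' y)) (comult x1)) (\<delta> x)"
    by (rule tlift_cong, rule tlift_cong, rule coassoc_sweedler[OF d(2) x(2)]) (intro clin K d d')+
  also have "\<dots> = tlift (\<lambda>x0 x1. tlift (\<lambda>y0 y1. tlift (\<lambda>g g'. tlift (\<lambda>h h'. K x0 g g' y0 h h') (comult y1)) (comult x1)) (\<delta>' y)) (\<delta> x)"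
    by (rule tlift_cong, rule tlift_swap) (intro clin K d d')+
  finally show ?thesis .
qed

end

lemma tlift_tlift:
  assumes "\<And>a. clinear (F a)" "\<And>b. clinear (\<lambda>a. F a b)" "\<And>a. clinear (f a)" "\<And>b. clinear (\<lambda>a. f a b)"
  shows "tlift F (tlift f t) = tlift (\<lambda>a b. tlift F (f a b)) t"
  by (rule clinear_tlift_commute[OF clinear_tlift[OF cbilinearI[OF assms(1,2)]] assms(3,4)])

context hopf_algebra
begin

text \<open>Once the inner coactions of both factors are replaced by coproducts, what remains is
  multiplicativity of \<open>comult\<close>.\<close>

lemma coassoc_at_tensor:
  fixes \<delta>A :: "'a::complex_vector \<Rightarrow> 'a \<otimes> 'h" and \<delta>B :: "'b::complex_vector \<Rightarrow> 'b \<otimes> 'h"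
  assumes d: "clinear \<delta>A" "clinear \<delta>B" and a: "coassoc_at \<delta>A a" and b: "coassoc_at \<delta>B b"
  shows "coassoc_at (tensor_coaction \<delta>A \<delta>B) (a \<otimes> b)"
proof -
  note d' = clinear_compose[OF d(1)] clinear_compose[OF d(2)]
  let ?T = "\<lambda>f s t. tlift (\<lambda>a0 a1. tlift (\<lambda>b0 b1. f a0 a1 b0 b1) t) s"
  let ?D = "tensor_coaction \<delta>A \<delta>B"
  have D: "clinear ?D" by (rule clinear_tensor_coaction[OF d])
  note D' = clinear_compose[OF D]
  have p: "\<forall>(s :: 'a \<otimes> 'h) (t :: 'b \<otimes> 'h). tassoc (?T (\<lambda>a0 a1 b0 b1. (a0 \<otimes> b0) \<otimes> (a1 * b1)) s t \<otimes> g) =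
      ?T (\<lambda>a0 a1 b0 b1. (a0 \<otimes> b0) \<otimes> ((a1 * b1) \<otimes> g)) s t" for g :: 'h
    by (rule tensor_ext2) (intro clin | simp add: clin tassoc_tens)+
  have "\<forall>(s :: 'a \<otimes> 'h) (t :: 'b \<otimes> 'h). tassoc (tmap ?D id (?T (\<lambda>a0 a1 b0 b1. (a0 \<otimes> b0) \<otimes> (a1 * b1)) s t)) =
      ?T (\<lambda>a0 a1 b0 b1. ?T (\<lambda>a00 a01 b00 b01. (a00 \<otimes> b00) \<otimes> ((a01 * b01) \<otimes> (a1 * b1))) (\<delta>A a0) (\<delta>B b0)) s t"
    by (rule tensor_ext2) (intro clin d' D D' | simp add: clin d' D tmap_tens p tensor_coaction_tens d)+
  then have 1: "tassoc (tmap ?D id (?D (a \<otimes> b))) =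
      ?T (\<lambda>a0 a1 b0 b1. ?T (\<lambda>a00 a01 b00 b01. (a00 \<otimes> b00) \<otimes> ((a01 * b01) \<otimes> (a1 * b1))) (\<delta>A a0) (\<delta>B b0)) (\<delta>A a) (\<delta>B b)"
    by (simp add: tensor_coaction_tens d)
  have 2: "\<dots> = ?T (\<lambda>a0 a1 b0 b1. ?T (\<lambda>g g' h h'. (a0 \<otimes> b0) \<otimes> ((g * h) \<otimes> (g' * h'))) (comult a1) (comult b1)) (\<delta>A a) (\<delta>B b)"
    by (rule coassoc_sweedler2[OF d a b]) (intro clin)+
  have q: "\<forall>(s :: 'h \<otimes> 'h) (t :: 'h \<otimes> 'h). x \<otimes> ?T (\<lambda>g g' h h'. (g * h) \<otimes> (g' * h')) s t = ?T (\<lambda>g g' h h'. x \<otimes> ((g * h) \<otimes> (g' * h'))) s t"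
    for x :: "'a \<otimes> 'b"
    by (rule tensor_ext2) (intro clin | simp add: clin)+
  have "\<forall>(s :: 'a \<otimes> 'h) (t :: 'b \<otimes> 'h). tmap id comult (?T (\<lambda>a0 a1 b0 b1. (a0 \<otimes> b0) \<otimes> (a1 * b1)) s t) =
      ?T (\<lambda>a0 a1 b0 b1. ?T (\<lambda>g g' h h'. (a0 \<otimes> b0) \<otimes> ((g * h) \<otimes> (g' * h'))) (comult a1) (comult b1)) s t"
    by (rule tensor_ext2) (intro clin comult_linear | simp add: clin tmap_tens comult_linear comult_mult q)+
  with 1 2 show ?thesis by (simp add: coassoc_at_def tensor_coaction_tens d)
qed

lemma counit_at_tensor:
  fixes \<delta>A :: "'a::complex_vector \<Rightarrow> 'a \<otimes> 'h" and \<delta>B :: "'b::complex_vector \<Rightarrow> 'b \<otimes> 'h"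
  assumes d: "clinear \<delta>A" "clinear \<delta>B" and a: "counit_at \<delta>A a" and b: "counit_at \<delta>B b"
  shows "counit_at (tensor_coaction \<delta>A \<delta>B) (a \<otimes> b)"
proof -
  have "\<forall>(s :: 'a \<otimes> 'h) (t :: 'b \<otimes> 'h). tlift (\<lambda>x0 x1. counit x1 *\<^sub>C x0) (tlift (\<lambda>a0 a1. tlift (\<lambda>b0 b1. (a0 \<otimes> b0) \<otimes> (a1 * b1)) t) s) =
      tlift (\<lambda>a0 a1. counit a1 *\<^sub>C a0) s \<otimes> tlift (\<lambda>b0 b1. counit b1 *\<^sub>C b0) t"
    by (rule tensor_ext2) (intro clin | simp add: clin tens_scale scaleC_scaleC counit_mult mult.commute)+
  then show ?thesis using a b by (simp add: counit_at_def tensor_coaction_tens d)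
qed

text \<open>The coaction law passes to images under colinear maps. The tensor algebra inherits it in
  this way from tensor products of comodules, and the quotients from the tensor algebra.\<close>

lemma coassoc_at_colinear:
  fixes \<delta> :: "'a::complex_vector \<Rightarrow> 'a \<otimes> 'h"
  assumes d: "clinear \<delta>" "clinear \<delta>'" "clinear f" and c: "\<And>x. colinear_at \<delta> \<delta>' f x" and a: "coassoc_at \<delta> a"
  shows "coassoc_at \<delta>' (f a)"
proof -
  note d' = clinear_compose[OF d(1)] clinear_compose[OF d(2)] clinear_compose[OF d(3)]
  have *: "\<delta>' (f x) = tmap f id (\<delta> x)" for x using c by (simp add: colinear_at_def)
  have 1: "\<forall>(u :: 'a \<otimes> 'h). tassoc (tmap f id u \<otimes> z) = tmap f id (tassoc (u \<otimes> z))" for z :: 'h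
    by (rule tensor_ext) (intro clin d | simp add: clin d tmap_tens tassoc_tens)+
  have "\<forall>(s :: 'a \<otimes> 'h). tassoc (tmap \<delta>' id (tmap f id s)) = tmap f id (tassoc (tmap \<delta> id s))"
    by (rule tensor_ext) (intro clin d | simp add: clin d tmap_tens 1 *)+
  moreover have "\<forall>(s :: 'a \<otimes> 'h). tmap id comult (tmap f id s) = tmap f id (tmap id comult s)"
    by (rule tensor_ext) (intro clin d comult_linear | simp add: clin d tmap_tens comult_linear)+
  ultimately show ?thesis using a by (simp add: coassoc_at_def *)
qed

lemma counit_at_colinear:
  fixes \<delta> :: "'a::complex_vector \<Rightarrow> 'a \<otimes> 'h"
  assumes d: "clinear \<delta>" "clinear \<delta>'" "clinear f" and c: "colinear_at \<delta> \<delta>' f a" and a: "counit_at \<delta> a"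
  shows "counit_at \<delta>' (f a)"
proof -
  have "\<forall>(s :: 'a \<otimes> 'h). tlift (\<lambda>x0 x1. counit x1 *\<^sub>C x0) (tmap f id s) = f (tlift (\<lambda>x0 x1. counit x1 *\<^sub>C x0) s)"
    by (rule tensor_ext) (intro clin d clinear_compose[OF d(3)] | simp add: clin d tmap_tens clinear_scale[OF d(3)])+
  then show ?thesis using a c by (simp add: counit_at_def colinear_at_def)
qed

lemma coassoc_at_span:
  assumes d: "clinear \<delta>" and "\<And>x. x \<in> S \<Longrightarrow> coassoc_at \<delta> x" "x \<in> cvec.span S"
  shows "coassoc_at \<delta> x"
  unfolding coassoc_at_def
  by (rule clinear_eq_on_span[OF _ _ _ assms(3)])
    (use assms(2) in \<open>auto intro!: clin clinear_compose[OF clinear_tmap[OF d clin_id']] d comult_linear simp: coassoc_at_def id_def\<close>)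

lemma counit_at_span:
  assumes d: "clinear \<delta>" and "\<And>x. x \<in> S \<Longrightarrow> counit_at \<delta> x" "x \<in> cvec.span S"
  shows "counit_at \<delta> x"
  unfolding counit_at_def
  by (rule clinear_eq_on_span[OF _ _ _ assms(3)])
    (use assms(2) in \<open>auto intro!: clin d simp: counit_at_def\<close>)

end

context coquasitriangular_hopf_algebra
begin

lemma clin_R [clin]: "clinear f \<Longrightarrow> clinear (\<lambda>x. R (f x))"
  by (rule clinear_compose[OF R_linear])

text \<open>The right H-action that R induces on a comodule; \<open>actl\<close> is the left one.
  The two multiplicativity axioms of R are their module laws, and read through
  \<open>braiding_actr\<close> and \<open>braiding_actl\<close> these laws become the hexagon
  identities.\<close>

definition actr :: "('a::complex_vector \<Rightarrow> 'a \<otimes> 'h) \<Rightarrow> 'a \<Rightarrow> 'h \<Rightarrow> 'a"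
  where "actr \<delta> v h = tlift (\<lambda>v0 v1. R (v1 \<otimes> h) *\<^sub>C v0) (\<delta> v)"

definition actl :: "('a::complex_vector \<Rightarrow> 'a \<otimes> 'h) \<Rightarrow> 'a \<Rightarrow> 'h \<Rightarrow> 'a"
  where "actl \<delta> v h = tlift (\<lambda>v0 v1. R (h \<otimes> v1) *\<^sub>C v0) (\<delta> v)"

lemma clin_actr [clin]: "clinear \<delta> \<Longrightarrow> clinear f \<Longrightarrow> clinear (\<lambda>x. actr \<delta> (f x) h)"
  unfolding actr_def by (rule clin_tlift_arg) (intro clin, intro clin, rule clinear_compose)

lemma clin_actr_right [clin]: "clinear f \<Longrightarrow> clinear (\<lambda>x. actr \<delta> v (f x))"
  unfolding actr_def by (intro clin)

lemma clin_actl [clin]: "clinear \<delta> \<Longrightarrow> clinear f \<Longrightarrow> clinear (\<lambda>x. actl \<delta> (f x) h)"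
  unfolding actl_def by (rule clin_tlift_arg) (intro clin, intro clin, rule clinear_compose)

lemma clin_actl_right [clin]: "clinear f \<Longrightarrow> clinear (\<lambda>x. actl \<delta> v (f x))"
  unfolding actl_def by (intro clin)

lemma actr_actr:
  assumes d: "clinear \<delta>" and v: "coassoc_at \<delta> v"
  shows "actr \<delta> (actr \<delta> v h) k = actr \<delta> v (h * k)"
proof -
  note d' = clinear_compose[OF d]
  have "actr \<delta> (actr \<delta> v h) k = tlift (\<lambda>v0 v1. actr \<delta> (R (v1 \<otimes> h) *\<^sub>C v0) k) (\<delta> v)"
    unfolding actr_def[of \<delta> v] by (rule clinear_tlift_commute) (intro clin d)+
  also have "\<dots> = tlift (\<lambda>v0 v1. R (v1 \<otimes> h) *\<^sub>C actr \<delta> v0 k) (\<delta> v)"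
    by (simp add: clinear_scale[OF clin_actr[OF d clin_id]])
  also have "\<dots> = tlift (\<lambda>v0 v1. tlift (\<lambda>v00 v01. R (v1 \<otimes> h) *\<^sub>C R (v01 \<otimes> k) *\<^sub>C v00) (\<delta> v0)) (\<delta> v)"
    unfolding actr_def by (rule tlift_cong, rule clinear_tlift_commute) (intro clin)+
  also have "\<dots> = tlift (\<lambda>v0 v1. tlift (\<lambda>g g'. R (g' \<otimes> h) *\<^sub>C R (g \<otimes> k) *\<^sub>C v0) (comult v1)) (\<delta> v)"
    by (rule coassoc_sweedler[OF d v]) (intro clin)+
  also have "\<dots> = actr \<delta> v (h * k)"
    unfolding actr_def R_mult_right
    by (rule tlift_cong, subst tlift_scale_left) (intro clin | simp add: scaleC_scaleC mult.commute)+
  finally show ?thesis .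
qed

lemma actl_actl:
  assumes d: "clinear \<delta>" and v: "coassoc_at \<delta> v"
  shows "actl \<delta> (actl \<delta> v h) k = actl \<delta> v (k * h)"
proof -
  note d' = clinear_compose[OF d]
  have "actl \<delta> (actl \<delta> v h) k = tlift (\<lambda>v0 v1. actl \<delta> (R (h \<otimes> v1) *\<^sub>C v0) k) (\<delta> v)"
    unfolding actl_def[of \<delta> v] by (rule clinear_tlift_commute) (intro clin d)+
  also have "\<dots> = tlift (\<lambda>v0 v1. R (h \<otimes> v1) *\<^sub>C actl \<delta> v0 k) (\<delta> v)"
    by (simp add: clinear_scale[OF clin_actl[OF d clin_id]])
  also have "\<dots> = tlift (\<lambda>v0 v1. tlift (\<lambda>v00 v01. R (h \<otimes> v1) *\<^sub>C R (k \<otimes> v01) *\<^sub>C v00) (\<delta> v0)) (\<delta> v)"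
    unfolding actl_def by (rule tlift_cong, rule clinear_tlift_commute) (intro clin)+
  also have "\<dots> = tlift (\<lambda>v0 v1. tlift (\<lambda>g g'. R (h \<otimes> g') *\<^sub>C R (k \<otimes> g) *\<^sub>C v0) (comult v1)) (\<delta> v)"
    by (rule coassoc_sweedler[OF d v]) (intro clin)+
  also have "\<dots> = actl \<delta> v (k * h)"
    unfolding actl_def R_mult_left
    by (rule tlift_cong, subst tlift_scale_left) (intro clin | simp add: scaleC_scaleC mult.commute)+
  finally show ?thesis .
qed

lemma braiding_actr:
  fixes \<delta>V :: "'a::complex_vector \<Rightarrow> 'a \<otimes> 'h" and \<delta>W :: "'b::complex_vector \<Rightarrow> 'b \<otimes> 'h"
  assumes d: "clinear \<delta>V" "clinear \<delta>W"
  shows "braiding R \<delta>V \<delta>W (v \<otimes> w) = tlift (\<lambda>w0 w1. w0 \<otimes> actr \<delta>V v w1) (\<delta>W w)"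
proof -
  have "\<forall>(s :: 'a \<otimes> 'h) (t :: 'b \<otimes> 'h). tlift (\<lambda>v0 v1. tlift (\<lambda>w0 w1. R (v1 \<otimes> w1) *\<^sub>C (w0 \<otimes> v0)) t) s =
      tlift (\<lambda>w0 w1. w0 \<otimes> tlift (\<lambda>v0 v1. R (v1 \<otimes> w1) *\<^sub>C v0) s) t"
    by (rule tensor_ext2) (intro clin | simp add: clin tens_scale)+
  then show ?thesis by (simp add: braiding_tens[OF R_linear d] actr_def)
qed

lemma braiding_actl:
  fixes \<delta>V :: "'a::complex_vector \<Rightarrow> 'a \<otimes> 'h" and \<delta>W :: "'b::complex_vector \<Rightarrow> 'b \<otimes> 'h"
  assumes d: "clinear \<delta>V" "clinear \<delta>W"
  shows "braiding R \<delta>V \<delta>W (v \<otimes> w) = tlift (\<lambda>v0 v1. actl \<delta>W w v1 \<otimes> v0) (\<delta>V v)"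
proof -
  have "\<forall>(s :: 'a \<otimes> 'h) (t :: 'b \<otimes> 'h). tlift (\<lambda>v0 v1. tlift (\<lambda>w0 w1. R (v1 \<otimes> w1) *\<^sub>C (w0 \<otimes> v0)) t) s =
      tlift (\<lambda>v0 v1. tlift (\<lambda>w0 w1. R (v1 \<otimes> w1) *\<^sub>C w0) t \<otimes> v0) s"
    by (rule tensor_ext2) (intro clin | simp add: clin tens_scale)+
  then show ?thesis by (simp add: braiding_tens[OF R_linear d] actl_def)
qed

text \<open>The braiding moves w0 to the front and acts by w1 on the other factor. The tensor
  coaction multiplies the two H-components, so this is the module law
  \<open>actr_actr\<close>.\<close>

lemma hexagon_right:
  assumes d: "clinear \<delta>A" "clinear \<delta>B" "clinear \<delta>C" and c: "coassoc_at \<delta>C c"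
  shows "braiding R \<delta>C (tensor_coaction \<delta>A \<delta>B) (c \<otimes> a \<otimes> b) =
    tlift (\<lambda>a' c'. tlift (\<lambda>b' c''. (a' \<otimes> b') \<otimes> c'') (braiding R \<delta>C \<delta>B (c' \<otimes> b))) (braiding R \<delta>C \<delta>A (c \<otimes> a))"
proof -
  note D = clinear_tensor_coaction(1)[OF d(1,2)]
  have "braiding R \<delta>C (tensor_coaction \<delta>A \<delta>B) (c \<otimes> a \<otimes> b) =
      tlift (\<lambda>a0 a1. tlift (\<lambda>b0 b1. (a0 \<otimes> b0) \<otimes> actr \<delta>C (actr \<delta>C c a1) b1) (\<delta>B b)) (\<delta>A a)"
    unfolding braiding_actr[OF d(3) D] tensor_coaction_tens[OF d(1,2)] actr_actr[OF d(3) c]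
    by (subst tlift_tlift, (intro clin)+, rule tlift_cong, subst tlift_tlift, (intro clin)+, rule tlift_cong)
      (simp add: clin)
  moreover have "tlift (\<lambda>a' c'. tlift (\<lambda>b' c''. (a' \<otimes> b') \<otimes> c'') (braiding R \<delta>C \<delta>B (c' \<otimes> b))) (braiding R \<delta>C \<delta>A (c \<otimes> a)) =
      tlift (\<lambda>a0 a1. tlift (\<lambda>b0 b1. (a0 \<otimes> b0) \<otimes> actr \<delta>C (actr \<delta>C c a1) b1) (\<delta>B b)) (\<delta>A a)"
    unfolding braiding_actr[OF d(3,1)] braiding_actr[OF d(3,2)]
    by (subst tlift_tlift, (intro clin d)+, rule tlift_cong, subst tlift_eq, (intro clin d)+, subst tlift_tlift, (intro clin d)+)
      (simp add: clin)
  ultimately show ?thesis by simp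
qed

text \<open>The module law \<open>actl_actl\<close> in the same way, except that the two Sweedler
  sums occur in opposite orders and have to be exchanged.\<close>

lemma hexagon_left:
  assumes d: "clinear \<delta>A" "clinear \<delta>B" "clinear \<delta>C" and c: "coassoc_at \<delta>C c"
  shows "braiding R (tensor_coaction \<delta>A \<delta>B) \<delta>C ((a \<otimes> b) \<otimes> c) =
    tlift (\<lambda>c' b'. tlift (\<lambda>c'' a'. c'' \<otimes> a' \<otimes> b') (braiding R \<delta>A \<delta>C (a \<otimes> c'))) (braiding R \<delta>B \<delta>C (b \<otimes> c))"
proof -
  note D = clinear_tensor_coaction(1)[OF d(1,2)]
  have "braiding R (tensor_coaction \<delta>A \<delta>B) \<delta>C ((a \<otimes> b) \<otimes> c) =
      tlift (\<lambda>a0 a1. tlift (\<lambda>b0 b1. actl \<delta>C (actl \<delta>C c b1) a1 \<otimes> a0 \<otimes> b0) (\<delta>B b)) (\<delta>A a)"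
    unfolding braiding_actl[OF D d(3)] tensor_coaction_tens[OF d(1,2)] actl_actl[OF d(3) c]
    by (subst tlift_tlift, (intro clin)+, rule tlift_cong, subst tlift_tlift, (intro clin)+, rule tlift_cong)
      (simp add: clin)
  also have "\<dots> = tlift (\<lambda>b0 b1. tlift (\<lambda>a0 a1. actl \<delta>C (actl \<delta>C c b1) a1 \<otimes> a0 \<otimes> b0) (\<delta>A a)) (\<delta>B b)"
    by (rule tlift_swap) (intro clin d)+
  moreover have "tlift (\<lambda>c' b'. tlift (\<lambda>c'' a'. c'' \<otimes> a' \<otimes> b') (braiding R \<delta>A \<delta>C (a \<otimes> c'))) (braiding R \<delta>B \<delta>C (b \<otimes> c)) =
      tlift (\<lambda>b0 b1. tlift (\<lambda>a0 a1. actl \<delta>C (actl \<delta>C c b1) a1 \<otimes> a0 \<otimes> b0) (\<delta>A a)) (\<delta>B b)"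
    unfolding braiding_actl[OF d(1,3)] braiding_actl[OF d(2,3)]
    by (subst tlift_tlift, (intro clin d)+, rule tlift_cong, subst tlift_eq, (intro clin d)+, subst tlift_tlift, (intro clin d)+)
      (simp add: clin)
  ultimately show ?thesis by simp
qed

text \<open>By coassociativity both sides become sums over the coproducts of v1 and w1. They differ
  by whether R takes the second legs, with the first multiplied as h g, or the first legs, with the
  second multiplied as g h; this is \<open>R_commute\<close>.\<close>

lemma braiding_colinear:
  fixes \<delta>V :: "'a::complex_vector \<Rightarrow> 'a \<otimes> 'h" and \<delta>W :: "'b::complex_vector \<Rightarrow> 'b \<otimes> 'h"
  assumes d: "clinear \<delta>V" "clinear \<delta>W" and v: "coassoc_at \<delta>V v" and w: "coassoc_at \<delta>W w"
  shows "colinear_at (tensor_coaction \<delta>V \<delta>W) (tensor_coaction \<delta>W \<delta>V) (braiding R \<delta>V \<delta>W) (v \<otimes> w)"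
proof -
  note d' = clinear_compose[OF d(1)] clinear_compose[OF d(2)]
  note D = clinear_tensor_coaction(1)[OF d(2,1)] clinear_braiding(1)[OF R_linear d]
  note D' = clinear_compose[OF D(1)] clinear_compose[OF D(2)]
  let ?T = "\<lambda>f s t. tlift (\<lambda>a0 a1. tlift (\<lambda>b0 b1. f a0 a1 b0 b1) t) s"
  have a: "\<forall>(s :: 'a \<otimes> 'h) (t :: 'b \<otimes> 'h). tensor_coaction \<delta>W \<delta>V (?T (\<lambda>v0 v1 w0 w1. R (v1 \<otimes> w1) *\<^sub>C (w0 \<otimes> v0)) s t) =
      ?T (\<lambda>v0 v1 w0 w1. tlift (\<lambda>v00 v01. tlift (\<lambda>w00 w01. R (v1 \<otimes> w1) *\<^sub>C ((w00 \<otimes> v00) \<otimes> (w01 * v01))) (\<delta>W w0)) (\<delta>V v0)) s t"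
    (is "\<forall>s t. ?L s t = ?R s t")
  proof (rule tensor_ext2)
    show "?L (x \<otimes> y) (x' \<otimes> y') = ?R (x \<otimes> y) (x' \<otimes> y')" for x y x' y'
    proof -
      have "?L (x \<otimes> y) (x' \<otimes> y') = R (y \<otimes> y') *\<^sub>C tlift (\<lambda>w00 w01. tlift (\<lambda>v00 v01. (w00 \<otimes> v00) \<otimes> (w01 * v01)) (\<delta>V x)) (\<delta>W x')"
        by (simp add: clin clinear_scale[OF D(1)] tensor_coaction_tens d)
      also have "\<dots> = R (y \<otimes> y') *\<^sub>C tlift (\<lambda>v00 v01. tlift (\<lambda>w00 w01. (w00 \<otimes> v00) \<otimes> (w01 * v01)) (\<delta>W x')) (\<delta>V x)"
        by (rule arg_cong[where f = "scaleC (R (y \<otimes> y'))"], rule tlift_swap) (intro clin)+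
      also have "\<dots> = tlift (\<lambda>v00 v01. R (y \<otimes> y') *\<^sub>C tlift (\<lambda>w00 w01. (w00 \<otimes> v00) \<otimes> (w01 * v01)) (\<delta>W x')) (\<delta>V x)"
        by (rule clinear_tlift_commute) (intro clin)+
      also have "\<dots> = tlift (\<lambda>v00 v01. tlift (\<lambda>w00 w01. R (y \<otimes> y') *\<^sub>C ((w00 \<otimes> v00) \<otimes> (w01 * v01))) (\<delta>W x')) (\<delta>V x)"
        by (rule tlift_cong, rule clinear_tlift_commute) (intro clin)+
      finally show ?thesis by (simp add: clin d')
    qed
  qed (intro clin d' D')+
  have b: "?T (\<lambda>v0 v1 w0 w1. tlift (\<lambda>v00 v01. tlift (\<lambda>w00 w01. R (v1 \<otimes> w1) *\<^sub>C ((w00 \<otimes> v00) \<otimes> (w01 * v01))) (\<delta>W w0)) (\<delta>V v0)) (\<delta>V v) (\<delta>W w) =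
      ?T (\<lambda>v0 v1 w0 w1. ?T (\<lambda>g g' h h'. R (g' \<otimes> h') *\<^sub>C ((w0 \<otimes> v0) \<otimes> (h * g))) (comult v1) (comult w1)) (\<delta>V v) (\<delta>W w)"
    by (rule coassoc_sweedler2[OF d v w]) (intro clin)+
  have pull: "?T (\<lambda>g g' h h'. x \<otimes> K g g' h h') s t = x \<otimes> ?T K s t"
    if "\<And>b c d. clinear (\<lambda>a. K a b c d)" "\<And>a c d. clinear (\<lambda>b. K a b c d)" "\<And>a b d. clinear (\<lambda>c. K a b c d)"
      "\<And>a b c. clinear (\<lambda>d. K a b c d)"
    for x :: "'b \<otimes> 'a" and K :: "'h \<Rightarrow> 'h \<Rightarrow> 'h \<Rightarrow> 'h \<Rightarrow> 'h" and s t
  proof -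
    have "\<forall>s t. ?T (\<lambda>g g' h h'. x \<otimes> K g g' h h') s t = x \<otimes> ?T K s t"
      by (rule tensor_ext2) (intro clin that | simp add: clin that)+
    then show ?thesis by blast
  qed
  \<comment> \<open>\<open>R_commute\<close> is an identity in H alone; \<open>pull\<close> moves
    the constant tensor out of the Sweedler sums so that it applies.\<close>
  have c: "?T (\<lambda>g g' h h'. R (g' \<otimes> h') *\<^sub>C ((w0 \<otimes> v0) \<otimes> (h * g))) (comult v1) (comult w1) =
      ?T (\<lambda>g g' h h'. R (g \<otimes> h) *\<^sub>C ((w0 \<otimes> v0) \<otimes> (g' * h'))) (comult v1) (comult w1)"
    for w0 :: 'b and v0 :: 'a and v1 w1 :: 'h
  proof -
    have "?T (\<lambda>g g' h h'. (w0 \<otimes> v0) \<otimes> (R (g' \<otimes> h') *\<^sub>C (h * g))) (comult v1) (comult w1) =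
        (w0 \<otimes> v0) \<otimes> ?T (\<lambda>g g' h h'. R (g' \<otimes> h') *\<^sub>C (h * g)) (comult v1) (comult w1)"
      by (rule pull) (intro clin)+
    moreover have "?T (\<lambda>g g' h h'. (w0 \<otimes> v0) \<otimes> (R (g \<otimes> h) *\<^sub>C (g' * h'))) (comult v1) (comult w1) =
        (w0 \<otimes> v0) \<otimes> ?T (\<lambda>g g' h h'. R (g \<otimes> h) *\<^sub>C (g' * h')) (comult v1) (comult w1)"
      by (rule pull) (intro clin)+
    ultimately show ?thesis unfolding tens_scale(2) R_commute by simp
  qed
  have e: "?T (\<lambda>v0 v1 w0 w1. tlift (\<lambda>v00 v01. tlift (\<lambda>w00 w01. R (v01 \<otimes> w01) *\<^sub>C ((w00 \<otimes> v00) \<otimes> (v1 * w1))) (\<delta>W w0)) (\<delta>V v0)) (\<delta>V v) (\<delta>W w) =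
      ?T (\<lambda>v0 v1 w0 w1. ?T (\<lambda>g g' h h'. R (g \<otimes> h) *\<^sub>C ((w0 \<otimes> v0) \<otimes> (g' * h'))) (comult v1) (comult w1)) (\<delta>V v) (\<delta>W w)"
    by (rule coassoc_sweedler2[OF d v w]) (intro clin)+
  have f: "\<forall>(s :: 'a \<otimes> 'h) (t :: 'b \<otimes> 'h). tmap (braiding R \<delta>V \<delta>W) id (?T (\<lambda>v0 v1 w0 w1. (v0 \<otimes> w0) \<otimes> (v1 * w1)) s t) =
      ?T (\<lambda>v0 v1 w0 w1. tlift (\<lambda>v00 v01. tlift (\<lambda>w00 w01. R (v01 \<otimes> w01) *\<^sub>C ((w00 \<otimes> v00) \<otimes> (v1 * w1))) (\<delta>W w0)) (\<delta>V v0)) s t"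
    (is "\<forall>s t. ?L s t = ?R s t")
  proof (rule tensor_ext2)
    have p: "\<forall>(s :: 'a \<otimes> 'h) (t :: 'b \<otimes> 'h). ?T (\<lambda>v0 v1 w0 w1. R (v1 \<otimes> w1) *\<^sub>C (w0 \<otimes> v0)) s t \<otimes> h =
        ?T (\<lambda>v0 v1 w0 w1. R (v1 \<otimes> w1) *\<^sub>C ((w0 \<otimes> v0) \<otimes> h)) s t" for h :: 'h
      by (rule tensor_ext2) (intro clin | simp add: clin tens_scale)+
    show "?L (x \<otimes> y) (x' \<otimes> y') = ?R (x \<otimes> y) (x' \<otimes> y')" for x y x' y'
      by (simp add: clin d' tmap_tens D braiding_tens[OF R_linear d] p)
  qed (intro clin d' D D')+
  show ?thesis
    using a b c e f by (simp add: colinear_at_def braiding_tens[OF R_linear d] tensor_coaction_tens d)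
qed

end

lemma antilinear_tensor_ext2:
  assumes "\<And>w. antilinear (\<lambda>z. f z w)" "\<And>z. antilinear (f z)" "\<And>w. antilinear (\<lambda>z. g z w)" "\<And>z. antilinear (g z)"
    and "\<And>x y x' y'. f (x \<otimes> y) (x' \<otimes> y') = g (x \<otimes> y) (x' \<otimes> y')"
  shows "\<forall>z w. f z w = g z w"
proof (intro allI)
  fix z w
  have "\<forall>w. f (x \<otimes> y) w = g (x \<otimes> y) w" for x y
    using assms(2,4,5) by (rule antilinear_tensor_ext)
  then have "\<forall>z. f z w = g z w"
    by (intro antilinear_tensor_ext assms) auto
  then show "f z w = g z w" ..
qed

context coquasitriangular_hopf_algebra
begin

text \<open>In a convolution algebra r r = r and r r' = 1 give 1 = r r' = (r r) r' = r (r r') =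
  r.\<close>

lemma convolution_idempotent:
  assumes r: "clinear r" "clinear r'" and rr: "\<And>h. r h = tlift (\<lambda>x y. r x * r y) (comult h)"
    and inv: "\<And>h. tlift (\<lambda>x y. r x * r' y) (comult h) = counit h"
  shows "r h = counit h"
proof -
  note r' = clinear_compose[OF r(1)] clinear_compose[OF r(2)]
  have "counit h = tlift (\<lambda>x y. tlift (\<lambda>u v. r u * r v * r' y) (comult x)) (comult h)"
  proof -
    have "counit h = tlift (\<lambda>x y. tlift (\<lambda>u v. r u * r v) (comult x) * r' y) (comult h)"
      by (simp only: rr[symmetric] inv)
    also have "\<dots> = tlift (\<lambda>x y. tlift (\<lambda>u v. r u * r v * r' y) (comult x)) (comult h)"
      by (rule tlift_cong, rule clinear_tlift_commute[of "\<lambda>z. z * _"]) (intro clin r')+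
    finally show ?thesis .
  qed
  also have "\<dots> = tlift (\<lambda>x y. tlift (\<lambda>u v. r x * r u * r' v) (comult y)) (comult h)"
    by (rule coassoc_sweedler) (auto intro!: comult_linear clin r' simp: coassoc_at_def coassoc)
  also have "\<dots> = tlift (\<lambda>x y. r x * counit y) (comult h)"
  proof (rule tlift_cong)
    fix x y
    have "tlift (\<lambda>u v. r x * (r u * r' v)) (comult y) = r x * tlift (\<lambda>u v. r u * r' v) (comult y)"
      by (rule clinear_tlift_commute[symmetric]) (intro clin r')+
    then show "tlift (\<lambda>u v. r x * r u * r' v) (comult y) = r x * counit y" by (simp add: inv mult.assoc)
  qed
  also have "\<dots> = tlift (\<lambda>x y. r (counit y *\<^sub>C x)) (comult h)"
    unfolding clinear_scale[OF r(1)] scaleC_complex_def by (simp add: mult.commute)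
  also have "\<dots> = r (tlift (\<lambda>x y. counit y *\<^sub>C x) (comult h))"
    by (rule clinear_tlift_commute[symmetric]) (intro clin r)+
  finally show ?thesis by (simp add: counit_right)
qed

definition Rinv :: "'h \<otimes> 'h \<Rightarrow> complex"
  where "Rinv = (SOME R'. clinear R' \<and> (\<forall>g h.
      tlift (\<lambda>g1 g2. tlift (\<lambda>h1 h2. R (g1 \<otimes> h1) * R' (g2 \<otimes> h2)) (comult h)) (comult g) = counit g * counit h \<and>
      tlift (\<lambda>g1 g2. tlift (\<lambda>h1 h2. R' (g1 \<otimes> h1) * R (g2 \<otimes> h2)) (comult h)) (comult g) = counit g * counit h))"

lemma Rinv:
  "clinear Rinv"
  "tlift (\<lambda>g1 g2. tlift (\<lambda>h1 h2. R (g1 \<otimes> h1) * Rinv (g2 \<otimes> h2)) (comult h)) (comult g) = counit g * counit h"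
  "tlift (\<lambda>g1 g2. tlift (\<lambda>h1 h2. Rinv (g1 \<otimes> h1) * R (g2 \<otimes> h2)) (comult h)) (comult g) = counit g * counit h"
  using someI_ex[OF R_convolution_invertible] unfolding Rinv_def by blast+

lemma clin_Rinv [clin]: "clinear f \<Longrightarrow> clinear (\<lambda>x. Rinv (f x))"
  by (rule clinear_compose[OF Rinv(1)])

text \<open>Multiplicativity at 1 = 1 * 1 makes R(1, -) a convolution idempotent, and the inverse of
  R restricts to an inverse of it.\<close>

lemma R_one_left: "R (1 \<otimes> h) = counit h"
proof (rule convolution_idempotent[where r = "\<lambda>h. R (1 \<otimes> h)" and r' = "\<lambda>h. Rinv (1 \<otimes> h)"])
  show "R (1 \<otimes> h) = tlift (\<lambda>x y. R (1 \<otimes> x) * R (1 \<otimes> y)) (comult h)" for h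
    using R_mult_left[of 1 1 h] by simp
  show "tlift (\<lambda>x y. R (1 \<otimes> x) * Rinv (1 \<otimes> y)) (comult h) = counit h" for h
    using Rinv(2)[of h 1] by (simp add: comult_one counit_one clin)
qed (intro clin)+

lemma R_one_right: "R (h \<otimes> 1) = counit h"
proof (rule convolution_idempotent[where r = "\<lambda>h. R (h \<otimes> 1)" and r' = "\<lambda>h. Rinv (h \<otimes> 1)"])
  show "R (h \<otimes> 1) = tlift (\<lambda>x y. R (x \<otimes> 1) * R (y \<otimes> 1)) (comult h)" for h
    using R_mult_right[of h 1 1] by simp
  show "tlift (\<lambda>x y. R (x \<otimes> 1) * Rinv (y \<otimes> 1)) (comult h) = counit h" for h
    using Rinv(2)[of 1 h] by (simp add: comult_one counit_one clin)
qed (intro clin)+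

lemma braiding_one_left:
  assumes d: "clinear \<delta>V" "clinear \<delta>W" and v: "\<delta>V v = v \<otimes> 1" and w: "counit_at \<delta>W w"
  shows "braiding R \<delta>V \<delta>W (v \<otimes> w) = w \<otimes> v"
  using w unfolding braiding_actl[OF d] v by (simp add: clin d actl_def R_one_left counit_at_def)

lemma braiding_one_right:
  assumes d: "clinear \<delta>V" "clinear \<delta>W" and w: "\<delta>W w = w \<otimes> 1" and v: "counit_at \<delta>V v"
  shows "braiding R \<delta>V \<delta>W (v \<otimes> w) = w \<otimes> v"
  using v unfolding braiding_actr[OF d] w by (simp add: clin d actr_def R_one_right counit_at_def)

definition inv_braiding :: "('v::complex_vector \<Rightarrow> 'v \<otimes> 'h) \<Rightarrow> ('w::complex_vector \<Rightarrow> 'w \<otimes> 'h) \<Rightarrow> 'w \<otimes> 'v \<Rightarrow> 'v \<otimes> 'w"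
  where "inv_braiding \<delta>V \<delta>W = tlift (\<lambda>w v.
    tlift (\<lambda>v0 v1. tlift (\<lambda>w0 w1. Rinv (v1 \<otimes> w1) *\<^sub>C (v0 \<otimes> w0)) (\<delta>W w)) (\<delta>V v))"

lemma inv_braiding:
  assumes d: "clinear \<delta>V" "clinear \<delta>W"
  shows clinear_inv_braiding: "clinear (inv_braiding \<delta>V \<delta>W)"
    and inv_braiding_tens: "inv_braiding \<delta>V \<delta>W (w \<otimes> v) =
      tlift (\<lambda>v0 v1. tlift (\<lambda>w0 w1. Rinv (v1 \<otimes> w1) *\<^sub>C (v0 \<otimes> w0)) (\<delta>W w)) (\<delta>V v)"
proof -
  have c: "cbilinear (\<lambda>w v. tlift (\<lambda>v0 v1. tlift (\<lambda>w0 w1. Rinv (v1 \<otimes> w1) *\<^sub>C (v0 \<otimes> w0)) (\<delta>W w)) (\<delta>V v))"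
    by (intro cbilinearI clin d)
  show "clinear (inv_braiding \<delta>V \<delta>W)" "inv_braiding \<delta>V \<delta>W (w \<otimes> v) =
      tlift (\<lambda>v0 v1. tlift (\<lambda>w0 w1. Rinv (v1 \<otimes> w1) *\<^sub>C (v0 \<otimes> w0)) (\<delta>W w)) (\<delta>V v)"
    unfolding inv_braiding_def by (rule clinear_tlift[OF c], rule tlift_tens[OF c])
qed

lemma counit_pair:
  assumes v: "counit_at \<delta>V v" and w: "counit_at \<delta>W w" and F: "\<And>a. clinear (F a)" "\<And>b. clinear (\<lambda>a. F a b)"
  shows "tlift (\<lambda>v0 v1. tlift (\<lambda>w0 w1. (counit v1 * counit w1) *\<^sub>C F v0 w0) (\<delta>W w)) (\<delta>V v) = F v w"
proof -
  have "\<forall>s t. tlift (\<lambda>v0 v1. tlift (\<lambda>w0 w1. (counit v1 * counit w1) *\<^sub>C F v0 w0) t) s =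
      F (tlift (\<lambda>v0 v1. counit v1 *\<^sub>C v0) s) (tlift (\<lambda>w0 w1. counit w1 *\<^sub>C w0) t)"
  proof (rule tensor_ext2)
    fix x y x' y'
    show "tlift (\<lambda>v0 v1. tlift (\<lambda>w0 w1. (counit v1 * counit w1) *\<^sub>C F v0 w0) (x' \<otimes> y')) (x \<otimes> y) =
      F (tlift (\<lambda>v0 v1. counit v1 *\<^sub>C v0) (x \<otimes> y)) (tlift (\<lambda>w0 w1. counit w1 *\<^sub>C w0) (x' \<otimes> y'))"
      by (simp add: clin F clinear_scale[OF F(1)] clinear_scale[OF F(2)] scaleC_scaleC mult.commute)
  qed (intro clin F clinear_compose[OF F(1)] clinear_compose[OF F(2)])+
  with v w show ?thesis by (simp add: counit_at_def)
qed

lemma tlift4_scale: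
  fixes s t :: "'h \<otimes> 'h"
  assumes "\<And>b c d. clinear (\<lambda>a. r a b c d)" "\<And>a c d. clinear (\<lambda>b. r a b c d)"
    "\<And>a b d. clinear (\<lambda>c. r a b c d)" "\<And>a b c. clinear (\<lambda>d. r a b c d)"
  shows "tlift (\<lambda>g g'. tlift (\<lambda>h h'. r g g' h h' *\<^sub>C x) t) s = tlift (\<lambda>g g'. tlift (\<lambda>h h'. r g g' h h') t) s *\<^sub>C x"
proof -
  have "\<forall>(s :: 'h \<otimes> 'h) (t :: 'h \<otimes> 'h). tlift (\<lambda>g g'. tlift (\<lambda>h h'. r g g' h h' *\<^sub>C x) t) s =
      tlift (\<lambda>g g'. tlift (\<lambda>h h'. r g g' h h') t) s *\<^sub>C x"
    by (rule tensor_ext2) (intro clin assms | simp add: clin assms)+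
  then show ?thesis by blast
qed

text \<open>Coassociativity collects the two coefficients into the convolution product of
  \<open>Rinv\<close> and \<open>R\<close>, which is the product of the counits.\<close>

lemma inv_braiding_braiding:
  fixes \<delta>V :: "'a::complex_vector \<Rightarrow> 'a \<otimes> 'h" and \<delta>W :: "'b::complex_vector \<Rightarrow> 'b \<otimes> 'h"
  assumes d: "clinear \<delta>V" "clinear \<delta>W" and v: "coassoc_at \<delta>V v" "counit_at \<delta>V v"
    and w: "coassoc_at \<delta>W w" "counit_at \<delta>W w"
  shows "inv_braiding \<delta>V \<delta>W (braiding R \<delta>V \<delta>W (v \<otimes> w)) = v \<otimes> w"
proof -
  note d' = clinear_compose[OF d(1)] clinear_compose[OF d(2)]
  note I = clinear_inv_braiding[OF d] and I' = clinear_compose[OF clinear_inv_braiding[OF d]]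
  let ?T = "\<lambda>f s t. tlift (\<lambda>a0 a1. tlift (\<lambda>b0 b1. f a0 a1 b0 b1) t) s"
  have "\<forall>(s :: 'a \<otimes> 'h) (t :: 'b \<otimes> 'h). inv_braiding \<delta>V \<delta>W (?T (\<lambda>v0 v1 w0 w1. R (v1 \<otimes> w1) *\<^sub>C (w0 \<otimes> v0)) s t) =
      ?T (\<lambda>v0 v1 w0 w1. ?T (\<lambda>v00 v01 w00 w01. (Rinv (v01 \<otimes> w01) * R (v1 \<otimes> w1)) *\<^sub>C (v00 \<otimes> w00)) (\<delta>V v0) (\<delta>W w0)) s t"
    (is "\<forall>s t. ?L s t = ?R s t")
  proof (rule tensor_ext2)
    fix x y x' y'
    have "\<forall>s t. y'' *\<^sub>C ?T (\<lambda>v0 v1 w0 w1. Rinv (v1 \<otimes> w1) *\<^sub>C (v0 \<otimes> w0)) s t =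
        ?T (\<lambda>v0 v1 w0 w1. (Rinv (v1 \<otimes> w1) * y'') *\<^sub>C (v0 \<otimes> w0)) (s :: 'a \<otimes> 'h) (t :: 'b \<otimes> 'h)" for y''
      by (rule tensor_ext2) (intro clin | simp add: clin scaleC_scaleC mult.commute)+
    then show "?L (x \<otimes> y) (x' \<otimes> y') = ?R (x \<otimes> y) (x' \<otimes> y')"
      by (simp add: clin d' clinear_scale[OF I] inv_braiding_tens d)
  qed (intro clin d' I')+
  then have "inv_braiding \<delta>V \<delta>W (braiding R \<delta>V \<delta>W (v \<otimes> w)) =
      ?T (\<lambda>v0 v1 w0 w1. ?T (\<lambda>v00 v01 w00 w01. (Rinv (v01 \<otimes> w01) * R (v1 \<otimes> w1)) *\<^sub>C (v00 \<otimes> w00)) (\<delta>V v0) (\<delta>W w0)) (\<delta>V v) (\<delta>W w)"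
    by (simp add: braiding_tens[OF R_linear d])
  also have "\<dots> = ?T (\<lambda>v0 v1 w0 w1. ?T (\<lambda>g g' h h'. (Rinv (g \<otimes> h) * R (g' \<otimes> h')) *\<^sub>C (v0 \<otimes> w0)) (comult v1) (comult w1)) (\<delta>V v) (\<delta>W w)"
    by (rule coassoc_sweedler2[OF d v(1) w(1)]) (intro clin)+
  also have "\<dots> = ?T (\<lambda>v0 v1 w0 w1. (counit v1 * counit w1) *\<^sub>C (v0 \<otimes> w0)) (\<delta>V v) (\<delta>W w)"
    by (subst tlift4_scale, (intro clin)+) (simp only: Rinv)
  also have "\<dots> = v \<otimes> w" by (rule counit_pair[OF v(2) w(2)]) (intro clin)+
  finally show ?thesis .
qed

lemma braiding_inv_braiding:
  fixes \<delta>V :: "'a::complex_vector \<Rightarrow> 'a \<otimes> 'h" and \<delta>W :: "'b::complex_vector \<Rightarrow> 'b \<otimes> 'h"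
  assumes d: "clinear \<delta>V" "clinear \<delta>W" and v: "coassoc_at \<delta>V v" "counit_at \<delta>V v"
    and w: "coassoc_at \<delta>W w" "counit_at \<delta>W w"
  shows "braiding R \<delta>V \<delta>W (inv_braiding \<delta>V \<delta>W (w \<otimes> v)) = w \<otimes> v"
proof -
  note d' = clinear_compose[OF d(1)] clinear_compose[OF d(2)]
  note I = clinear_braiding(1)[OF R_linear d]
  note I' = clinear_compose[OF I]
  let ?T = "\<lambda>f s t. tlift (\<lambda>a0 a1. tlift (\<lambda>b0 b1. f a0 a1 b0 b1) t) s"
  have "\<forall>(s :: 'a \<otimes> 'h) (t :: 'b \<otimes> 'h). braiding R \<delta>V \<delta>W (?T (\<lambda>v0 v1 w0 w1. Rinv (v1 \<otimes> w1) *\<^sub>C (v0 \<otimes> w0)) s t) =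
      ?T (\<lambda>v0 v1 w0 w1. ?T (\<lambda>v00 v01 w00 w01. (R (v01 \<otimes> w01) * Rinv (v1 \<otimes> w1)) *\<^sub>C (w00 \<otimes> v00)) (\<delta>V v0) (\<delta>W w0)) s t"
    (is "\<forall>s t. ?L s t = ?R s t")
  proof (rule tensor_ext2)
    fix x y x' y'
    have "\<forall>s t. y'' *\<^sub>C ?T (\<lambda>v0 v1 w0 w1. R (v1 \<otimes> w1) *\<^sub>C (w0 \<otimes> v0)) s t =
        ?T (\<lambda>v0 v1 w0 w1. (R (v1 \<otimes> w1) * y'') *\<^sub>C (w0 \<otimes> v0)) (s :: 'a \<otimes> 'h) (t :: 'b \<otimes> 'h)" for y''
      by (rule tensor_ext2) (intro clin | simp add: clin scaleC_scaleC mult.commute)+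
    then show "?L (x \<otimes> y) (x' \<otimes> y') = ?R (x \<otimes> y) (x' \<otimes> y')"
      by (simp add: clin d' clinear_scale[OF I] braiding_tens[OF R_linear] d)
  qed (intro clin d' I')+
  then have "braiding R \<delta>V \<delta>W (inv_braiding \<delta>V \<delta>W (w \<otimes> v)) =
      ?T (\<lambda>v0 v1 w0 w1. ?T (\<lambda>v00 v01 w00 w01. (R (v01 \<otimes> w01) * Rinv (v1 \<otimes> w1)) *\<^sub>C (w00 \<otimes> v00)) (\<delta>V v0) (\<delta>W w0)) (\<delta>V v) (\<delta>W w)"
    by (simp add: inv_braiding_tens d)
  also have "\<dots> = ?T (\<lambda>v0 v1 w0 w1. ?T (\<lambda>g g' h h'. (R (g \<otimes> h) * Rinv (g' \<otimes> h')) *\<^sub>C (w0 \<otimes> v0)) (comult v1) (comult w1)) (\<delta>V v) (\<delta>W w)"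
    by (rule coassoc_sweedler2[OF d v(1) w(1)]) (intro clin)+
  also have "\<dots> = ?T (\<lambda>v0 v1 w0 w1. (counit v1 * counit w1) *\<^sub>C (w0 \<otimes> v0)) (\<delta>V v) (\<delta>W w)"
    by (subst tlift4_scale, (intro clin)+) (simp only: Rinv)
  also have "\<dots> = w \<otimes> v" by (rule counit_pair[OF v(2) w(2)]) (intro clin)+
  finally show ?thesis .
qed

end

text \<open>Unitarity puts stars on the H-components, so the coefficient becomes R of the starred
  components in reversed order; real type identifies it with the complex conjugate of R(v1, w1), as
  antilinearity requires.\<close>

lemma (in real_coquasitriangular_hopf_star_algebra) braiding_star:
  fixes \<delta> :: "'v::complex_vector \<Rightarrow> 'v \<otimes> 'h"
  assumes d: "clinear \<delta>" and s: "antilinear s" and u: "\<And>v. tmap_anti s star (\<delta> v) = \<delta> (s v)"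
  shows "braiding R \<delta> \<delta> (s w \<otimes> s v) = tlift_anti (\<lambda>v w. s w \<otimes> s v) (braiding R \<delta> \<delta> (v \<otimes> w))"
proof -
  let ?f = "\<lambda>v w. s w \<otimes> s v"
  have f: "antilinear (?f v)" "antilinear (\<lambda>v. ?f v w)" for v w
    by (intro antilinear_tens_left antilinear_tens_right s)+
  note D = antilinear_tlift_anti[of ?f, OF f]
  let ?T = "\<lambda>f s t. tlift (\<lambda>a0 a1. tlift (\<lambda>b0 b1. f a0 a1 b0 b1) t) s"
  have "\<forall>(p :: 'v \<otimes> 'h) (q :: 'v \<otimes> 'h). ?T (\<lambda>v0 v1 w0 w1. R (v1 \<otimes> w1) *\<^sub>C (w0 \<otimes> v0)) (tmap_anti s star p) (tmap_anti s star q) =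
      tlift_anti ?f (?T (\<lambda>v0 v1 w0 w1. R (v1 \<otimes> w1) *\<^sub>C (w0 \<otimes> v0)) q p)"
    (is "\<forall>p q. ?L p q = ?R p q")
  proof (rule antilinear_tensor_ext2)
    note ta = antilinear_tmap_anti[OF s star_antilinear]
    show "antilinear (\<lambda>p. ?L p q)" for q
      by (rule clinear_antilinear[OF _ ta]) (intro clin)
    show "antilinear (?L p)" for p
      by (rule clinear_antilinear[OF _ ta]) (intro clin)
    show "antilinear (\<lambda>p. ?R p q)" for q
      by (rule antilinear_clinear[OF D]) (intro clin)
    show "antilinear (?R p)" for p
      by (rule antilinear_clinear[OF D]) (intro clin)
    show "?L (x \<otimes> y) (x' \<otimes> y') = ?R (x \<otimes> y) (x' \<otimes> y')" for x y x' y'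
      by (simp add: tmap_anti_tens s star_antilinear clin antilinear_scale[OF D] tlift_anti_tens[of ?f, OF f] real_type)
  qed
  then show ?thesis by (simp add: braiding_tens[OF R_linear d d] u[symmetric])
qed

section \<open>The braiding of the tensor algebra as crossings of strands\<close>

section \<open>The braided tensor algebra of a comodule\<close>

text \<open>Undoes multiplication when the left factor has degree n. It mediates between one long
  tensor, on which braids act, and tensor products, on which braidings and coproducts are
  defined.\<close>

definition cut :: "nat \<Rightarrow> 'v::complex_vector tensor_algebra \<Rightarrow> 'v tensor_algebra \<otimes> 'v tensor_algebra"
  where "cut n = talift (\<lambda>xs. tword (take n xs) \<otimes> tword (drop n xs))"

lemma multilinear_cut: "multilinear (\<lambda>xs. tword (take n xs) \<otimes> tword (drop n xs))"
proof (rule multilinearI)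
  fix xs ys :: "'a list"
  show "clinear (\<lambda>v. tword (take n (xs @ [v] @ ys)) \<otimes> tword (drop n (xs @ [v] @ ys)))"
  proof (cases "n \<le> length xs")
    case True
    then show ?thesis by (simp add: clin)
  next
    case False
    then obtain k where "n = length xs + Suc k" by (metis add_Suc_right less_imp_Suc_add linorder_not_le)
    then show ?thesis by (simp add: clin)
  qed
qed

lemma clinear_cut: "clinear (cut n)"
  and cut_tword: "cut n (tword xs) = tword (take n xs) \<otimes> tword (drop n xs)"
  unfolding cut_def by (rule clinear_talift talift_tword, rule multilinear_cut)+

lemma clin_cut [clin]: "clinear f \<Longrightarrow> clinear (\<lambda>x. cut n (f x))"
  by (rule clinear_compose[OF clinear_cut])

lemma cut_tmul: "x \<in> tdeg n \<Longrightarrow> cut n (tmul x y) = x \<otimes> y"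
proof -
  have "\<forall>y. cut n (tmul (tword xs) y) = tword xs \<otimes> y" if "length xs = n" for xs :: "'a list"
    by (rule tword_ext) (intro clin | simp add: cut_tword that)+
  then have "\<forall>x\<in>tdeg n. cut n (tmul x y) = x \<otimes> y"
    by (intro tdeg_ext) (intro clin | simp)+
  then show "x \<in> tdeg n \<Longrightarrow> cut n (tmul x y) = x \<otimes> y" by blast
qed

lemma cut_tmul_left: "x \<in> tdeg m \<Longrightarrow> cut (m + n) (tmul x y) = tmap (tmul x) (\<lambda>z. z) (cut n y)"
proof -
  have "\<forall>y. cut (m + n) (tmul (tword xs) y) = tmap (tmul (tword xs)) (\<lambda>z. z) (cut n y)" if "length xs = m" for xs :: "'a list"
    by (rule tword_ext) (intro clin clinear_tmul_right | simp add: cut_tword tmap_tens clin clinear_tmul_right that[symmetric])+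
  moreover have "clinear (\<lambda>x. tmap (tmul x) (\<lambda>z. z) t)" for t :: "'a tensor_algebra \<otimes> 'a tensor_algebra"
    unfolding tmap_def by (intro clin)
  ultimately have "\<forall>x\<in>tdeg m. cut (m + n) (tmul x y) = tmap (tmul x) (\<lambda>z. z) (cut n y)"
    by (intro tdeg_ext) (intro clin | simp)+
  then show "x \<in> tdeg m \<Longrightarrow> ?thesis" by blast
qed

lemma cut_tmul_right: "x \<in> tdeg m \<Longrightarrow> n \<le> m \<Longrightarrow> cut n (tmul x y) = tmap (\<lambda>z. z) (\<lambda>z. tmul z y) (cut n x)"
proof -
  assume n: "n \<le> m"
  have "\<forall>y. cut n (tmul (tword xs) y) = tmap (\<lambda>z. z) (\<lambda>z. tmul z y) (cut n (tword xs))" if "length xs = m" for xs :: "'a list"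
  proof -
    have "clinear (\<lambda>y. tmap (\<lambda>z. z) (\<lambda>z. tmul z y) t)" for t :: "'a tensor_algebra \<otimes> 'a tensor_algebra"
      unfolding tmap_def by (intro clin)
    then show ?thesis
      by (intro tword_ext) (intro clin | simp add: cut_tword tmap_tens clin that n)+
  qed
  then have "\<forall>x\<in>tdeg m. cut n (tmul x y) = tmap (\<lambda>z. z) (\<lambda>z. tmul z y) (cut n x)"
    by (intro tdeg_ext) (intro clin | simp)+
  then show "x \<in> tdeg m \<Longrightarrow> ?thesis" by blast
qed

definition tjoin :: "'v::complex_vector tensor_algebra \<otimes> 'v tensor_algebra \<Rightarrow> 'v tensor_algebra"
  where "tjoin = tlift tmul"

lemma clinear_tjoin: "clinear tjoin" and tjoin_tens [simp]: "tjoin (x \<otimes> y) = tmul x y"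
  unfolding tjoin_def by (intro clinear_tlift cbilinearI clinear_tmul_left clinear_tmul_right | simp add: clinear_tmul_left clinear_tmul_right)+

lemma clin_tjoin [clin]: "clinear f \<Longrightarrow> clinear (\<lambda>x. tjoin (f x))"
  by (rule clinear_compose[OF clinear_tjoin])

lemma tjoin_cut: "tjoin (cut n x) = x"
proof -
  have "\<forall>x. tjoin (cut n x) = (x :: 'a tensor_algebra)" by (rule tword_ext) (intro clin | simp add: cut_tword)+
  then show ?thesis ..
qed

definition pair2 :: "'v::complex_vector \<otimes> 'v \<Rightarrow> 'v tensor_algebra"
  where "pair2 = tlift (\<lambda>a b. tword [a, b])"

lemma clin_pair [clin]: "clinear (\<lambda>b. tword (xs @ a # f b # ys))" if "clinear f"
  using clin_tword[OF that, of "xs @ [a]" ys] by simp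

lemma clin_pair0 [clin]: "clinear (\<lambda>b. tword (a # f b # ys))" if "clinear f"
  using clin_tword[OF that, of "[a]" ys] by simp

lemma clinear_pair2: "clinear pair2" and pair2_tens: "pair2 (a \<otimes> b) = tword [a, b]"
  unfolding pair2_def by (intro clinear_tlift cbilinearI clin | simp add: clin)+

lemma clin_pair2 [clin]: "clinear f \<Longrightarrow> clinear (\<lambda>x. pair2 (f x))"
  by (rule clinear_compose[OF clinear_pair2])

lemma tlift_tword_pair: "tlift (\<lambda>a b. tword (p @ a # b # r)) z = tmul (tmul (tword p) (pair2 z)) (tword r)"
proof -
  have "\<forall>z. tlift (\<lambda>a b. tword (p @ a # b # r)) z = tmul (tmul (tword p) (pair2 z)) (tword r)"
    by (rule tensor_ext) (intro clin | simp add: clin pair2_tens)+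
  then show ?thesis ..
qed

locale braided_space =
  fixes \<Psi> :: "'v::complex_vector \<otimes> 'v \<Rightarrow> 'v \<otimes> 'v"
  assumes Psi_linear: "clinear \<Psi>"
begin

lemma clin_Psi [clin]: "clinear f \<Longrightarrow> clinear (\<lambda>x. \<Psi> (f x))"
  by (rule clinear_compose[OF Psi_linear])

abbreviation "braid_word i xs \<equiv> (if Suc i < length xs
    then tlift (\<lambda>a b. tword (take i xs @ [a, b] @ drop (i + 2) xs)) (\<Psi> (xs ! i \<otimes> xs ! Suc i)) else 0)"

lemma braid_word_split: "length p = i \<Longrightarrow>
    braid_word i (p @ a # b # r) = tmul (tmul (tword p) (pair2 (\<Psi> (a \<otimes> b)))) (tword r)"
  by (simp add: nth_append tlift_tword_pair)

lemma multilinear_braid_word: "multilinear (braid_word i)"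
proof (rule multilinear_if_length)
  fix us ws :: "'v list" assume len: "Suc i < length us + Suc (length ws)"
  let ?f = "\<lambda>xs. tlift (\<lambda>a b. tword (take i xs @ [a, b] @ drop (i + 2) xs)) (\<Psi> (xs ! i \<otimes> xs ! Suc i))"
  have f: "?f (p @ a # b # r) = tmul (tmul (tword p) (pair2 (\<Psi> (a \<otimes> b)))) (tword r)" if "length p = i" for p a b r
    using braid_word_split[OF that, of a b r] that by (simp add: nth_append)
  have two: "\<exists>p a b r. xs = p @ a # b # r \<and> length p = j" if "Suc j < length xs" for j and xs :: "'v list"
    using id_take_nth_drop[of j xs] that Cons_nth_drop_Suc[of "Suc j" xs]
    by (intro exI[of _ "take j xs"] exI[of _ "xs ! j"] exI[of _ "xs ! Suc j"] exI[of _ "drop (Suc (Suc j)) xs"]) auto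
  \<comment> \<open>The varied letter lies before the two braided letters, is the first or the
    second of them, or lies after them; in each case the value is a product in which it occurs
    once.\<close>
  consider "length us < i" | "length us = i" | "length us = Suc i" | "Suc i < length us" by linarith
  then show "clinear (\<lambda>v. ?f (us @ v # ws))"
  proof cases
    case 1
    then have "Suc (i - Suc (length us)) < length ws" using len by arith
    then obtain p a b r where "ws = p @ a # b # r" "length p = i - Suc (length us)"
      using two by blast
    then have "?f (us @ v # ws) = tmul (tmul (tword (us @ v # p)) (pair2 (\<Psi> (a \<otimes> b)))) (tword r)" for v
      using f[of "us @ v # p" a b r] 1 by simp
    then show ?thesis by (simp only:) (intro clin)
  next
    case 2
    then obtain b r where "ws = b # r" using len by (cases ws) auto
    then have "?f (us @ v # ws) = tmul (tmul (tword us) (pair2 (\<Psi> (v \<otimes> b)))) (tword r)" for v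
      using f[of us v b r] 2 by simp
    then show ?thesis by (simp only:) (intro clin)
  next
    case 3
    then obtain p a where "us = p @ [a]" "length p = i" by (cases us rule: rev_cases) auto
    then have "?f (us @ v # ws) = tmul (tmul (tword p) (pair2 (\<Psi> (a \<otimes> v)))) (tword ws)" for v
      using f[of p a v ws] by simp
    then show ?thesis by (simp only:) (intro clin)
  next
    case 4
    then obtain p a b r where "us = p @ a # b # r" "length p = i" using two by blast
    then have "?f (us @ v # ws) = tmul (tmul (tword p) (pair2 (\<Psi> (a \<otimes> b)))) (tword (r @ v # ws))" for v
      using f[of p a b "r @ v # ws"] by simp
    then show ?thesis by (simp only:) (intro clin)
  qed
qed

definition b :: "nat \<Rightarrow> 'v tensor_algebra endo" where "b i = Endo (braid_at \<Psi> i)"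

lemma app_b: "app (b i) = braid_at \<Psi> i"
  unfolding b_def braid_at_def by (rule app_Endo, rule clinear_talift, rule multilinear_braid_word)

lemma b_tword: "app (b i) (tword xs) = braid_word i xs"
  unfolding app_b braid_at_def by (rule talift_tword, rule multilinear_braid_word)

lemma b_tword_split: "length p = i \<Longrightarrow> app (b i) (tword (p @ x # y # r)) = tmul (tmul (tword p) (pair2 (\<Psi> (x \<otimes> y)))) (tword r)"
  using b_tword braid_word_split by simp

lemma b_tword_short: "length xs \<le> Suc i \<Longrightarrow> app (b i) (tword xs) = 0"
  by (simp add: b_tword)

lemma split_at: "Suc i < length xs \<Longrightarrow> \<exists>p x y r. xs = p @ x # y # r \<and> length p = i"
  using id_take_nth_drop[of i xs] Cons_nth_drop_Suc[of "Suc i" xs]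
  by (intro exI[of _ "take i xs"] exI[of _ "xs ! i"] exI[of _ "xs ! Suc i"] exI[of _ "drop (Suc (Suc i)) xs"]) auto

lemma b_tmul_left: "x \<in> tdeg n \<Longrightarrow> Suc i < n \<Longrightarrow> app (b i) (tmul x y) = tmul (app (b i) x) y"
proof -
  assume i: "Suc i < n"
  have "\<forall>y. app (b i) (tmul (tword xs) y) = tmul (app (b i) (tword xs)) y" if "length xs = n" for xs
  proof -
    obtain p a c r where "xs = p @ a # c # r" "length p = i" using split_at i \<open>length xs = n\<close> by blast
    then show ?thesis
      by (intro tword_ext) (intro clin | simp add: b_tword_split tmul_assoc)+
  qed
  then have "\<forall>x\<in>tdeg n. app (b i) (tmul x y) = tmul (app (b i) x) y"
    by (intro tdeg_ext) (intro clin | simp)+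
  then show "x \<in> tdeg n \<Longrightarrow> ?thesis" by blast
qed

lemma b_tmul_right: "x \<in> tdeg n \<Longrightarrow> app (b (i + n)) (tmul x y) = tmul x (app (b i) y)"
proof -
  have "\<forall>y. app (b (i + n)) (tmul (tword xs) y) = tmul (tword xs) (app (b i) y)" if n: "length xs = n" for xs
  proof (rule tword_ext)
    show "app (b (i + n)) (tmul (tword xs) (tword ys)) = tmul (tword xs) (app (b i) (tword ys))" for ys
    proof (cases "Suc i < length ys")
      case True
      then obtain p a c r where "ys = p @ a # c # r" "length p = i" using split_at by blast
      then show ?thesis using b_tword_split[of "xs @ p" "i + n" a c r] n
        by (simp add: b_tword_split tmul_assoc[symmetric])
    qed (simp add: b_tword_short n clinear_zero[OF clinear_tmul_right])
  qed (intro clin)+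
  then have "\<forall>x\<in>tdeg n. app (b (i + n)) (tmul x y) = tmul x (app (b i) y)"
    by (intro tdeg_ext) (intro clin | simp)+
  then show "x \<in> tdeg n \<Longrightarrow> ?thesis" by blast
qed

lemma pair2_tdeg: "pair2 z \<in> tdeg 2"
proof -
  have "z \<in> cvec.span {x \<otimes> y | x y. True}" by (rule tensor_span)
  then have "pair2 z \<in> cvec.span (pair2 ` {x \<otimes> y | x y. True})"
    using clinear_image_span[OF clinear_pair2, of "{x \<otimes> y | x y. True}"] by blast
  also have "\<dots> \<subseteq> tdeg 2"
    by (intro cvec.span_minimal subspace_tdeg) (auto simp: pair2_tens intro!: tword_tdeg)
  finally show ?thesis .
qed

lemma b_tdeg: "x \<in> tdeg n \<Longrightarrow> app (b i) x \<in> tdeg n"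
proof (rule tdeg_map[OF clinear_app])
  fix xs :: "'v list" assume n: "length xs = n"
  show "app (b i) (tword xs) \<in> tdeg n"
  proof (cases "Suc i < n")
    case True
    then obtain p a c r where p: "xs = p @ a # c # r" "length p = i" using split_at n by blast
    have "tmul (tmul (tword p) (pair2 (\<Psi> (a \<otimes> c)))) (tword r) \<in> tdeg ((i + 2) + length r)"
      by (rule tmul_tdeg[OF tmul_tdeg[OF tword_tdeg[OF p(2)] pair2_tdeg] tword_tdeg[OF refl]])
    with p n show ?thesis by (simp add: b_tword_split)
  next
    case False
    with n show ?thesis using cvec.subspace_0[OF subspace_tdeg] by (simp add: b_tword_short)
  qed
qed

text \<open>The same product as \<open>bw\<close>, available before the braid relation is
  established; the proof of that relation needs it, and \<open>be_bw\<close> identifies the two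
  afterwards.\<close>

definition be :: "nat list \<Rightarrow> 'v tensor_algebra endo" where "be is = prod_list (map b is)"

lemma be_simps [simp]: "be [] = 1" "be (i # is) = b i * be is" "be (is @ js) = be is * be js"
  by (simp_all add: be_def)

lemma be_tdeg: "x \<in> tdeg n \<Longrightarrow> app (be is) x \<in> tdeg n"
  by (induction "is") (auto intro: b_tdeg)

lemma be_tmul_left: "x \<in> tdeg n \<Longrightarrow> \<forall>i\<in>set is. Suc i < n \<Longrightarrow> app (be is) (tmul x y) = tmul (app (be is) x) y"
  by (induction "is") (auto simp: b_tmul_left[OF be_tdeg])

lemma be_tmul_right: "x \<in> tdeg n \<Longrightarrow> app (be (map (\<lambda>i. i + n) is)) (tmul x y) = tmul x (app (be is) y)"
  by (induction "is") (auto simp: b_tmul_right)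

lemma b_far: "Suc i < j \<Longrightarrow> b i * b j = b j * b i"
proof (rule app_inject)
  fix x assume ij: "Suc i < j"
  have "\<forall>x. app (b i * b j) x = app (b j * b i) x"
  proof (rule tword_ext)
    fix xs :: "'v list"
    show "app (b i * b j) (tword xs) = app (b j * b i) (tword xs)"
    proof (cases "Suc j < length xs")
      case True
      have xs: "tword xs = tmul (tword (take j xs)) (tword (drop j xs))" by simp
      have d: "tword (take j xs) \<in> tdeg j" using True by (intro tword_tdeg) simp
      show ?thesis
        using b_tmul_left[OF d ij] b_tmul_right[OF d, of 0] b_tmul_right[OF b_tdeg[OF d, of i], of 0]
        by (simp add: xs del: tmul_tword append_take_drop_id)
    next
      case False
      \<comment> \<open>On words with fewer than j + 2 letters \<open>b j\<close> vanishes by the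
        default value in \<open>braid_at\<close>, so both products are 0.\<close>
      have "app (b j) (tword xs) = 0" using False by (simp add: b_tword_short)
      moreover have "app (b j) y = 0" if "y \<in> tdeg (length xs)" for y
      proof -
        have "\<forall>y\<in>tdeg (length xs). app (b j) y = 0"
          by (rule tdeg_ext) (use False in \<open>auto intro!: clin clinear_app simp: b_tword_short\<close>)
        with that show ?thesis by blast
      qed
      ultimately show ?thesis using b_tdeg[OF tword_tdeg[of xs]] by (simp add: clinear_zero[OF clinear_app])
    qed
  qed (intro clinear_app)+
  then show "app (b i * b j) x = app (b j * b i) x" ..
qed

text \<open>The operators touch three consecutive letters, so words of length three decide. On words
  too short for position i + 1 both sides vanish by the default value in
  \<open>braid_at\<close>.\<close>

lemma b_braid:
  assumes "\<And>x y z. app (b 0 * b 1 * b 0) (tword [x, y, z]) = app (b 1 * b 0 * b 1) (tword [x, y, z])"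
  shows "b i * b (Suc i) * b i = b (Suc i) * b i * b (Suc i)"
proof (rule app_inject)
  fix x
  have "\<forall>x. app (b i * b (Suc i) * b i) x = app (b (Suc i) * b i * b (Suc i)) x"
  proof (rule tword_ext)
    fix xs :: "'v list"
    have short: "app (b (Suc i)) y = 0" if "y \<in> tdeg (length xs)" "\<not> Suc (Suc i) < length xs" for y
    proof -
      have "\<forall>y\<in>tdeg (length xs). app (b (Suc i)) y = 0"
        by (rule tdeg_ext) (use that in \<open>auto intro!: clin clinear_app simp: b_tword_short\<close>)
      with that show ?thesis by blast
    qed
    show "app (b i * b (Suc i) * b i) (tword xs) = app (b (Suc i) * b i * b (Suc i)) (tword xs)"
    proof (cases "Suc (Suc i) < length xs")
      case True
      then obtain p a c r where p: "xs = p @ a # c # r" "length p = i" using split_at[of i xs] by auto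
      then obtain d r' where "r = d # r'" using True by (cases r) auto
      with p have xs: "tword xs = tmul (tword p) (tmul (tword [a, c, d]) (tword r'))" by simp
      have dp: "tword p \<in> tdeg i" and d3: "tword [a, c, d] \<in> tdeg 3"
        using p by (auto intro: tword_tdeg)
      have *: "app (be [i1 + i, i2 + i, i3 + i]) (tword xs) = tmul (tword p) (tmul (app (be [i1, i2, i3]) (tword [a, c, d])) (tword r'))"
        if "i1 \<le> 1" "i2 \<le> 1" "i3 \<le> 1" for i1 i2 i3
        using be_tmul_right[OF dp, of "[i1, i2, i3]" "tmul (tword [a, c, d]) (tword r')"]
          be_tmul_left[OF d3, of "[i1, i2, i3]" "tword r'"] that unfolding xs by simp
      show ?thesis
        using *[of 0 1 0] *[of 1 0 1] assms[of a c d] by (simp add: mult.assoc)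
    next
      case False
      then show ?thesis
        using short b_tdeg[OF tword_tdeg[of xs], of _ i] tword_tdeg[of xs] by (simp add: clinear_zero[OF clinear_app])
    qed
  qed (intro clinear_app)+
  then show "app (b i * b (Suc i) * b i) x = app (b (Suc i) * b i * b (Suc i)) x" ..
qed

end

locale braided_comodule = coquasitriangular_hopf_algebra comult counit antipode R
  for comult :: "'h::complex_algebra_1 \<Rightarrow> 'h \<otimes> 'h" and counit antipode R +
  fixes \<delta> :: "'v::complex_vector \<Rightarrow> 'v \<otimes> 'h"
  assumes comodule: "right_comodule comult counit \<delta>"
begin

lemma delta_linear: "clinear \<delta>"
  and delta_coassoc: "coassoc_at \<delta> v"
  and delta_counit: "counit_at \<delta> v"
  using comodule by (simp_all add: right_comodule_def coassoc_at_def counit_at_def)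

lemma clin_delta [clin]: "clinear f \<Longrightarrow> clinear (\<lambda>x. \<delta> (f x))"
  by (rule clinear_compose[OF delta_linear])

sublocale braided_space "braiding R \<delta> \<delta>"
  by (rule braided_space.intro, rule clinear_braiding(1)[OF R_linear delta_linear delta_linear])

text \<open>The product of the algebra \<open>T(V) \<otimes> H\<close>; the coaction
  \<open>cT\<close> is the algebra map into it that extends the coaction on letters.\<close>

definition coprod :: "'v tensor_algebra \<otimes> 'h \<Rightarrow> 'v tensor_algebra \<otimes> 'h \<Rightarrow> 'v tensor_algebra \<otimes> 'h"
  where "coprod s t = tlift (\<lambda>x0 x1. tlift (\<lambda>y0 y1. tmul x0 y0 \<otimes> (x1 * y1)) t) s"

lemma clin_coprod_left [clin]: "clinear f \<Longrightarrow> clinear (\<lambda>x. coprod (f x) t)"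
  and clin_coprod_right [clin]: "clinear f \<Longrightarrow> clinear (\<lambda>x. coprod s (f x))"
  unfolding coprod_def by (intro clin, assumption)+

lemma coprod_tens [simp]: "coprod (x0 \<otimes> x1) (y0 \<otimes> y1) = tmul x0 y0 \<otimes> (x1 * y1)"
  by (simp add: coprod_def clin)

lemma coprod_assoc: "coprod (coprod s t) r = coprod s (coprod t r)"
proof -
  have "\<forall>r. coprod (coprod (x0 \<otimes> x1) (y0 \<otimes> y1)) r = coprod (x0 \<otimes> x1) (coprod (y0 \<otimes> y1) r)" for x0 x1 y0 y1
    by (rule tensor_ext) (intro clin | simp add: tmul_assoc mult.assoc)+
  then have "\<forall>s t. coprod (coprod s t) r = coprod s (coprod t r)"
    by (intro tensor_ext2) (intro clin | simp)+
  then show ?thesis by blast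
qed

lemma coprod_one: "coprod s (tword [] \<otimes> 1) = s" "coprod (tword [] \<otimes> 1) s = s"
proof -
  have "\<forall>s. coprod s (tword [] \<otimes> 1) = s" by (rule tensor_ext) (intro clin | simp)+
  moreover have "\<forall>s. coprod (tword [] \<otimes> 1) s = s" by (rule tensor_ext) (intro clin | simp)+
  ultimately show "coprod s (tword [] \<otimes> 1) = s" "coprod (tword [] \<otimes> 1) s = s" by blast+
qed

definition letter :: "'v \<Rightarrow> 'v tensor_algebra" where "letter v = tword [v]"

lemma clin_letter [clin]: "clinear f \<Longrightarrow> clinear (\<lambda>x. letter (f x))"
  unfolding letter_def by (intro clin)

lemma clinear_letter: "clinear letter"
  unfolding letter_def by (intro clin)

lemma word_coaction_Cons: "word_coaction \<delta> (v # vs) = coprod (tmap letter id (\<delta> v)) (word_coaction \<delta> vs)"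
  unfolding coprod_def word_coaction.simps
  by (subst tlift_tmap) (intro clin clinear_letter | simp add: letter_def)+

lemma multilinear_word_coaction: "multilinear (word_coaction \<delta>)"
proof (rule multilinearI)
  show "clinear (\<lambda>v. word_coaction \<delta> (xs @ [v] @ ys))" for xs ys
    by (induction xs) (simp_all only: append.simps word_coaction_Cons, (intro clin clinear_letter | assumption)+)
qed

definition cT :: "'v tensor_algebra \<Rightarrow> 'v tensor_algebra \<otimes> 'h"
  where "cT = talift (word_coaction \<delta>)"

lemma clinear_cT: "clinear cT" and cT_tword: "cT (tword xs) = word_coaction \<delta> xs"
  unfolding cT_def by (rule clinear_talift talift_tword, rule multilinear_word_coaction)+

lemma clin_cT [clin]: "clinear f \<Longrightarrow> clinear (\<lambda>x. cT (f x))"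
  by (rule clinear_compose[OF clinear_cT])

lemma cT_one: "cT (tword []) = tword [] \<otimes> 1"
  by (simp add: cT_tword)

lemma cT_letter: "cT (letter v) = tmap letter id (\<delta> v)"
  by (simp add: letter_def cT_tword word_coaction_Cons coprod_one del: word_coaction.simps(2))

lemma cT_tmul: "cT (tmul x y) = coprod (cT x) (cT y)"
proof -
  have *: "word_coaction \<delta> (xs @ ys) = coprod (word_coaction \<delta> xs) (word_coaction \<delta> ys)" for xs ys
    by (induction xs) (simp_all add: coprod_one word_coaction_Cons coprod_assoc del: word_coaction.simps(2))
  have "\<forall>y. cT (tmul (tword xs) y) = coprod (cT (tword xs)) (cT y)" for xs
    by (rule tword_ext) (intro clin | simp add: cT_tword *)+
  then have "\<forall>x. cT (tmul x y) = coprod (cT x) (cT y)"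
    by (intro tword_ext) (intro clin | simp)+
  then show ?thesis ..
qed

lemma letter_colinear: "colinear_at \<delta> cT letter v"
  by (simp add: colinear_at_def cT_letter)

lemma tjoin_colinear: "colinear_at (tensor_coaction cT cT) cT tjoin z"
proof -
  have p: "\<forall>s t. tmap tjoin id (tlift (\<lambda>v0 v1. tlift (\<lambda>w0 w1. (v0 \<otimes> w0) \<otimes> (v1 * w1)) t) s) = coprod s t"
    by (rule tensor_ext2) (intro clin clinear_tjoin | simp add: clin tmap_tens clinear_tjoin)+
  have "\<forall>z. cT (tjoin z) = tmap tjoin id (tensor_coaction cT cT z)"
  proof (rule tensor_ext)
    show "clinear (\<lambda>z. tmap tjoin id (tensor_coaction cT cT z))"
      by (intro clin clinear_tjoin clinear_tensor_coaction clinear_cT)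
    show "cT (tjoin (x \<otimes> y)) = tmap tjoin id (tensor_coaction cT cT (x \<otimes> y))" for x y
      using p by (simp add: tensor_coaction_tens clinear_cT cT_tmul)
  qed (intro clin)
  then show ?thesis by (simp add: colinear_at_def)
qed

lemma pair2_tjoin: "pair2 z = tjoin (tmap letter letter z)"
proof -
  have "\<forall>z. pair2 z = tjoin (tmap letter letter z)"
    by (rule tensor_ext) (intro clin clinear_pair2 clinear_letter | simp add: tmap_tens clinear_letter pair2_tens letter_def)+
  then show ?thesis ..
qed

text \<open>A word is the image of letter \<otimes> shorter word under the colinear multiplication,
  so induction reduces both laws to tensor products of comodules.\<close>

lemma cT_coassoc: "coassoc_at cT x" and cT_counit: "counit_at cT x"
proof -
  have l: "coassoc_at cT (letter v)" "counit_at cT (letter v)" for v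
    using coassoc_at_colinear[OF delta_linear clinear_cT clinear_letter letter_colinear delta_coassoc]
      counit_at_colinear[OF delta_linear clinear_cT clinear_letter letter_colinear delta_counit] by auto
  have w: "coassoc_at cT (tword xs) \<and> counit_at cT (tword xs)" for xs
  proof (induction xs)
    case Nil
    show ?case
      by (simp add: coassoc_at_def counit_at_def cT_one tmap_tens clinear_cT tassoc_tens comult_linear clin comult_one
          counit_one scaleC_one)
  next
    case (Cons v xs)
    have t: "tword (v # xs) = tjoin (letter v \<otimes> tword xs)" by (simp add: letter_def)
    note D = clinear_tensor_coaction(1)[OF clinear_cT clinear_cT]
    show ?case unfolding t
      using coassoc_at_colinear[OF D clinear_cT clinear_tjoin tjoin_colinear coassoc_at_tensor[OF clinear_cT clinear_cT l(1)]]
        counit_at_colinear[OF D clinear_cT clinear_tjoin tjoin_colinear counit_at_tensor[OF clinear_cT clinear_cT l(2)]] Cons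
      by blast
  qed
  show "coassoc_at cT x"
    by (rule coassoc_at_span[OF clinear_cT _ tensor_algebra_span]) (use w in auto)
  show "counit_at cT x"
    by (rule counit_at_span[OF clinear_cT _ tensor_algebra_span]) (use w in auto)
qed

abbreviation "\<Psi>T \<equiv> braiding R cT cT"

lemma clin_PsiT [clin]: "clinear f \<Longrightarrow> clinear (\<lambda>x. \<Psi>T (f x))"
  by (rule clinear_compose[OF clinear_braiding(1)[OF R_linear clinear_cT clinear_cT]])

lemma PsiT_letters: "\<Psi>T (letter u \<otimes> letter v) = tmap letter letter (braiding R \<delta> \<delta> (u \<otimes> v))"
  by (rule braiding_natural[OF R_linear delta_linear delta_linear clinear_cT clinear_cT clinear_letter clinear_letter
        letter_colinear letter_colinear])

lemma colinear_id: "colinear_at \<delta>' \<delta>' (\<lambda>x. x) y"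
  by (simp add: colinear_at_def id_def tmap_id)

text \<open>The hexagon identity for the tensor algebra: multiplication is colinear, hence can be
  taken outside the braiding.\<close>

lemma PsiT_left: "\<Psi>T (tmul x y \<otimes> z) =
    tlift (\<lambda>z' y'. tlift (\<lambda>z'' x'. z'' \<otimes> tmul x' y') (\<Psi>T (x \<otimes> z'))) (\<Psi>T (y \<otimes> z))"
proof -
  note D = clinear_tensor_coaction(1)[OF clinear_cT clinear_cT]
  have "\<Psi>T (tjoin (x \<otimes> y) \<otimes> z) = tmap (\<lambda>x. x) tjoin (braiding R (tensor_coaction cT cT) cT ((x \<otimes> y) \<otimes> z))"
    by (rule braiding_natural[OF R_linear D clinear_cT clinear_cT clinear_cT clinear_tjoin clin_id tjoin_colinear colinear_id])
  also have "\<dots> = tmap (\<lambda>x. x) tjoin (tlift (\<lambda>z' y'. tlift (\<lambda>z'' x'. z'' \<otimes> x' \<otimes> y') (\<Psi>T (x \<otimes> z'))) (\<Psi>T (y \<otimes> z)))"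
    by (subst hexagon_left[OF clinear_cT clinear_cT clinear_cT cT_coassoc]) (rule refl)
  also have "\<dots> = tlift (\<lambda>z' y'. tmap (\<lambda>x. x) tjoin (tlift (\<lambda>z'' x'. z'' \<otimes> x' \<otimes> y') (\<Psi>T (x \<otimes> z')))) (\<Psi>T (y \<otimes> z))"
    by (rule clinear_tlift_commute[OF clinear_tmap[OF clin_id clinear_tjoin]]) (intro clin)+
  also have "\<dots> = tlift (\<lambda>z' y'. tlift (\<lambda>z'' x'. tmap (\<lambda>x. x) tjoin (z'' \<otimes> x' \<otimes> y')) (\<Psi>T (x \<otimes> z'))) (\<Psi>T (y \<otimes> z))"
    by (rule tlift_cong, rule clinear_tlift_commute[OF clinear_tmap[OF clin_id clinear_tjoin]]) (intro clin)+
  finally show ?thesis by (simp add: tmap_tens clin clinear_tjoin)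
qed

lemma PsiT_right: "\<Psi>T (z \<otimes> tmul x y) =
    tlift (\<lambda>x' z'. tlift (\<lambda>y' z''. tmul x' y' \<otimes> z'') (\<Psi>T (z' \<otimes> y))) (\<Psi>T (z \<otimes> x))"
proof -
  note D = clinear_tensor_coaction(1)[OF clinear_cT clinear_cT]
  have "\<Psi>T (z \<otimes> tjoin (x \<otimes> y)) = tmap tjoin (\<lambda>x. x) (braiding R cT (tensor_coaction cT cT) (z \<otimes> x \<otimes> y))"
    by (rule braiding_natural[OF R_linear clinear_cT D clinear_cT clinear_cT clin_id clinear_tjoin colinear_id tjoin_colinear])
  also have "\<dots> = tmap tjoin (\<lambda>x. x) (tlift (\<lambda>x' z'. tlift (\<lambda>y' z''. (x' \<otimes> y') \<otimes> z'') (\<Psi>T (z' \<otimes> y))) (\<Psi>T (z \<otimes> x)))"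
    by (subst hexagon_right[OF clinear_cT clinear_cT clinear_cT cT_coassoc]) (rule refl)
  also have "\<dots> = tlift (\<lambda>x' z'. tmap tjoin (\<lambda>x. x) (tlift (\<lambda>y' z''. (x' \<otimes> y') \<otimes> z'') (\<Psi>T (z' \<otimes> y)))) (\<Psi>T (z \<otimes> x))"
    by (rule clinear_tlift_commute[OF clinear_tmap[OF clinear_tjoin clin_id]]) (intro clin)+
  also have "\<dots> = tlift (\<lambda>x' z'. tlift (\<lambda>y' z''. tmap tjoin (\<lambda>x. x) ((x' \<otimes> y') \<otimes> z'')) (\<Psi>T (z' \<otimes> y))) (\<Psi>T (z \<otimes> x))"
    by (rule tlift_cong, rule clinear_tlift_commute[OF clinear_tmap[OF clinear_tjoin clin_id]]) (intro clin)+
  finally show ?thesis by (simp add: tmap_tens clin clinear_tjoin)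
qed

lemma PsiT_one_left: "\<Psi>T (tword [] \<otimes> x) = x \<otimes> tword []"
  by (rule braiding_one_left[OF clinear_cT clinear_cT cT_one cT_counit])

lemma PsiT_one_right: "\<Psi>T (x \<otimes> tword []) = tword [] \<otimes> x"
  by (rule braiding_one_right[OF clinear_cT clinear_cT cT_one cT_counit])

lemma cut_letter: "cut (Suc n) (tmul (letter u) x) = tmap (tmul (letter u)) (\<lambda>z. z) (cut n x)"
  using cut_tmul_left[of "letter u" 1 n x] by (simp add: letter_def tword_tdeg)

lemma tmap_tlift: "clinear f \<Longrightarrow> clinear g \<Longrightarrow> tlift (\<lambda>x y. f x \<otimes> g y) t = tmap f g t"
  by (simp add: tmap_def)

text \<open>The letter passes the first letter of the word by the braiding on
  \<open>V \<otimes> V\<close> and the rest by the induction hypothesis, whose positions are shifted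
  by one.\<close>

lemma PsiT_single: "\<Psi>T (letter u \<otimes> tword vs) = cut (length vs) (app (be (rev [0..<length vs])) (tmul (letter u) (tword vs)))"
proof (induction vs arbitrary: u)
  case Nil
  show ?case by (simp add: PsiT_one_right letter_def cut_tword)
next
  case (Cons w ws)
  let ?n = "length ws"
  have step: "\<forall>t. tlift (\<lambda>x' z'. tlift (\<lambda>y' z''. tmul x' y' \<otimes> z'') (\<Psi>T (z' \<otimes> tword ws))) (tmap letter letter t) =
      cut (Suc ?n) (app (be (rev [Suc 0..<Suc ?n])) (tmul (pair2 t) (tword ws)))"
  proof (rule tensor_ext)
    fix w0 u0
    have "tlift (\<lambda>y' z''. tmul (letter w0) y' \<otimes> z'') (\<Psi>T (letter u0 \<otimes> tword ws)) =
        tmap (tmul (letter w0)) (\<lambda>z. z) (\<Psi>T (letter u0 \<otimes> tword ws))"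
      by (rule tmap_tlift) (intro clin clinear_tmul_right)+
    also have "\<dots> = cut (Suc ?n) (tmul (letter w0) (app (be (rev [0..<?n])) (tmul (letter u0) (tword ws))))"
      by (simp add: Cons cut_letter)
    also have "tmul (letter w0) (app (be (rev [0..<?n])) (tmul (letter u0) (tword ws))) =
        app (be (map (\<lambda>i. i + 1) (rev [0..<?n]))) (tmul (letter w0) (tmul (letter u0) (tword ws)))"
      by (rule be_tmul_right[symmetric]) (simp add: letter_def tword_tdeg)
    also have "map (\<lambda>i. i + 1) (rev [0..<?n]) = rev [Suc 0..<Suc ?n]"
      by (simp only: rev_map[symmetric] Suc_eq_plus1[symmetric] map_Suc_upt)
    also have "tmul (letter w0) (tmul (letter u0) (tword ws)) = tmul (pair2 (w0 \<otimes> u0)) (tword ws)"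
      by (simp add: letter_def pair2_tens)
    finally show "tlift (\<lambda>x' z'. tlift (\<lambda>y' z''. tmul x' y' \<otimes> z'') (\<Psi>T (z' \<otimes> tword ws))) (tmap letter letter (w0 \<otimes> u0)) =
      cut (Suc ?n) (app (be (rev [Suc 0..<Suc ?n])) (tmul (pair2 (w0 \<otimes> u0)) (tword ws)))"
      by (simp add: tmap_tens clinear_letter clin del: upt_Suc)
  qed (intro clin clinear_letter)+
  have "\<Psi>T (letter u \<otimes> tword (w # ws)) = \<Psi>T (letter u \<otimes> tmul (letter w) (tword ws))" by (simp add: letter_def)
  also have "\<dots> = cut (Suc ?n) (app (be (rev [Suc 0..<Suc ?n])) (tmul (pair2 (braiding R \<delta> \<delta> (u \<otimes> w))) (tword ws)))"
    using step by (simp add: PsiT_right PsiT_letters del: upt_Suc)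
  also have "tmul (pair2 (braiding R \<delta> \<delta> (u \<otimes> w))) (tword ws) = app (b 0) (tword (u # w # ws))"
    using b_tword_split[of "[]" 0 u w ws] by simp
  also have "app (be (rev [Suc 0..<Suc ?n])) \<dots> = app (be (rev [0..<Suc ?n])) (tword (u # w # ws))"
    by (simp add: upt_conv_Cons[of 0 "Suc ?n"] del: upt_Suc)
  finally show ?case by (simp add: letter_def del: upt_Suc)
qed

text \<open>The link between the Hopf-theoretic braiding and the braid calculus. The strands of the
  left word cross one at a time, each step being a hexagon identity combined with
  \<open>PsiT_single\<close>.\<close>

lemma PsiT_words: "\<Psi>T (tword us \<otimes> tword vs) = cut (length vs) (app (be (crw 0 (length us) (length vs))) (tword (us @ vs)))"
proof (induction us)
  case Nil
  show ?case by (simp add: PsiT_one_left cut_tword)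
next
  case (Cons u us)
  let ?m = "length us" and ?n = "length vs"
  let ?c = "be (rev [0..<?n])"
  have step: "\<forall>Z\<in>tdeg (?n + ?m). tlift (\<lambda>z' y'. tlift (\<lambda>z'' x'. z'' \<otimes> tmul x' y') (\<Psi>T (letter u \<otimes> z'))) (cut ?n Z) =
      cut ?n (app ?c (tmul (letter u) Z))"
  proof (rule tdeg_ext)
    fix zs :: "'v list" assume len: "length zs = ?n + ?m"
    define z1 y1 where "z1 = take ?n zs" and "y1 = drop ?n zs"
    have zs: "zs = z1 @ y1" "length z1 = ?n" using len by (auto simp: z1_def y1_def)
    have deg: "tmul (letter u) (tword z1) \<in> tdeg (Suc ?n)" by (simp add: letter_def tword_tdeg zs)
    have "tlift (\<lambda>z'' x'. z'' \<otimes> tmul x' (tword y1)) (\<Psi>T (letter u \<otimes> tword z1)) =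
        tmap (\<lambda>z. z) (\<lambda>z. tmul z (tword y1)) (cut ?n (app ?c (tmul (letter u) (tword z1))))"
      by (subst tmap_tlift) (intro clin | simp add: PsiT_single zs)+
    also have "\<dots> = cut ?n (tmul (app ?c (tmul (letter u) (tword z1))) (tword y1))"
      by (rule cut_tmul_right[symmetric, OF be_tdeg[OF deg]]) simp
    also have "tmul (app ?c (tmul (letter u) (tword z1))) (tword y1) = app ?c (tmul (tmul (letter u) (tword z1)) (tword y1))"
      by (rule be_tmul_left[symmetric, OF deg]) simp
    finally show "tlift (\<lambda>z' y'. tlift (\<lambda>z'' x'. z'' \<otimes> tmul x' y') (\<Psi>T (letter u \<otimes> z'))) (cut ?n (tword zs)) =
      cut ?n (app ?c (tmul (letter u) (tword zs)))"
      using zs by (simp add: cut_tword clin tmul_assoc)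
  qed (intro clin)+
  have "\<Psi>T (tword (u # us) \<otimes> tword vs) = \<Psi>T (tmul (letter u) (tword us) \<otimes> tword vs)" by (simp add: letter_def)
  also have "\<dots> = cut ?n (app ?c (tmul (letter u) (app (be (crw 0 ?m ?n)) (tword (us @ vs)))))"
    unfolding PsiT_left Cons
    by (rule bspec[OF step]) (auto intro!: be_tdeg tword_tdeg)
  also have "tmul (letter u) (app (be (crw 0 ?m ?n)) (tword (us @ vs))) =
      app (be (map (\<lambda>i. i + 1) (crw 0 ?m ?n))) (tmul (letter u) (tword (us @ vs)))"
    by (rule be_tmul_right[symmetric]) (simp add: letter_def tword_tdeg)
  also have "map (\<lambda>i. i + 1) (crw 0 ?m ?n) = crw (Suc 0) ?m ?n"
    using crw_shift[of 0 1] by simp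
  finally show ?case by (simp add: letter_def)
qed

end

lemma app_plus_fun: "app (e + f) = (\<lambda>x. app e x + app f x)"
  by (rule ext) simp

lemma app_times_fun: "app (e * f) = (\<lambda>x. app e (app f x))"
  by (rule ext) simp

context braided_comodule
begin

lemma pair2_colinear: "colinear_at (tensor_coaction \<delta> \<delta>) cT pair2 z"
proof -
  have "\<forall>z. cT (pair2 z) = tmap pair2 id (tensor_coaction \<delta> \<delta> z)"
  proof (rule tensor_ext)
    show "clinear (\<lambda>z. tmap pair2 id (tensor_coaction \<delta> \<delta> z))"
      by (intro clin clinear_pair2 clinear_tensor_coaction delta_linear)
    fix x y
    have "cT (pair2 (x \<otimes> y)) = tmap tjoin id (tensor_coaction cT cT (tmap letter letter (x \<otimes> y)))"
      using tjoin_colinear[of "tmap letter letter (x \<otimes> y)"] by (simp add: pair2_tjoin colinear_at_def)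
    also have "\<dots> = tmap tjoin id (tmap (tmap letter letter) id (tensor_coaction \<delta> \<delta> (x \<otimes> y)))"
      using tensor_coaction_natural[OF delta_linear delta_linear clinear_cT clinear_cT clinear_letter clinear_letter
          letter_colinear[of x] letter_colinear[of y]] by (simp add: colinear_at_def)
    also have "\<dots> = tmap pair2 id (tensor_coaction \<delta> \<delta> (x \<otimes> y))"
      by (subst tmap_tmap) (intro clin clinear_tjoin clinear_tmap clinear_letter | simp add: pair2_tjoin[abs_def] id_def)+
    finally show "cT (pair2 (x \<otimes> y)) = tmap pair2 id (tensor_coaction \<delta> \<delta> (x \<otimes> y))" .
  qed (intro clin)
  then show ?thesis by (simp add: colinear_at_def)
qed

lemma b_pair2: "app (b 0) (pair2 z) = pair2 (braiding R \<delta> \<delta> z)"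
proof -
  have "\<forall>z. app (b 0) (pair2 z) = pair2 (braiding R \<delta> \<delta> z)"
    by (rule tensor_ext) (intro clin | simp add: pair2_tens b_tword_split[of "[]", simplified])+
  then show ?thesis ..
qed

lemma Psi_colinear: "colinear_at (tensor_coaction \<delta> \<delta>) (tensor_coaction \<delta> \<delta>) (braiding R \<delta> \<delta>) z"
proof -
  note P = clinear_braiding(1)[OF R_linear delta_linear delta_linear]
  note D = clinear_tensor_coaction(1)[OF delta_linear delta_linear]
  have "\<forall>z. tensor_coaction \<delta> \<delta> (braiding R \<delta> \<delta> z) = tmap (braiding R \<delta> \<delta>) id (tensor_coaction \<delta> \<delta> z)"
    by (rule tensor_ext)
      (intro clin P clinear_compose[OF D] D clinear_compose[OF P] |
        simp add: braiding_colinear[OF delta_linear delta_linear delta_coassoc delta_coassoc, unfolded colinear_at_def])+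
  then show ?thesis by (simp add: colinear_at_def)
qed

lemma b_pair2_colinear: "cT (app (b 0) (pair2 z)) = tmap (app (b 0)) id (cT (pair2 z))"
proof -
  note P = clinear_braiding(1)[OF R_linear delta_linear delta_linear]
  have "cT (app (b 0) (pair2 z)) = tmap pair2 id (tmap (braiding R \<delta> \<delta>) id (tensor_coaction \<delta> \<delta> z))"
    using pair2_colinear[of "braiding R \<delta> \<delta> z"] Psi_colinear[of z] by (simp add: colinear_at_def b_pair2)
  also have "\<dots> = tmap (app (b 0)) id (tmap pair2 id (tensor_coaction \<delta> \<delta> z))"
    by (subst (1 2) tmap_tmap) (intro clin P clinear_app clinear_pair2 | simp add: b_pair2)+
  finally show ?thesis using pair2_colinear[of z] by (simp add: colinear_at_def)
qed

text \<open>The coaction preserves the degree of tensors, expressed through \<open>tproj\<close> as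
  a property of the first leg.\<close>

lemma cT_deg: "x \<in> tdeg n \<Longrightarrow> tmap (tproj n) id (cT x) = cT x"
proof -
  have t: "tproj (Suc n) (tmul (letter v) y) = tmul (letter v) (tproj n y)" for n v y
  proof -
    have "\<forall>y. tproj (Suc n) (tmul (letter v) y) = tmul (letter v) (tproj n y)"
      by (rule tword_ext) (intro clin | simp add: letter_def tproj_tword clinear_zero[OF clinear_tmul_right])+
    then show ?thesis ..
  qed
  have c: "\<forall>(s :: 'v \<otimes> 'h) (t :: 'v tensor_algebra \<otimes> 'h). tmap (tproj (Suc n)) id (coprod (tmap letter id s) t) = coprod (tmap letter id s) (tmap (tproj n) id t)" for n
    by (rule tensor_ext2) (intro clin clinear_letter clinear_tproj | simp add: tmap_tens clinear_letter clinear_tproj clin t)+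
  have "tmap (tproj (length xs)) id (cT (tword xs)) = cT (tword xs)" for xs
  proof (induction xs)
    case Nil
    show ?case by (simp add: cT_one tmap_tens clinear_tproj clin tproj_tword)
  next
    case (Cons v xs)
    then show ?case using c[of "length xs"] unfolding id_def by (simp add: word_coaction_Cons[unfolded id_def] cT_tword del: word_coaction.simps(2))
  qed
  then have "\<forall>x\<in>tdeg n. tmap (tproj n) id (cT x) = cT x"
    by (intro tdeg_ext) (intro clin clinear_tproj | auto)+
  then show "x \<in> tdeg n \<Longrightarrow> ?thesis" by blast
qed

lemma b_zero_deg: "x \<in> tdeg n \<Longrightarrow> n \<le> Suc i \<Longrightarrow> app (b i) x = 0"
proof -
  assume n: "n \<le> Suc i"
  have "\<forall>x\<in>tdeg n. app (b i) x = 0"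
    by (rule tdeg_ext) (use n in \<open>auto intro!: clin clinear_app simp: b_tword_short\<close>)
  then show "x \<in> tdeg n \<Longrightarrow> app (b i) x = 0" by blast
qed

lemma b_colinear: "cT (app (b i) x) = tmap (app (b i)) id (cT x)"
proof -
  \<comment> \<open>The coactions of the part before position i, of the two letters and of the part
    after them are replaced by arbitrary tensors. The projection \<open>tproj i\<close> keeps the
    first part in degree i, so that \<open>b i\<close> still meets the middle one.\<close>
  let ?L = "\<lambda>s t r. tmap (app (b i)) id (coprod (coprod (tmap (tproj i) id s) (tmap pair2 id t)) r)"
  let ?R = "\<lambda>s t r. coprod (coprod (tmap (tproj i) id s) (tmap (app (b 0)) id (tmap pair2 id t))) r"
  have w: "app (b i) (tmul (tmul (tproj i x) (pair2 z)) y) = tmul (tmul (tproj i x) (app (b 0) (pair2 z))) y" for x z y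
    using b_tmul_left[OF tmul_tdeg[OF tproj_in_tdeg pair2_tdeg], of i i x z y] b_tmul_right[OF tproj_in_tdeg, of 0 i x "pair2 z"]
    by simp
  note lin = clinear_tproj clinear_pair2 clinear_app
  have "\<forall>r. ?L (x \<otimes> h) (z \<otimes> k) r = ?R (x \<otimes> h) (z \<otimes> k) r" for x h z k
    by (rule tensor_ext) (intro clin lin | simp add: tmap_tens lin clin w)+
  then have "\<forall>s t. ?L s t r = ?R s t r" for r
    by (intro tensor_ext2) (intro clin lin | simp)+
  then have key: "?L s t r = ?R s t r" for s t r by blast
  have "\<forall>x. cT (app (b i) x) = tmap (app (b i)) id (cT x)"
  proof (rule tword_ext)
    fix xs :: "'v list"
    show "cT (app (b i) (tword xs)) = tmap (app (b i)) id (cT (tword xs))"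
    proof (cases "Suc i < length xs")
      case True
      then obtain p u v r where xs: "xs = p @ u # v # r" "length p = i" using split_at by blast
      have x: "tword xs = tmul (tmul (tword p) (pair2 (u \<otimes> v))) (tword r)" by (simp add: xs pair2_tens)
      have p2: "cT (pair2 (u \<otimes> v)) = tmap pair2 id (tensor_coaction \<delta> \<delta> (u \<otimes> v))"
        using pair2_colinear by (simp add: colinear_at_def)
      have "app (b i) (tword xs) = tmul (tmul (tword p) (app (b 0) (pair2 (u \<otimes> v)))) (tword r)"
        by (simp add: xs b_tword_split b_pair2)
      then have "cT (app (b i) (tword xs)) =
          coprod (coprod (cT (tword p)) (tmap (app (b 0)) id (tmap pair2 id (tensor_coaction \<delta> \<delta> (u \<otimes> v))))) (cT (tword r))"
        by (simp add: cT_tmul b_pair2_colinear p2)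
      also have "\<dots> = tmap (app (b i)) id (coprod (coprod (cT (tword p)) (cT (pair2 (u \<otimes> v)))) (cT (tword r)))"
        using key[of "cT (tword p)"] cT_deg[OF tword_tdeg[OF xs(2)]] by (simp add: p2)
      finally show ?thesis by (simp add: x cT_tmul)
    next
      case False
      have "tmap (app (b i)) id (cT (tword xs)) = tmap (app (b i)) id (tmap (tproj (length xs)) id (cT (tword xs)))"
        by (simp add: cT_deg[OF tword_tdeg[OF refl]])
      also have "\<dots> = tmap (\<lambda>x. 0) id (cT (tword xs))"
        unfolding id_def using b_zero_deg[OF tproj_in_tdeg] False by (subst tmap_tmap) (auto simp: lin clin)
      also have "\<dots> = 0"
      proof -
        have "\<forall>t :: 'v tensor_algebra \<otimes> 'h. tmap (\<lambda>x. 0) id t = 0" by (rule tensor_ext) (intro clin | simp add: tmap_tens clin)+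
        then show ?thesis by blast
      qed
      finally show ?thesis using False by (simp add: b_tword_short clinear_zero[OF clinear_cT])
    qed
  qed (intro clin clinear_app)+
  then show ?thesis ..
qed

lemma PsiT_tdeg:
  assumes "x \<in> tdeg m" "y \<in> tdeg n"
  shows "\<Psi>T (x \<otimes> y) = cut n (app (be (crw 0 m n)) (tmul x y))"
proof -
  have "\<forall>x\<in>tdeg m. \<forall>y\<in>tdeg n. \<Psi>T (x \<otimes> y) = cut n (app (be (crw 0 m n)) (tmul x y))"
    by (rule tdeg_ext2) (intro clin | simp add: PsiT_words)+
  with assms show ?thesis by blast
qed

lemma cut_be: "x \<in> tdeg m \<Longrightarrow> n \<le> m \<Longrightarrow> cut n (app (be (map (\<lambda>i. i + n) is)) x) = tmap (\<lambda>z. z) (app (be is)) (cut n x)"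
proof -
  assume n: "n \<le> m"
  have "\<forall>x\<in>tdeg m. cut n (app (be (map (\<lambda>i. i + n) is)) x) = tmap (\<lambda>z. z) (app (be is)) (cut n x)"
  proof (rule tdeg_ext)
    fix xs :: "'v list" assume "length xs = m"
    then have d: "tword (take n xs) \<in> tdeg n" using n by (intro tword_tdeg) simp
    have x: "tword xs = tmul (tword (take n xs)) (tword (drop n xs))" by simp
    show "cut n (app (be (map (\<lambda>i. i + n) is)) (tword xs)) = tmap (\<lambda>z. z) (app (be is)) (cut n (tword xs))"
      unfolding x be_tmul_right[OF d] cut_tmul[OF d] by (simp add: tmap_tens clin clinear_app)
  qed (intro clin clinear_app)+
  then show "x \<in> tdeg m \<Longrightarrow> ?thesis" by blast
qed

text \<open>Naturality of the braiding of \<open>T(V)\<close> with respect to the colinear map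
  \<open>b 0\<close>: two strands may be braided before or after they cross a third.\<close>

lemma yang_baxter: "app (b 0 * b 1 * b 0) (tword [x, y, z]) = app (b 1 * b 0 * b 1) (tword [x, y, z])"
proof -
  have crw: "crw 0 2 1 = [0, 1]" by (simp add: numeral_2_eq_2)
  have X: "tword [x, y] \<in> tdeg 2" and Z: "tword [z] \<in> tdeg 1" by (auto intro: tword_tdeg)
  have xyz: "tmul (tword [x, y]) (tword [z]) = tword [x, y, z]" by simp
  have d3: "tword [x, y, z] \<in> tdeg 3" by (rule tword_tdeg) simp
  have "\<Psi>T (app (b 0) (tword [x, y]) \<otimes> tword [z]) = tmap (\<lambda>z. z) (app (b 0)) (\<Psi>T (tword [x, y] \<otimes> tword [z]))"
    by (rule braiding_natural[OF R_linear clinear_cT clinear_cT clinear_cT clinear_cT clinear_app clin_id _ colinear_id])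
      (simp add: colinear_at_def b_colinear)
  then have "cut 1 (app (be [0, 1]) (tmul (app (b 0) (tword [x, y])) (tword [z]))) =
      tmap (\<lambda>z. z) (app (be [0])) (cut 1 (app (be [0, 1]) (tword [x, y, z])))"
    unfolding PsiT_tdeg[OF b_tdeg[OF X] Z] PsiT_tdeg[OF X Z] crw xyz by simp
  also have "\<dots> = cut 1 (app (be (map (\<lambda>i. i + 1) [0])) (app (be [0, 1]) (tword [x, y, z])))"
    by (rule cut_be[symmetric, OF be_tdeg[OF d3]]) simp
  finally have "app (be [0, 1]) (tmul (app (b 0) (tword [x, y])) (tword [z])) =
      app (be (map (\<lambda>i. i + 1) [0])) (app (be [0, 1]) (tword [x, y, z]))"
    by (metis tjoin_cut)
  moreover have "tmul (app (b 0) (tword [x, y])) (tword [z]) = app (b 0) (tword [x, y, z])"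
    using b_tmul_left[OF X, of 0 "tword [z]"] by simp
  ultimately show ?thesis by (simp add: mult.assoc)
qed

text \<open>From here on the identities of the braid ring hold for the operators on the whole tensor
  algebra, where a generator acts as 0 on words that are too short for it.\<close>

sublocale braid_ring b
  by (rule braid_ring.intro) (rule b_far b_braid yang_baxter | assumption)+

lemma be_bw: "be = bw"
  by (simp add: be_def bw_def fun_eq_iff)

lemma gen_induct_deg:
  assumes "e \<in> gen A"
  shows gen_tdeg: "x \<in> tdeg n \<Longrightarrow> app e x \<in> tdeg n"
    and gen_tmul_left: "x \<in> tdeg n \<Longrightarrow> (\<And>i. i \<in> A \<Longrightarrow> Suc i < n) \<Longrightarrow> app e (tmul x y) = tmul (app e x) y"
proof -
  note sub = subspace_tdeg
  have "(x \<in> tdeg n \<longrightarrow> app e x \<in> tdeg n) \<and>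
      (x \<in> tdeg n \<longrightarrow> (\<forall>i\<in>A. Suc i < n) \<longrightarrow> app e (tmul x y) = tmul (app e x) y)" for x
    using assms
  proof (induction arbitrary: x rule: gen.induct)
    case zero
    then show ?case by (simp add: cvec.subspace_0[OF sub] clinear_zero[OF clinear_tmul_left])
  next
    case (add e f)
    then show ?case by (simp add: cvec.subspace_add[OF sub] clinear_add[OF clinear_tmul_left])
  qed (auto simp: b_tdeg b_tmul_left)
  then show "x \<in> tdeg n \<Longrightarrow> app e x \<in> tdeg n"
    "x \<in> tdeg n \<Longrightarrow> (\<And>i. i \<in> A \<Longrightarrow> Suc i < n) \<Longrightarrow> app e (tmul x y) = tmul (app e x) y" by auto
qed

lemma gen_colinear: "e \<in> gen A \<Longrightarrow> cT (app e x) = tmap (app e) id (cT x)"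
proof (induction arbitrary: x rule: gen.induct)
  case one
  show ?case unfolding id_def by (simp add: tmap_id)
next
  case zero
  have "\<forall>t :: 'v tensor_algebra \<otimes> 'h. tmap (app 0) id t = 0" by (rule tensor_ext) (intro clin clinear_app | simp add: tmap_tens clinear_app clin)+
  then have "tmap (app 0) id (cT x) = 0" ..
  then show ?case unfolding app_simps by (simp only: clinear_zero[OF clinear_cT])
next
  case (gen i)
  show ?case unfolding id_def by (rule b_colinear[unfolded id_def])
next
  case (add e f)
  have "\<forall>t :: 'v tensor_algebra \<otimes> 'h. tmap (app (e + f)) id t = tmap (app e) id t + tmap (app f) id t"
    by (rule tensor_ext) (intro clin clinear_app | simp add: tmap_tens clinear_app clin tens_add)+
  with add show ?case unfolding id_def by (simp add: clinear_add[OF clinear_cT] app_plus_fun)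
next
  case (mult e f)
  have "tmap (app e) id (tmap (app f) id t) = tmap (app (e * f)) id t" for t :: "'v tensor_algebra \<otimes> 'h"
    unfolding id_def app_times_fun by (rule tmap_tmap) (intro clin clinear_app)+
  with mult show ?case unfolding id_def by (simp add: app_times_fun)
qed

lemma bw_shift: "x \<in> tdeg d \<Longrightarrow> app (bw (map (\<lambda>i. i + d) is)) (tmul x y) = tmul x (app (bw is) y)"
  using be_tmul_right by (simp add: be_bw)

lemma map_add_upt': "map (\<lambda>i. i + d) [a..<c] = [a + d..<c + d]"
  by (induction c) auto

lemma cr_shift: "x \<in> tdeg d \<Longrightarrow> app (cr (k + d) a c) (tmul x y) = tmul x (app (cr k a c) y)"
  using bw_shift[of x d "crw k a c" y] by (simp add: cr_def crw_shift)

lemma fac_shift: "x \<in> tdeg d \<Longrightarrow> app (fac (k + d) n) (tmul x y) = tmul x (app (fac k n) y)"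
proof (induction n arbitrary: y)
  case (Suc n)
  have "app (bw [k + d + n - j..<k + d + n]) (tmul x y) = tmul x (app (bw [k + n - j..<k + n]) y)" if "j \<le> n" for j y
    using bw_shift[OF Suc.prems, of "[k + n - j..<k + n]" y] that by (simp add: map_add_upt' add_ac)
  with Suc show ?case
    by (simp add: app_sum clinear_sum[OF clinear_tmul_right] del: sum.atMost_Suc)
qed simp

lemma dl_shift: "x \<in> tdeg d \<Longrightarrow> app (dl (k + d) n) (tmul x y) = tmul x (app (dl k n) y)"
  using bw_shift[of x d "[k..<k + j]" y for j]
  by (simp add: dl_def app_sum clinear_sum[OF clinear_tmul_right] map_add_upt' add_ac)

lemma sh_shift: "x \<in> tdeg d \<Longrightarrow> app (sh (k + d) n a) (tmul x y) = tmul x (app (sh k n a) y)"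
proof (induction n arbitrary: k a y)
  case 0
  then show ?case by (simp add: clinear_zero[OF clinear_tmul_right])
next
  case (Suc n)
  have "app (bw (rev [k + d..<k + d + a])) (tmul x y) = tmul x (app (bw (rev [k..<k + a])) y)" for y
    using bw_shift[OF Suc.prems, of "rev [k..<k + a]" y] by (simp add: rev_map[symmetric] map_add_upt' add_ac)
  with Suc.IH[OF Suc.prems, of "Suc k"] show ?case
    by (auto split: nat.split simp: clinear_add[OF clinear_tmul_right] clinear_zero[OF clinear_tmul_right])
qed

lemma PsiT_cr: "x \<in> tdeg m \<Longrightarrow> y \<in> tdeg n \<Longrightarrow> \<Psi>T (x \<otimes> y) = cut n (app (cr 0 m n) (tmul x y))"
  using PsiT_tdeg by (simp add: be_bw cr_def)

text \<open>The reduced expressions chosen in \<open>braid_perm\<close> are replaced by normal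
  words, over which the sum is known.\<close>

lemma braided_factorial_fac: "braided_factorial (braiding R \<delta> \<delta>) n x = app (fac 0 n) x"
proof -
  have f: "foldr (\<lambda>i f. braid_at (braiding R \<delta> \<delta>) i \<circ> f) is id = app (bw is)" for "is"
    by (induction "is") (auto simp: bw_Cons app_b fun_eq_iff)
  have "braided_factorial (braiding R \<delta> \<delta>) n x =
      (\<Sum>u\<in>normal_words n. braid_perm (braiding R \<delta> \<delta>) n (word_perm u) x)"
    unfolding braided_factorial_def by (rule sum.reindex_bij_betw[OF bij_betw_word_perm, symmetric])
  also have "\<dots> = (\<Sum>u\<in>normal_words n. app (bw u) x)"
    by (intro sum.cong refl) (simp add: braid_perm_def f bw_braid_equiv[OF some_reduced_expression])
  finally show ?thesis by (simp add: app_sum[symmetric] sum_normal_words)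
qed

lemma Psi_surj: "\<exists>w. braiding R \<delta> \<delta> w = z"
proof -
  note I = clinear_inv_braiding[OF delta_linear delta_linear]
  have "\<forall>z. braiding R \<delta> \<delta> (inv_braiding \<delta> \<delta> z) = z"
    by (rule tensor_ext)
      (intro clin I | simp add: braiding_inv_braiding delta_linear delta_coassoc delta_counit)+
  then show ?thesis by blast
qed

lemma b_surj:
  assumes "Suc i < n" "y \<in> tdeg n" shows "\<exists>x\<in>tdeg n. app (b i) x = y"
proof -
  have img: "app (b i) ` tdeg n = cvec.span (app (b i) ` {tword xs |xs. length xs = n})"
    by (simp only: tdeg_def clinear_image_span[OF clinear_app])
  have "tword xs \<in> app (b i) ` tdeg n" if n: "length xs = n" for xs
  proof -
    obtain p u v r where xs: "xs = p @ u # v # r" "length p = i" using split_at assms n by blast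
    obtain w where w: "braiding R \<delta> \<delta> w = u \<otimes> v" using Psi_surj by blast
    define x where "x = tmul (tmul (tword p) (pair2 w)) (tword r)"
    have d: "tmul (tword p) (pair2 w) \<in> tdeg (i + 2)" by (rule tmul_tdeg[OF tword_tdeg[OF xs(2)] pair2_tdeg])
    have "app (b i) x = tword xs"
      using b_tmul_left[OF d, of i] b_tmul_right[OF tword_tdeg[OF xs(2)], of 0 "pair2 w"]
      by (simp add: x_def b_pair2 w pair2_tens xs)
    moreover have "x \<in> tdeg n"
      using tmul_tdeg[OF d tword_tdeg[OF refl, of r]] n by (simp add: x_def xs)
    ultimately show ?thesis by (metis imageI)
  qed
  then have "tdeg n \<subseteq> app (b i) ` tdeg n"
    unfolding img by (subst tdeg_def) (intro cvec.span_minimal cvec.subspace_span; auto)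
  with assms(2) show ?thesis by auto
qed

text \<open>Rests on the invertibility of the braiding, hence of R under convolution; it yields that
  products in the opposite order span the forms.\<close>

lemma cr_surj:
  assumes "k + a + c \<le> n" "y \<in> tdeg n" shows "\<exists>x\<in>tdeg n. app (cr k a c) x = y"
proof -
  have "\<exists>x\<in>tdeg n. app (bw is) x = y" if "\<forall>i\<in>set is. Suc i < n" "y \<in> tdeg n" for "is" y
    using that
  proof (induction "is" arbitrary: y)
    case (Cons i "is")
    then obtain z where z: "z \<in> tdeg n" "app (b i) z = y" using b_surj[of i n y] by auto
    with Cons.IH[of z] Cons.prems obtain x where "x \<in> tdeg n" "app (bw is) x = z" by auto
    with z show ?case by (intro bexI[of _ x]) (simp_all add: bw_Cons)
  qed auto
  moreover have "\<forall>i\<in>set (crw k a c). Suc i < n"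
    using crw_letters[of _ k a c] assms(1) by (meson less_le_trans)
  ultimately show ?thesis using assms(2) unfolding cr_def by blast
qed

end

section \<open>The algebras \<open>\<Lambda>(V)\<close> and \<open>B\<close> and the product of
  forms on representatives\<close>

section \<open>Braided super tensor products and quotient algebras\<close>

text \<open>The prescribed values carry the sign (-1)^(j k), which has to come from one bilinear
  map. With the parity operators \<open>sA\<close> and \<open>sC\<close>, the element b' is split
  into an even and an odd part and the odd part is combined with \<open>sC c\<close>.\<close>

lemma super_mul:
  fixes A :: "('a::complex_vector, 'h::complex_vector) graded_comodule_algebra"
    and C :: "('c::complex_vector, 'h) graded_comodule_algebra"
  assumes R: "clinear R" and m: "cbilinear (mul A)" "cbilinear (mul C)" and d: "clinear (coact A)" "clinear (coact C)"
    and s: "clinear sA" "clinear sC" "\<And>i x. x \<in> deg A i \<Longrightarrow> sA x = (-1) ^ i *\<^sub>C x" "\<And>i x. x \<in> deg C i \<Longrightarrow> sC x = (-1) ^ i *\<^sub>C x"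
  shows cbilinear_super_mul: "cbilinear (super_mul R A C)"
    and super_mul_tens: "\<And>i j k l b c b' c'. b \<in> deg A i \<Longrightarrow> c \<in> deg C j \<Longrightarrow> b' \<in> deg A k \<Longrightarrow> c' \<in> deg C l \<Longrightarrow>
      super_mul R A C (b \<otimes> c) (b' \<otimes> c') = (-1) ^ (j * k) *\<^sub>C
        tlift (\<lambda>x y. mul A b x \<otimes> mul C y c') (braiding R (coact C) (coact A) (c \<otimes> b'))"
proof -
  note mA = clinear_compose[OF cbilinear_left[OF m(1)]] clinear_compose[OF cbilinear_right[OF m(1)]]
  note mC = clinear_compose[OF cbilinear_left[OF m(2)]] clinear_compose[OF cbilinear_right[OF m(2)]]
  note mm = mA mC cbilinear_right[OF m(1)] cbilinear_right[OF m(2)]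
  note br = clinear_compose[OF clinear_braiding(1)[OF R d(2,1)]]
  note ss = clinear_compose[OF s(1)] clinear_compose[OF s(2)]
  define E where "E b c b' c' = tlift (\<lambda>x y. mul A b x \<otimes> mul C y c') (braiding R (coact C) (coact A) (c \<otimes> b'))" for b c b' c'
  have E: "clinear f \<Longrightarrow> clinear (\<lambda>x. E (f x) c b' c')" "clinear g \<Longrightarrow> clinear (\<lambda>x. E b (g x) b' c')"
    "clinear h \<Longrightarrow> clinear (\<lambda>x. E b c (h x) c')" "clinear k \<Longrightarrow> clinear (\<lambda>x. E b c b' (k x))"
    for f :: "'x::complex_vector \<Rightarrow> 'a" and g :: "'y::complex_vector \<Rightarrow> 'c" and h :: "'z::complex_vector \<Rightarrow> 'a"
      and k :: "'w::complex_vector \<Rightarrow> 'c" and b c b' c'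
    unfolding E_def by (intro clin mm br, assumption?)+
  note E0 = E(1)[OF clin_id] E(2)[OF clin_id] E(3)[OF clin_id] E(4)[OF clin_id]
  have E_scale: "E b (r *\<^sub>C c) b' c' = r *\<^sub>C E b c b' c'" "E b c (r *\<^sub>C b') c' = r *\<^sub>C E b c b' c'" for r b c b' c'
    using clinear_scale[OF E(2)[OF clin_id]] clinear_scale[OF E(3)[OF clin_id]] by auto
  define ev where "ev x = (1/2) *\<^sub>C (x + sA x)" for x
  define od where "od x = (1/2) *\<^sub>C (x - sA x)" for x
  have eo: "clinear f \<Longrightarrow> clinear (\<lambda>x. ev (f x))" "clinear f \<Longrightarrow> clinear (\<lambda>x. od (f x))" for f :: "'x::complex_vector \<Rightarrow> 'a"
    unfolding ev_def od_def by (intro clin ss, assumption+)+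
  \<comment> \<open>For odd k the sign is (-1)^j, which \<open>sC\<close> supplies; for even k there
    is none, and only the even part of b' is present.\<close>
  define F where "F b c b' c' = E b c (ev b') c' + E b (sC c) (od b') c'" for b c b' c'
  have F: "clinear f \<Longrightarrow> clinear (\<lambda>x. F (f x) c b' c')" "clinear g \<Longrightarrow> clinear (\<lambda>x. F b (g x) b' c')"
    "clinear h \<Longrightarrow> clinear (\<lambda>x. F b c (h x) c')" "clinear k \<Longrightarrow> clinear (\<lambda>x. F b c b' (k x))"
    for f :: "'x::complex_vector \<Rightarrow> 'a" and g :: "'y::complex_vector \<Rightarrow> 'c" and h :: "'z::complex_vector \<Rightarrow> 'a"
      and k :: "'w::complex_vector \<Rightarrow> 'c" and b c b' c'
    unfolding F_def by (intro clin E eo ss, assumption+)+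
  note F0 = F(1)[OF clin_id] F(2)[OF clin_id] F(3)[OF clin_id] F(4)[OF clin_id]
  have F_deg: "F b c b' c' = (-1) ^ (j * k) *\<^sub>C E b c b' c'" if "c \<in> deg C j" "b' \<in> deg A k" for b c b' c' j k
  proof -
    have "b' + b' = 2 *\<^sub>C b'" using scaleC_add_left[of 1 1 b'] by (simp add: scaleC_one)
    then have half: "(1/2) *\<^sub>C (b' + b') = b'" by (simp add: scaleC_scaleC scaleC_one)
    show ?thesis
    proof (cases "even k")
      case True
      then have "ev b' = b'" "od b' = 0" using s(3)[OF that(2)] half by (simp_all add: ev_def od_def scaleC_one)
      then show ?thesis using True by (simp add: F_def clinear_zero[OF E0(3)] scaleC_one)
    next
      case False
      then have sb: "sA b' = - b'" using s(3)[OF that(2)] by (simp add: scaleC_one)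
      have "ev b' = 0" "od b' = b'" unfolding ev_def od_def sb using half by simp_all
      then show ?thesis using False
        by (simp add: F_def clinear_zero[OF E0(3)] s(4)[OF that(1)] E_scale power_mult minus_one_power_iff)
    qed
  qed
  define M where "M z z' = tlift (\<lambda>b c. tlift (\<lambda>b' c'. F b c b' c') z') z" for z z'
  have M: "cbilinear M" unfolding M_def by (intro cbilinearI clin F0)
  have "M (b \<otimes> c) (b' \<otimes> c') = F b c b' c'" for b c b' c' unfolding M_def by (simp add: clin F0)
  with M F_deg have "\<exists>m. cbilinear m \<and> (\<forall>i j k l. \<forall>b\<in>deg A i. \<forall>c\<in>deg C j. \<forall>b'\<in>deg A k. \<forall>c'\<in>deg C l.
      m (b \<otimes> c) (b' \<otimes> c') = (-1) ^ (j * k) *\<^sub>C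
        tlift (\<lambda>x y. mul A b x \<otimes> mul C y c') (braiding R (coact C) (coact A) (c \<otimes> b')))"
    unfolding E_def by (intro exI[of _ M]) simp
  from someI_ex[OF this] show "cbilinear (super_mul R A C)"
    "\<And>i j k l b c b' c'. b \<in> deg A i \<Longrightarrow> c \<in> deg C j \<Longrightarrow> b' \<in> deg A k \<Longrightarrow> c' \<in> deg C l \<Longrightarrow>
      super_mul R A C (b \<otimes> c) (b' \<otimes> c') = (-1) ^ (j * k) *\<^sub>C
        tlift (\<lambda>x y. mul A b x \<otimes> mul C y c') (braiding R (coact C) (coact A) (c \<otimes> b'))"
    unfolding super_mul_def[symmetric] by blast+
qed

lemma tmap_zero_left: "clinear g \<Longrightarrow> tmap (\<lambda>x. 0) g t = 0"
proof -
  assume g: "clinear g"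
  have "\<forall>t. tmap (\<lambda>x. 0) g t = 0" by (rule tensor_ext) (intro clin g | simp add: tmap_tens clin g)+
  then show ?thesis ..
qed

definition tsgn :: "'v::complex_vector tensor_algebra \<Rightarrow> 'v tensor_algebra"
  where "tsgn = talift (\<lambda>xs. (-1) ^ length xs *\<^sub>C tword xs)"

lemma multilinear_tsgn: "multilinear (\<lambda>xs. (-1) ^ length xs *\<^sub>C tword xs)"
  by (rule multilinearI) (simp, intro clin)

lemma clinear_tsgn: "clinear tsgn"
  and tsgn_tword: "tsgn (tword xs) = (-1) ^ length xs *\<^sub>C tword xs"
  unfolding tsgn_def by (rule clinear_talift talift_tword, rule multilinear_tsgn)+

lemma tsgn_tdeg: "x \<in> tdeg n \<Longrightarrow> tsgn x = (-1) ^ n *\<^sub>C x"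
proof -
  have "\<forall>x\<in>tdeg n. tsgn x = (-1) ^ n *\<^sub>C x" by (rule tdeg_ext) (intro clin clinear_tsgn | simp add: tsgn_tword)+
  then show "x \<in> tdeg n \<Longrightarrow> tsgn x = (-1) ^ n *\<^sub>C x" by blast
qed

context braided_comodule
begin

text \<open>The condition for a quotient of \<open>T(V)\<close> to be a comodule algebra: a
  two-sided ideal whose coaction vanishes after the first leg is passed to the quotient.\<close>

definition biideal :: "'v tensor_algebra set \<Rightarrow> bool"
  where "biideal I \<longleftrightarrow> (\<forall>x\<in>cvec.span I. (\<forall>y. tmul x y \<in> cvec.span I \<and> tmul y x \<in> cvec.span I) \<and> tmap (qcls I) id (cT x) = 0)"

lemma quotient_mul:
  assumes "biideal I"
  shows cbilinear_quotient_mul: "cbilinear (mul (quotient_comodule_algebra I G \<delta>))"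
    and quotient_mul_qcls: "mul (quotient_comodule_algebra I G \<delta>) (qcls I x) (qcls I y) = qcls I (tmul x y)"
proof -
  have c: "cbilinear (\<lambda>x y. qcls I (tmul x y))" by (intro cbilinearI clin clinear_tmul_left clinear_tmul_right)
  show "cbilinear (mul (quotient_comodule_algebra I G \<delta>))"
    "mul (quotient_comodule_algebra I G \<delta>) (qcls I x) (qcls I y) = qcls I (tmul x y)"
    using cbilinear_qlift2[OF c] qlift2_qcls[OF c] assms by (auto simp: quotient_comodule_algebra_def biideal_def qcls_eq_0_iff)
qed

lemma quotient_coact:
  assumes "biideal I"
  shows clinear_quotient_coact: "clinear (coact (quotient_comodule_algebra I G \<delta>))"
    and quotient_coact_qcls: "coact (quotient_comodule_algebra I G \<delta>) (qcls I x) = tmap (qcls I) id (cT x)"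
    and quotient_colinear: "colinear_at cT (coact (quotient_comodule_algebra I G \<delta>)) (qcls I) x"
proof -
  have c: "clinear (\<lambda>x. tmap (qcls I) id (cT x))" by (intro clin clinear_qcls)
  show 1: "clinear (coact (quotient_comodule_algebra I G \<delta>))"
    "coact (quotient_comodule_algebra I G \<delta>) (qcls I x) = tmap (qcls I) id (cT x)" for x
    using clinear_qlift[OF c] qlift_qcls[OF c] assms by (auto simp: quotient_comodule_algebra_def biideal_def cT_def[symmetric])
  show "colinear_at cT (coact (quotient_comodule_algebra I G \<delta>)) (qcls I) x" by (simp add: colinear_at_def 1)
qed

lemma quotient_coassoc:
  assumes "biideal I"
  shows "coassoc_at (coact (quotient_comodule_algebra I G \<delta>)) (qcls I x)"
    and "counit_at (coact (quotient_comodule_algebra I G \<delta>)) (qcls I x)"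
  using coassoc_at_colinear[OF clinear_cT clinear_quotient_coact[OF assms] clinear_qcls quotient_colinear[OF assms] cT_coassoc]
    counit_at_colinear[OF clinear_cT clinear_quotient_coact[OF assms] clinear_qcls quotient_colinear[OF assms] cT_counit]
  by auto

lemma quotient_braiding:
  assumes "biideal I" "biideal J"
  shows "braiding R (coact (quotient_comodule_algebra I G \<delta>)) (coact (quotient_comodule_algebra J G' \<delta>)) (qcls I x \<otimes> qcls J y) =
    tmap (qcls J) (qcls I) (\<Psi>T (x \<otimes> y))"
  by (rule braiding_natural[OF R_linear clinear_cT clinear_cT clinear_quotient_coact[OF assms(1)] clinear_quotient_coact[OF assms(2)]
        clinear_qcls clinear_qcls quotient_colinear[OF assms(1)] quotient_colinear[OF assms(2)]])

lemma quotient_simps [simp]: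
  "deg (quotient_comodule_algebra I G \<delta>) n = qcls I ` G n"
  "unit (quotient_comodule_algebra I G \<delta>) = qcls I (tword [])"
  by (simp_all add: quotient_comodule_algebra_def)


subsection \<open>The exterior algebra\<close>

definition IL :: "'v tensor_algebra set" where "IL = exterior_relations (braiding R \<delta> \<delta>)"

definition qL :: "'v tensor_algebra \<Rightarrow> 'v tensor_algebra quotients" where "qL = qcls IL"

lemma clinear_qL: "clinear qL" by (simp add: qL_def clinear_qcls)

lemma clin_qL [clin]: "clinear f \<Longrightarrow> clinear (\<lambda>x. qL (f x))"
  by (rule clinear_compose[OF clinear_qL])

lemma IL_eq: "IL = cvec.span {tmul (tmul x (pair2 (z + braiding R \<delta> \<delta> z))) y | x y z. True}"
  by (simp add: IL_def exterior_relations_def pair2_def)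

lemma qL_b: "x \<in> tdeg n \<Longrightarrow> Suc i < n \<Longrightarrow> qL (x + app (b i) x) = 0"
proof -
  assume i: "Suc i < n"
  have "\<forall>x\<in>tdeg n. qL (x + app (b i) x) = 0"
  proof (rule tdeg_ext)
    fix xs :: "'v list" assume "length xs = n"
    then obtain p u v r where xs: "xs = p @ u # v # r" "length p = i" using split_at i by blast
    have "tword xs + app (b i) (tword xs) = tmul (tmul (tword p) (pair2 (u \<otimes> v + braiding R \<delta> \<delta> (u \<otimes> v)))) (tword r)"
      by (simp add: xs b_tword_split clinear_add[OF clinear_pair2] clinear_add[OF clinear_tmul_left]
          clinear_add[OF clinear_tmul_right] pair2_tens)
    also have "\<dots> \<in> cvec.span IL" unfolding IL_eq cvec.span_span by (rule cvec.span_base) blast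
    finally show "qL (tword xs + app (b i) (tword xs)) = 0" by (simp add: qL_def qcls_eq_0_iff)
  qed (intro clin clinear_app)+
  then show "x \<in> tdeg n \<Longrightarrow> qL (x + app (b i) x) = 0" by blast
qed

text \<open>The ideal generated by the image of id + \<Psi> is spanned by elements x + b i x with x
  homogeneous, so maps out of \<open>\<Lambda>(V)\<close> need be tested only on these.\<close>

lemma IL_kill:
  assumes f: "clinear f" and k: "\<And>n i x. x \<in> tdeg n \<Longrightarrow> Suc i < n \<Longrightarrow> f (x + app (b i) x) = 0" and x: "x \<in> cvec.span IL"
  shows "f x = 0"
proof (rule clinear_vanishes_on_span[OF f _ x[unfolded IL_eq cvec.span_span]])
  note f' = clinear_compose[OF f]
  have w: "f (tmul (tmul (tword p) (pair2 (u \<otimes> v + braiding R \<delta> \<delta> (u \<otimes> v)))) (tword r)) = 0" for p u v r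
  proof -
    have "tword (p @ u # v # r) + app (b (length p)) (tword (p @ u # v # r)) =
        tmul (tmul (tword p) (pair2 (u \<otimes> v + braiding R \<delta> \<delta> (u \<otimes> v)))) (tword r)"
      by (simp add: b_tword_split clinear_add[OF clinear_pair2] clinear_add[OF clinear_tmul_left]
          clinear_add[OF clinear_tmul_right] pair2_tens)
    with k[OF tword_tdeg[OF refl], of "length p" "p @ u # v # r"] show ?thesis by simp
  qed
  have "\<forall>z. f (tmul (tmul (tword p) (pair2 (z + braiding R \<delta> \<delta> z))) (tword r)) = 0" for p r
    by (rule tensor_ext) (intro f' clin | simp add: w)+
  then have "\<forall>x. f (tmul (tmul x (pair2 (z + braiding R \<delta> \<delta> z))) (tword r)) = 0" for z r
    by (intro tword_ext) (intro f' clin | simp)+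
  then have "\<forall>y. f (tmul (tmul x (pair2 (z + braiding R \<delta> \<delta> z))) y) = 0" for x z
    by (intro tword_ext) (intro f' clin | simp)+
  then show "y \<in> {tmul (tmul x (pair2 (z + braiding R \<delta> \<delta> z))) y |x y z. True} \<Longrightarrow> f y = 0" for y by blast
qed

lemma biideal_IL: "biideal IL"
  unfolding biideal_def
proof (intro ballI conjI allI)
  fix x y assume x: "x \<in> cvec.span IL"
  have l: "qL (tmul x (tword ys)) = 0" for ys
  proof (rule IL_kill[OF _ _ x, where f = "\<lambda>x. qL (tmul x (tword ys))"])
    fix n i and x :: "'v tensor_algebra" assume "x \<in> tdeg n" "Suc i < n"
    then show "qL (tmul (x + app (b i) x) (tword ys)) = 0"
      using qL_b[OF tmul_tdeg[OF \<open>x \<in> tdeg n\<close> tword_tdeg[of ys, OF refl]], of i]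
      by (simp add: b_tmul_left clinear_add[OF clinear_tmul_left])
  qed (intro clin)
  have r: "qL (tmul (tword ys) x) = 0" for ys
  proof (rule IL_kill[OF _ _ x, where f = "\<lambda>x. qL (tmul (tword ys) x)"])
    fix n i and x :: "'v tensor_algebra" assume "x \<in> tdeg n" "Suc i < n"
    then show "qL (tmul (tword ys) (x + app (b i) x)) = 0"
      using qL_b[OF tmul_tdeg[OF tword_tdeg[of ys, OF refl] \<open>x \<in> tdeg n\<close>], of "i + length ys"]
      by (simp add: b_tmul_right[OF tword_tdeg[OF refl]] clinear_add[OF clinear_tmul_right])
  qed (intro clin)
  have "\<forall>y. qL (tmul x y) = 0" by (rule tword_ext) (intro clin | simp add: l)+
  then show "tmul x y \<in> cvec.span IL" by (simp add: qL_def qcls_eq_0_iff)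
  have "\<forall>y. qL (tmul y x) = 0" by (rule tword_ext) (intro clin | simp add: r)+
  then show "tmul y x \<in> cvec.span IL" by (simp add: qL_def qcls_eq_0_iff)
next
  fix x assume x: "x \<in> cvec.span IL"
  have "tmap qL id (cT x) = 0"
  proof (rule IL_kill[OF _ _ x, where f = "\<lambda>x. tmap qL id (cT x)"])
    fix n i and x :: "'v tensor_algebra" assume x: "x \<in> tdeg n" and i: "Suc i < n"
    have e: "app (1 + b i) x = x + app (b i) x" for x by simp
    have "cT (x + app (b i) x) = tmap (app (1 + b i)) id (cT x)"
      unfolding e[symmetric] by (rule gen_colinear[of _ UNIV]) (intro gen.intros UNIV_I)
    then have "tmap qL id (cT (x + app (b i) x)) = tmap qL (\<lambda>h. h) (tmap (app (1 + b i)) (\<lambda>h. h) (tmap (tproj n) (\<lambda>h. h) (cT x)))"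
      using cT_deg[OF x] by (simp add: id_def)
    also have "\<dots> = tmap (\<lambda>x. qL (app (1 + b i) (tproj n x))) (\<lambda>h. h) (cT x)"
      by (simp add: tmap_tmap clinear_qL clinear_app clinear_tproj clin)
    also have "\<dots> = 0"
      using qL_b[OF tproj_in_tdeg i] by (simp add: tmap_zero_left clin)
    finally show "tmap qL id (cT (x + app (b i) x)) = 0" .
  qed (intro clin clinear_qL)
  then show "tmap (qcls IL) id (cT x) = 0" by (simp add: qL_def)
qed

text \<open>The exterior relations are homogeneous, so the projections to the degrees descend to
  \<open>\<Lambda>(V)\<close>; directness of the gradings rests on this.\<close>

lemma qL_tproj: "qL x = 0 \<Longrightarrow> qL (tproj p x) = 0"
proof -
  assume "qL x = 0"
  then have x: "x \<in> cvec.span IL" by (simp add: qL_def qcls_eq_0_iff)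
  show ?thesis
  proof (rule IL_kill[OF _ _ x, where f = "\<lambda>x. qL (tproj p x)"])
    fix n i and x :: "'v tensor_algebra" assume x: "x \<in> tdeg n" and i: "Suc i < n"
    have "x + app (b i) x \<in> tdeg n" by (rule cvec.subspace_add[OF subspace_tdeg x b_tdeg[OF x]])
    then show "qL (tproj p (x + app (b i) x)) = 0"
      using qL_b[OF x i] by (simp add: tproj_tdeg clinear_zero[OF clinear_qL])
  qed (intro clin)
qed

definition sgnL :: "'v tensor_algebra quotients \<Rightarrow> 'v tensor_algebra quotients"
  where "sgnL = qlift IL (\<lambda>x. qL (tsgn x))"

definition projL :: "nat \<Rightarrow> 'v tensor_algebra quotients \<Rightarrow> 'v tensor_algebra quotients"
  where "projL p = qlift IL (\<lambda>x. qL (tproj p x))"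

lemma projL: "clinear (projL p)" "projL p (qL x) = qL (tproj p x)"
proof -
  have c: "clinear (\<lambda>x. qL (tproj p x))" by (intro clin)
  show "clinear (projL p)" "projL p (qL x) = qL (tproj p x)"
    unfolding projL_def qL_def[THEN fun_cong]
    using clinear_qlift[OF c] qlift_qcls[OF c] qL_tproj by (auto simp: qL_def qcls_eq_0_iff)
qed

lemma sgnL: "clinear sgnL" "sgnL (qL x) = qL (tsgn x)"
proof -
  have c: "clinear (\<lambda>x. qL (tsgn x))" by (intro clin clinear_compose[OF clinear_qL clinear_tsgn])
  have "qL (tsgn x) = 0" if x: "x \<in> cvec.span IL" for x
  proof (rule IL_kill[OF c _ x])
    fix n i and x :: "'v tensor_algebra" assume x: "x \<in> tdeg n" and i: "Suc i < n"
    have "x + app (b i) x \<in> tdeg n" by (rule cvec.subspace_add[OF subspace_tdeg x b_tdeg[OF x]])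
    then show "qL (tsgn (x + app (b i) x)) = 0"
      using qL_b[OF x i] by (simp add: tsgn_tdeg clinear_scale[OF clinear_qL])
  qed
  then show "clinear sgnL" "sgnL (qL x) = qL (tsgn x)"
    unfolding sgnL_def using clinear_qlift[OF c, of IL] qlift_qcls[OF c, of IL] by (auto simp: qL_def)
qed

abbreviation "Ext \<equiv> exterior_algebra R \<delta>"

lemma Ext_eq: "Ext = quotient_comodule_algebra IL tdeg \<delta>"
  by (simp add: exterior_algebra_def IL_def)

lemma Ext_deg: "deg Ext n = qL ` tdeg n" and Ext_unit: "unit Ext = qL (tword [])"
  by (simp_all add: Ext_eq qL_def)

lemma Ext_mul: "cbilinear (mul Ext)" "mul Ext (qL x) (qL y) = qL (tmul x y)"
  unfolding Ext_eq qL_def by (rule quotient_mul[OF biideal_IL])+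

lemma Ext_coact: "clinear (coact Ext)" "colinear_at cT (coact Ext) qL x"
  "coassoc_at (coact Ext) (qL x)" "counit_at (coact Ext) (qL x)"
  unfolding Ext_eq qL_def by (rule quotient_coact[OF biideal_IL] quotient_coassoc[OF biideal_IL])+

lemma Ext_sgn: "\<omega> \<in> deg Ext n \<Longrightarrow> sgnL \<omega> = (-1) ^ n *\<^sub>C \<omega>"
  by (auto simp: Ext_deg sgnL tsgn_tdeg clinear_scale[OF clinear_qL])


subsection \<open>The Nichols algebra\<close>

definition IB :: "'v tensor_algebra set" where "IB = nichols_relations (braiding R \<delta> \<delta>)"

definition qB :: "'v tensor_algebra \<Rightarrow> 'v tensor_algebra quotients" where "qB = qcls IB"

lemma clinear_qB: "clinear qB" by (simp add: qB_def clinear_qcls)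

lemma clin_qB [clin]: "clinear f \<Longrightarrow> clinear (\<lambda>x. qB (f x))"
  by (rule clinear_compose[OF clinear_qB])

lemma IB_eq: "IB = cvec.span (\<Union>n. {x \<in> tdeg n. app (fac 0 n) x = 0})"
  by (simp add: IB_def nichols_relations_def braided_factorial_fac)

lemma qB_fac: "x \<in> tdeg n \<Longrightarrow> app (fac 0 n) x = 0 \<Longrightarrow> qB x = 0"
  unfolding qB_def qcls_eq_0_iff IB_eq cvec.span_span by (rule cvec.span_base) blast

lemma IB_kill:
  assumes f: "clinear f" and k: "\<And>n x. x \<in> tdeg n \<Longrightarrow> app (fac 0 n) x = 0 \<Longrightarrow> f x = 0" and x: "x \<in> cvec.span IB"
  shows "f x = 0"
  by (rule clinear_vanishes_on_span[OF f _ x[unfolded IB_eq cvec.span_span]]) (use k in blast)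

text \<open>With \<open>fac_right_factor\<close>, the reason that the kernels of the factorials form
  an ideal: the factorial of more strands has that of the first, or of the last, n strands as a
  right factor.\<close>

lemma fac_left_factor: "\<exists>e. fac k (n + m) = e * fac k n"
proof (induction m)
  case 0
  show ?case by (intro exI[of _ 1]) simp
next
  case (Suc m)
  then obtain e where "fac k (n + m) = e * fac k n" ..
  then have "fac k (n + Suc m) = ((\<Sum>j\<le>n + m. bw [k + (n + m) - j..<k + (n + m)]) * e) * fac k n"
    by (simp add: mult.assoc del: sum.atMost_Suc upt_Suc)
  then show ?case by blast
qed

lemma fac_right_factor: "\<exists>e. fac k (m + n) = e * fac (k + m) n"
proof (induction m arbitrary: k)
  case 0
  show ?case by (intro exI[of _ 1]) simp
next
  case (Suc m)
  obtain e where "fac (Suc k) (m + n) = e * fac (Suc k + m) n" using Suc by blast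
  then have "fac k (Suc m + n) = (ins k (Suc (m + n)) * e) * fac (k + Suc m) n"
    unfolding add_Suc fac_Suc_left by (simp add: mult.assoc)
  then show ?case by blast
qed

lemma fac_tmul_left: "x \<in> tdeg n \<Longrightarrow> app (fac 0 n) (tmul x y) = tmul (app (fac 0 n) x) y"
  by (rule gen_tmul_left[OF gen_fac]) auto

text \<open>Degree n of \<open>B\<close> is the image of the factorial, and \<open>unfac n\<close>
  reads the class of an element off the value of its factorial. Being linear, it can be applied in
  tensor factors, which reduces vanishing there to vanishing of factorials.\<close>

definition unfac :: "nat \<Rightarrow> 'v tensor_algebra \<Rightarrow> 'v tensor_algebra quotients"
  where "unfac n = (SOME J. clinear J \<and> (\<forall>x. J (app (fac 0 n) (tproj n x)) = qB (tproj n x)))"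

lemma unfac: "clinear (unfac n)" "x \<in> tdeg n \<Longrightarrow> unfac n (app (fac 0 n) x) = qB x"
proof -
  have "\<exists>J. clinear J \<and> (\<forall>x. J (app (fac 0 n) (tproj n x)) = qB (tproj n x))"
    by (rule clinear_factor) (intro clin | rule qB_fac[OF tproj_in_tdeg], assumption)+
  from someI_ex[OF this] show "clinear (unfac n)" "x \<in> tdeg n \<Longrightarrow> unfac n (app (fac 0 n) x) = qB x"
    unfolding unfac_def[symmetric] by (auto dest: spec[of _ x] simp: tproj_tdeg)
qed

lemma biideal_IB: "biideal IB"
  unfolding biideal_def
proof (intro ballI conjI allI)
  fix x y assume x: "x \<in> cvec.span IB"
  have l: "qB (tmul x (tword ys)) = 0" for ys
  proof (rule IB_kill[OF _ _ x, where f = "\<lambda>x. qB (tmul x (tword ys))"])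
    fix n and x :: "'v tensor_algebra" assume x: "x \<in> tdeg n" and f: "app (fac 0 n) x = 0"
    obtain e where e: "fac 0 (n + length ys) = e * fac 0 n" using fac_left_factor by blast
    show "qB (tmul x (tword ys)) = 0"
      by (rule qB_fac[OF tmul_tdeg[OF x tword_tdeg[OF refl]]])
        (simp add: e fac_tmul_left[OF x] f clinear_zero[OF clinear_tmul_left] clinear_zero[OF clinear_app])
  qed (intro clin)
  have r: "qB (tmul (tword ys) x) = 0" for ys
  proof (rule IB_kill[OF _ _ x, where f = "\<lambda>x. qB (tmul (tword ys) x)"])
    fix n and x :: "'v tensor_algebra" assume x: "x \<in> tdeg n" and f: "app (fac 0 n) x = 0"
    obtain e where e: "fac 0 (length ys + n) = e * fac (0 + length ys) n" using fac_right_factor by blast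
    show "qB (tmul (tword ys) x) = 0"
      by (rule qB_fac[OF tmul_tdeg[OF tword_tdeg[OF refl] x]])
        (simp add: e fac_shift[OF tword_tdeg[OF refl], of 0, simplified] f clinear_zero[OF clinear_tmul_right] clinear_zero[OF clinear_app])
  qed (intro clin)
  have "\<forall>y. qB (tmul x y) = 0" by (rule tword_ext) (intro clin | simp add: l)+
  then show "tmul x y \<in> cvec.span IB" by (simp add: qB_def qcls_eq_0_iff)
  have "\<forall>y. qB (tmul y x) = 0" by (rule tword_ext) (intro clin | simp add: r)+
  then show "tmul y x \<in> cvec.span IB" by (simp add: qB_def qcls_eq_0_iff)
next
  fix x assume x: "x \<in> cvec.span IB"
  have "tmap qB id (cT x) = 0"
  proof (rule IB_kill[OF _ _ x, where f = "\<lambda>x. tmap qB id (cT x)"])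
    fix n and x :: "'v tensor_algebra" assume x: "x \<in> tdeg n" and f: "app (fac 0 n) x = 0"
    \<comment> \<open>The factorial is colinear, so it kills the first leg of the coaction of its
      kernel; hence so does \<open>qB\<close>, which factors through it.\<close>
    have q: "qB (tproj n y) = unfac n (app (fac 0 n) (tproj n y))" for y by (simp add: unfac tproj_in_tdeg)
    have "tmap qB id (cT x) = tmap qB (\<lambda>h. h) (tmap (tproj n) (\<lambda>h. h) (cT x))"
      using cT_deg[OF x] by (simp add: id_def)
    also have "\<dots> = tmap (unfac n) (\<lambda>h. h) (tmap (app (fac 0 n)) (\<lambda>h. h) (tmap (tproj n) (\<lambda>h. h) (cT x)))"
      by (simp add: tmap_tmap clinear_qB clinear_app clinear_tproj unfac(1) clin q)
    also have "tmap (app (fac 0 n)) (\<lambda>h. h) (tmap (tproj n) (\<lambda>h. h) (cT x)) = 0"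
      using gen_colinear[OF gen_fac, of 0 n x] cT_deg[OF x] by (simp add: id_def f clinear_zero[OF clinear_cT])
    finally show "tmap qB id (cT x) = 0" by (simp add: clinear_zero[OF clinear_tmap] unfac(1) clin id_def)
  qed (intro clin clinear_qB)
  then show "tmap (qcls IB) id (cT x) = 0" by (simp add: qB_def)
qed

abbreviation "Nic \<equiv> nichols_algebra R \<delta>"

lemma Nic_eq: "Nic = quotient_comodule_algebra IB (\<lambda>n. if n = 0 then UNIV else {0}) \<delta>"
  by (simp add: nichols_algebra_def IB_def)

lemma Nic_deg: "deg Nic n = (if n = 0 then range qB else {0})" and Nic_unit: "unit Nic = qB (tword [])"
  by (auto simp: Nic_eq qB_def clinear_zero[OF clinear_qcls])

lemma Nic_mul: "cbilinear (mul Nic)" "mul Nic (qB x) (qB y) = qB (tmul x y)"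
  unfolding Nic_eq qB_def by (rule quotient_mul[OF biideal_IB])+

lemma Nic_coact: "clinear (coact Nic)" "colinear_at cT (coact Nic) qB x"
  "coassoc_at (coact Nic) (qB x)" "counit_at (coact Nic) (qB x)"
  unfolding Nic_eq qB_def by (rule quotient_coact[OF biideal_IB] quotient_coassoc[OF biideal_IB])+

text \<open>All of \<open>B\<close> has degree 0 and the other components are zero, so the identity
  serves as its parity operator.\<close>

lemma Nic_sgn: "x \<in> deg Nic n \<Longrightarrow> x = (-1) ^ n *\<^sub>C x"
  by (auto simp: Nic_deg scaleC_one split: if_splits)

lemma Nic_total: "total_space Nic = range qB"
proof -
  have "(\<Union>n. deg Nic n) = range qB" using clinear_zero[OF clinear_qB] by (auto simp: Nic_deg)
  then show ?thesis using clinear_image_span[OF clinear_qB, of UNIV] by (simp add: total_space_def)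
qed

end

lemma super_tensor_simps [simp]:
  "mul (super_tensor R A C) = super_mul R A C"
  "unit (super_tensor R A C) = unit A \<otimes> unit C"
  "coact (super_tensor R A C) = tensor_coaction (coact A) (coact C)"
  "deg (super_tensor R A C) n = cvec.span (\<Union>i\<le>n. {b \<otimes> c | b c. b \<in> deg A i \<and> c \<in> deg C (n - i)})"
  by (simp_all add: super_tensor_def)

lemma cut_deg: "x \<in> tdeg n \<Longrightarrow> k \<le> n \<Longrightarrow> cut k x = tmap (tproj k) (\<lambda>x. x) (cut k x)"
proof -
  assume k: "k \<le> n"
  have "\<forall>x\<in>tdeg n. cut k x = tmap (tproj k) (\<lambda>x. x) (cut k x)"
    by (rule tdeg_ext) (intro clin clinear_tproj | simp add: cut_tword tmap_tens clin clinear_tproj tproj_tword k)+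
  then show "x \<in> tdeg n \<Longrightarrow> ?thesis" by blast
qed

lemma tword_split3: "length xs = l + m + n \<Longrightarrow>
    \<exists>us vs ws. xs = us @ vs @ ws \<and> length us = l \<and> length vs = m \<and> length ws = n"
  by (rule exI[of _ "take l xs"], rule exI[of _ "take m (drop l xs)"], rule exI[of _ "drop m (drop l xs)"])
    (simp del: drop_drop)

context braided_comodule
begin

abbreviation "LB \<equiv> super_tensor R Ext Nic"

abbreviation "Om \<equiv> Omega R \<delta>"

lemma Om_eq: "Om = super_tensor R LB Ext"
  by (simp add: Omega_def)

definition sgnLB where "sgnLB = tmap sgnL (\<lambda>x :: 'v tensor_algebra quotients. x)"

lemma clinear_sgnLB: "clinear sgnLB"
  unfolding sgnLB_def by (intro clinear_tmap sgnL(1) clin)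

lemma LB_deg: "deg LB n = cvec.span {qL u \<otimes> qB v | u v. u \<in> tdeg n}"
proof -
  \<comment> \<open>Where \<open>B\<close> is taken in positive degree, the tensors have second
    factor 0; adding 0 to both sides absorbs them.\<close>
  have "(\<Union>i\<le>n. {b \<otimes> c | b c. b \<in> deg Ext i \<and> c \<in> deg Nic (n - i)}) \<union> {0} = {qL u \<otimes> qB v | u v. u \<in> tdeg n} \<union> {0}"
    (is "?A \<union> {0} = ?B \<union> {0}")
  proof (rule equalityI)
    show "?A \<union> {0} \<subseteq> ?B \<union> {0}"
      by (auto simp: Ext_deg Nic_deg split: if_splits) blast
    show "?B \<union> {0} \<subseteq> ?A \<union> {0}"
    proof (rule Un_mono[OF subsetI subset_refl])
      fix x assume "x \<in> ?B"
      then obtain u v where "x = qL u \<otimes> qB v" "u \<in> tdeg n" by blast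
      then have "x \<in> {b \<otimes> c |b c. b \<in> deg Ext n \<and> c \<in> deg Nic (n - n)}"
        unfolding Ext_deg Nic_deg by auto
      then show "x \<in> ?A" by (intro UN_I[of n]) auto
    qed
  qed
  then have "cvec.span (?A \<union> {0}) = cvec.span (?B \<union> {0})" by simp
  then show ?thesis by (simp add: cvec.span_insert_0)
qed

lemma LB_sgn: "x \<in> deg LB n \<Longrightarrow> sgnLB x = (-1) ^ n *\<^sub>C x"
  unfolding LB_deg
  by (rule clinear_eq_on_span[OF clinear_sgnLB clin_scale[OF clin_id]])
    (auto simp: sgnLB_def tmap_tens sgnL clin tsgn_tdeg clinear_scale[OF clinear_qL] tens_scale)

lemma LB_mul: "cbilinear (mul LB)"
  "u \<in> tdeg i \<Longrightarrow> u' \<in> tdeg k \<Longrightarrow> mul LB (qL u \<otimes> qB v) (qL u' \<otimes> qB v') =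
    tlift (\<lambda>x y. qL (tmul u x) \<otimes> qB (tmul y v')) (\<Psi>T (v \<otimes> u'))"
proof -
  note sm = super_mul[OF R_linear Ext_mul(1) Nic_mul(1) Ext_coact(1) Nic_coact(1) sgnL(1) clin_id Ext_sgn Nic_sgn]
  show "cbilinear (mul LB)" using sm(1) by simp
  assume u: "u \<in> tdeg i" "u' \<in> tdeg k"
  have br: "braiding R (coact Nic) (coact Ext) (qB v \<otimes> qL u') = tmap qL qB (\<Psi>T (v \<otimes> u'))"
    unfolding Nic_eq Ext_eq qB_def qL_def by (rule quotient_braiding[OF biideal_IB biideal_IL])
  have "mul LB (qL u \<otimes> qB v) (qL u' \<otimes> qB v') =
      tlift (\<lambda>x y. mul Ext (qL u) x \<otimes> mul Nic y (qB v')) (tmap qL qB (\<Psi>T (v \<otimes> u')))"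
    using sm(2)[of "qL u" i "qB v" 0 "qL u'" k "qB v'" 0] u by (simp add: Ext_deg Nic_deg br scaleC_one)
  also have "\<dots> = tlift (\<lambda>x y. mul Ext (qL u) (qL x) \<otimes> mul Nic (qB y) (qB v')) (\<Psi>T (v \<otimes> u'))"
    by (rule tlift_tmap[OF clinear_qL clinear_qB])
      (intro clin clinear_compose[OF cbilinear_left[OF Nic_mul(1)]] cbilinear_right[OF Ext_mul(1)])+
  finally show "mul LB (qL u \<otimes> qB v) (qL u' \<otimes> qB v') =
      tlift (\<lambda>x y. qL (tmul u x) \<otimes> qB (tmul y v')) (\<Psi>T (v \<otimes> u'))"
    by (simp add: Ext_mul Nic_mul)
qed

lemma LB_coact: "clinear (coact LB)" "colinear_at (tensor_coaction cT cT) (coact LB) (tmap qL qB) z"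
proof -
  show c: "clinear (coact LB)" by (simp add: clinear_tensor_coaction Ext_coact Nic_coact)
  note D = clinear_tensor_coaction(1)[OF clinear_cT clinear_cT]
  note D' = clinear_compose[OF D]
  have "\<forall>z. coact LB (tmap qL qB z) = tmap (tmap qL qB) id (tensor_coaction cT cT z)"
  proof (rule tensor_ext)
    show "coact LB (tmap qL qB (x \<otimes> y)) = tmap (tmap qL qB) id (tensor_coaction cT cT (x \<otimes> y))" for x y
      using tensor_coaction_natural[OF clinear_cT clinear_cT Ext_coact(1) Nic_coact(1) clinear_qL clinear_qB
          Ext_coact(2) Nic_coact(2)] by (simp add: colinear_at_def)
  qed (intro clin clinear_compose[OF c] clinear_qL clinear_qB clinear_tmap D)+
  then show "colinear_at (tensor_coaction cT cT) (coact LB) (tmap qL qB) z" by (simp add: colinear_at_def)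
qed

text \<open>\<open>W l m z\<close> is the form represented by a tensor \<open>z\<close> of degree \<open>l + m + n\<close>: its first \<open>l\<close> factors are
  read in \<open>\<Lambda>(V)\<close>, the next \<open>m\<close> in \<open>B\<^sub>+(V)\<close>, and the last \<open>n\<close> in \<open>\<Lambda>(V)\<close>.\<close>

definition W2 :: "nat \<Rightarrow> 'v tensor_algebra \<Rightarrow> 'v tensor_algebra quotients \<otimes> 'v tensor_algebra quotients"
  where "W2 l z = tmap qL qB (cut l z)"

definition W :: "nat \<Rightarrow> nat \<Rightarrow> 'v tensor_algebra \<Rightarrow> 'v forms"
  where "W l m z = tmap (W2 l) qL (cut (l + m) z)"

lemma clin_W2 [clin]: "clinear f \<Longrightarrow> clinear (\<lambda>x. W2 l (f x))"
  unfolding W2_def by (intro clin clinear_qL clinear_qB)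

lemma clinear_W2: "clinear (W2 l)"
  using clin_W2[OF clin_id] .

lemma clin_W [clin]: "clinear f \<Longrightarrow> clinear (\<lambda>x. W l m (f x))"
  unfolding W_def by (intro clin clinear_qL clinear_W2)

lemma clinear_W: "clinear (W l m)"
  using clin_W[OF clin_id] .

lemma W2_tmul: "u \<in> tdeg l \<Longrightarrow> W2 l (tmul u v) = qL u \<otimes> qB v"
  by (simp add: W2_def cut_tmul tmap_tens clinear_qL clinear_qB)

lemma W_tmul: "z \<in> tdeg (l + m) \<Longrightarrow> W l m (tmul z w) = W2 l z \<otimes> qL w"
  by (simp add: W_def cut_tmul tmap_tens clinear_qL clinear_W2)

lemma W_tmul3: "u \<in> tdeg l \<Longrightarrow> v \<in> tdeg m \<Longrightarrow> W l m (tmul u (tmul v w)) = (qL u \<otimes> qB v) \<otimes> qL w"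
  using W_tmul[OF tmul_tdeg, of u l v m w] W2_tmul[of u l v] by (simp add: tmul_assoc)

lemma W_tword: "length us = l \<Longrightarrow> length vs = m \<Longrightarrow> W l m (tword (us @ vs @ ws)) = (qL (tword us) \<otimes> qB (tword vs)) \<otimes> qL (tword ws)"
  using W_tmul3[OF tword_tdeg tword_tdeg, of us l vs m "tword ws"] by simp

lemma Om_mul: "cbilinear (mul Om)"
  "u \<in> deg LB i \<Longrightarrow> c \<in> deg Ext j \<Longrightarrow> u' \<in> deg LB k \<Longrightarrow> c' \<in> deg Ext l \<Longrightarrow>
    mul Om (u \<otimes> c) (u' \<otimes> c') = (-1) ^ (j * k) *\<^sub>C
        tlift (\<lambda>x y. mul LB u x \<otimes> mul Ext y c') (braiding R (coact Ext) (coact LB) (c \<otimes> u'))"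
proof -
  note sm = super_mul[OF R_linear LB_mul(1) Ext_mul(1) LB_coact(1) Ext_coact(1) clinear_sgnLB sgnL(1) LB_sgn Ext_sgn]
  show "cbilinear (mul Om)" using sm(1) by (simp add: Om_eq)
  show "u \<in> deg LB i \<Longrightarrow> c \<in> deg Ext j \<Longrightarrow> u' \<in> deg LB k \<Longrightarrow> c' \<in> deg Ext l \<Longrightarrow>
    mul Om (u \<otimes> c) (u' \<otimes> c') = (-1) ^ (j * k) *\<^sub>C
        tlift (\<lambda>x y. mul LB u x \<otimes> mul Ext y c') (braiding R (coact Ext) (coact LB) (c \<otimes> u'))"
    unfolding Om_eq super_tensor_simps(1)[of R LB Ext] by (rule sm(2))
qed

text \<open>Crossing a product and crossing its two factors in turn agree by the hexagon identity;
  here the factors are the two parts of a single tensor.\<close>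

lemma braiding_cut:
  assumes w: "w \<in> tdeg n" and z: "z \<in> tdeg (l + m)"
  shows "braiding R cT (tensor_coaction cT cT) (w \<otimes> cut l z) = tmap (cut l) (\<lambda>x. x) (\<Psi>T (w \<otimes> z))"
proof -
  note D = clinear_tensor_coaction(1)[OF clinear_cT clinear_cT]
  note B = clinear_braiding(1)[OF R_linear clinear_cT D]
  note B' = clinear_compose[OF B]
  have "\<forall>z\<in>tdeg (l + m). braiding R cT (tensor_coaction cT cT) (w \<otimes> cut l z) = tmap (cut l) (\<lambda>x. x) (\<Psi>T (w \<otimes> z))"
  proof (rule tdeg_ext)
    fix zs :: "'v list" assume len: "length zs = l + m"
    define a where "a = tword (take l zs)"
    define c where "c = tword (drop l zs)"
    have a: "a \<in> tdeg l" and z: "tword zs = tmul a c" using len by (auto simp: a_def c_def intro: tword_tdeg)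
    \<comment> \<open>\<open>cut_tmul\<close> asks for a first factor of degree l. The braiding
      keeps \<open>a\<close> in that degree, so \<open>tproj l\<close> may be inserted and removed
      again.\<close>
    have deg: "\<Psi>T (w \<otimes> a) = tmap (tproj l) (\<lambda>x. x) (\<Psi>T (w \<otimes> a))"
      unfolding PsiT_cr[OF w a]
      by (rule cut_deg[OF gen_tdeg[OF gen_cr tmul_tdeg[OF w a]]]) simp
    let ?F = "\<lambda>x' z'. tlift (\<lambda>y' z''. cut l (tmul x' y') \<otimes> z'') (\<Psi>T (z' \<otimes> c))"
    let ?G = "\<lambda>x' z'. tlift (\<lambda>y' z''. (x' \<otimes> y') \<otimes> z'') (\<Psi>T (z' \<otimes> c))"
    have "tmap (cut l) (\<lambda>x. x) (\<Psi>T (w \<otimes> tmul a c)) = tlift ?F (\<Psi>T (w \<otimes> a))"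
      unfolding PsiT_right
      by (subst clinear_tlift_commute[OF clinear_tmap[OF clinear_cut clin_id]], (intro clin)+, rule tlift_cong,
          subst clinear_tlift_commute[OF clinear_tmap[OF clinear_cut clin_id]], (intro clin)+)
        (simp add: tmap_tens clinear_cut clin)
    also have "\<dots> = tlift ?F (tmap (tproj l) (\<lambda>x. x) (\<Psi>T (w \<otimes> a)))" using deg by simp
    also have "\<dots> = tlift (\<lambda>x'. ?F (tproj l x')) (\<Psi>T (w \<otimes> a))"
      by (rule tlift_tmap) (intro clin clinear_tproj)+
    also have "\<dots> = tlift (\<lambda>x'. ?G (tproj l x')) (\<Psi>T (w \<otimes> a))"
      by (simp add: cut_tmul[OF tproj_in_tdeg])
    also have "\<dots> = tlift ?G (tmap (tproj l) (\<lambda>x. x) (\<Psi>T (w \<otimes> a)))"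
      by (rule tlift_tmap[symmetric]) (intro clin clinear_tproj)+
    also have "\<dots> = tlift ?G (\<Psi>T (w \<otimes> a))" using deg by simp
    also have "\<dots> = braiding R cT (tensor_coaction cT cT) (w \<otimes> a \<otimes> c)"
      by (rule hexagon_right[OF clinear_cT clinear_cT clinear_cT cT_coassoc, symmetric])
    finally show "braiding R cT (tensor_coaction cT cT) (w \<otimes> cut l (tword zs)) = tmap (cut l) (\<lambda>x. x) (\<Psi>T (w \<otimes> tword zs))"
      by (simp add: z cut_tmul[OF a])
  qed (intro clin clinear_cut B')+
  with z show ?thesis by blast
qed

lemma braiding_W2:
  assumes w: "w \<in> tdeg n" and z: "z \<in> tdeg (l + m)"
  shows "braiding R (coact Ext) (coact LB) (qL w \<otimes> W2 l z) = W l m (app (cr 0 n (l + m)) (tmul w z))"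
proof -
  note D = clinear_tensor_coaction(1)[OF clinear_cT clinear_cT]
  have "braiding R (coact Ext) (coact LB) (qL w \<otimes> tmap qL qB (cut l z)) =
      tmap (tmap qL qB) qL (braiding R cT (tensor_coaction cT cT) (w \<otimes> cut l z))"
    by (rule braiding_natural[OF R_linear clinear_cT D Ext_coact(1) LB_coact(1) clinear_qL
          clinear_tmap[OF clinear_qL clinear_qB] Ext_coact(2) LB_coact(2)])
  also have "\<dots> = tmap (W2 l) qL (\<Psi>T (w \<otimes> z))"
    unfolding braiding_cut[OF w z] W2_def[abs_def]
    by (rule tmap_tmap) (intro clinear_tmap clinear_qL clinear_qB clinear_cut clin)+
  finally show ?thesis by (simp add: W_def PsiT_cr[OF w z] W2_def)
qed

lemma LB_mul_W2:
  assumes "z \<in> tdeg (l + m)" "z' \<in> tdeg (l' + m')"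
  shows "mul LB (W2 l z) (W2 l' z') = W2 (l + l') (app (cr l m l') (tmul z z'))"
proof -
  note m = cbilinear_left[OF LB_mul(1)] cbilinear_right[OF LB_mul(1)]
  note m' = clinear_compose[OF m(1)] clinear_compose[OF m(2)]
  have "\<forall>z\<in>tdeg (l + m). \<forall>z'\<in>tdeg (l' + m'). mul LB (W2 l z) (W2 l' z') = W2 (l + l') (app (cr l m l') (tmul z z'))"
  proof (rule tdeg_ext2)
    fix xs ys :: "'v list" assume len: "length xs = l + m" "length ys = l' + m'"
    define u where "u = tword (take l xs)"
    define v where "v = tword (drop l xs)"
    define u' where "u' = tword (take l' ys)"
    define v' where "v' = tword (drop l' ys)"
    have d: "u \<in> tdeg l" "v \<in> tdeg m" "u' \<in> tdeg l'" and z: "tword xs = tmul u v" "tword ys = tmul u' v'"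
      using len by (auto simp: u_def v_def u'_def v'_def intro: tword_tdeg)
    have *: "\<forall>s\<in>tdeg (l' + m). tlift (\<lambda>x y. qL (tmul u x) \<otimes> qB (tmul y v')) (cut l' s) = W2 (l + l') (tmul u (tmul s v'))"
    proof (rule tdeg_ext)
      fix ss :: "'v list" assume "length ss = l' + m"
      then have "tword (take l' ss) \<in> tdeg l'" by (intro tword_tdeg) simp
      then have "W2 (l + l') (tmul (tmul u (tword (take l' ss))) (tmul (tword (drop l' ss)) v')) =
          qL (tmul u (tword (take l' ss))) \<otimes> qB (tmul (tword (drop l' ss)) v')"
        by (intro W2_tmul tmul_tdeg d)
      moreover have "tmul (tmul u (tword (take l' ss))) (tmul (tword (drop l' ss)) v') = tmul u (tmul (tword ss) v')"
      proof -
        have "tmul (tword ss) v' = tmul (tword (take l' ss)) (tmul (tword (drop l' ss)) v')"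
          by (simp add: tmul_assoc[symmetric])
        then show ?thesis by (simp add: tmul_assoc)
      qed
      ultimately show "tlift (\<lambda>x y. qL (tmul u x) \<otimes> qB (tmul y v')) (cut l' (tword ss)) = W2 (l + l') (tmul u (tmul (tword ss) v'))"
        by (simp add: cut_tword clin)
    qed (intro clin)+
    have vu: "tmul v u' \<in> tdeg (m + l')" using d by (intro tmul_tdeg)
    have "mul LB (W2 l (tword xs)) (W2 l' (tword ys)) = tlift (\<lambda>x y. qL (tmul u x) \<otimes> qB (tmul y v')) (\<Psi>T (v \<otimes> u'))"
      unfolding z W2_tmul[OF d(1)] W2_tmul[OF d(3)] by (rule LB_mul(2)[OF d(1,3)])
    also have "\<dots> = W2 (l + l') (tmul u (tmul (app (cr 0 m l') (tmul v u')) v'))"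
      unfolding PsiT_cr[OF d(2,3)]
      by (rule bspec[OF *]) (use gen_tdeg[OF gen_cr vu] in \<open>simp add: add.commute\<close>)
    also have "tmul (app (cr 0 m l') (tmul v u')) v' = app (cr 0 m l') (tmul (tmul v u') v')"
      by (rule gen_tmul_left[OF gen_cr vu, symmetric]) auto
    also have "tmul u \<dots> = app (cr l m l') (tmul u (tmul (tmul v u') v'))"
      using cr_shift[OF d(1), of 0 m l'] by simp
    finally show "mul LB (W2 l (tword xs)) (W2 l' (tword ys)) = W2 (l + l') (app (cr l m l') (tmul (tword xs) (tword ys)))"
      by (simp add: z tmul_assoc)
  qed (intro clin m' clinear_app)+
  with assms show ?thesis by blast
qed

lemma W2_deg: "z \<in> tdeg (l + m) \<Longrightarrow> W2 l z \<in> deg LB l"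
proof -
  assume z: "z \<in> tdeg (l + m)"
  show ?thesis unfolding LB_deg
  proof (rule clinear_span_into[OF clinear_W2 _ z[unfolded tdeg_def]])
    fix x :: "'v tensor_algebra" assume "x \<in> {tword xs |xs. length xs = l + m}"
    then obtain xs where x: "x = tmul (tword (take l xs)) (tword (drop l xs))" "length xs = l + m" by auto
    then have d: "tword (take l xs) \<in> tdeg l" by (intro tword_tdeg) simp
    show "W2 l x \<in> cvec.span {qL u \<otimes> qB v |u v. u \<in> tdeg l}"
      unfolding x W2_tmul[OF d] by (rule cvec.span_base) (use d in blast)
  qed
qed

text \<open>The right block n of the first factor crosses the left and middle blocks of the second,
  and then the middle block m crosses l'. As \<open>B\<close> has degree 0, the only odd blocks that
  cross are n and l', whence the sign.\<close>

theorem W_mul: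
  assumes "z \<in> tdeg (l + m + n)" "z' \<in> tdeg (l' + m' + n')"
  shows "mul Om (W l m z) (W l' m' z') = (-1) ^ (n * l') *\<^sub>C
    W (l + l') (m + m') (app (cr l m l' * cr (l + m) n (l' + m')) (tmul z z'))"
proof -
  note m = cbilinear_left[OF Om_mul(1)] cbilinear_right[OF Om_mul(1)]
  note m' = clinear_compose[OF m(1)] clinear_compose[OF m(2)]
  note mL = clinear_compose[OF cbilinear_right[OF LB_mul(1)]] clinear_compose[OF cbilinear_left[OF Ext_mul(1)]]
    cbilinear_right[OF LB_mul(1)]
  have "\<forall>z\<in>tdeg (l + m + n). \<forall>z'\<in>tdeg (l' + m' + n'). mul Om (W l m z) (W l' m' z') = (-1) ^ (n * l') *\<^sub>C
    W (l + l') (m + m') (app (cr l m l') (app (cr (l + m) n (l' + m')) (tmul z z')))"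
  proof (rule tdeg_ext2)
    fix xs ys :: "'v list" assume len: "length xs = l + m + n" "length ys = l' + m' + n'"
    define z1 where "z1 = tword (take (l + m) xs)"
    define w where "w = tword (drop (l + m) xs)"
    define z1' where "z1' = tword (take (l' + m') ys)"
    define w' where "w' = tword (drop (l' + m') ys)"
    have d: "z1 \<in> tdeg (l + m)" "w \<in> tdeg n" "z1' \<in> tdeg (l' + m')" "w' \<in> tdeg n'"
      and z: "tword xs = tmul z1 w" "tword ys = tmul z1' w'"
      using len by (auto simp: z1_def w_def z1'_def w'_def intro!: tword_tdeg)
    have wd: "qL w \<in> deg Ext n" "qL w' \<in> deg Ext n'" using d by (auto simp: Ext_deg)
    let ?t = "app (cr 0 n (l' + m')) (tmul w z1')"
    have td: "?t \<in> tdeg (l' + m' + n)"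
      using gen_tdeg[OF gen_cr tmul_tdeg[OF d(2,3)], of 0 n "l' + m'"] by (simp add: add_ac)
    have *: "\<forall>t\<in>tdeg (l' + m' + n). tlift (\<lambda>x y. mul LB (W2 l z1) x \<otimes> mul Ext y (qL w')) (W l' m' t) =
        W (l + l') (m + m') (app (cr l m l') (tmul z1 (tmul t w')))"
    proof (rule tdeg_ext)
      fix ts :: "'v list" assume lt: "length ts = l' + m' + n"
      define a where "a = tword (take (l' + m') ts)"
      define c where "c = tword (drop (l' + m') ts)"
      have ac: "a \<in> tdeg (l' + m')" "tword ts = tmul a c" using lt by (auto simp: a_def c_def intro!: tword_tdeg)
      have za: "tmul z1 a \<in> tdeg (l + l' + (m + m'))" using tmul_tdeg[OF d(1) ac(1)] by (simp add: add_ac)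
      have "tlift (\<lambda>x y. mul LB (W2 l z1) x \<otimes> mul Ext y (qL w')) (W l' m' (tword ts)) =
          W2 (l + l') (app (cr l m l') (tmul z1 a)) \<otimes> qL (tmul c w')"
        unfolding ac(2) W_tmul[OF ac(1)]
        by (simp add: clin mL LB_mul_W2[OF d(1) ac(1)] Ext_mul(2) del: super_tensor_simps)
      also have "\<dots> = W (l + l') (m + m') (tmul (app (cr l m l') (tmul z1 a)) (tmul c w'))"
        by (rule W_tmul[symmetric]) (rule gen_tdeg[OF gen_cr za])
      also have "tmul (app (cr l m l') (tmul z1 a)) (tmul c w') = app (cr l m l') (tmul (tmul z1 a) (tmul c w'))"
        by (rule gen_tmul_left[OF gen_cr za, symmetric]) auto
      finally show "tlift (\<lambda>x y. mul LB (W2 l z1) x \<otimes> mul Ext y (qL w')) (W l' m' (tword ts)) =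
        W (l + l') (m + m') (app (cr l m l') (tmul z1 (tmul (tword ts) w')))"
        by (simp add: ac(2) tmul_assoc)
    qed (intro clin mL clinear_app)+
    have "mul Om (W l m (tword xs)) (W l' m' (tword ys)) = (-1) ^ (n * l') *\<^sub>C
        tlift (\<lambda>x y. mul LB (W2 l z1) x \<otimes> mul Ext y (qL w')) (W l' m' ?t)"
      unfolding z W_tmul[OF d(1)] W_tmul[OF d(3)] braiding_W2[OF d(2,3), symmetric]
      by (rule Om_mul(2)[OF W2_deg[OF d(1)] wd(1) W2_deg[OF d(3)] wd(2)])
    also have "\<dots> = (-1) ^ (n * l') *\<^sub>C W (l + l') (m + m') (app (cr l m l') (tmul z1 (tmul ?t w')))"
      using * td by simp
    also have "tmul ?t w' = app (cr 0 n (l' + m')) (tmul (tmul w z1') w')"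
      by (rule gen_tmul_left[OF gen_cr tmul_tdeg[OF d(2,3)], symmetric]) auto
    also have "tmul z1 \<dots> = app (cr (l + m) n (l' + m')) (tmul z1 (tmul (tmul w z1') w'))"
      using cr_shift[OF d(1), of 0 n "l' + m'"] by simp
    finally show "mul Om (W l m (tword xs)) (W l' m' (tword ys)) = (-1) ^ (n * l') *\<^sub>C
      W (l + l') (m + m') (app (cr l m l') (app (cr (l + m) n (l' + m')) (tmul (tword xs) (tword ys))))"
      by (simp add: z tmul_assoc)
  qed (intro clin m' clinear_app)+
  with assms show ?thesis by simp
qed

end

lemma tlift_zero: "tlift (\<lambda>a b. 0) t = 0"
proof -
  have "\<forall>t. tlift (\<lambda>a b. 0) t = 0" by (rule tensor_ext) (intro clin | simp add: clin)+
  then show ?thesis ..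
qed

context braided_comodule
begin

section \<open>The coproduct as a sum of braided shuffles; the differentials on
  representatives\<close>

section \<open>The comultiplication and the two differentials\<close>

lemma BB_mul: "cbilinear (super_mul R Nic Nic)"
  "super_mul R Nic Nic (qB x \<otimes> qB y) (qB x' \<otimes> qB y') = tlift (\<lambda>s t. qB (tmul x s) \<otimes> qB (tmul t y')) (\<Psi>T (y \<otimes> x'))"
proof -
  note sm = super_mul[OF R_linear Nic_mul(1) Nic_mul(1) Nic_coact(1) Nic_coact(1) clin_id clin_id Nic_sgn Nic_sgn]
  show "cbilinear (super_mul R Nic Nic)" by (rule sm(1))
  have br: "braiding R (coact Nic) (coact Nic) (qB y \<otimes> qB x') = tmap qB qB (\<Psi>T (y \<otimes> x'))"
    unfolding Nic_eq qB_def by (rule quotient_braiding[OF biideal_IB biideal_IB])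
  have "super_mul R Nic Nic (qB x \<otimes> qB y) (qB x' \<otimes> qB y') =
      tlift (\<lambda>s t. mul Nic (qB x) s \<otimes> mul Nic t (qB y')) (tmap qB qB (\<Psi>T (y \<otimes> x')))"
    using sm(2)[of "qB x" 0 "qB y" 0 "qB x'" 0 "qB y'" 0] by (simp add: Nic_deg br scaleC_one)
  also have "\<dots> = tlift (\<lambda>s t. mul Nic (qB x) (qB s) \<otimes> mul Nic (qB t) (qB y')) (\<Psi>T (y \<otimes> x'))"
    by (rule tlift_tmap[OF clinear_qB clinear_qB])
      (intro clin clinear_compose[OF cbilinear_left[OF Nic_mul(1)]] cbilinear_right[OF Nic_mul(1)])+
  finally show "super_mul R Nic Nic (qB x \<otimes> qB y) (qB x' \<otimes> qB y') =
      tlift (\<lambda>s t. qB (tmul x s) \<otimes> qB (tmul t y')) (\<Psi>T (y \<otimes> x'))"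
    by (simp add: Nic_mul)
qed

abbreviation "cutB k z \<equiv> tmap qB qB (cut k z)"

lemma clin_cutB: "clinear f \<Longrightarrow> clinear (\<lambda>x. cutB k (f x))"
  by (intro clin clinear_qB)

lemma cutB_tmul: "x \<in> tdeg k \<Longrightarrow> cutB k (tmul x y) = qB x \<otimes> qB y"
  by (simp add: cut_tmul tmap_tens clinear_qB)

text \<open>In the braided product v \<otimes> 1 puts v in front of the left leg, while 1 \<otimes>
  v takes v across the a strands of the left leg to the front of the right one.\<close>

lemma primitive_mul:
  assumes z: "z \<in> tdeg n" and a: "a \<le> n"
  shows "super_mul R Nic Nic (qB (letter v) \<otimes> qB (tword []) + qB (tword []) \<otimes> qB (letter v)) (cutB a z) =
    cutB (Suc a) (tmul (letter v) z) + cutB a (app (cr 0 (Suc 0) a) (tmul (letter v) z))"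
proof -
  note m = cbilinear_right[OF BB_mul(1)] cbilinear_left[OF BB_mul(1)]
  have lv: "letter v \<in> tdeg (Suc 0)" by (simp add: letter_def tword_tdeg)
  have "\<forall>z\<in>tdeg n. super_mul R Nic Nic (qB (letter v) \<otimes> qB (tword []) + qB (tword []) \<otimes> qB (letter v)) (cutB a z) =
    cutB (Suc a) (tmul (letter v) z) + cutB a (app (cr 0 (Suc 0) a) (tmul (letter v) z))"
  proof (rule tdeg_ext)
    fix zs :: "'v list" assume len: "length zs = n"
    define x where "x = tword (take a zs)"
    define y where "y = tword (drop a zs)"
    have x: "x \<in> tdeg a" and z: "tword zs = tmul x y" using len a by (auto simp: x_def y_def intro: tword_tdeg)
    have d: "tmul (letter v) x \<in> tdeg (Suc a)" using tmul_tdeg[OF lv x] by simp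
    have 1: "super_mul R Nic Nic (qB (letter v) \<otimes> qB (tword [])) (qB x \<otimes> qB y) = cutB (Suc a) (tmul (letter v) (tmul x y))"
      using cutB_tmul[OF d, of y] by (simp add: BB_mul PsiT_one_left clin tmul_assoc)
    have *: "\<forall>S\<in>tdeg (Suc a). tlift (\<lambda>s t. qB (tmul (tword []) s) \<otimes> qB (tmul t y)) (cut a S) = cutB a (tmul S y)"
    proof (rule tdeg_ext)
      fix ss :: "'v list" assume "length ss = Suc a"
      then have "tword (take a ss) \<in> tdeg a" by (intro tword_tdeg) simp
      from cutB_tmul[OF this, of "tmul (tword (drop a ss)) y"]
      show "tlift (\<lambda>s t. qB (tmul (tword []) s) \<otimes> qB (tmul t y)) (cut a (tword ss)) = cutB a (tmul (tword ss) y)"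
        by (simp add: cut_tword clin tmul_assoc[symmetric])
    qed (intro clin clinear_qB)+
    have 2: "super_mul R Nic Nic (qB (tword []) \<otimes> qB (letter v)) (qB x \<otimes> qB y) =
        cutB a (app (cr 0 (Suc 0) a) (tmul (letter v) (tmul x y)))"
      unfolding BB_mul(2) PsiT_cr[OF lv x] bspec[OF * gen_tdeg[OF gen_cr d]]
      by (subst gen_tmul_left[OF gen_cr d, symmetric]) (auto simp: tmul_assoc)
    show "super_mul R Nic Nic (qB (letter v) \<otimes> qB (tword []) + qB (tword []) \<otimes> qB (letter v)) (cutB a (tword zs)) =
      cutB (Suc a) (tmul (letter v) (tword zs)) + cutB a (app (cr 0 (Suc 0) a) (tmul (letter v) (tword zs)))"
      unfolding z cutB_tmul[OF x] clinear_add[OF m(2)] 1 2 ..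
  qed (intro clin clinear_qB clinear_compose[OF m(1)] clinear_app)+
  with z show ?thesis by blast
qed

text \<open>The coproduct on degree n: its component with a factors in the left leg is the shuffle
  operator followed by a cut.\<close>

definition wcom :: "nat \<Rightarrow> 'v tensor_algebra \<Rightarrow> 'v tensor_algebra quotients \<otimes> 'v tensor_algebra quotients"
  where "wcom n z = (\<Sum>a\<le>n. cutB a (app (sh 0 n a) z))"

lemma clin_wcom: "clinear f \<Longrightarrow> clinear (\<lambda>x. wcom n (f x))"
  unfolding wcom_def by (intro clin clinear_qB clin_app)

lemma foldr_wcom:
  "foldr (\<lambda>v z. super_mul R Nic Nic (qB (letter v) \<otimes> qB (tword []) + qB (tword []) \<otimes> qB (letter v)) z) vs (qB (tword []) \<otimes> qB (tword [])) =
    wcom (length vs) (tword vs)"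
proof (induction vs)
  case Nil
  show ?case using cutB_tmul[OF tword_tdeg[of "[] :: 'v list", OF refl], of "tword []"] by (simp add: wcom_def)
next
  case (Cons v vs)
  let ?n = "length vs"
  let ?m = "super_mul R Nic Nic (qB (letter v) \<otimes> qB (tword []) + qB (tword []) \<otimes> qB (letter v))"
  have lv: "letter v \<in> tdeg (Suc 0)" by (simp add: letter_def tword_tdeg)
  have t: "tword (v # vs) = tmul (letter v) (tword vs)" by (simp add: letter_def)
  have s: "tmul (letter v) (app (sh 0 ?n a) x) = app (sh (Suc 0) ?n a) (tmul (letter v) x)" for a x
    using sh_shift[OF lv, of 0 ?n a x] by simp
  have "?m (wcom ?n (tword vs)) = (\<Sum>a\<le>?n. ?m (cutB a (app (sh 0 ?n a) (tword vs))))"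
    unfolding wcom_def by (rule clinear_sum[OF cbilinear_right[OF BB_mul(1)]])
  also have "\<dots> = (\<Sum>a\<le>?n. cutB (Suc a) (app (sh (Suc 0) ?n a) (tword (v # vs))) +
      cutB a (app (cr 0 (Suc 0) a * sh (Suc 0) ?n a) (tword (v # vs))))"
    by (rule sum.cong[OF refl]) (simp add: primitive_mul[OF gen_tdeg[OF gen_sh tword_tdeg[OF refl]]] s t)
  \<comment> \<open>The first sum is shifted and starts with 0 at a = 0; the second is extended to a
    = n + 1, where the shuffle of n strands is 0. Termwise this is the recursion of
    \<open>sh\<close>.\<close>
  also have "\<dots> = (\<Sum>a\<le>Suc ?n. cutB a (app (case a of 0 \<Rightarrow> 0 | Suc a' \<Rightarrow> sh (Suc 0) ?n a') (tword (v # vs)))) +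
      (\<Sum>a\<le>Suc ?n. cutB a (app (cr 0 (Suc 0) a * sh (Suc 0) ?n a) (tword (v # vs))))"
  proof -
    have z: "cutB a 0 = 0" for a by (simp add: clinear_zero[OF clin_cutB[OF clin_id]])
    have split: "(\<Sum>a\<le>n. A (Suc a) + C a) = sum A {..Suc n} + sum C {..Suc n}"
      if "A 0 = 0" "C (Suc n) = 0" for A C :: "nat \<Rightarrow> 'v tensor_algebra quotients \<otimes> 'v tensor_algebra quotients" and n
      unfolding sum.atMost_Suc_shift[of A n] sum.atMost_Suc[of C n] using that by (simp add: sum.distrib)
    show ?thesis
      using split[of "\<lambda>a. cutB a (app (case a of 0 \<Rightarrow> 0 | Suc a' \<Rightarrow> sh (Suc 0) ?n a') (tword (v # vs)))"
          "\<lambda>a. cutB a (app (cr 0 (Suc 0) a * sh (Suc 0) ?n a) (tword (v # vs)))" ?n]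
      by (simp add: z clinear_zero[OF clinear_app] del: sum.atMost_Suc)
  qed
  also have "\<dots> = wcom (Suc ?n) (tword (v # vs))"
    unfolding wcom_def sum.distrib[symmetric]
    by (rule sum.cong[OF refl]) (simp add: cr_single_left clinear_add[OF clin_cutB[OF clin_id]])
  finally show ?case by (simp add: Cons)
qed

text \<open>An element of \<open>B \<otimes> B\<close> with legs of degrees a and n - a is
  determined by the two factorials applied to a representative.\<close>

lemma cutB_fac:
  assumes y: "y \<in> tdeg n" and a: "a \<le> n"
  shows "cutB a y = tmap (unfac a) (unfac (n - a)) (cut a (app (fac 0 a * fac a (n - a)) y))"
proof -
  have "\<forall>y\<in>tdeg n. cutB a y = tmap (unfac a) (unfac (n - a)) (cut a (app (fac 0 a) (app (fac a (n - a)) y)))"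
  proof (rule tdeg_ext)
    fix ys :: "'v list" assume len: "length ys = n"
    define u where "u = tword (take a ys)"
    define v where "v = tword (drop a ys)"
    have d: "u \<in> tdeg a" "v \<in> tdeg (n - a)" and z: "tword ys = tmul u v" using len a by (auto simp: u_def v_def intro!: tword_tdeg)
    have "app (fac 0 a) (app (fac a (n - a)) (tmul u v)) = tmul (app (fac 0 a) u) (app (fac 0 (n - a)) v)"
      using fac_shift[OF d(1), of 0 "n - a" v] fac_tmul_left[OF d(1)] by simp
    then show "cutB a (tword ys) = tmap (unfac a) (unfac (n - a)) (cut a (app (fac 0 a) (app (fac a (n - a)) (tword ys))))"
      unfolding z cutB_tmul[OF d(1)]
      by (simp add: cut_tmul[OF gen_tdeg[OF gen_fac d(1)]] tmap_tens unfac d)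
  qed (intro clin clinear_qB unfac(1) clinear_app)+
  with y show ?thesis by simp
qed

text \<open>Why the coproduct descends to \<open>B\<close>: after the factorials on both legs, the
  shuffle term is the full factorial by \<open>fac_fac_sh\<close>, and that vanishes.\<close>

lemma wcom_kill: "x \<in> tdeg n \<Longrightarrow> app (fac 0 n) x = 0 \<Longrightarrow> wcom n x = 0"
  unfolding wcom_def
proof (rule sum.neutral, rule ballI)
  fix a assume x: "x \<in> tdeg n" "app (fac 0 n) x = 0" and a: "a \<in> {..n}"
  have "app (fac 0 a * fac a (n - a)) (app (sh 0 n a) x) = app (fac 0 a * fac (0 + a) (n - a) * sh 0 n a) x" by simp
  also have "\<dots> = 0" using fac_fac_sh[of a n 0] a x(2) by (simp del: app_simps)
  finally have "app (fac 0 a * fac a (n - a)) (app (sh 0 n a) x) = 0" .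
  then show "cutB a (app (sh 0 n a) x) = 0"
    using cutB_fac[OF gen_tdeg[OF gen_sh[of 0 n a] x(1)], of a] a
    by (simp only: atMost_iff clinear_zero[OF clinear_cut] clinear_zero[OF clinear_tmap[OF unfac(1) unfac(1)]])
qed

lemma nichols_comult: "clinear (nichols_comult R \<delta>)"
  "x \<in> tdeg n \<Longrightarrow> nichols_comult R \<delta> (qB x) = wcom n x"
proof -
  define F where "F vs = wcom (length vs) (tword vs)" for vs
  have ml: "multilinear F"
  proof (rule multilinearI)
    show "clinear (\<lambda>v. F (xs @ [v] @ ys))" for xs ys
      unfolding F_def by (simp, intro clin_wcom clin)
  qed
  have deg: "talift F y = wcom m y" if "y \<in> tdeg m" for m y
  proof -
    have "\<forall>y\<in>tdeg m. talift F y = wcom m y"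
      by (rule tdeg_ext) (intro clinear_talift ml clin_wcom clin | simp add: talift_tword[OF ml] F_def)+
    with that show ?thesis by blast
  qed
  have k: "talift F x = 0" if x: "x \<in> cvec.span IB" for x
    by (rule IB_kill[OF clinear_talift[OF ml] _ x]) (simp add: deg wcom_kill)
  have e: "nichols_comult R \<delta> = qlift IB (talift F)"
    unfolding nichols_comult_def Let_def IB_def[symmetric] F_def[abs_def] foldr_wcom[symmetric]
    by (simp add: nichols_gen_def IB_def[symmetric] qB_def[symmetric] Nic_unit letter_def)
  show "clinear (nichols_comult R \<delta>)" unfolding e by (rule clinear_qlift[OF clinear_talift[OF ml] k])
  show "x \<in> tdeg n \<Longrightarrow> nichols_comult R \<delta> (qB x) = wcom n x"
    unfolding e qB_def using qlift_qcls[OF clinear_talift[OF ml] k, where x = x] deg by simp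
qed

lemma nichols_proj1: "clinear (nichols_proj1 R \<delta>)"
  "letter (nichols_proj1 R \<delta> (qB y)) = tproj 1 y"
proof -
  define h where "h vs = (if length vs = 1 then hd vs else 0)" for vs :: "'v list"
  have ml: "multilinear h"
    unfolding h_def[abs_def] by (rule multilinear_if_length) (auto simp: clin)
  have deg: "talift h x = 0" if "x \<in> tdeg n" "n \<noteq> 1" for n x
  proof -
    have "\<forall>x\<in>tdeg n. talift h x = 0"
      by (rule tdeg_ext) (use that in \<open>auto intro!: clinear_talift ml clin simp: talift_tword[OF ml] h_def\<close>)
    with that show ?thesis by blast
  qed
  have k: "talift h x = 0" if x: "x \<in> cvec.span IB" for x
  proof (rule IB_kill[OF clinear_talift[OF ml] _ x])
    fix n and x :: "'v tensor_algebra" assume x: "x \<in> tdeg n" "app (fac 0 n) x = 0"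
    show "talift h x = 0"
    proof (cases "n = 1")
      case True
      \<comment> \<open>The factorial of one strand is the identity, so there are no relations in
        degree 1.\<close>
      with x(2) have "x = 0" by simp
      then show ?thesis by (simp add: clinear_zero[OF clinear_talift[OF ml]])
    qed (use deg x in blast)
  qed
  have e: "nichols_proj1 R \<delta> = qlift IB (talift h)"
    unfolding nichols_proj1_def IB_def[symmetric] h_def[abs_def] ..
  show "clinear (nichols_proj1 R \<delta>)" unfolding e by (rule clinear_qlift[OF clinear_talift[OF ml] k])
  have "nichols_proj1 R \<delta> (qB y) = talift h y"
    unfolding e qB_def by (rule qlift_qcls[OF clinear_talift[OF ml] k])
  moreover have "\<forall>y. letter (talift h y) = tproj 1 y"
  proof (rule tword_ext)
    show "letter (talift h (tword xs)) = tproj 1 (tword xs)" for xs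
      by (cases xs) (auto simp: talift_tword[OF ml] h_def tproj_tword letter_def clinear_zero[OF clinear_letter, unfolded letter_def])
  qed (intro clin clinear_talift ml clinear_tproj)+
  ultimately show "letter (nichols_proj1 R \<delta> (qB y)) = tproj 1 y" by simp
qed

lemma exterior_gen_proj1: "exterior_gen R \<delta> (nichols_proj1 R \<delta> (qB y)) = qL (tproj 1 y)"
  using nichols_proj1(2)[of y] by (simp add: exterior_gen_def IL_def[symmetric] qL_def[symmetric] letter_def)

lemma clin_gen_proj1: "clinear f \<Longrightarrow> clinear (\<lambda>x. exterior_gen R \<delta> (nichols_proj1 R \<delta> (f x)))"
  unfolding exterior_gen_def by (intro clin clinear_compose[OF nichols_proj1(1)])

lemma clin_comult_B: "clinear f \<Longrightarrow> clinear (\<lambda>x. nichols_comult R \<delta> (f x))"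
  by (rule clinear_compose[OF nichols_comult(1)])

text \<open>The map demanded by the choice exists because its sign (-1)^p is the action of the
  parity operator on the left exterior factor; the same holds for \<open>delbar\<close>.\<close>

lemma del: "clinear (del R \<delta>)"
  "\<omega> \<in> deg Ext p \<Longrightarrow> x \<in> total_space Nic \<Longrightarrow> \<eta> \<in> deg Ext q \<Longrightarrow>
    del R \<delta> ((\<omega> \<otimes> x) \<otimes> \<eta>) = (-1) ^ p *\<^sub>C tlift (\<lambda>b1 b2.
        (mul Ext \<omega> (exterior_gen R \<delta> (nichols_proj1 R \<delta> b1)) \<otimes> b2) \<otimes> \<eta>) (nichols_comult R \<delta> x)"
proof -
  note mE = clinear_compose[OF cbilinear_left[OF Ext_mul(1)]] clinear_compose[OF cbilinear_right[OF Ext_mul(1)]]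
  note lin = clin mE clin_gen_proj1 clin_comult_B clinear_compose[OF sgnL(1)]
  define G where "G \<omega> x (\<eta> :: 'v tensor_algebra quotients) = tlift (\<lambda>b1 b2. (mul Ext \<omega> (exterior_gen R \<delta> (nichols_proj1 R \<delta> b1)) \<otimes> b2) \<otimes> \<eta>) (nichols_comult R \<delta> x)" for \<omega> x \<eta>
  have G: "clinear (\<lambda>\<omega>. G \<omega> x \<eta>)" "clinear (\<lambda>x. G \<omega> x \<eta>)" "clinear (\<lambda>\<eta>. G \<omega> x \<eta>)" for \<omega> x \<eta>
    unfolding G_def by (intro lin)+
  note G' = clinear_compose[OF G(1)] G
  define D where "D = tlift (\<lambda>z \<eta>. tlift (\<lambda>\<omega> x. G (sgnL \<omega>) x \<eta>) z)"
  have D: "clinear D" unfolding D_def by (intro clinear_tlift cbilinearI clin G' sgnL)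
  have "D ((\<omega> \<otimes> x) \<otimes> \<eta>) = (-1) ^ p *\<^sub>C G \<omega> x \<eta>" if "\<omega> \<in> deg Ext p" for \<omega> x \<eta> p
    using Ext_sgn[OF that] by (simp add: D_def clin G' sgnL clinear_scale[OF G(1)])
  with D have "\<exists>D. clinear D \<and> (\<forall>p q. \<forall>\<omega>\<in>deg Ext p. \<forall>b\<in>total_space Nic. \<forall>\<eta>\<in>deg Ext q.
      D ((\<omega> \<otimes> b) \<otimes> \<eta>) = (-1) ^ p *\<^sub>C tlift (\<lambda>b1 b2.
        (mul Ext \<omega> (exterior_gen R \<delta> (nichols_proj1 R \<delta> b1)) \<otimes> b2) \<otimes> \<eta>) (nichols_comult R \<delta> b))"
    unfolding G_def by (intro exI[of _ D]) auto
  from someI_ex[OF this] show "clinear (del R \<delta>)"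
    "\<omega> \<in> deg Ext p \<Longrightarrow> x \<in> total_space Nic \<Longrightarrow> \<eta> \<in> deg Ext q \<Longrightarrow>
    del R \<delta> ((\<omega> \<otimes> x) \<otimes> \<eta>) = (-1) ^ p *\<^sub>C tlift (\<lambda>b1 b2.
        (mul Ext \<omega> (exterior_gen R \<delta> (nichols_proj1 R \<delta> b1)) \<otimes> b2) \<otimes> \<eta>) (nichols_comult R \<delta> x)"
    unfolding del_def Let_def by blast+
qed

lemma delbar: "clinear (delbar R \<delta>)"
  "\<omega> \<in> deg Ext p \<Longrightarrow> x \<in> total_space Nic \<Longrightarrow> \<eta> \<in> deg Ext q \<Longrightarrow>
    delbar R \<delta> ((\<omega> \<otimes> x) \<otimes> \<eta>) = (-1) ^ p *\<^sub>C tlift (\<lambda>b1 b2.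
        (\<omega> \<otimes> b1) \<otimes> mul Ext (exterior_gen R \<delta> (nichols_proj1 R \<delta> b2)) \<eta>) (nichols_comult R \<delta> x)"
proof -
  note mE = clinear_compose[OF cbilinear_left[OF Ext_mul(1)]] clinear_compose[OF cbilinear_right[OF Ext_mul(1)]]
  note lin = clin mE clin_gen_proj1 clin_comult_B clinear_compose[OF sgnL(1)] cbilinear_right[OF Ext_mul(1)]
  define G where "G (\<omega> :: 'v tensor_algebra quotients) x \<eta> = tlift (\<lambda>b1 b2. (\<omega> \<otimes> b1) \<otimes> mul Ext (exterior_gen R \<delta> (nichols_proj1 R \<delta> b2)) \<eta>) (nichols_comult R \<delta> x)" for \<omega> x \<eta>
  have G: "clinear (\<lambda>\<omega>. G \<omega> x \<eta>)" "clinear (\<lambda>x. G \<omega> x \<eta>)" "clinear (\<lambda>\<eta>. G \<omega> x \<eta>)" for \<omega> x \<eta>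
    unfolding G_def by (intro lin)+
  note G' = clinear_compose[OF G(1)] G
  define D where "D = tlift (\<lambda>z \<eta>. tlift (\<lambda>\<omega> x. G (sgnL \<omega>) x \<eta>) z)"
  have D: "clinear D" unfolding D_def by (intro clinear_tlift cbilinearI clin G' sgnL)
  have "D ((\<omega> \<otimes> x) \<otimes> \<eta>) = (-1) ^ p *\<^sub>C G \<omega> x \<eta>" if "\<omega> \<in> deg Ext p" for \<omega> x \<eta> p
    using Ext_sgn[OF that] by (simp add: D_def clin G' sgnL clinear_scale[OF G(1)])
  with D have "\<exists>D. clinear D \<and> (\<forall>p q. \<forall>\<omega>\<in>deg Ext p. \<forall>b\<in>total_space Nic. \<forall>\<eta>\<in>deg Ext q.
      D ((\<omega> \<otimes> b) \<otimes> \<eta>) = (-1) ^ p *\<^sub>C tlift (\<lambda>b1 b2.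
        (\<omega> \<otimes> b1) \<otimes> mul Ext (exterior_gen R \<delta> (nichols_proj1 R \<delta> b2)) \<eta>) (nichols_comult R \<delta> b))"
    unfolding G_def by (intro exI[of _ D]) auto
  from someI_ex[OF this] show "clinear (delbar R \<delta>)"
    "\<omega> \<in> deg Ext p \<Longrightarrow> x \<in> total_space Nic \<Longrightarrow> \<eta> \<in> deg Ext q \<Longrightarrow>
    delbar R \<delta> ((\<omega> \<otimes> x) \<otimes> \<eta>) = (-1) ^ p *\<^sub>C tlift (\<lambda>b1 b2.
        (\<omega> \<otimes> b1) \<otimes> mul Ext (exterior_gen R \<delta> (nichols_proj1 R \<delta> b2)) \<eta>) (nichols_comult R \<delta> x)"
    unfolding delbar_def Let_def by blast+
qed

text \<open>The projection \<varpi> leaves the component of the coproduct with one factor in the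
  left leg, whose shuffle is \<open>dl\<close>. For m = 0 the truncated m - 1 is harmless, since
  then \<open>dl\<close> is 0.\<close>

lemma del_W:
  assumes "z \<in> tdeg (l + m + n)"
  shows "del R \<delta> (W l m z) = (-1) ^ l *\<^sub>C W (Suc l) (m - 1) (app (dl l m) z)"
proof -
  note mE = clinear_compose[OF cbilinear_right[OF Ext_mul(1)]]
  note lin = clin mE clin_gen_proj1 clinear_qL clinear_qB
  have "\<forall>z\<in>tdeg (l + m + n). del R \<delta> (W l m z) = (-1) ^ l *\<^sub>C W (Suc l) (m - 1) (app (dl l m) z)"
  proof (rule tdeg_ext)
    fix zs :: "'v list" assume "length zs = l + m + n"
    then obtain us vs ws where zs: "zs = us @ vs @ ws" "length us = l" "length vs = m" "length ws = n"
      using tword_split3 by blast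
    define u v w where "u = tword us" and "v = tword vs" and "w = tword ws"
    have d: "u \<in> tdeg l" "v \<in> tdeg m" "w \<in> tdeg n" using zs by (auto simp: u_def v_def w_def intro: tword_tdeg)
    have z: "tword zs = tmul u (tmul v w)" by (simp add: zs u_def v_def w_def)
    let ?F = "\<lambda>b1 b2. (mul Ext (qL u) (exterior_gen R \<delta> (nichols_proj1 R \<delta> b1)) \<otimes> b2) \<otimes> qL w"
    let ?H = "\<lambda>x1 x2. (qL (tmul u (tproj 1 x1)) \<otimes> qB x2) \<otimes> qL w"
    have F: "tlift ?F (cutB a y) = tlift ?H (cut a y)" for a y
      by (subst tlift_tmap) (intro lin | simp add: exterior_gen_proj1 Ext_mul)+
    have F0: "tlift ?F (cutB a y) = 0" if y: "y \<in> tdeg m" and a: "a \<le> m" "a \<noteq> 1" for a y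
    proof -
      have "tlift ?H (cut a y) = tlift ?H (tmap (tproj a) (\<lambda>x. x) (cut a y))" using cut_deg[OF y a(1)] by simp
      also have "\<dots> = tlift (\<lambda>x1 x2. ?H (tproj a x1) x2) (cut a y)"
        by (rule tlift_tmap) (intro lin clinear_tproj)+
      also have "\<dots> = tlift (\<lambda>x1 x2. 0) (cut a y)"
        using a(2) by (simp add: tproj_tdeg[OF tproj_in_tdeg] clinear_zero[OF clinear_tmul_right] clinear_zero[OF clinear_qL])
      also have "\<dots> = 0" by (rule tlift_zero)
      finally show ?thesis by (simp add: F)
    qed
    have F1: "tlift ?F (cutB (Suc 0) y) = W (Suc l) (m - 1) (tmul u (tmul y w))" if y: "y \<in> tdeg m" and m: "m \<noteq> 0" for y
    proof -
      have "\<forall>y\<in>tdeg m. tlift ?F (cutB (Suc 0) y) = W (Suc l) (m - 1) (tmul u (tmul y w))"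
      proof (rule tdeg_ext)
        fix ys :: "'v list" assume ly: "length ys = m"
        define y1 y2 where "y1 = tword (take 1 ys)" and "y2 = tword (drop 1 ys)"
        have y: "y1 \<in> tdeg 1" "y2 \<in> tdeg (m - 1)" "tword ys = tmul y1 y2"
          using ly m by (cases ys; auto simp: y1_def y2_def intro: tword_tdeg)+
        have uy: "tmul u y1 \<in> tdeg (Suc l)" using tmul_tdeg[OF d(1) y(1)] by simp
        show "tlift ?F (cutB (Suc 0) (tword ys)) = W (Suc l) (m - 1) (tmul u (tmul (tword ys) w))"
          using W_tmul3[OF uy y(2), of w] y(1) unfolding F y(3)
          by (simp add: cut_tmul[of y1 "Suc 0"] clin tproj_tdeg tmul_assoc)
      qed (intro lin clinear_app)+
      with y show ?thesis by blast
    qed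
    have "del R \<delta> (W l m (tword zs)) = (-1) ^ l *\<^sub>C tlift ?F (wcom m v)"
      unfolding z W_tmul3[OF d(1,2)] nichols_comult(2)[OF d(2), symmetric]
      by (rule del(2)) (use d in \<open>auto simp: Ext_deg Nic_total\<close>)
    also have "tlift ?F (wcom m v) = (\<Sum>a\<le>m. tlift ?F (cutB a (app (sh 0 m a) v)))"
      unfolding wcom_def by (rule clinear_sum) (intro lin)
    also have "\<dots> = W (Suc l) (m - 1) (app (dl l m) (tword zs))"
    proof (cases "m = 0")
      case True
      then show ?thesis using F0[of v 0] d by (simp add: dl_def clinear_zero[OF clinear_W])
    next
      case False
      have "(\<Sum>a\<le>m. tlift ?F (cutB a (app (sh 0 m a) v))) = (\<Sum>a\<in>{Suc 0}. tlift ?F (cutB a (app (sh 0 m a) v)))"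
        by (rule sum.mono_neutral_right) (use False F0 gen_tdeg[OF gen_sh d(2)] in auto)
      also have "\<dots> = W (Suc l) (m - 1) (tmul u (tmul (app (dl 0 m) v) w))"
        using F1[OF gen_tdeg[OF gen_dl d(2)] False] by (simp add: sh_1)
      also have "tmul (app (dl 0 m) v) w = app (dl 0 m) (tmul v w)"
        by (rule gen_tmul_left[OF gen_dl d(2), symmetric]) auto
      also have "tmul u \<dots> = app (dl l m) (tword zs)" using dl_shift[OF d(1), of 0 m "tmul v w"] by (simp add: z)
      finally show ?thesis .
    qed
    finally show "del R \<delta> (W l m (tword zs)) = (-1) ^ l *\<^sub>C W (Suc l) (m - 1) (app (dl l m) (tword zs))" .
  qed (intro clin clinear_compose[OF del(1)] clinear_app clinear_W)+
  with assms show ?thesis by blast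
qed

lemma dr_shift: "x \<in> tdeg d \<Longrightarrow> app (dr d m) (tmul x y) = tmul x (app (dr 0 m) y)"
proof (cases m)
  case (Suc n)
  then show "x \<in> tdeg d \<Longrightarrow> ?thesis" using sh_shift[of x d 0 m n y] by (simp add: sh_last del: sh.simps)
qed (simp add: dr_def clinear_zero[OF clinear_tmul_right])

text \<open>Here the component with one factor in the right leg survives, that is a + 1 = m, and its
  shuffle is \<open>dr\<close>. The middle block shrinks by one while l is unchanged.\<close>

lemma delbar_W:
  assumes "z \<in> tdeg (l + m + n)"
  shows "delbar R \<delta> (W l m z) = (-1) ^ l *\<^sub>C W l (m - 1) (app (dr l m) z)"
proof -
  note mE = clinear_compose[OF cbilinear_left[OF Ext_mul(1)]]
  note lin = clin mE clin_gen_proj1 clinear_qL clinear_qB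
  have "\<forall>z\<in>tdeg (l + m + n). delbar R \<delta> (W l m z) = (-1) ^ l *\<^sub>C W l (m - 1) (app (dr l m) z)"
  proof (rule tdeg_ext)
    fix zs :: "'v list" assume "length zs = l + m + n"
    then obtain us vs ws where zs: "zs = us @ vs @ ws" "length us = l" "length vs = m" "length ws = n"
      using tword_split3 by blast
    define u v w where "u = tword us" and "v = tword vs" and "w = tword ws"
    have d: "u \<in> tdeg l" "v \<in> tdeg m" "w \<in> tdeg n" using zs by (auto simp: u_def v_def w_def intro: tword_tdeg)
    have z: "tword zs = tmul u (tmul v w)" by (simp add: zs u_def v_def w_def)
    let ?F = "\<lambda>b1 b2. (qL u \<otimes> b1) \<otimes> mul Ext (exterior_gen R \<delta> (nichols_proj1 R \<delta> b2)) (qL w)"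
    let ?H = "\<lambda>x1 x2. (qL u \<otimes> qB x1) \<otimes> qL (tmul (tproj 1 x2) w)"
    have F: "tlift ?F (cutB a y) = tlift ?H (cut a y)" for a y
      by (subst tlift_tmap) (intro lin | simp add: exterior_gen_proj1 Ext_mul)+
    have FH: "tlift ?F (cutB a y) = (if Suc a = m then W l (m - 1) (tmul u (tmul y w)) else 0)"
      if y: "y \<in> tdeg m" and a: "a \<le> m" for a y
    proof -
      have "\<forall>y\<in>tdeg m. tlift ?F (cutB a y) = (if Suc a = m then W l (m - 1) (tmul u (tmul y w)) else 0)"
      proof (rule tdeg_ext)
        fix ys :: "'v list" assume ly: "length ys = m"
        define y1 y2 where "y1 = tword (take a ys)" and "y2 = tword (drop a ys)"
        have y: "y1 \<in> tdeg a" "y2 \<in> tdeg (m - a)" "tword ys = tmul y1 y2"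
          using ly a by (auto simp: y1_def y2_def intro!: tword_tdeg)
        have uy: "tmul u (tmul y1 (tmul y2 w)) = tmul u (tmul (tword ys) w)" by (simp add: y(3) tmul_assoc)
        have "tlift ?F (cutB a (tword ys)) = (qL u \<otimes> qB y1) \<otimes> qL (tmul (tproj 1 y2) w)"
          unfolding F y(3) by (simp add: cut_tmul[OF y(1)] clin)
        also have "\<dots> = (if Suc a = m then W l (m - 1) (tmul u (tmul (tword ys) w)) else 0)"
        proof (cases "Suc a = m")
          case True
          then have "m - a = 1" by simp
          then have "tproj 1 y2 = y2" using y(2) tproj_tdeg[of y2 1 1] by simp
          moreover have "W l a (tmul u (tmul y1 (tmul y2 w))) = (qL u \<otimes> qB y1) \<otimes> qL (tmul y2 w)"
            by (rule W_tmul3[OF d(1) y(1)])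
          moreover have "m - 1 = a" using True by simp
          ultimately show ?thesis using True uy by simp
        next
          case False
          then have "m - a \<noteq> 1" using a by simp
          then have "tproj 1 y2 = 0" using y(2) by (simp add: tproj_tdeg)
          then show ?thesis using False by (simp add: clinear_zero[OF clinear_tmul_left] clinear_zero[OF clinear_qL])
        qed
        finally show "tlift ?F (cutB a (tword ys)) = (if Suc a = m then W l (m - 1) (tmul u (tmul (tword ys) w)) else 0)" .
      qed (intro lin clinear_app)+
      with y show ?thesis by blast
    qed
    have "delbar R \<delta> (W l m (tword zs)) = (-1) ^ l *\<^sub>C tlift ?F (wcom m v)"
      unfolding z W_tmul3[OF d(1,2)] nichols_comult(2)[OF d(2), symmetric]
      by (rule delbar(2)) (use d in \<open>auto simp: Ext_deg Nic_total\<close>)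
    also have "tlift ?F (wcom m v) = (\<Sum>a\<le>m. tlift ?F (cutB a (app (sh 0 m a) v)))"
      unfolding wcom_def by (rule clinear_sum) (intro lin)
    also have "\<dots> = (\<Sum>a\<le>m. if Suc a = m then W l (m - 1) (tmul u (tmul (app (sh 0 m a) v) w)) else 0)"
      by (rule sum.cong[OF refl]) (simp add: FH gen_tdeg[OF gen_sh d(2)])
    also have "\<dots> = W l (m - 1) (app (dr l m) (tword zs))"
    proof (cases m)
      case 0
      then show ?thesis by (simp add: dr_def clinear_zero[OF clinear_W])
    next
      case (Suc k)
      have "(\<Sum>a\<le>m. if Suc a = m then W l (m - 1) (tmul u (tmul (app (sh 0 m a) v) w)) else 0) =
          W l (m - 1) (tmul u (tmul (app (dr 0 m) v) w))"
        by (simp add: Suc sh_last sum.delta del: sh.simps cong: if_cong)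
      also have "tmul (app (dr 0 m) v) w = app (dr 0 m) (tmul v w)"
        by (rule gen_tmul_left[OF gen_dr d(2), symmetric]) auto
      also have "tmul u \<dots> = app (dr l m) (tword zs)" using dr_shift[OF d(1), of m "tmul v w"] by (simp add: z)
      finally show ?thesis .
    qed
    finally show "delbar R \<delta> (W l m (tword zs)) = (-1) ^ l *\<^sub>C W l (m - 1) (app (dr l m) (tword zs))" .
  qed (intro clin clinear_compose[OF delbar(1)] clinear_app clinear_W)+
  with assms show ?thesis by blast
qed

end

lemma minus_one_power_cong: "even (a + b) \<Longrightarrow> (-1 :: complex) ^ a = (-1) ^ b"
  by (simp add: minus_one_power_iff)

context braided_comodule
begin

section \<open>The calculus axioms as braid identities on representatives\<close>

subsection \<open>Identities in the double complex\<close>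

text \<open>In \<open>\<Lambda>(V)\<close> a generator acts as -1, because the image of id + \<Psi>
  is divided out.\<close>

lemma W_b_left:
  assumes z: "z \<in> tdeg (l + m + n)" and i: "Suc i < l"
  shows "W l m (app (b i) z) = - W l m z"
proof -
  have "\<forall>z\<in>tdeg (l + m + n). W l m (z + app (b i) z) = 0"
  proof (rule tdeg_ext)
    fix zs :: "'v list" assume "length zs = l + m + n"
    then obtain us vs ws where zs: "zs = us @ vs @ ws" "length us = l" "length vs = m" using tword_split3 by blast
    have d: "tword us \<in> tdeg l" "tword vs \<in> tdeg m" using zs by (auto intro: tword_tdeg)
    have t: "tword zs = tmul (tword us) (tmul (tword vs) (tword ws))" by (simp add: zs)
    have q: "qL (tword us) + qL (app (b i) (tword us)) = 0"
      using qL_b[OF d(1) i] by (simp add: clinear_add[OF clinear_qL])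
    have "W l m (tword zs + app (b i) (tword zs)) =
        (qL (tword us) \<otimes> qB (tword vs)) \<otimes> qL (tword ws) + (qL (app (b i) (tword us)) \<otimes> qB (tword vs)) \<otimes> qL (tword ws)"
      unfolding t b_tmul_left[OF d(1) i] clinear_add[OF clinear_W] W_tmul3[OF d] W_tmul3[OF b_tdeg[OF d(1)] d(2)] ..
    also have "\<dots> = 0" unfolding tens_add[symmetric] q by simp
    finally show "W l m (tword zs + app (b i) (tword zs)) = 0" .
  qed (intro clin clinear_W clinear_app)+
  with z have "W l m (z + app (b i) z) = 0" by blast
  then show ?thesis by (simp add: clinear_add[OF clinear_W] add_eq_0_iff2)
qed

lemma W_bw_left:
  assumes "z \<in> tdeg (l + m + n)" "\<forall>i\<in>set is. Suc i < l"
  shows "W l m (app (bw is) z) = (-1) ^ length is *\<^sub>C W l m z"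
  using assms(2)
proof (induction "is")
  case (Cons i "is")
  have "app (bw is) z \<in> tdeg (l + m + n)" using assms(1) by (simp add: be_bw[symmetric] be_tdeg)
  then have "W l m (app (b i) (app (bw is) z)) = - W l m (app (bw is) z)"
    using Cons.prems by (intro W_b_left) auto
  with Cons show ?case by (simp add: bw_Cons)
qed (simp add: scaleC_one)

text \<open>The class of the middle block depends on the tensor only through its factorial, by
  \<open>unfac\<close>. Identities of forms may therefore be checked after multiplication with the
  factorial of the middle strands.\<close>

lemma W_fac:
  assumes z: "z \<in> tdeg (l + m + n)" and f: "app (fac l m) z = 0"
  shows "W l m z = 0"
proof -
  let ?W = "\<lambda>z. tmap (\<lambda>x. tmap qL (unfac m) (cut l x)) qL (cut (l + m) z)"
  note lin = clin clinear_qL unfac(1)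
  have "\<forall>z\<in>tdeg (l + m + n). W l m z = ?W (app (fac l m) z)"
  proof (rule tdeg_ext)
    fix zs :: "'v list" assume "length zs = l + m + n"
    then obtain us vs ws where zs: "zs = us @ vs @ ws" "length us = l" "length vs = m" using tword_split3 by blast
    have d: "tword us \<in> tdeg l" "tword vs \<in> tdeg m" using zs by (auto intro: tword_tdeg)
    have fv: "app (fac 0 m) (tword vs) \<in> tdeg m" by (rule gen_tdeg[OF gen_fac d(2)])
    have t: "tword zs = tmul (tword us) (tmul (tword vs) (tword ws))" by (simp add: zs)
    have "app (fac l m) (tword zs) = tmul (tmul (tword us) (app (fac 0 m) (tword vs))) (tword ws)"
      using fac_shift[OF d(1), of 0 m] fac_tmul_left[OF d(2)] unfolding t by (simp del: tmul_tword add: tmul_assoc)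
    then have "?W (app (fac l m) (tword zs)) = tmap qL (unfac m) (cut l (tmul (tword us) (app (fac 0 m) (tword vs)))) \<otimes> qL (tword ws)"
      by (simp add: cut_tmul[OF tmul_tdeg[OF d(1) fv]] tmap_tens lin)
    also have "\<dots> = W l m (tword zs)"
      unfolding t W_tmul3[OF d] by (simp add: cut_tmul[OF d(1)] tmap_tens lin unfac(2)[OF d(2)])
    finally show "W l m (tword zs) = ?W (app (fac l m) (tword zs))" ..
  qed (intro lin clinear_W clinear_app)+
  with z have "W l m z = ?W (app (fac l m) z)" by blast
  also have "\<dots> = 0" unfolding f clinear_zero[OF clinear_cut] by (rule clinear_zero) (intro clinear_tmap lin)
  finally show ?thesis .
qed

text \<open>Both bracketings apply the same braid, by \<open>cr_product_assoc\<close>, and both sign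
  exponents equal n l' + n l'' + n' l''.\<close>

lemma W_assoc:
  assumes z: "z \<in> tdeg (l + m + n)" and z': "z' \<in> tdeg (l' + m' + n')" and z'': "z'' \<in> tdeg (l'' + m'' + n'')"
  shows "mul Om (mul Om (W l m z) (W l' m' z')) (W l'' m'' z'') = mul Om (W l m z) (mul Om (W l' m' z') (W l'' m'' z''))"
proof -
  note sc = clinear_scale[OF cbilinear_left[OF Om_mul(1)]] clinear_scale[OF cbilinear_right[OF Om_mul(1)]]
  define e1 where "e1 = cr l m l' * cr (l + m) n (l' + m')"
  define e2 where "e2 = cr l' m' l'' * cr (l' + m') n' (l'' + m'')"
  have zz: "tmul z z' \<in> tdeg (l + m + n + (l' + m' + n'))" by (rule tmul_tdeg[OF z z'])
  have zz': "tmul z' z'' \<in> tdeg (l' + m' + n' + (l'' + m'' + n''))" by (rule tmul_tdeg[OF z' z''])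
  have g1: "e1 \<in> gen {i. Suc i < l + m + n + (l' + m' + n')}"
    unfolding e1_def by (intro gen.mult; rule gen_mono[OF gen_cr]) auto
  have g2: "e2 \<in> gen UNIV"
    unfolding e2_def by (intro gen.mult; rule gen_mono[OF gen_cr]) auto
  have d1: "app e1 (tmul z z') \<in> tdeg (l + l' + (m + m') + (n + n'))"
    using gen_tdeg[OF g1 zz] by (simp add: add_ac)
  have d2: "app e2 (tmul z' z'') \<in> tdeg (l' + l'' + (m' + m'') + (n' + n''))"
    using gen_tdeg[OF g2 zz'] by (simp add: add_ac)
  have t1: "tmul (app e1 (tmul z z')) z'' = app e1 (tmul z (tmul z' z''))"
    using gen_tmul_left[OF g1 zz, of z''] by (simp add: tmul_assoc)
  have t2: "tmul z (app e2 (tmul z' z'')) =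
      app (cr (l + m + n + l') m' l'' * cr (l + m + n + l' + m') n' (l'' + m'')) (tmul z (tmul z' z''))"
    unfolding e2_def using cr_shift[OF z, of l'] cr_shift[OF z, of "l' + m'"] by (simp add: add_ac)
  have "mul Om (mul Om (W l m z) (W l' m' z')) (W l'' m'' z'') = (-1) ^ (n * l' + (n + n') * l'') *\<^sub>C
      W (l + l' + l'') (m + m' + m'') (app (cr (l + l') (m + m') l'' * cr (l + l' + m + m') (n + n') (l'' + m'') * e1) (tmul z (tmul z' z'')))"
    unfolding W_mul[OF z z'] sc e1_def[symmetric] W_mul[OF d1 z''] t1
    by (simp add: scaleC_scaleC power_add add_ac)
  moreover have "mul Om (W l m z) (mul Om (W l' m' z') (W l'' m'' z'')) = (-1) ^ (n' * l'' + n * (l' + l'')) *\<^sub>C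
      W (l + (l' + l'')) (m + (m' + m'')) (app (cr l m (l' + l'') * cr (l + m) n (l' + l'' + (m' + m'')) *
        (cr (l + m + n + l') m' l'' * cr (l + m + n + l' + m') n' (l'' + m''))) (tmul z (tmul z' z'')))"
    unfolding W_mul[OF z' z''] sc e2_def[symmetric] W_mul[OF z d2] t2
    by (simp add: scaleC_scaleC power_add)
  moreover have "(-1 :: complex) ^ (n * l' + (n + n') * l'') = (-1) ^ (n' * l'' + n * (l' + l''))"
    by (rule minus_one_power_cong) (simp add: algebra_simps)
  moreover have "cr (l + l') (m + m') l'' * cr (l + l' + m + m') (n + n') (l'' + m'') * e1 =
      cr l m (l' + l'') * cr (l + m) n (l' + l'' + (m' + m'')) *
        (cr (l + m + n + l') m' l'' * cr (l + m + n + l' + m') n' (l'' + m''))"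
    using cr_product_assoc[of l l' m m' l'' n n' m''] by (simp add: e1_def add_ac)
  ultimately show ?thesis by (simp only: add.assoc)
qed

lemma W_unit: "unit Om = W 0 0 (tword [])"
  using W_tmul3[of "tword []" 0 "tword []" 0 "tword []"] tword_tdeg[of "[] :: 'v list" 0]
  by (simp add: Om_eq Ext_unit Nic_unit)

lemma W_mul_unit:
  assumes z: "z \<in> tdeg (l + m + n)"
  shows "mul Om (unit Om) (W l m z) = W l m z" "mul Om (W l m z) (unit Om) = W l m z"
proof -
  have e: "tword [] \<in> tdeg (0 + 0 + 0)" by (simp add: tword_tdeg)
  show "mul Om (unit Om) (W l m z) = W l m z"
    unfolding W_unit W_mul[OF e z] by (simp add: scaleC_one)
  show "mul Om (W l m z) (unit Om) = W l m z"
    unfolding W_unit W_mul[OF z e] by (simp add: scaleC_one)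
qed

text \<open>\<open>dl_add\<close> separates the strands of the two factors. Each part is moved
  inside the crossings of the product, to the factor it belongs to; the signs come from the new odd
  strand passing the blocks l' or n.\<close>

lemma del_derivation_W:
  assumes z: "z \<in> tdeg (l + m + n)" and z': "z' \<in> tdeg (l' + m' + n')"
  shows "del R \<delta> (mul Om (W l m z) (W l' m' z')) =
    mul Om (del R \<delta> (W l m z)) (W l' m' z') + (-1) ^ (l + n) *\<^sub>C mul Om (W l m z) (del R \<delta> (W l' m' z'))"
proof -
  note sc = clinear_scale[OF cbilinear_left[OF Om_mul(1)]] clinear_scale[OF cbilinear_right[OF Om_mul(1)]]
  note m0 = clinear_zero[OF cbilinear_left[OF Om_mul(1)]] clinear_zero[OF cbilinear_right[OF Om_mul(1)]]
  define p where "p = l + l'"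
  define A where "A = cr (l + m) n (l' + m')"
  define B where "B = cr l m l'"
  define y where "y = tmul z z'"
  have y: "y \<in> tdeg (l + m + n + (l' + m' + n'))" unfolding y_def by (rule tmul_tdeg[OF z z'])
  have AB: "A * B \<in> gen UNIV" "B * A \<in> gen UNIV"
    unfolding A_def B_def by (intro gen.mult; rule gen_mono[OF gen_cr]; simp)+
  have d: "app (B * A) y \<in> tdeg (p + (m + m') + (n + n'))"
    using gen_tdeg[OF AB(2) y] by (simp add: p_def add_ac)
  \<comment> \<open>In the second term the strand comes from the second factor and crosses the m
    middle strands as well, so the crossing of m with l' becomes one with l' + 1 strands.\<close>
  have split: "dl p (m + m') * (B * A) = B * A * dl l m + cr l m (Suc l') * A * dl (p + m + n) m'"
  proof -
    have 1: "dl p m * B = B * dl l m" using cr_dl[of l m l'] by (simp add: B_def p_def)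
    have 2: "dl l m * A = A * dl l m" unfolding A_def by (rule gen_commute[OF gen_dl gen_cr]) auto
    have 3: "dl (p + m) m' * B = B * dl (p + m) m'" unfolding B_def p_def by (rule gen_commute[OF gen_dl gen_cr]) auto
    have 4: "A * dl (p + m + n) m' = dl (p + m) m' * A"
      unfolding A_def p_def by (rule cr_dl_right) auto
    have 5: "cr p m (Suc 0) * B = cr l m (Suc l')" using cr_add_right[of l m l' "Suc 0"] by (simp add: B_def p_def)
    have "dl p (m + m') * (B * A) = (dl p m * B) * A + cr p m (Suc 0) * (dl (p + m) m' * B) * A"
      by (simp add: dl_add distrib_right mult.assoc)
    also have "\<dots> = B * (dl l m * A) + (cr p m (Suc 0) * B) * (dl (p + m) m' * A)"
      by (simp add: 1 3 mult.assoc)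
    finally show ?thesis by (simp add: 2 4[symmetric] 5 mult.assoc)
  qed
  have L: "del R \<delta> (mul Om (W l m z) (W l' m' z')) = (-1) ^ (n * l' + p) *\<^sub>C
      (W (Suc p) (m + m' - 1) (app (B * A * dl l m) y) + W (Suc p) (m + m' - 1) (app (cr l m (Suc l') * A * dl (p + m + n) m') y))"
  proof -
    have "del R \<delta> (mul Om (W l m z) (W l' m' z')) = (-1) ^ (n * l') *\<^sub>C (-1) ^ p *\<^sub>C
        W (Suc p) (m + m' - 1) (app (dl p (m + m')) (app (B * A) y))"
      unfolding W_mul[OF z z'] clinear_scale[OF del(1)] p_def[symmetric] A_def[symmetric] B_def[symmetric] y_def[symmetric]
        del_W[OF d] ..
    also have "app (dl p (m + m')) (app (B * A) y) = app (dl p (m + m') * (B * A)) y" by simp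
    finally show ?thesis unfolding split by (simp add: clinear_add[OF clinear_W] scaleC_scaleC power_add)
  qed
  have T1: "mul Om (del R \<delta> (W l m z)) (W l' m' z') = (-1) ^ (n * l' + p) *\<^sub>C W (Suc p) (m + m' - 1) (app (B * A * dl l m) y)"
  proof (cases m)
    case 0
    then have "dl l m = 0" by (simp add: dl_def)
    then show ?thesis
      unfolding del_W[OF z] by (simp add: clinear_zero[OF clinear_W] m0)
  next
    case (Suc k)
    have dz: "app (dl l m) z \<in> tdeg (Suc l + k + n)" using gen_tdeg[OF gen_dl z, of l m] by (simp add: Suc)
    have t: "tmul (app (dl l m) z) z' = app (dl l m) y"
      unfolding y_def by (rule gen_tmul_left[OF gen_dl z, symmetric]) auto
    \<comment> \<open>The strand just split off now belongs to the left block. Its crossing with the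
      l' strands acts inside that block and contributes (-1)^l'.\<close>
    have B: "B = cr l (Suc 0) l' * cr (Suc l) k l'" unfolding B_def Suc by (rule cr_Suc_left)
    have r: "app (cr (Suc l) k l' * A * dl l m) y \<in> tdeg (Suc p + (k + m') + (n + n'))"
    proof -
      have "cr (Suc l) k l' * A * dl l m \<in> gen UNIV"
        unfolding A_def by (intro gen.mult; rule gen_mono[OF gen_cr] gen_mono[OF gen_dl]; simp)
      from gen_tdeg[OF this y] show ?thesis by (simp add: p_def Suc add_ac)
    qed
    have "W (Suc p) (k + m') (app (B * A * dl l m) y) = W (Suc p) (k + m') (app (bw (rev [l..<l + l'])) (app (cr (Suc l) k l' * A * dl l m) y))"
      by (simp add: B cr_single_left)
    also have "\<dots> = (-1) ^ l' *\<^sub>C W (Suc p) (k + m') (app (cr (Suc l) k l' * A * dl l m) y)"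
      by (subst W_bw_left[OF r]) (auto simp: p_def)
    finally have s: "W (Suc p) (k + m') (app (B * A * dl l m) y) = (-1) ^ l' *\<^sub>C W (Suc p) (k + m') (app (cr (Suc l) k l' * A * dl l m) y)" .
    have "mul Om (del R \<delta> (W l m z)) (W l' m' z') = (-1) ^ l *\<^sub>C mul Om (W (Suc l) k (app (dl l m) z)) (W l' m' z')"
      unfolding del_W[OF z] sc by (simp add: Suc)
    also have "\<dots> = (-1) ^ l *\<^sub>C (-1) ^ (n * l') *\<^sub>C W (Suc p) (k + m') (app (cr (Suc l) k l' * A * dl l m) y)"
      unfolding W_mul[OF dz z'] t by (simp add: A_def p_def Suc)
    also have "\<dots> = (-1) ^ (n * l' + p) *\<^sub>C (-1) ^ l' *\<^sub>C W (Suc p) (k + m') (app (cr (Suc l) k l' * A * dl l m) y)"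
      unfolding scaleC_scaleC power_add[symmetric]
      by (rule arg_cong[where f = "\<lambda>c. c *\<^sub>C _"], rule minus_one_power_cong) (auto simp: p_def)
    finally show ?thesis unfolding s[symmetric] by (simp add: Suc)
  qed
  have T2: "(-1) ^ (l + n) *\<^sub>C mul Om (W l m z) (del R \<delta> (W l' m' z')) =
      (-1) ^ (n * l' + p) *\<^sub>C W (Suc p) (m + m' - 1) (app (cr l m (Suc l') * A * dl (p + m + n) m') y)"
  proof (cases m')
    case 0
    then have "dl l' m' = 0" "dl (p + m + n) m' = 0" by (simp_all add: dl_def)
    then show ?thesis
      unfolding del_W[OF z'] by (simp add: clinear_zero[OF clinear_W] m0)
  next
    case (Suc k)
    have dz: "app (dl l' m') z' \<in> tdeg (Suc l' + k + n')" using gen_tdeg[OF gen_dl z', of l' m'] by (simp add: Suc)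
    have t: "tmul z (app (dl l' m') z') = app (dl (p + m + n) m') y"
      unfolding y_def using dl_shift[OF z, of l' m' z'] by (simp add: p_def add_ac)
    have "(-1) ^ (l + n) *\<^sub>C mul Om (W l m z) (del R \<delta> (W l' m' z')) =
        (-1) ^ (l + n) *\<^sub>C (-1) ^ l' *\<^sub>C mul Om (W l m z) (W (Suc l') k (app (dl l' m') z'))"
      unfolding del_W[OF z'] sc by (simp add: Suc)
    also have "\<dots> = (-1) ^ (l + n) *\<^sub>C (-1) ^ l' *\<^sub>C (-1) ^ (n * Suc l') *\<^sub>C
        W (Suc p) (m + k) (app (cr l m (Suc l') * A * dl (p + m + n) m') y)"
      unfolding W_mul[OF z dz] t by (simp add: A_def p_def Suc)
    also have "\<dots> = (-1) ^ (n * l' + p) *\<^sub>C W (Suc p) (m + k) (app (cr l m (Suc l') * A * dl (p + m + n) m') y)"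
      unfolding scaleC_scaleC power_add[symmetric]
      by (rule arg_cong[where f = "\<lambda>c. c *\<^sub>C _"], rule minus_one_power_cong) (auto simp: p_def)
    finally show ?thesis by (simp add: Suc)
  qed
  show ?thesis unfolding L T1 T2 by (simp add: scaleC_add_right)
qed

text \<open>By \<open>dl_dl\<close> the composite has the left factor 1 + b l. The generator
  exchanges the two new strands, both now in the left exterior factor, where this factor is
  zero.\<close>

lemma del_del_W:
  assumes z: "z \<in> tdeg (l + m + n)" shows "del R \<delta> (del R \<delta> (W l m z)) = 0"
proof (cases "m \<le> 1")
  case True
  have "dl l 0 = 0" "dl (Suc l) 0 = 0" by (simp_all add: dl_def)
  then show ?thesis
  proof (cases m)
    case 0
    then show ?thesis using \<open>dl l 0 = 0\<close> unfolding del_W[OF z] by (simp add: clinear_zero[OF clinear_W] clinear_zero[OF del(1)])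
  next
    case (Suc k)
    with True have m: "m = 1" by simp
    have dz: "app (dl l m) z \<in> tdeg (Suc l + 0 + n)" using gen_tdeg[OF gen_dl z, of l m] by (simp add: m)
    show ?thesis unfolding del_W[OF z] clinear_scale[OF del(1)]
      using del_W[OF dz] \<open>dl (Suc l) 0 = 0\<close> by (simp add: m clinear_zero[OF clinear_W])
  qed
next
  case False
  then obtain k where m: "m = Suc (Suc k)" by (metis One_nat_def le_SucI le_zero_eq not0_implies_Suc not_less_eq_eq)
  have dz: "app (dl l m) z \<in> tdeg (Suc l + Suc k + n)" using gen_tdeg[OF gen_dl z, of l m] by (simp add: m)
  obtain x' where x': "x' \<in> gen UNIV" "dl (Suc l) (Suc k) * dl l m = (1 + b l) * x'"
    using dl_dl[of l "Suc k"] by (auto simp: m)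
  have d: "app x' z \<in> tdeg (Suc (Suc l) + k + n)" using gen_tdeg[OF x'(1) z] by (simp add: m)
  have "W (Suc (Suc l)) k (app (dl (Suc l) (Suc k)) (app (dl l m) z)) = W (Suc (Suc l)) k (app (dl (Suc l) (Suc k) * dl l m) z)" by simp
  also have "\<dots> = W (Suc (Suc l)) k (app x' z) + W (Suc (Suc l)) k (app (b l) (app x' z))"
    unfolding x'(2) by (simp add: distrib_right clinear_add[OF clinear_W])
  also have "\<dots> = 0" using W_b_left[OF d, of l] by simp
  finally have "W (Suc (Suc l)) k (app (dl (Suc l) (Suc k)) (app (dl l m) z)) = 0" .
  then show ?thesis unfolding del_W[OF z] clinear_scale[OF del(1)] using del_W[OF dz] by (simp add: m)
qed

lemma del_delbar_W:
  assumes z: "z \<in> tdeg (l + m + n)" shows "del R \<delta> (delbar R \<delta> (W l m z)) + delbar R \<delta> (del R \<delta> (W l m z)) = 0"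
proof -
  have z0: "dl k 0 = 0" "dr k 0 = 0" for k by (simp_all add: dl_def dr_def)
  consider "m = 0" | "m = 1" | k where "m = Suc (Suc k)" by (metis One_nat_def not0_implies_Suc)
  then show ?thesis
  proof cases
    case 1
    then show ?thesis unfolding del_W[OF z] delbar_W[OF z]
      by (simp add: z0 clinear_zero[OF clinear_W] clinear_zero[OF del(1)] clinear_zero[OF delbar(1)])
  next
    case 2
    have d1: "app (dl l m) z \<in> tdeg (Suc l + 0 + n)" using gen_tdeg[OF gen_dl z, of l m] by (simp add: 2)
    have d2: "app (dr l m) z \<in> tdeg (l + 0 + Suc n)" using gen_tdeg[OF gen_dr z, of l m] by (simp add: 2)
    show ?thesis unfolding del_W[OF z] delbar_W[OF z] clinear_scale[OF del(1)] clinear_scale[OF delbar(1)]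
      using del_W[OF d2] delbar_W[OF d1] by (simp add: 2 z0 clinear_zero[OF clinear_W])
  next
    case (3 k)
    have d1: "app (dl l m) z \<in> tdeg (Suc l + Suc k + n)" using gen_tdeg[OF gen_dl z, of l m] by (simp add: 3)
    have d2: "app (dr l m) z \<in> tdeg (l + Suc k + Suc n)" using gen_tdeg[OF gen_dr z, of l m] by (simp add: 3)
    define u where "u = app (dl l (Suc k) * dr l m) z - app (dr (Suc l) (Suc k) * dl l m) z"
    have "fac (Suc l) k * (dl l (Suc k) * dr l m) = fac l m"
      unfolding mult.assoc[symmetric] fac_dl using fac_dr[of l "Suc k"] by (simp add: 3)
    moreover have "fac (Suc l) k * (dr (Suc l) (Suc k) * dl l m) = fac l m"
      unfolding mult.assoc[symmetric] fac_dr using fac_dl[of l "Suc k"] by (simp add: 3)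
    ultimately have "fac (Suc l) k * (dl l (Suc k) * dr l m) = fac (Suc l) k * (dr (Suc l) (Suc k) * dl l m)" by simp
    from arg_cong[OF this, of "\<lambda>e. app e z"] have f: "app (fac (Suc l) k) u = 0"
      unfolding u_def by (simp add: clinear_diff[OF clinear_app])
    have "app (dl l (Suc k) * dr l m) z \<in> tdeg (Suc l + k + Suc n)"
      using gen_tdeg[OF gen_dl d2, of l "Suc k"] by simp
    moreover have "app (dr (Suc l) (Suc k) * dl l m) z \<in> tdeg (Suc l + k + Suc n)"
      using gen_tdeg[OF gen_dr d1, of "Suc l" "Suc k"] by simp
    ultimately have "u \<in> tdeg (Suc l + k + Suc n)" unfolding u_def by (rule cvec.subspace_diff[OF subspace_tdeg])
    from W_fac[OF this f] have "W (Suc l) k (app (dl l (Suc k)) (app (dr l m) z)) = W (Suc l) k (app (dr (Suc l) (Suc k)) (app (dl l m) z))"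
      unfolding u_def by (simp add: clinear_diff[OF clinear_W])
    \<comment> \<open>\<open>del\<close> raises l by one, so \<open>delbar\<close> applied after it
      carries the opposite sign; equality of the two braided terms therefore means
      anticommutation.\<close>
    then show ?thesis unfolding del_W[OF z] delbar_W[OF z] clinear_scale[OF del(1)] clinear_scale[OF delbar(1)]
      using del_W[OF d2] delbar_W[OF d1] by (simp add: 3 scaleC_scaleC)
  qed
qed

end

text \<open>Exponents of reversal signs: reversing m + n odd factors means reversing both groups and
  exchanging them.\<close>

lemma choose_two_add: "(m + n) choose 2 = (m choose 2) + (n choose 2) + m * n"
  by (induction m) (simp_all add: numeral_2_eq_2)

text \<open>Reversal of n factors takes the generator at i to the one at n - 2 - i, so increasing
  runs become decreasing ones.\<close>

lemma flip_upt: "Suc e \<le> n \<Longrightarrow> map (\<lambda>i. n - Suc (Suc i)) [a..<e] = rev [n - 1 - e..<n - 1 - a]"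
  by (rule nth_equalityI) (auto simp: rev_nth)

locale unitary_braided_comodule =
  real_coquasitriangular_hopf_star_algebra comult counit antipode star R + braided_comodule comult counit antipode R \<delta>
  for comult :: "'h::complex_algebra_1 \<Rightarrow> 'h \<otimes> 'h" and counit antipode star R and \<delta> :: "'v::complex_vector \<Rightarrow> 'v \<otimes> 'h" +
  fixes starV :: "'v \<Rightarrow> 'v"
  assumes unitary: "unitary_comodule comult counit star \<delta> starV"
begin

subsection \<open>The *-operation\<close>

lemma starV_antilinear: "antilinear starV" and starV_starV: "starV (starV v) = v"
  and starV_delta: "tmap_anti starV star (\<delta> v) = \<delta> (starV v)"
  using unitary by (simp_all add: unitary_comodule_def)

lemma antilinear_word: "antilinear (\<lambda>v. tword (rev (map starV (xs @ v # ys))))"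
  using clinear_antilinear[OF clin_tword[OF clin_id, of "rev (map starV ys)" "rev (map starV xs)"] starV_antilinear] by simp

text \<open>Reversal without signs, from which the stars on \<open>B\<close> and on
  \<open>\<Lambda>(V)\<close> are induced, the latter with one sign in each degree.\<close>

definition dag :: "'v tensor_algebra \<Rightarrow> 'v tensor_algebra"
  where "dag = talift_anti (\<lambda>vs. tword (rev (map starV vs)))"

lemma antilinear_dag: "antilinear dag" and dag_tword: "dag (tword vs) = tword (rev (map starV vs))"
  unfolding dag_def by (rule antilinear_talift_anti talift_anti_tword, rule antilinear_word)+

lemma dag_dag: "dag (dag x) = x"
proof -
  have "\<forall>x. dag (dag x) = x"
    by (rule tword_ext[OF antilinear_antilinear[OF antilinear_dag antilinear_dag] clin_id])
      (simp add: dag_tword rev_map comp_def starV_starV)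
  then show ?thesis by blast
qed

lemma dag_tmul: "dag (tmul x y) = tmul (dag y) (dag x)"
proof -
  note l = antilinear_clinear[OF antilinear_dag clinear_tmul_right] antilinear_clinear[OF antilinear_dag clinear_tmul_left]
    clinear_antilinear[OF clinear_tmul_right antilinear_dag] clinear_antilinear[OF clinear_tmul_left antilinear_dag]
  have "\<forall>y. dag (tmul (tword xs) y) = tmul (dag y) (dag (tword xs))" for xs
    by (rule antilinear_tword_ext[OF l(1) l(4)]) (simp add: dag_tword)
  then have "\<forall>x. dag (tmul x y) = tmul (dag y) (dag x)"
    by (intro antilinear_tword_ext[OF l(2) l(3)]) blast
  then show ?thesis by blast
qed

lemma dag_tdeg: "x \<in> tdeg n \<Longrightarrow> dag x \<in> tdeg n"
  unfolding tdeg_def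
proof (induction rule: cvec.span_induct_alt)
  case base
  show ?case by (simp add: antilinear_zero[OF antilinear_dag] cvec.span_zero)
next
  case (step c x y)
  then obtain xs where "x = tword xs" "length xs = n" by blast
  then have "dag x \<in> cvec.span {tword xs |xs. length xs = n}"
    by (intro cvec.span_base) (auto simp: dag_tword)
  with step show ?case
    by (simp add: antilinear_add[OF antilinear_dag] antilinear_scale[OF antilinear_dag] cvec.span_add cvec.span_scale)
qed

lemma dag_pair2: "dag (pair2 z) = pair2 (tlift_anti (\<lambda>v w. starV w \<otimes> starV v) z)"
proof -
  note f = antilinear_tens_left[OF starV_antilinear] antilinear_tens_right[OF starV_antilinear]
  note t = antilinear_tlift_anti[OF f] tlift_anti_tens[OF f]
  have "\<forall>z. dag (pair2 z) = pair2 (tlift_anti (\<lambda>v w. starV w \<otimes> starV v) z)"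
    by (rule antilinear_tensor_ext[OF antilinear_clinear[OF antilinear_dag clinear_pair2] clinear_antilinear[OF clinear_pair2 t(1)]])
      (simp add: pair2_tens dag_tword t(2))
  then show ?thesis by blast
qed

lemma dag_b:
  assumes "x \<in> tdeg n" "Suc i < n"
  shows "dag (app (b i) x) = app (b (n - Suc (Suc i))) (dag x)"
proof -
  have "\<forall>x\<in>tdeg n. dag (app (b i) x) = app (b (n - Suc (Suc i))) (dag x)"
  proof (rule antilinear_tdeg_ext[OF antilinear_clinear[OF antilinear_dag clinear_app] clinear_antilinear[OF clinear_app antilinear_dag]])
    fix xs :: "'v list" assume n: "length xs = n"
    with assms(2) obtain p u v r where xs: "xs = p @ u # v # r" "length p = i" using split_at[of i xs] by blast
    have r: "length (rev (map starV r)) = n - Suc (Suc i)" using n xs by simp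
    have "dag (app (b i) (tword xs)) = tmul (dag (tword r)) (tmul (dag (pair2 (braiding R \<delta> \<delta> (u \<otimes> v)))) (dag (tword p)))"
      unfolding xs(1) b_tword_split[OF xs(2)] dag_tmul ..
    also have "dag (pair2 (braiding R \<delta> \<delta> (u \<otimes> v))) = pair2 (braiding R \<delta> \<delta> (starV v \<otimes> starV u))"
      unfolding dag_pair2 braiding_star[OF delta_linear starV_antilinear starV_delta] ..
    also have "tmul (dag (tword r)) (tmul \<dots> (dag (tword p))) = app (b (n - Suc (Suc i))) (dag (tword xs))"
      unfolding xs(1) using b_tword_split[OF r, of "starV v" "starV u" "rev (map starV p)"]
      by (simp add: dag_tword tmul_assoc)
    finally show "dag (app (b i) (tword xs)) = app (b (n - Suc (Suc i))) (dag (tword xs))" .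
  qed
  with assms(1) show ?thesis by blast
qed

lemma dag_bw:
  assumes x: "x \<in> tdeg n" and i: "\<forall>i\<in>set is. Suc i < n"
  shows "dag (app (bw is) x) = app (bw (map (\<lambda>i. n - Suc (Suc i)) is)) (dag x)"
  using i
proof (induction "is")
  case (Cons i "is")
  have "app (bw is) x \<in> tdeg n" using x by (simp add: be_bw[symmetric] be_tdeg)
  from dag_b[OF this, of i] Cons show ?case by (simp add: bw_Cons)
qed simp

text \<open>Peels off the first strand of the moving block: its reversed path is the last crossing
  on the mirrored side, where \<open>cr_add_right\<close> attaches it.\<close>

lemma dag_cr: "x \<in> tdeg n \<Longrightarrow> k + a + c \<le> n \<Longrightarrow> dag (app (cr k a c) x) = app (cr (n - k - a - c) c a) (dag x)"
proof (induction a arbitrary: k)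
  case (Suc a)
  define K where "K = n - k - Suc a - c"
  have "app (cr (Suc k) a c) x \<in> tdeg n" by (rule gen_tdeg[OF gen_cr Suc.prems(1)])
  then have "dag (app (cr k (Suc a) c) x) =
      app (bw (map (\<lambda>i. n - Suc (Suc i)) (rev [k..<k + c]))) (dag (app (cr (Suc k) a c) x))"
    using Suc.prems(2) by (simp add: cr_Suc_left[of k a] cr_single_left) (subst dag_bw, auto)
  also have "map (\<lambda>i. n - Suc (Suc i)) (rev [k..<k + c]) = [K + a..<K + a + c]"
    using flip_upt[of "k + c" n k] Suc.prems(2) by (simp add: rev_map[symmetric] K_def)
  also have "dag (app (cr (Suc k) a c) x) = app (cr K c a) (dag x)"
    using Suc.IH[of "Suc k"] Suc.prems by (simp add: K_def)
  also have "app (bw [K + a..<K + a + c]) (app (cr K c a) (dag x)) = app (cr K c (Suc a)) (dag x)"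
    using cr_add_right[of K c a "Suc 0"] by (simp add: cr_single_right)
  finally show ?case by (simp add: K_def)
qed simp

lemma dag_sum: "dag (app (sum f A) x) = (\<Sum>i\<in>A. dag (app (f i) x))"
  by (simp add: app_sum antilinear_sum[OF antilinear_dag])

lemma dag_dl:
  assumes "x \<in> tdeg n" "l + m \<le> n"
  shows "dag (app (dl l m) x) = app (dr (n - l - m) m) (dag x)"
  unfolding dl_def dr_def dag_sum unfolding app_sum
proof (rule sum.cong)
  fix j assume j: "j \<in> {..<m}"
  have "map (\<lambda>i. n - Suc (Suc i)) [l..<l + j] = rev [n - l - m + m - 1 - j..<n - l - m + m - 1]"
    using flip_upt[of "l + j" n l] j assms(2) by (simp add: algebra_simps)
  then show "dag (app (bw [l..<l + j]) x) = app (bw (rev [n - l - m + m - 1 - j..<n - l - m + m - 1])) (dag x)"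
    using j assms by (subst dag_bw[OF assms(1)]) auto
qed simp

text \<open>Reversal exchanges building the factorial from the last strand with building it from the
  first, and \<open>fac_Suc_left\<close> says that the results agree. Hence the kernels that define
  \<open>B\<close> are stable under reversal.\<close>

lemma dag_fac: "x \<in> tdeg n \<Longrightarrow> k + m \<le> n \<Longrightarrow> dag (app (fac k m) x) = app (fac (n - k - m) m) (dag x)"
proof (induction m)
  case (Suc m)
  define K where "K = n - k - Suc m"
  have d: "app (fac k m) x \<in> tdeg n" by (rule gen_tdeg[OF gen_fac Suc.prems(1)])
  have "dag (app (fac k (Suc m)) x) = (\<Sum>j\<le>m. dag (app (bw [k + m - j..<k + m]) (app (fac k m) x)))"
    by (simp add: dag_sum)
  also have "\<dots> = (\<Sum>j\<le>m. app (bw (rev [K..<K + j])) (dag (app (fac k m) x)))"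
  proof (rule sum.cong)
    fix j assume j: "j \<in> {..m}"
    have "map (\<lambda>i. n - Suc (Suc i)) [k + m - j..<k + m] = rev [K..<K + j]"
      using flip_upt[of "k + m" n "k + m - j"] j Suc.prems(2) by (simp add: K_def algebra_simps)
    then show "dag (app (bw [k + m - j..<k + m]) (app (fac k m) x)) = app (bw (rev [K..<K + j])) (dag (app (fac k m) x))"
      using j Suc.prems by (subst dag_bw[OF d]) auto
  qed simp
  also have "\<dots> = app (ins K (Suc m)) (dag (app (fac k m) x))"
    by (simp only: ins_def app_sum lessThan_Suc_atMost)
  also have "dag (app (fac k m) x) = app (fac (Suc K) m) (dag x)"
    using Suc.IH Suc.prems by (simp add: K_def Suc_diff_Suc)
  also have "app (ins K (Suc m)) (app (fac (Suc K) m) (dag x)) = app (fac K (Suc m)) (dag x)"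
    unfolding fac_Suc_left by simp
  finally show ?case by (simp add: K_def)
qed simp

abbreviation "EL \<equiv> exterior_star R \<delta> starV"

abbreviation "NB \<equiv> nichols_star R \<delta> starV"

definition esd :: "'v tensor_algebra \<Rightarrow> 'v tensor_algebra"
  where "esd = talift_anti (\<lambda>vs. (-1) ^ (length vs choose 2) *\<^sub>C tword (rev (map starV vs)))"

lemma antilinear_esd: "antilinear esd"
  and esd_tword: "esd (tword vs) = (-1) ^ (length vs choose 2) *\<^sub>C dag (tword vs)"
proof -
  have a: "antilinear (\<lambda>v. (-1) ^ (length (xs @ v # ys) choose 2) *\<^sub>C tword (rev (map starV (xs @ v # ys))))" for xs ys
    using clinear_antilinear[OF clin_scale[OF clin_id] antilinear_word[of xs ys]] by simp
  show "antilinear esd" unfolding esd_def by (rule antilinear_talift_anti, rule a)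
  show "esd (tword vs) = (-1) ^ (length vs choose 2) *\<^sub>C dag (tword vs)"
    unfolding esd_def dag_tword by (rule talift_anti_tword, rule a)
qed

lemma esd_tdeg: "x \<in> tdeg n \<Longrightarrow> esd x = (-1) ^ (n choose 2) *\<^sub>C dag x"
  using antilinear_tdeg_ext[OF antilinear_esd clinear_antilinear[OF clin_scale[OF clin_id] antilinear_dag], of n "(-1) ^ (n choose 2)"]
  by (simp add: esd_tword)

lemma EL: "antilinear EL" "EL (qL x) = qL (esd x)"
proof -
  have a: "antilinear (\<lambda>x. qL (esd x))" by (rule clinear_antilinear[OF clinear_qL antilinear_esd])
  have k: "qL (esd x) = 0" if "x \<in> cvec.span IL" for x
  proof -
    \<comment> \<open>\<open>IL_kill\<close> concerns linear maps, so it is applied to the map into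
      the conjugate space.\<close>
    have "conj (qL (esd x)) = 0"
    proof (rule IL_kill[OF _ _ that])
      show "clinear (\<lambda>x. conj (qL (esd x)))" by (simp add: clinear_conj_iff a)
      fix n i and x :: "'v tensor_algebra" assume x: "x \<in> tdeg n" "Suc i < n"
      have "qL (dag x + app (b (n - Suc (Suc i))) (dag x)) = 0"
        using x by (intro qL_b[OF dag_tdeg[OF x(1)]]) auto
      then have "qL (esd (x + app (b i) x)) = 0"
        unfolding antilinear_add[OF antilinear_esd] esd_tdeg[OF x(1)] esd_tdeg[OF b_tdeg[OF x(1)]] dag_b[OF x]
          scaleC_add_right[symmetric] clinear_scale[OF clinear_qL] by simp
      then show "conj (qL (esd (x + app (b i) x))) = 0" by (simp add: zero_conj_def)
    qed
    then show ?thesis by (simp add: zero_conj_def conj_inject)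
  qed
  have e: "EL = qlift_anti IL (\<lambda>x. qL (esd x))"
    unfolding exterior_star_def Let_def IL_def[symmetric] qL_def[symmetric] esd_def[symmetric] ..
  show "antilinear EL" unfolding e by (rule antilinear_qlift_anti[OF a k])
  show "EL (qL x) = qL (esd x)" unfolding e by (subst (2) qL_def, rule qlift_anti_qcls[OF a k])
qed

lemma NB: "antilinear NB" "NB (qB x) = qB (dag x)"
proof -
  have a: "antilinear (\<lambda>x. qB (dag x))" by (rule clinear_antilinear[OF clinear_qB antilinear_dag])
  have k: "qB (dag x) = 0" if "x \<in> cvec.span IB" for x
  proof -
    have "conj (qB (dag x)) = 0"
    proof (rule IB_kill[OF _ _ that])
      show "clinear (\<lambda>x. conj (qB (dag x)))" by (simp add: clinear_conj_iff a)
      fix n and x :: "'v tensor_algebra" assume x: "x \<in> tdeg n" "app (fac 0 n) x = 0"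
      have "app (fac 0 n) (dag x) = 0"
        using dag_fac[OF x(1), of 0 n] by (simp add: x(2) antilinear_zero[OF antilinear_dag])
      then have "qB (dag x) = 0" by (rule qB_fac[OF dag_tdeg[OF x(1)]])
      then show "conj (qB (dag x)) = 0" by (simp add: zero_conj_def)
    qed
    then show ?thesis by (simp add: zero_conj_def conj_inject)
  qed
  have e: "NB = qlift_anti IB (\<lambda>x. qB (dag x))"
    unfolding nichols_star_def Let_def IB_def[symmetric] qB_def[symmetric] dag_def[symmetric] ..
  show "antilinear NB" unfolding e by (rule antilinear_qlift_anti[OF a k])
  show "NB (qB x) = qB (dag x)" unfolding e by (subst (2) qB_def, rule qlift_anti_qcls[OF a k])
qed

abbreviation "star\<Omega> \<equiv> Omega_star R \<delta> starV"

text \<open>The sign (-1)^(p q) depends on two parities at once. For s = (-1)^p and t = (-1)^q it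
  equals (1 + s + t - s t) / 2, and \<open>tw\<close> is this polynomial in the two parity
  operators.\<close>

lemma Omega_star: "antilinear star\<Omega>"
  "\<omega> \<in> deg Ext p \<Longrightarrow> x \<in> total_space Nic \<Longrightarrow> \<eta> \<in> deg Ext q \<Longrightarrow>
    star\<Omega> ((\<omega> \<otimes> x) \<otimes> \<eta>) = (-1) ^ (p * q) *\<^sub>C ((EL \<eta> \<otimes> NB x) \<otimes> EL \<omega>)"
proof -
  define \<sigma>1 :: "'v forms \<Rightarrow> 'v forms" where "\<sigma>1 = tmap (tmap sgnL (\<lambda>x. x)) (\<lambda>x. x)"
  define \<sigma>2 :: "'v forms \<Rightarrow> 'v forms" where "\<sigma>2 = tmap (\<lambda>x. x) sgnL"
  define tw where "tw t = (1/2) *\<^sub>C (t + \<sigma>1 t + \<sigma>2 t - \<sigma>1 (\<sigma>2 t))" for t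
  define rv :: "'v forms \<Rightarrow> 'v forms" where "rv = tlift (\<lambda>z \<eta>. tlift (\<lambda>\<omega> x. (\<eta> \<otimes> x) \<otimes> \<omega>) z)"
  define s where "s t = rv (tmap_anti (tmap_anti EL NB) EL (tw t))" for t
  note a = antilinear_tmap_anti[OF antilinear_tmap_anti[OF EL(1) NB(1)] EL(1)]
  have s1: "clinear \<sigma>1" and s2: "clinear \<sigma>2" unfolding \<sigma>1_def \<sigma>2_def by (intro clinear_tmap clin sgnL)+
  have tw: "clinear tw" unfolding tw_def by (intro clin s1 s2 clinear_compose[OF s1 s2])
  have rv: "clinear rv" unfolding rv_def by (rule clin_tlift_arg[OF _ _ clin_id]) (intro clin)+
  have rvt: "rv ((u \<otimes> y) \<otimes> w) = (w \<otimes> y) \<otimes> u" for u y w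
    unfolding rv_def by (subst tlift_eq) (intro clin | simp add: clin)+
  have "antilinear s" unfolding s_def by (intro clinear_antilinear[OF rv] antilinear_clinear[OF a tw])
  moreover have "s ((\<omega> \<otimes> x) \<otimes> \<eta>) = (-1) ^ (p * q) *\<^sub>C ((EL \<eta> \<otimes> NB x) \<otimes> EL \<omega>)"
    if d: "\<omega> \<in> deg Ext p" "\<eta> \<in> deg Ext q" for p q \<omega> x \<eta>
  proof -
    let ?t = "(\<omega> \<otimes> x) \<otimes> \<eta>"
    have t1: "\<sigma>1 ?t = (-1) ^ p *\<^sub>C ?t" unfolding \<sigma>1_def by (simp add: tmap_tens sgnL clin clinear_tmap Ext_sgn[OF d(1)] tens_scale)
    have t2: "\<sigma>2 ?t = (-1) ^ q *\<^sub>C ?t" unfolding \<sigma>2_def by (simp add: tmap_tens sgnL clin Ext_sgn[OF d(2)] tens_scale)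
    have "tw ?t = ((1/2) * (1 + (-1) ^ p + (-1) ^ q - (-1) ^ q * (-1) ^ p)) *\<^sub>C ?t"
      unfolding tw_def t1 t2 clinear_scale[OF s1]
      by (simp add: scaleC_add_left cvec.scale_left_diff_distrib scaleC_scaleC scaleC_one scaleC_add_right cvec.scale_right_diff_distrib ring_distribs)
    also have "(1/2) * (1 + (-1) ^ p + (-1) ^ q - (-1) ^ q * (-1) ^ p) = ((-1) ^ (p * q) :: complex)"
      by (cases "even p"; cases "even q") auto
    finally have "tw ?t = (-1) ^ (p * q) *\<^sub>C ?t" .
    then show ?thesis unfolding s_def
      by (simp add: antilinear_scale[OF a] clinear_scale[OF rv] tmap_anti_tens EL(1) NB(1) antilinear_tmap_anti rvt)
  qed
  ultimately have "\<exists>s. antilinear s \<and> (\<forall>p q. \<forall>\<omega>\<in>deg Ext p. \<forall>x\<in>total_space Nic. \<forall>\<eta>\<in>deg Ext q.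
      s ((\<omega> \<otimes> x) \<otimes> \<eta>) = (-1) ^ (p * q) *\<^sub>C ((EL \<eta> \<otimes> NB x) \<otimes> EL \<omega>))" by blast
  from someI_ex[OF this] show "antilinear star\<Omega>"
    "\<omega> \<in> deg Ext p \<Longrightarrow> x \<in> total_space Nic \<Longrightarrow> \<eta> \<in> deg Ext q \<Longrightarrow>
    star\<Omega> ((\<omega> \<otimes> x) \<otimes> \<eta>) = (-1) ^ (p * q) *\<^sub>C ((EL \<eta> \<otimes> NB x) \<otimes> EL \<omega>)"
    unfolding Omega_star_def Let_def by blast+
qed

text \<open>The reversals inside the two exterior factors and their exchange contribute three signs;
  \<open>choose_two_add\<close> combines them into the sign of reversing l + n odd factors.\<close>

lemma star_W:
  assumes "z \<in> tdeg (l + m + n)"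
  shows "star\<Omega> (W l m z) = (-1) ^ ((l + n) choose 2) *\<^sub>C W n m (dag z)"
proof -
  have "\<forall>z\<in>tdeg (l + m + n). star\<Omega> (W l m z) = (-1) ^ ((l + n) choose 2) *\<^sub>C W n m (dag z)"
  proof (rule antilinear_tdeg_ext)
    show "antilinear (\<lambda>z. star\<Omega> (W l m z))" by (rule antilinear_clinear[OF Omega_star(1) clinear_W])
    show "antilinear (\<lambda>z. (-1) ^ ((l + n) choose 2) *\<^sub>C W n m (dag z))"
      by (rule clinear_antilinear[OF clin_scale[OF clinear_W] antilinear_dag])
    fix zs :: "'v list" assume "length zs = l + m + n"
    then obtain us vs ws where zs: "zs = us @ vs @ ws" "length us = l" "length vs = m" "length ws = n"
      using tword_split3 by blast
    have d: "tword us \<in> tdeg l" "tword vs \<in> tdeg m" "tword ws \<in> tdeg n" using zs by (auto intro: tword_tdeg)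
    have t: "tword zs = tmul (tword us) (tmul (tword vs) (tword ws))" by (simp add: zs)
    have "star\<Omega> (W l m (tword zs)) = (-1) ^ (l * n) *\<^sub>C ((EL (qL (tword ws)) \<otimes> NB (qB (tword vs))) \<otimes> EL (qL (tword us)))"
      unfolding t W_tmul3[OF d(1,2)] by (rule Omega_star(2)) (auto simp: Ext_deg Nic_total d)
    also have "\<dots> = (-1) ^ ((l + n) choose 2) *\<^sub>C ((qL (dag (tword ws)) \<otimes> qB (dag (tword vs))) \<otimes> qL (dag (tword us)))"
      unfolding EL(2) NB(2) esd_tdeg[OF d(1)] esd_tdeg[OF d(3)] clinear_scale[OF clinear_qL] tens_scale scaleC_scaleC
      by (simp add: choose_two_add power_add mult_ac)
    also have "(qL (dag (tword ws)) \<otimes> qB (dag (tword vs))) \<otimes> qL (dag (tword us)) = W n m (dag (tword zs))"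
      unfolding t dag_tmul tmul_assoc by (rule W_tmul3[symmetric]) (intro dag_tdeg d)+
    finally show "star\<Omega> (W l m (tword zs)) = (-1) ^ ((l + n) choose 2) *\<^sub>C W n m (dag (tword zs))" .
  qed
  with assms show ?thesis by blast
qed

lemma star_star_W:
  assumes z: "z \<in> tdeg (l + m + n)" shows "star\<Omega> (star\<Omega> (W l m z)) = W l m z"
proof -
  have "dag z \<in> tdeg (n + m + l)" using dag_tdeg[OF z] by (simp add: add_ac)
  from star_W[OF this] show ?thesis
    unfolding star_W[OF z] antilinear_scale[OF Omega_star(1)]
    by (simp add: dag_dag scaleC_scaleC scaleC_one add.commute flip: power_add)
qed

lemma star_mul_W:
  assumes z: "z \<in> tdeg (l + m + n)" and z': "z' \<in> tdeg (l' + m' + n')"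
  shows "star\<Omega> (mul Om (W l m z) (W l' m' z')) =
    (-1) ^ ((l + n) * (l' + n')) *\<^sub>C mul Om (star\<Omega> (W l' m' z')) (star\<Omega> (W l m z))"
proof -
  note sc = clinear_scale[OF cbilinear_left[OF Om_mul(1)]] clinear_scale[OF cbilinear_right[OF Om_mul(1)]]
  define N where "N = l + m + n + (l' + m' + n')"
  define C where "C = (l + n choose 2) + (l' + n' choose 2) + (l + n) * (l' + n')"
  have zz: "tmul z z' \<in> tdeg N" unfolding N_def by (rule tmul_tdeg[OF z z'])
  have e: "app (cr (l + m) n (l' + m')) (tmul z z') \<in> tdeg N" by (rule gen_tdeg[OF gen_cr zz])
  have e': "app (cr l m l' * cr (l + m) n (l' + m')) (tmul z z') \<in> tdeg ((l + l') + (m + m') + (n + n'))"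
    using gen_tdeg[OF gen_cr e, of l m l'] by (simp add: N_def add_ac)
  have dz: "dag z \<in> tdeg (n + m + l)" "dag z' \<in> tdeg (n' + m' + l')"
    using dag_tdeg[OF z] dag_tdeg[OF z'] by (simp_all add: add_ac)
  \<comment> \<open>Two words for one exchange of blocks: on the left m' and l' cross n together and
    then l' crosses m; on the right l' crosses n and m at once and then m' crosses n.\<close>
  have X: "cr (n' + m' + n) l' m * cr n' (l' + m') n = cr n' m' n * cr (n' + m') l' (n + m)"
  proof -
    have "cr n' m' n * cr (n' + m') l' (n + m) = cr n' m' n * cr (n' + m' + n) l' m * cr (n' + m') l' n"
      by (simp add: cr_add_right mult.assoc)
    also have "cr n' m' n * cr (n' + m' + n) l' m = cr (n' + m' + n) l' m * cr n' m' n"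
      by (rule gen_commute[OF gen_cr gen_cr]) auto
    finally show ?thesis using cr_add_left[of n' m' l' n] by (simp add: mult.assoc add.commute)
  qed
  have "dag (app (cr l m l' * cr (l + m) n (l' + m')) (tmul z z')) =
      app (cr (n' + m' + n) l' m * cr n' (l' + m') n) (tmul (dag z') (dag z))"
  proof -
    have "dag (app (cr l m l') (app (cr (l + m) n (l' + m')) (tmul z z'))) =
        app (cr (N - l - m - l') l' m) (app (cr (N - (l + m) - n - (l' + m')) (l' + m') n) (dag (tmul z z')))"
      using dag_cr[OF e, of l m l'] dag_cr[OF zz, of "l + m" n "l' + m'"] by (simp add: N_def)
    moreover have "N - l - m - l' = n' + m' + n" "N - (l + m) - n - (l' + m') = n'" by (simp_all add: N_def)
    ultimately show ?thesis by (simp add: dag_tmul)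
  qed
  then have "star\<Omega> (mul Om (W l m z) (W l' m' z')) = (-1) ^ (n * l' + C) *\<^sub>C
      W (n + n') (m + m') (app (cr n' m' n * cr (n' + m') l' (n + m)) (tmul (dag z') (dag z)))"
    unfolding W_mul[OF z z'] antilinear_scale[OF Omega_star(1)] star_W[OF e'] X
    using choose_two_add[of "l + n" "l' + n'"] by (simp add: scaleC_scaleC power_add C_def add_ac)
  moreover have "(-1) ^ ((l + n) * (l' + n')) *\<^sub>C mul Om (star\<Omega> (W l' m' z')) (star\<Omega> (W l m z)) =
      (-1) ^ ((l + n) * (l' + n') + ((l + n choose 2) + ((l' + n' choose 2) + l' * n))) *\<^sub>C
      W (n' + n) (m' + m) (app (cr n' m' n * cr (n' + m') l' (n + m)) (tmul (dag z') (dag z)))"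
    unfolding star_W[OF z] star_W[OF z'] sc W_mul[OF dz(2,1)] scaleC_scaleC power_add mult.assoc ..
  moreover have "n * l' + C = (l + n) * (l' + n') + ((l + n choose 2) + ((l' + n' choose 2) + l' * n))"
    by (simp add: C_def)
  ultimately show ?thesis by (simp only: add.commute[of n' n] add.commute[of m' m])
qed

lemma star_del_W:
  assumes z: "z \<in> tdeg (l + m + n)"
  shows "star\<Omega> (del R \<delta> (W l m z)) = delbar R \<delta> (star\<Omega> (W l m z))"
proof -
  have dz: "dag z \<in> tdeg (n + m + l)" using dag_tdeg[OF z] by (simp add: add_ac)
  have R: "delbar R \<delta> (star\<Omega> (W l m z)) = (-1) ^ (((l + n) choose 2) + n) *\<^sub>C W n (m - 1) (app (dr n m) (dag z))"
    unfolding star_W[OF z] clinear_scale[OF delbar(1)] delbar_W[OF dz] by (simp add: scaleC_scaleC power_add)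
  show ?thesis
  proof (cases m)
    case 0
    then have "dl l m = 0" "dr n m = 0" by (simp_all add: dl_def dr_def)
    then show ?thesis unfolding R del_W[OF z] by (simp add: clinear_zero[OF clinear_W] antilinear_zero[OF Omega_star(1)])
  next
    case (Suc k)
    have d: "app (dl l m) z \<in> tdeg (Suc l + k + n)" using gen_tdeg[OF gen_dl z, of l m] by (simp add: Suc)
    \<comment> \<open>One more odd factor changes the reversal sign by (-1)^(l + n). Together with
      the (-1)^l of \<open>del\<close> this leaves the (-1)^n of \<open>delbar\<close> on a form
      whose left degree is n.\<close>
    have c: "Suc (l + n) choose 2 = l + n + (l + n choose 2)" by (simp add: numeral_2_eq_2)
    have D: "dag (app (dl l m) z) = app (dr n m) (dag z)" using dag_dl[OF z, of l m] by simp
    have "star\<Omega> (del R \<delta> (W l m z)) = (-1) ^ l *\<^sub>C (-1) ^ ((Suc l + n) choose 2) *\<^sub>C W n k (app (dr n m) (dag z))"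
      using star_W[OF d] unfolding del_W[OF z] antilinear_scale[OF Omega_star(1)] D by (simp add: Suc)
    also have "\<dots> = (-1) ^ (((l + n) choose 2) + n) *\<^sub>C W n k (app (dr n m) (dag z))"
      unfolding scaleC_scaleC power_add[symmetric]
      by (rule arg_cong[where f = "\<lambda>c. c *\<^sub>C _"], rule minus_one_power_cong) (auto simp: c)
    finally show ?thesis unfolding R by (simp add: Suc)
  qed
qed

end

section \<open>From representatives to spans: bigrading, calculus, factorisation\<close>

lemma span_UN_span: "cvec.span (\<Union>i\<in>I. cvec.span (S i)) = cvec.span (\<Union>i\<in>I. S i)"
proof (rule antisym)
  show "cvec.span (\<Union>i\<in>I. cvec.span (S i)) \<subseteq> cvec.span (\<Union>i\<in>I. S i)"
    by (intro cvec.span_minimal UN_least cvec.span_mono cvec.subspace_span) auto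
  show "cvec.span (\<Union>i\<in>I. S i) \<subseteq> cvec.span (\<Union>i\<in>I. cvec.span (S i))"
    by (intro cvec.span_mono UN_mono order_refl cvec.span_superset)
qed

lemma bilinear_eq_on_span:
  assumes "\<And>y. clinear (\<lambda>x. f x y)" "\<And>x. clinear (f x)" "\<And>y. clinear (\<lambda>x. g x y)" "\<And>x. clinear (g x)"
    and eq: "\<And>x y. x \<in> A \<Longrightarrow> y \<in> B \<Longrightarrow> f x y = g x y" and "x \<in> cvec.span A" "y \<in> cvec.span B"
  shows "f x y = g x y"
proof -
  have "f x y = g x y" if "x \<in> A" for x
    by (rule clinear_eq_on_span[OF assms(2,4) _ assms(7)]) (rule eq[OF that])
  then show ?thesis by (rule clinear_eq_on_span[OF assms(1,3) _ assms(6)])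
qed

lemma antibilinear_eq_on_span:
  assumes "\<And>y. antilinear (\<lambda>x. f x y)" "\<And>x. antilinear (f x)" "\<And>y. antilinear (\<lambda>x. g x y)" "\<And>x. antilinear (g x)"
    and eq: "\<And>x y. x \<in> A \<Longrightarrow> y \<in> B \<Longrightarrow> f x y = g x y" and "x \<in> cvec.span A" "y \<in> cvec.span B"
  shows "f x y = g x y"
proof -
  have "f x y = g x y" if "x \<in> A" for x
    by (rule antilinear_on_span[OF assms(2,4) _ assms(7)]) (rule eq[OF that])
  then show ?thesis by (rule antilinear_on_span[OF assms(1,3) _ assms(6)])
qed

lemma bilinear_span_into:
  assumes f: "cbilinear f" and i: "\<And>x y. x \<in> A \<Longrightarrow> y \<in> B \<Longrightarrow> f x y \<in> cvec.span C"
    and x: "x \<in> cvec.span A" and y: "y \<in> cvec.span B"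
  shows "f x y \<in> cvec.span C"
proof -
  have "f x y \<in> cvec.span C" if "x \<in> A" for x
    by (rule clinear_span_into[OF cbilinear_right[OF f] _ y]) (rule i[OF that])
  then show ?thesis by (rule clinear_span_into[OF cbilinear_left[OF f] _ x])
qed

lemma antilinear_span_into:
  assumes f: "antilinear f" and i: "\<And>x. x \<in> A \<Longrightarrow> f x \<in> cvec.span C" and x: "x \<in> cvec.span A"
  shows "f x \<in> cvec.span C"
  using x
proof (induction rule: cvec.span_induct_alt)
  case base
  show ?case by (simp add: antilinear_zero[OF f] cvec.span_zero)
next
  case (step c x y)
  then show ?case by (simp add: antilinear_add[OF f] antilinear_scale[OF f] i cvec.span_add cvec.span_scale)
qed

text \<open>Independence by projections: the one for i picks the term f i out of a vanishing
  sum.\<close>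

lemma direct_sumI:
  assumes s: "\<And>i. i \<in> I \<Longrightarrow> cvec.subspace (F i)" and W: "W = cvec.span (\<Union>i\<in>I. F i)"
    and p: "\<And>i. clinear (\<pi> i)" "\<And>i x. i \<in> I \<Longrightarrow> x \<in> F i \<Longrightarrow> \<pi> i x = x"
      "\<And>i j x. i \<in> I \<Longrightarrow> j \<in> I \<Longrightarrow> i \<noteq> j \<Longrightarrow> x \<in> F j \<Longrightarrow> \<pi> i x = 0"
  shows "direct_sum I F W"
  unfolding direct_sum_def
proof (intro conjI allI impI ballI)
  fix J f i
  assume J: "finite J" "J \<subseteq> I" and f: "\<forall>i\<in>J. f i \<in> F i" and 0: "(\<Sum>i\<in>J. f i) = 0" and i: "i \<in> J"
  have "0 = \<pi> i (\<Sum>j\<in>J. f j)" by (simp add: 0 clinear_zero[OF p(1)])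
  also have "\<dots> = (\<Sum>j\<in>J. if j = i then f i else 0)"
    unfolding clinear_sum[OF p(1)]
  proof (rule sum.cong)
    fix j assume "j \<in> J"
    with i f J have "i \<in> I" "j \<in> I" "f j \<in> F j" by auto
    then show "\<pi> i (f j) = (if j = i then f i else 0)" using p(2)[of j "f j"] p(3)[of i j "f j"] by auto
  qed simp
  also have "\<dots> = f i" using J i by simp
  finally show "f i = 0" ..
qed (use s W in auto)

context unitary_braided_comodule
begin

subsection \<open>The bigrading\<close>

abbreviation "P \<equiv> Omega_bideg R \<delta>"

text \<open>The spanning forms on which the formulas for \<open>W\<close> apply: homogeneous also in
  the number m of middle factors, which the bidegree does not record.\<close>

definition PG :: "nat \<Rightarrow> nat \<Rightarrow> 'v forms set"
  where "PG p q = {W p m z | m z. z \<in> tdeg (p + m + q)}"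

lemma PG_I: "z \<in> tdeg (p + m + q) \<Longrightarrow> W p m z \<in> PG p q"
  by (auto simp: PG_def)

lemma PG_E: "x \<in> PG p q \<Longrightarrow> (\<And>m z. z \<in> tdeg (p + m + q) \<Longrightarrow> x = W p m z \<Longrightarrow> thesis) \<Longrightarrow> thesis"
  by (auto simp: PG_def)

lemma bideg_eq: "P p q = cvec.span (PG p q)"
proof (rule antisym)
  let ?S = "{(\<omega> \<otimes> x) \<otimes> \<eta> | \<omega> x \<eta>. \<omega> \<in> deg Ext p \<and> x \<in> total_space Nic \<and> \<eta> \<in> deg Ext q}"
  have e: "P p q = cvec.span ?S" by (simp add: Omega_bideg_def)
  show "P p q \<subseteq> cvec.span (PG p q)" unfolding e
  proof (intro cvec.span_minimal cvec.subspace_span subsetI)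
    fix y assume "y \<in> ?S"
    then obtain u x w where y: "y = (qL u \<otimes> qB x) \<otimes> qL w" and u: "u \<in> tdeg p" and w: "w \<in> tdeg q"
      by (auto simp: Ext_deg Nic_total)
    have "(qL u \<otimes> qB x) \<otimes> qL w \<in> cvec.span (PG p q)"
    proof (rule clinear_span_into[OF _ _ tensor_algebra_span_tdeg[of x], where f = "\<lambda>x. (qL u \<otimes> qB x) \<otimes> qL w"])
      show "clinear (\<lambda>x. (qL u \<otimes> qB x) \<otimes> qL w)" by (intro clin clinear_qB)
      fix x assume "x \<in> (\<Union>n. tdeg n :: 'v tensor_algebra set)"
      then obtain m where x: "x \<in> tdeg m" by blast
      have "tmul u (tmul x w) \<in> tdeg (p + m + q)" using tmul_tdeg[OF u tmul_tdeg[OF x w]] by (simp add: add_ac)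
      then show "(qL u \<otimes> qB x) \<otimes> qL w \<in> cvec.span (PG p q)"
        unfolding W_tmul3[OF u x, symmetric] by (intro cvec.span_base PG_I)
    qed
    then show "y \<in> cvec.span (PG p q)" by (simp add: y)
  qed
  show "cvec.span (PG p q) \<subseteq> P p q" unfolding e
  proof (intro cvec.span_minimal cvec.subspace_span subsetI)
    fix y assume "y \<in> PG p q"
    then obtain m z where z: "z \<in> tdeg (p + m + q)" and y: "y = W p m z" by (rule PG_E)
    show "y \<in> cvec.span ?S" unfolding y
    proof (rule clinear_span_into[OF clinear_W _ z[unfolded tdeg_def]])
      fix x :: "'v tensor_algebra" assume "x \<in> {tword xs |xs. length xs = p + m + q}"
      then obtain us vs ws where x: "x = tword (us @ vs @ ws)" "length us = p" "length vs = m" "length ws = q"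
        using tword_split3 by blast
      have "(qL (tword us) \<otimes> qB (tword vs)) \<otimes> qL (tword ws) \<in> ?S"
        using x tword_tdeg by (fastforce simp: Ext_deg Nic_total)
      then show "W p m x \<in> cvec.span ?S" unfolding x(1) W_tword[OF x(2,3)] by (rule cvec.span_base)
    qed
  qed
qed

lemma Om_deg: "deg Om n = cvec.span (\<Union>p\<le>n. PG p (n - p))"
proof -
  have "deg Om n = cvec.span (\<Union>p\<le>n. P p (n - p))"
  proof (rule antisym)
    have "deg Om n = cvec.span (\<Union>i\<le>n. {u \<otimes> c | u c. u \<in> deg LB i \<and> c \<in> deg Ext (n - i)})"
      by (subst Om_eq) (rule super_tensor_simps)
    also have "\<dots> \<subseteq> cvec.span (\<Union>p\<le>n. P p (n - p))"
    proof (intro cvec.span_minimal cvec.subspace_span UN_least subsetI)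
      fix i x assume i: "i \<in> {..n}" and "x \<in> {u \<otimes> c | u c. u \<in> deg LB i \<and> c \<in> deg Ext (n - i)}"
      then obtain u c where x: "x = u \<otimes> c" and u: "u \<in> deg LB i" and c: "c \<in> deg Ext (n - i)" by blast
      have "u \<otimes> c \<in> P i (n - i)" unfolding Omega_bideg_def
      proof (rule clinear_span_into[OF _ _ u[unfolded LB_deg], where f = "\<lambda>u. u \<otimes> c"])
        fix y assume "y \<in> {qL u \<otimes> qB v |u v. u \<in> tdeg i}"
        then obtain u v where y: "y = qL u \<otimes> qB v" and u: "u \<in> tdeg i" by blast
        have "qL u \<in> deg Ext i" "qB v \<in> total_space Nic" using u by (simp_all add: Ext_deg Nic_total)
        with c show "y \<otimes> c \<in> cvec.span {(\<omega> \<otimes> b) \<otimes> \<eta> |\<omega> b \<eta>. \<omega> \<in> deg Ext i \<and> b \<in> total_space Nic \<and> \<eta> \<in> deg Ext (n - i)}"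
          unfolding y by (intro cvec.span_base) blast
      qed (intro clin)
      with i show "x \<in> cvec.span (\<Union>p\<le>n. P p (n - p))" unfolding x by (intro cvec.span_base) blast
    qed
    finally show "deg Om n \<subseteq> cvec.span (\<Union>p\<le>n. P p (n - p))" .
    show "cvec.span (\<Union>p\<le>n. P p (n - p)) \<subseteq> deg Om n"
    proof -
      have "{(\<omega> \<otimes> x) \<otimes> \<eta> |\<omega> x \<eta>. \<omega> \<in> deg Ext p \<and> x \<in> total_space Nic \<and> \<eta> \<in> deg Ext (n - p)}
          \<subseteq> {u \<otimes> c | u c. u \<in> deg LB p \<and> c \<in> deg Ext (n - p)}" for p
      proof
        fix y assume "y \<in> {(\<omega> \<otimes> x) \<otimes> \<eta> |\<omega> x \<eta>. \<omega> \<in> deg Ext p \<and> x \<in> total_space Nic \<and> \<eta> \<in> deg Ext (n - p)}"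
        then obtain u x c where y: "y = (qL u \<otimes> qB x) \<otimes> c" and u: "u \<in> tdeg p" and c: "c \<in> deg Ext (n - p)"
          unfolding Ext_deg[of p] Nic_total by blast
        have "qL u \<otimes> qB x \<in> deg LB p" unfolding LB_deg using u by (intro cvec.span_base) blast
        with c show "y \<in> {u \<otimes> c | u c. u \<in> deg LB p \<and> c \<in> deg Ext (n - p)}" unfolding y by blast
      qed
      then show ?thesis unfolding Om_eq super_tensor_simps Omega_bideg_def span_UN_span
        by (intro cvec.span_mono UN_mono order_refl)
    qed
  qed
  then show ?thesis by (simp add: bideg_eq span_UN_span)
qed

lemma Om_total: "total_space Om = cvec.span (\<Union>p q. PG p q)"
proof -
  have "(\<Union>n. \<Union>p\<le>n. PG p (n - p)) = (\<Union>p q. PG p q)"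
  proof (intro antisym subsetI)
    fix x assume "x \<in> (\<Union>p q. PG p q)"
    then obtain p q where "x \<in> PG p q" by blast
    then have "x \<in> PG p (p + q - p)" by simp
    then show "x \<in> (\<Union>n. \<Union>p\<le>n. PG p (n - p))" by (meson UN_I UNIV_I atMost_iff le_add1)
  qed blast
  then show ?thesis unfolding total_space_def Om_deg span_UN_span by simp
qed

lemma bideg_total: "P p q \<subseteq> total_space Om"
  unfolding bideg_eq Om_total by (rule cvec.span_mono) blast

lemma deg_total: "deg Om n \<subseteq> total_space Om"
  unfolding total_space_def by (rule order_trans[OF UN_upper cvec.span_superset]) simp

lemma deg_0: "deg Om 0 = P 0 0"
  by (simp add: Om_deg bideg_eq)

lemma bideg_mul: "x \<in> P p q \<Longrightarrow> y \<in> P p' q' \<Longrightarrow> mul Om x y \<in> P (p + p') (q + q')"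
  unfolding bideg_eq
proof (rule bilinear_span_into[OF Om_mul(1)])
  fix x y assume "x \<in> PG p q" "y \<in> PG p' q'"
  then obtain m z m' z' where z: "z \<in> tdeg (p + m + q)" "x = W p m z" and z': "z' \<in> tdeg (p' + m' + q')" "y = W p' m' z'"
    by (elim PG_E)
  have "app (cr p m p' * cr (p + m) q (p' + m')) (tmul z z') \<in> tdeg ((p + p') + (m + m') + (q + q'))"
    using gen_tdeg[OF gen_cr gen_tdeg[OF gen_cr tmul_tdeg[OF z(1) z'(1)]], of p m p' "p + m" q "p' + m'"] by (simp add: add_ac)
  then show "mul Om x y \<in> cvec.span (PG (p + p') (q + q'))"
    unfolding z(2) z'(2) W_mul[OF z(1) z'(1)] by (intro cvec.span_scale cvec.span_base PG_I)
qed

lemma deg_span: "x \<in> deg Om n \<Longrightarrow> x \<in> cvec.span (\<Union>p\<le>n. P p (n - p))"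
  by (simp add: Om_deg bideg_eq span_UN_span)

lemma deg_eq: "deg Om n = cvec.span (\<Union>p\<le>n. P p (n - p))"
  by (simp add: Om_deg bideg_eq span_UN_span)

lemma deg_mul: "x \<in> deg Om m \<Longrightarrow> y \<in> deg Om n \<Longrightarrow> mul Om x y \<in> deg Om (m + n)"
  unfolding deg_eq
proof (rule bilinear_span_into[OF Om_mul(1)])
  fix x y assume "x \<in> (\<Union>p\<le>m. P p (m - p))" "y \<in> (\<Union>p\<le>n. P p (n - p))"
  then obtain p p' where p: "p \<le> m" "x \<in> P p (m - p)" "p' \<le> n" "y \<in> P p' (n - p')" by blast
  then have "mul Om x y \<in> P (p + p') (m + n - (p + p'))" using bideg_mul[OF p(2,4)] by simp
  then show "mul Om x y \<in> cvec.span (\<Union>p\<le>m + n. P p (m + n - p))"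
    using p(1,3) by (intro cvec.span_base UN_I[of "p + p'"]) auto
qed

lemma total_mul: "x \<in> total_space Om \<Longrightarrow> y \<in> total_space Om \<Longrightarrow> mul Om x y \<in> total_space Om"
  unfolding total_space_def
proof (rule bilinear_span_into[OF Om_mul(1)])
  fix x y assume "x \<in> (\<Union>n. deg Om n)" "y \<in> (\<Union>n. deg Om n)"
  then obtain m n where "x \<in> deg Om m" "y \<in> deg Om n" by blast
  from deg_mul[OF this] show "mul Om x y \<in> cvec.span (\<Union>n. deg Om n)" by (blast intro: cvec.span_base)
qed

definition proj :: "nat \<Rightarrow> nat \<Rightarrow> 'v forms \<Rightarrow> 'v forms"
  where "proj p q = tmap (tmap (projL p) (\<lambda>x. x)) (projL q)"

lemma clinear_proj: "clinear (proj p q)"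
  unfolding proj_def by (intro clinear_tmap clin projL)

lemma proj_bideg: "x \<in> P p' q' \<Longrightarrow> proj p q x = (if p = p' \<and> q = q' then x else 0)"
  unfolding Omega_bideg_def
proof (rule clinear_eq_on_span[OF clinear_proj])
  show "clinear (\<lambda>x :: 'v forms. if p = p' \<and> q = q' then x else 0)" by (intro clin)
  fix x assume "x \<in> {(\<omega> \<otimes> b) \<otimes> \<eta> |\<omega> b \<eta>. \<omega> \<in> deg Ext p' \<and> b \<in> total_space Nic \<and> \<eta> \<in> deg Ext q'}"
  then obtain u y w where x: "x = (qL u \<otimes> y) \<otimes> qL w" and u: "u \<in> tdeg p'" and w: "w \<in> tdeg q'"
    by (auto simp: Ext_deg)
  show "proj p q x = (if p = p' \<and> q = q' then x else 0)"
    unfolding x proj_def using tproj_tdeg[OF u, of p] tproj_tdeg[OF w, of q]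
    by (simp add: tmap_tens projL clin clinear_tmap clinear_zero[OF clinear_qL])
qed

lemma direct_sum_bideg: "direct_sum {(p, q). p + q = n} (\<lambda>(p, q). P p q) (deg Om n)"
proof (rule direct_sumI)
  show "cvec.subspace (case i of (p, q) \<Rightarrow> P p q)" for i by (cases i) (simp add: bideg_eq)
  have "(\<Union>p\<le>n. P p (n - p)) = (\<Union>i\<in>{(p, q). p + q = n}. case i of (p, q) \<Rightarrow> P p q)"
  proof (intro antisym subsetI)
    fix x assume "x \<in> (\<Union>p\<le>n. P p (n - p))"
    then obtain p where "p \<le> n" "x \<in> P p (n - p)" by blast
    then show "x \<in> (\<Union>i\<in>{(p, q). p + q = n}. case i of (p, q) \<Rightarrow> P p q)" by (intro UN_I[of "(p, n - p)"]) auto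
  next
    fix x assume "x \<in> (\<Union>i\<in>{(p, q). p + q = n}. case i of (p, q) \<Rightarrow> P p q)"
    then obtain p q where "p + q = n" "x \<in> P p q" by blast
    then show "x \<in> (\<Union>p\<le>n. P p (n - p))" by (intro UN_I[of p]) auto
  qed
  then show "deg Om n = cvec.span (\<Union>i\<in>{(p, q). p + q = n}. case i of (p, q) \<Rightarrow> P p q)" by (simp add: deg_eq)
  show "clinear (case i of (p, q) \<Rightarrow> proj p q)" for i by (cases i) (simp add: clinear_proj)
  fix i x assume "i \<in> {(p, q). p + q = n}"
  show "x \<in> (case i of (p, q) \<Rightarrow> P p q) \<Longrightarrow> (case i of (p, q) \<Rightarrow> proj p q) x = x"
    by (cases i) (simp add: proj_bideg)
  show "i \<noteq> j \<Longrightarrow> x \<in> (case j of (p, q) \<Rightarrow> P p q) \<Longrightarrow> (case i of (p, q) \<Rightarrow> proj p q) x = 0" for j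
    by (cases i; cases j) (auto simp: proj_bideg)
qed

lemma direct_sum_deg: "direct_sum UNIV (deg Om) (total_space Om)"
proof (rule direct_sumI)
  let ?\<pi> = "\<lambda>n x. \<Sum>p\<le>n. proj p (n - p) x"
  show lin: "clinear (?\<pi> n)" for n by (intro clin_sum clinear_proj)
  have e: "?\<pi> n x = (if n = m then x else 0)" if "x \<in> deg Om m" for n m x
  proof (rule clinear_eq_on_span[OF lin _ _ deg_span[OF that]])
    show "clinear (\<lambda>x :: 'v forms. if n = m then x else 0)" by (intro clin)
    fix x assume "x \<in> (\<Union>p\<le>m. P p (m - p))"
    then obtain p where p: "p \<le> m" "x \<in> P p (m - p)" by blast
    have "?\<pi> n x = (\<Sum>k\<le>n. if k = p then (if n = m then x else 0) else 0)"
      by (rule sum.cong) (use p in \<open>auto simp: proj_bideg\<close>)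
    then show "?\<pi> n x = (if n = m then x else 0)" using p(1) by auto
  qed
  show "?\<pi> n x = x" if "x \<in> deg Om n" for n x using e[OF that, of n] by simp
  show "?\<pi> n x = 0" if "n \<noteq> m" "x \<in> deg Om m" for n m x using e[OF that(2), of n] that(1) by simp
qed (simp_all add: Om_deg total_space_def)

lemma unit_deg: "unit Om \<in> deg Om 0"
  unfolding deg_0 bideg_eq W_unit by (intro cvec.span_base PG_I tword_tdeg) simp

lemma total_E:
  assumes "x \<in> (\<Union>p q. PG p q)" obtains p q m z where "z \<in> tdeg (p + m + q)" "x = W p m z"
  using assms by (blast elim: PG_E)

lemma Om_unit:
  assumes "x \<in> total_space Om" shows "mul Om (unit Om) x = x" "mul Om x (unit Om) = x"
proof -
  show "mul Om (unit Om) x = x"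
    by (rule clinear_eq_on_span[OF cbilinear_right[OF Om_mul(1)] clin_id _ assms[unfolded Om_total]])
      (erule total_E, simp add: W_mul_unit)
  show "mul Om x (unit Om) = x"
    by (rule clinear_eq_on_span[OF cbilinear_left[OF Om_mul(1)] clin_id _ assms[unfolded Om_total]])
      (erule total_E, simp add: W_mul_unit)
qed

lemma clin_Om [clin]: "clinear f \<Longrightarrow> clinear (\<lambda>x. mul Om (f x) y)"
  and clin_Om' [clin]: "clinear f \<Longrightarrow> clinear (\<lambda>x. mul Om y (f x))"
  by (rule clinear_compose[OF cbilinear_left[OF Om_mul(1)]] clinear_compose[OF cbilinear_right[OF Om_mul(1)]], assumption)+

lemma Om_assoc:
  assumes "x \<in> total_space Om" "y \<in> total_space Om" "z \<in> total_space Om"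
  shows "mul Om (mul Om x y) z = mul Om x (mul Om y z)"
proof -
  note T = assms[unfolded Om_total]
  have 1: "mul Om (mul Om x y) z = mul Om x (mul Om y z)" if "z \<in> (\<Union>p q. PG p q)" for z
  proof (rule bilinear_eq_on_span[where f = "\<lambda>x y. mul Om (mul Om x y) z" and g = "\<lambda>x y. mul Om x (mul Om y z)", OF _ _ _ _ _ T(1,2)])
    fix x y assume "x \<in> (\<Union>p q. PG p q)" "y \<in> (\<Union>p q. PG p q)"
    with that show "mul Om (mul Om x y) z = mul Om x (mul Om y z)"
      by (elim total_E) (simp add: W_assoc)
  qed (intro clin)+
  show ?thesis
    by (rule clinear_eq_on_span[where f = "mul Om (mul Om x y)" and g = "\<lambda>z. mul Om x (mul Om y z)", OF _ _ 1 T(3)])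
      (intro clin cbilinear_right[OF Om_mul(1)])+
qed

lemma Om_graded_algebra: "is_graded_algebra Om"
  unfolding is_graded_algebra_def is_algebra_def
  using unit_deg deg_total[of 0] direct_sum_deg
  by (auto simp: Om_unit Om_assoc total_mul deg_mul clinear_add[OF cbilinear_left[OF Om_mul(1)]]
      clinear_add[OF cbilinear_right[OF Om_mul(1)]] clinear_scale[OF cbilinear_left[OF Om_mul(1)]]
      clinear_scale[OF cbilinear_right[OF Om_mul(1)]])

subsection \<open>The *-differential calculus\<close>

lemma del_bideg: "x \<in> P p q \<Longrightarrow> del R \<delta> x \<in> P (Suc p) q"
  unfolding bideg_eq
proof (rule clinear_span_into[OF del(1)])
  fix x assume "x \<in> PG p q"
  then obtain m z where z: "z \<in> tdeg (p + m + q)" "x = W p m z" by (rule PG_E)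
  show "del R \<delta> x \<in> cvec.span (PG (Suc p) q)"
  proof (cases m)
    case 0
    then have "dl p m = 0" by (simp add: dl_def)
    then show ?thesis unfolding z(2) del_W[OF z(1)] by (simp add: clinear_zero[OF clinear_W] cvec.span_zero)
  next
    case (Suc k)
    have "app (dl p m) z \<in> tdeg (Suc p + k + q)" using gen_tdeg[OF gen_dl z(1), of p m] by (simp add: Suc)
    from PG_I[OF this] show ?thesis unfolding z(2) del_W[OF z(1)] by (simp add: Suc cvec.span_scale cvec.span_base)
  qed
qed

lemma del_deg: "x \<in> deg Om n \<Longrightarrow> del R \<delta> x \<in> deg Om (Suc n)"
  unfolding deg_eq
proof (rule clinear_span_into[OF del(1)])
  fix x assume "x \<in> (\<Union>p\<le>n. P p (n - p))"
  then obtain p where "p \<le> n" "x \<in> P p (n - p)" by blast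
  with del_bideg[OF this(2)] show "del R \<delta> x \<in> cvec.span (\<Union>p\<le>Suc n. P p (Suc n - p))"
    by (intro cvec.span_base UN_I[of "Suc p"]) auto
qed

lemma del_total: "x \<in> total_space Om \<Longrightarrow> del R \<delta> x \<in> total_space Om"
  unfolding total_space_def
proof (rule clinear_span_into[OF del(1)])
  fix x assume "x \<in> (\<Union>n. deg Om n)"
  then obtain n where "x \<in> deg Om n" by blast
  from del_deg[OF this] show "del R \<delta> x \<in> cvec.span (\<Union>n. deg Om n)" by (intro cvec.span_base) blast
qed

lemma del_derivation:
  assumes x: "x \<in> deg Om n" and y: "y \<in> total_space Om"
  shows "del R \<delta> (mul Om x y) = mul Om (del R \<delta> x) y + (-1) ^ n *\<^sub>C mul Om x (del R \<delta> y)"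
proof (rule bilinear_eq_on_span[where f = "\<lambda>x y. del R \<delta> (mul Om x y)" and
      g = "\<lambda>x y. mul Om (del R \<delta> x) y + (-1) ^ n *\<^sub>C mul Om x (del R \<delta> y)",
      OF _ _ _ _ _ x[unfolded Om_deg] y[unfolded Om_total]])
  note c = clinear_compose[OF del(1)]
  show "clinear (\<lambda>x. del R \<delta> (mul Om x y))" "clinear (\<lambda>y. del R \<delta> (mul Om x y))"
    "clinear (\<lambda>x. mul Om (del R \<delta> x) y + (-1) ^ n *\<^sub>C mul Om x (del R \<delta> y))"
    "clinear (\<lambda>y. mul Om (del R \<delta> x) y + (-1) ^ n *\<^sub>C mul Om x (del R \<delta> y))" for x y
    by (intro clin c del(1))+
  fix x y assume "x \<in> (\<Union>p\<le>n. PG p (n - p))" "y \<in> (\<Union>p q. PG p q)"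
  then obtain p m z p' q' m' z' where p: "p \<le> n" and z: "z \<in> tdeg (p + m + (n - p))" "x = W p m z"
    and z': "z' \<in> tdeg (p' + m' + q')" "y = W p' m' z'" by (blast elim: PG_E total_E)
  show "del R \<delta> (mul Om x y) = mul Om (del R \<delta> x) y + (-1) ^ n *\<^sub>C mul Om x (del R \<delta> y)"
    using del_derivation_W[OF z(1) z'(1)] p unfolding z(2) z'(2) by simp
qed

lemma del_del: "x \<in> total_space Om \<Longrightarrow> del R \<delta> (del R \<delta> x) = 0"
  unfolding Om_total
  by (rule clinear_vanishes_on_span[OF clinear_compose[OF del(1) del(1)]]) (erule total_E, simp add: del_del_W)

lemma del_delbar: "x \<in> total_space Om \<Longrightarrow> del R \<delta> (delbar R \<delta> x) + delbar R \<delta> (del R \<delta> x) = 0"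
  unfolding Om_total
  by (rule clinear_vanishes_on_span[OF clin_add[OF clinear_compose[OF del(1) delbar(1)] clinear_compose[OF delbar(1) del(1)]]])
    (erule total_E, simp add: del_delbar_W)

lemma star_bideg: "x \<in> P p q \<Longrightarrow> star\<Omega> x \<in> P q p"
  unfolding bideg_eq
proof (rule antilinear_span_into[OF Omega_star(1)])
  fix x assume "x \<in> PG p q"
  then obtain m z where z: "z \<in> tdeg (p + m + q)" "x = W p m z" by (rule PG_E)
  have "dag z \<in> tdeg (q + m + p)" using dag_tdeg[OF z(1)] by (simp add: add_ac)
  then show "star\<Omega> x \<in> cvec.span (PG q p)"
    unfolding z(2) star_W[OF z(1)] by (intro cvec.span_scale cvec.span_base PG_I)
qed

lemma star_deg: "x \<in> deg Om n \<Longrightarrow> star\<Omega> x \<in> deg Om n"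
  unfolding deg_eq
proof (rule antilinear_span_into[OF Omega_star(1)])
  fix x assume "x \<in> (\<Union>p\<le>n. P p (n - p))"
  then obtain p where "p \<le> n" "x \<in> P p (n - p)" by blast
  with star_bideg[OF this(2)] show "star\<Omega> x \<in> cvec.span (\<Union>p\<le>n. P p (n - p))"
    by (intro cvec.span_base UN_I[of "n - p"]) auto
qed

lemma star_total: "x \<in> total_space Om \<Longrightarrow> star\<Omega> x \<in> total_space Om"
  unfolding total_space_def
proof (rule antilinear_span_into[OF Omega_star(1)])
  fix x assume "x \<in> (\<Union>n. deg Om n)"
  then obtain n where "x \<in> deg Om n" by blast
  from star_deg[OF this] show "star\<Omega> x \<in> cvec.span (\<Union>n. deg Om n)" by (intro cvec.span_base) blast
qed

lemma star_star': "x \<in> total_space Om \<Longrightarrow> star\<Omega> (star\<Omega> x) = x"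
  unfolding Om_total
  by (rule clinear_eq_on_span[OF antilinear_antilinear[OF Omega_star(1) Omega_star(1)] clin_id])
    (erule total_E, simp add: star_star_W)

lemma star_mul:
  assumes x: "x \<in> deg Om m" and y: "y \<in> deg Om n"
  shows "star\<Omega> (mul Om x y) = (-1) ^ (m * n) *\<^sub>C mul Om (star\<Omega> y) (star\<Omega> x)"
proof (rule antibilinear_eq_on_span[where f = "\<lambda>x y. star\<Omega> (mul Om x y)" and
      g = "\<lambda>x y. (-1) ^ (m * n) *\<^sub>C mul Om (star\<Omega> y) (star\<Omega> x)", OF _ _ _ _ _ x[unfolded Om_deg] y[unfolded Om_deg]])
  show "antilinear (\<lambda>x. star\<Omega> (mul Om x y))" for y
    by (rule antilinear_clinear[OF Omega_star(1) cbilinear_left[OF Om_mul(1)]])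
  show "antilinear (\<lambda>y. star\<Omega> (mul Om x y))" for x
    by (rule antilinear_clinear[OF Omega_star(1) cbilinear_right[OF Om_mul(1)]])
  show "antilinear (\<lambda>x. (-1) ^ (m * n) *\<^sub>C mul Om (star\<Omega> y) (star\<Omega> x))" for y
    by (rule clinear_antilinear[OF clin_scale[OF cbilinear_right[OF Om_mul(1)]] Omega_star(1)])
  show "antilinear (\<lambda>y. (-1) ^ (m * n) *\<^sub>C mul Om (star\<Omega> y) (star\<Omega> x))" for x
    by (rule clinear_antilinear[OF clin_scale[OF cbilinear_left[OF Om_mul(1)]] Omega_star(1)])
  fix x y assume "x \<in> (\<Union>p\<le>m. PG p (m - p))" "y \<in> (\<Union>p\<le>n. PG p (n - p))"
  then obtain p k z p' k' z' where p: "p \<le> m" "p' \<le> n" and z: "z \<in> tdeg (p + k + (m - p))" "x = W p k z"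
    and z': "z' \<in> tdeg (p' + k' + (n - p'))" "y = W p' k' z'" by (blast elim: PG_E)
  show "star\<Omega> (mul Om x y) = (-1) ^ (m * n) *\<^sub>C mul Om (star\<Omega> y) (star\<Omega> x)"
    using star_mul_W[OF z(1) z'(1)] p unfolding z(2) z'(2) by simp
qed

lemma star_del: "x \<in> total_space Om \<Longrightarrow> star\<Omega> (del R \<delta> x) = delbar R \<delta> (star\<Omega> x)"
  unfolding Om_total
  by (rule antilinear_on_span[OF antilinear_clinear[OF Omega_star(1) del(1)] clinear_antilinear[OF delbar(1) Omega_star(1)]])
    (erule total_E, simp add: star_del_W)

text \<open>Transfers the statements about \<open>del\<close> to \<open>delbar\<close> by
  conjugation, which spares a second computation with right ends of strands.\<close>

lemma delbar_eq: "x \<in> total_space Om \<Longrightarrow> delbar R \<delta> x = star\<Omega> (del R \<delta> (star\<Omega> x))"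
  by (simp add: star_del star_total star_star')

lemma delbar_bideg: "x \<in> P p q \<Longrightarrow> delbar R \<delta> x \<in> P p (Suc q)"
  using bideg_total[of p q] by (simp add: delbar_eq star_bideg del_bideg subset_iff)

lemma delbar_deg: "x \<in> deg Om n \<Longrightarrow> delbar R \<delta> x \<in> deg Om (Suc n)"
  using deg_total[of n] by (simp add: delbar_eq star_deg del_deg subset_iff)

lemma star_delbar: "x \<in> total_space Om \<Longrightarrow> star\<Omega> (delbar R \<delta> x) = del R \<delta> (star\<Omega> x)"
  by (simp add: delbar_eq star_star' del_total star_total)

lemma delbar_delbar: "x \<in> total_space Om \<Longrightarrow> delbar R \<delta> (delbar R \<delta> x) = 0"
  by (simp add: delbar_eq star_star' del_total star_total del_del antilinear_zero[OF Omega_star(1)])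

text \<open>Conjugating the Leibniz rule of \<open>del\<close> interchanges its two terms, since the
  involution reverses products. The signs of the reversals agree modulo 2 with the Koszul sign
  (-1)^n.\<close>

lemma delbar_derivation:
  assumes x: "x \<in> deg Om n" and y: "y \<in> total_space Om"
  shows "delbar R \<delta> (mul Om x y) = mul Om (delbar R \<delta> x) y + (-1) ^ n *\<^sub>C mul Om x (delbar R \<delta> y)"
proof (rule clinear_eq_on_span[where f = "\<lambda>y. delbar R \<delta> (mul Om x y)", OF _ _ _ y[unfolded total_space_def]])
  show "clinear (\<lambda>y. delbar R \<delta> (mul Om x y))" by (intro clinear_compose[OF delbar(1)] clin)
  show "clinear (\<lambda>y. mul Om (delbar R \<delta> x) y + (-1) ^ n *\<^sub>C mul Om x (delbar R \<delta> y))"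
    by (intro clin clinear_compose[OF delbar(1)])
  fix y assume "y \<in> (\<Union>n. deg Om n)"
  then obtain k where y: "y \<in> deg Om k" by blast
  have xT: "x \<in> total_space Om" and yT: "y \<in> total_space Om" using x y deg_total by blast+
  have sx: "star\<Omega> x \<in> deg Om n" "del R \<delta> (star\<Omega> x) \<in> deg Om (Suc n)" and sy: "star\<Omega> y \<in> deg Om k" "del R \<delta> (star\<Omega> y) \<in> deg Om (Suc k)"
    using star_deg del_deg x y by blast+
  have "delbar R \<delta> (mul Om x y) = (-1) ^ (n * k) *\<^sub>C star\<Omega> (del R \<delta> (mul Om (star\<Omega> y) (star\<Omega> x)))"
    by (simp add: delbar_eq total_mul xT yT star_mul[OF x y] clinear_scale[OF del(1)] antilinear_scale[OF Omega_star(1)])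
  also have "del R \<delta> (mul Om (star\<Omega> y) (star\<Omega> x)) =
      mul Om (del R \<delta> (star\<Omega> y)) (star\<Omega> x) + (-1) ^ k *\<^sub>C mul Om (star\<Omega> y) (del R \<delta> (star\<Omega> x))"
    by (rule del_derivation[OF sy(1) star_total[OF xT]])
  also have "star\<Omega> \<dots> = (-1) ^ (Suc k * n) *\<^sub>C mul Om x (delbar R \<delta> y) + (-1) ^ k *\<^sub>C (-1) ^ (k * Suc n) *\<^sub>C mul Om (delbar R \<delta> x) y"
    unfolding antilinear_add[OF Omega_star(1)] antilinear_scale[OF Omega_star(1)] star_mul[OF sy(2) sx(1)] star_mul[OF sy(1) sx(2)]
    by (simp add: star_star' xT yT delbar_eq)
  also have "(-1) ^ (n * k) *\<^sub>C ((-1) ^ (Suc k * n) *\<^sub>C mul Om x (delbar R \<delta> y) + (-1) ^ k *\<^sub>C (-1) ^ (k * Suc n) *\<^sub>C mul Om (delbar R \<delta> x) y) =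
      (-1) ^ (n * k + Suc k * n) *\<^sub>C mul Om x (delbar R \<delta> y) + (-1) ^ (n * k + k + k * Suc n) *\<^sub>C mul Om (delbar R \<delta> x) y"
    by (simp add: scaleC_add_right scaleC_scaleC power_add)
  also have "(-1 :: complex) ^ (n * k + Suc k * n) = (-1) ^ n" by (rule minus_one_power_cong) auto
  also have "(-1 :: complex) ^ (n * k + k + k * Suc n) = (-1) ^ 0" by (rule minus_one_power_cong) auto
  finally show "delbar R \<delta> (mul Om x y) = mul Om (delbar R \<delta> x) y + (-1) ^ n *\<^sub>C mul Om x (delbar R \<delta> y)"
    by (simp add: scaleC_one add.commute)
qed

lemma clinear_linear_on: "clinear f \<Longrightarrow> linear_on S f"
  by (simp add: linear_on_def clinear_add clinear_scale)

lemma graded_derivation_del: "graded_derivation Om (del R \<delta>)"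
  and graded_derivation_delbar: "graded_derivation Om (delbar R \<delta>)"
  unfolding graded_derivation_def
  using del_deg delbar_deg del_derivation delbar_derivation clinear_linear_on[OF del(1)] clinear_linear_on[OF delbar(1)]
  by blast+

lemma clinear_d: "clinear (Omega_d R \<delta>)"
  unfolding Omega_d_def by (intro clin del(1) delbar(1))

lemma DGA_Om: "DGA Om (Omega_d R \<delta>)"
  unfolding DGA_def graded_derivation_def
proof (intro conjI allI ballI Om_graded_algebra clinear_linear_on clinear_d)
  show "Omega_d R \<delta> ` deg Om n \<subseteq> deg Om (Suc n)" for n
    by (auto simp: Omega_d_def Om_deg intro!: cvec.span_add del_deg[unfolded Om_deg] delbar_deg[unfolded Om_deg])
  fix n x y assume "x \<in> deg Om n" "y \<in> total_space Om"
  then show "Omega_d R \<delta> (mul Om x y) = mul Om (Omega_d R \<delta> x) y + (-1) ^ n *\<^sub>C mul Om x (Omega_d R \<delta> y)"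
    by (simp add: Omega_d_def del_derivation delbar_derivation clinear_add[OF cbilinear_left[OF Om_mul(1)]]
        clinear_add[OF cbilinear_right[OF Om_mul(1)]] scaleC_add_right)
next
  fix x assume x: "x \<in> total_space Om"
  have "Omega_d R \<delta> (Omega_d R \<delta> x) = del R \<delta> (del R \<delta> x) + (del R \<delta> (delbar R \<delta> x) + delbar R \<delta> (del R \<delta> x)) + delbar R \<delta> (delbar R \<delta> x)"
    by (simp add: Omega_d_def clinear_add[OF del(1)] clinear_add[OF delbar(1)] add_ac)
  then show "Omega_d R \<delta> (Omega_d R \<delta> x) = 0" using x by (simp add: del_del delbar_delbar del_delbar)
qed

lemma star_algebra_Nic: "star_algebra Nic NB"
proof -
  note m = Nic_mul(2) tmul_assoc clinear_add[OF cbilinear_left[OF Nic_mul(1)]] clinear_add[OF cbilinear_right[OF Nic_mul(1)]]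
    clinear_scale[OF cbilinear_left[OF Nic_mul(1)]] clinear_scale[OF cbilinear_right[OF Nic_mul(1)]]
  have "is_algebra Nic" unfolding is_algebra_def Nic_total Nic_unit by (auto simp: m)
  then show ?thesis
    unfolding star_algebra_def antilinear_involution_on_def Nic_total
    by (auto simp: Nic_mul(2) NB(2) dag_dag dag_tmul antilinear_add[OF NB(1)] antilinear_scale[OF NB(1)])
qed

abbreviation "j \<equiv> Omega_incl R \<delta>"

lemma clinear_j: "clinear j"
  unfolding Omega_incl_def by (intro clin)

lemma j_qB: "x \<in> tdeg m \<Longrightarrow> j (qB x) = W 0 m x"
  using W_tmul3[of "tword []" 0 x m "tword []"] tword_tdeg[of "[] :: 'v list" 0]
  by (simp add: Omega_incl_def Ext_unit)

lemma Nic_span: "total_space Nic = cvec.span (\<Union>n. qB ` tdeg n)"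
proof -
  have "range qB = qB ` cvec.span (\<Union>n. tdeg n)" using tensor_algebra_span_tdeg by blast
  also have "\<dots> = cvec.span (\<Union>n. qB ` tdeg n)" unfolding clinear_image_span[OF clinear_qB] image_UN ..
  finally show ?thesis by (simp add: Nic_total)
qed

lemma j_image: "j ` total_space Nic = deg Om 0"
proof -
  have "j ` (\<Union>n. qB ` tdeg n) = PG 0 0"
  proof (intro antisym subsetI)
    fix y assume "y \<in> j ` (\<Union>n. qB ` tdeg n)"
    then obtain n x where x: "x \<in> tdeg n" "y = j (qB x)" by blast
    with PG_I[of x 0 n 0] show "y \<in> PG 0 0" by (simp add: j_qB)
  next
    fix y assume "y \<in> PG 0 0"
    then obtain m z where z: "z \<in> tdeg (0 + m + 0)" "y = W 0 m z" by (rule PG_E)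
    then have "z \<in> tdeg m" "y = j (qB z)" by (simp_all add: j_qB)
    then show "y \<in> j ` (\<Union>n. qB ` tdeg n)" by blast
  qed
  then show ?thesis unfolding Nic_span clinear_image_span[OF clinear_j] deg_0 bideg_eq by simp
qed

text \<open>The counit of \<open>\<Lambda>(V)\<close>, well defined because the relations have
  degree at least 2. Applied to both outer factors, it gives a left inverse of the inclusion of
  \<open>B\<close>.\<close>

definition aug :: "'v tensor_algebra quotients \<Rightarrow> complex"
  where "aug = qlift IL (talift (\<lambda>xs. if xs = [] then 1 else 0))"

lemma aug: "clinear aug" "aug (unit Ext) = 1"
proof -
  have m: "multilinear (\<lambda>xs :: 'v list. if xs = [] then 1 else 0 :: complex)"
    using multilinear_if_length[where P = "\<lambda>n. n = 0" and f = "\<lambda>xs :: 'v list. 1 :: complex"] by simp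
  let ?f = "talift (\<lambda>xs :: 'v list. if xs = [] then 1 else 0 :: complex)"
  have f: "clinear ?f" by (rule clinear_talift[OF m])
  have 0: "?f x = 0" if "x \<in> tdeg n" "n \<noteq> 0" for x n
    by (rule clinear_vanishes_on_span[OF f _ that(1)[unfolded tdeg_def]]) (use that(2) in \<open>auto simp: talift_tword[OF m]\<close>)
  have k: "?f x = 0" if "x \<in> cvec.span IL" for x
  proof (rule IL_kill[OF f _ that])
    fix n i and x :: "'v tensor_algebra" assume x: "x \<in> tdeg n" "Suc i < n"
    then have "x + app (b i) x \<in> tdeg n" by (intro cvec.subspace_add[OF subspace_tdeg] b_tdeg)
    then show "?f (x + app (b i) x) = 0" by (rule 0) (use x in auto)
  qed
  show "clinear aug" unfolding aug_def by (rule clinear_qlift[OF f k])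
  show "aug (unit Ext) = 1" unfolding aug_def Ext_unit qL_def
    by (subst qlift_qcls[OF f k]) (simp_all add: talift_tword[OF m])
qed

lemma j_inj: "inj j"
proof -
  define r :: "'v forms \<Rightarrow> 'v tensor_algebra quotients"
    where "r = tlift (\<lambda>z \<eta>. aug \<eta> *\<^sub>C tlift (\<lambda>\<omega> x. aug \<omega> *\<^sub>C x) z)"
  have "r (j x) = x" for x
    unfolding r_def Omega_incl_def
    by (subst tlift_eq) (intro clin aug clinear_compose[OF aug(1)] | simp add: clin aug scaleC_one)+
  then show ?thesis by (metis injI)
qed

lemma j_mul: "x \<in> total_space Nic \<Longrightarrow> y \<in> total_space Nic \<Longrightarrow> j (mul Nic x y) = mul Om (j x) (j y)"
  unfolding Nic_span
proof (rule bilinear_eq_on_span[where f = "\<lambda>x y. j (mul Nic x y)" and g = "\<lambda>x y. mul Om (j x) (j y)"])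
  show "clinear (\<lambda>x. j (mul Nic x y))" "clinear (\<lambda>y. j (mul Nic x y))"
    "clinear (\<lambda>x. mul Om (j x) (j y))" "clinear (\<lambda>y. mul Om (j x) (j y))" for x y
    by (intro clin clinear_j clinear_compose[OF clinear_j] cbilinear_left[OF Nic_mul(1)] cbilinear_right[OF Nic_mul(1)])+
  fix x y assume "x \<in> (\<Union>n. qB ` tdeg n)" "y \<in> (\<Union>n. qB ` tdeg n)"
  then obtain m n u v where u: "u \<in> tdeg m" "x = qB u" and v: "v \<in> tdeg n" "y = qB v" by blast
  have "u \<in> tdeg (0 + m + 0)" "v \<in> tdeg (0 + n + 0)" using u v by simp_all
  from W_mul[OF this] show "j (mul Nic x y) = mul Om (j x) (j y)"
    by (simp add: u(2) v(2) Nic_mul(2) j_qB[OF u(1)] j_qB[OF v(1)] j_qB[OF tmul_tdeg[OF u(1) v(1)]] scaleC_one)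
qed

lemma j_star: "x \<in> total_space Nic \<Longrightarrow> j (NB x) = star\<Omega> (j x)"
  unfolding Nic_span
proof (rule antilinear_on_span[OF clinear_antilinear[OF clinear_j NB(1)] antilinear_clinear[OF Omega_star(1) clinear_j]])
  fix x assume "x \<in> (\<Union>n. qB ` tdeg n)"
  then obtain n u where u: "u \<in> tdeg n" "x = qB u" by blast
  have "u \<in> tdeg (0 + n + 0)" using u by simp
  from star_W[OF this] show "j (NB x) = star\<Omega> (j x)"
    by (simp add: u(2) NB(2) j_qB[OF u(1)] j_qB[OF dag_tdeg[OF u(1)]] scaleC_one numeral_2_eq_2)
qed

lemma star_calculus: "star_differential_calculus Nic NB j Om (Omega_d R \<delta>) star\<Omega>"
  unfolding star_differential_calculus_def antilinear_involution_on_def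
proof (intro conjI allI ballI star_algebra_Nic DGA_Om clinear_linear_on clinear_j j_mul j_star star_mul star_total star_star')
  show "bij_betw j (total_space Nic) (deg Om 0)"
    using j_image inj_on_subset[OF j_inj subset_UNIV] by (auto simp: bij_betw_def)
  show "j (unit Nic) = unit Om"
    using j_qB[of "tword []" 0] by (simp add: Nic_unit W_unit tword_tdeg)
  show "star\<Omega> ` deg Om n \<subseteq> deg Om n" for n using star_deg by blast
  show "Omega_d R \<delta> (star\<Omega> x) = star\<Omega> (Omega_d R \<delta> x)" if "x \<in> total_space Om" for x
    using that by (simp add: Omega_d_def antilinear_add[OF Omega_star(1)] star_del star_delbar add.commute)
qed (auto simp: antilinear_add[OF Omega_star(1)] antilinear_scale[OF Omega_star(1)])

lemma dolbeault: "dolbeault_double_complex Om P (Omega_d R \<delta>) (del R \<delta>) (delbar R \<delta>) star\<Omega>"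
  unfolding dolbeault_double_complex_def
proof (intro conjI allI ballI direct_sum_bideg graded_derivation_del graded_derivation_delbar del_del delbar_delbar del_delbar
    star_del bideg_mul)
  fix p q x y assume "y \<in> deg Om 0" "x \<in> P p q"
  then show "mul Om y x \<in> P p q" "mul Om x y \<in> P p q"
    using bideg_mul[of y 0 0 x p q] bideg_mul[of x p q y 0 0] by (simp_all add: deg_0)
next
  show "Omega_d R \<delta> x = del R \<delta> x + delbar R \<delta> x" for x by (rule Omega_d_def)
  show "del R \<delta> ` P p q \<subseteq> P (Suc p) q" "delbar R \<delta> ` P p q \<subseteq> P p (Suc q)" for p q
    by (intro image_subsetI del_bideg delbar_bideg, assumption)+
  show "star\<Omega> ` P p q = P q p" for p q
  proof
    show "star\<Omega> ` P p q \<subseteq> P q p" by (intro image_subsetI star_bideg)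
    show "P q p \<subseteq> star\<Omega> ` P p q"
    proof
      fix x assume x: "x \<in> P q p"
      then have "x = star\<Omega> (star\<Omega> x)" using star_star'[of x] subsetD[OF bideg_total, of x q p] by simp
      then show "x \<in> star\<Omega> ` P p q" by (rule image_eqI) (rule star_bideg[OF x])
    qed
  qed
qed

subsection \<open>Factorisability\<close>

lemma balance:
  assumes "x \<in> M" "c \<in> deg Om 0" "y \<in> N"
  shows "qcls (balanced_relations Om M N) (mul Om x c \<otimes> y) = qcls (balanced_relations Om M N) (x \<otimes> mul Om c y)"
  unfolding qcls_eq_iff balanced_relations_def using assms by (intro cvec.span_base) blast

text \<open>Multiplication descends to the balanced tensor product by associativity, and
  \<open>\<Phi>\<close> inverts it. The condition on \<open>\<Phi>\<close> is bilinear, so spanning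
  sets \<open>A\<close> and \<open>B\<close> suitable for the computation are enough.\<close>

lemma wedge_isoI:
  assumes T: "M \<subseteq> total_space Om" "N \<subseteq> total_space Om"
    and M: "M = cvec.span A" and N: "N = cvec.span B"
    and Q: "Q = cvec.span {mul Om x y | x y. x \<in> M \<and> y \<in> N}"
    and \<Phi>: "clinear \<Phi>" "\<And>x y. x \<in> A \<Longrightarrow> y \<in> B \<Longrightarrow> \<Phi> (mul Om x y) = qcls (balanced_relations Om M N) (x \<otimes> y)"
  shows "wedge_is_bimodule_iso Om M N Q"
proof -
  let ?I = "balanced_relations Om M N"
  let ?S = "{x \<otimes> y | x y. x \<in> M \<and> y \<in> N}"
  define f where "f = tlift (mul Om)"
  define \<phi> where "\<phi> = qlift ?I f"
  have f: "clinear f" "\<And>x y. f (x \<otimes> y) = mul Om x y"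
    unfolding f_def by (rule clinear_tlift tlift_tens, rule Om_mul(1))+
  have D: "deg Om 0 \<subseteq> total_space Om" by (rule deg_total)
  have k: "f t = 0" if "t \<in> cvec.span ?I" for t
  proof (rule clinear_vanishes_on_span[OF f(1) _ that])
    fix t assume "t \<in> ?I"
    then obtain x c y where t: "t = mul Om x c \<otimes> y - x \<otimes> mul Om c y" and i: "x \<in> M" "c \<in> deg Om 0" "y \<in> N"
      unfolding balanced_relations_def by blast
    then have "x \<in> total_space Om" "c \<in> total_space Om" "y \<in> total_space Om" using T D by blast+
    from Om_assoc[OF this] show "f t = 0" unfolding t clinear_diff[OF f(1)] f(2) by simp
  qed
  have \<phi>: "clinear \<phi>" "\<And>t. \<phi> (qcls ?I t) = f t"
    unfolding \<phi>_def using clinear_qlift[OF f(1) k] qlift_qcls[OF f(1) k] by blast+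
  have \<Phi>\<phi>: "\<Phi> (\<phi> (qcls ?I t)) = qcls ?I t" if "t \<in> cvec.span ?S" for t
  proof (rule clinear_eq_on_span[where f = "\<lambda>t. \<Phi> (\<phi> (qcls ?I t))", OF _ clinear_qcls _ that])
    show "clinear (\<lambda>t. \<Phi> (\<phi> (qcls ?I t)))"
      by (rule clinear_compose[OF \<Phi>(1) clinear_compose[OF \<phi>(1) clinear_qcls]])
    fix t assume "t \<in> ?S"
    then obtain x y where t: "t = x \<otimes> y" and xy: "x \<in> cvec.span A" "y \<in> cvec.span B" unfolding M N by blast
    have "\<Phi> (mul Om x y) = qcls ?I (x \<otimes> y)"
      by (rule bilinear_eq_on_span[where f = "\<lambda>x y. \<Phi> (mul Om x y)" and g = "\<lambda>x y. qcls ?I (x \<otimes> y)", OF _ _ _ _ \<Phi>(2) xy])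
        (intro clinear_compose[OF \<Phi>(1)] clin cbilinear_left[OF Om_mul(1)] cbilinear_right[OF Om_mul(1)])+
    then show "\<Phi> (\<phi> (qcls ?I t)) = qcls ?I t" unfolding t \<phi>(2) f(2) .
  qed
  have "bij_betw \<phi> (balanced_tensor Om M N) Q"
  proof (rule bij_betw_imageI)
    show "inj_on \<phi> (balanced_tensor Om M N)"
      unfolding balanced_tensor_def by (rule inj_on_inverseI[where g = \<Phi>]) (use \<Phi>\<phi> in blast)
    have "f ` ?S = {mul Om x y | x y. x \<in> M \<and> y \<in> N}"
    proof (intro antisym subsetI)
      fix t assume "t \<in> f ` ?S"
      then obtain x y where "t = f (x \<otimes> y)" "x \<in> M" "y \<in> N" by blast
      then show "t \<in> {mul Om x y | x y. x \<in> M \<and> y \<in> N}" unfolding f(2) by blast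
    next
      fix t assume "t \<in> {mul Om x y | x y. x \<in> M \<and> y \<in> N}"
      then obtain x y where "t = f (x \<otimes> y)" "x \<in> M" "y \<in> N" unfolding f(2) by blast
      then show "t \<in> f ` ?S" by blast
    qed
    then show "\<phi> ` balanced_tensor Om M N = Q"
      unfolding balanced_tensor_def image_image \<phi>(2) clinear_image_span[OF f(1)] Q by simp
  qed
  moreover have "\<phi> (qcls ?I (mul Om c x \<otimes> y)) = mul Om c (\<phi> (qcls ?I (x \<otimes> y)))"
    "\<phi> (qcls ?I (x \<otimes> mul Om y c)) = mul Om (\<phi> (qcls ?I (x \<otimes> y))) c" if "c \<in> deg Om 0" "x \<in> M" "y \<in> N" for c x y
  proof -
    have "c \<in> total_space Om" "x \<in> total_space Om" "y \<in> total_space Om" using that T D by blast+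
    then show "\<phi> (qcls ?I (mul Om c x \<otimes> y)) = mul Om c (\<phi> (qcls ?I (x \<otimes> y)))"
      "\<phi> (qcls ?I (x \<otimes> mul Om y c)) = mul Om (\<phi> (qcls ?I (x \<otimes> y))) c"
      unfolding \<phi>(2) f(2) by (simp_all add: Om_assoc)
  qed
  ultimately show ?thesis
    unfolding wedge_is_bimodule_iso_def Let_def using \<phi> f(2) by (intro exI[of _ \<phi>]) auto
qed

lemma W_mul_right:
  assumes "z \<in> tdeg (p + m)" "z' \<in> tdeg (m' + q)"
  shows "mul Om (W p m z) (W 0 m' z') = W p (m + m') (tmul z z')"
  using W_mul[of z p m 0 z' 0 m' q] assms by (simp add: scaleC_one)

lemma W_mul_zero:
  assumes "z \<in> tdeg m" "z' \<in> tdeg (p + m')"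
  shows "mul Om (W 0 m z) (W p m' z') = W p (m + m') (app (cr 0 m p) (tmul z z'))"
  using W_mul[of z 0 m 0 z' p m' 0] assms by (simp add: scaleC_one)

lemma W_mul_left:
  assumes "c \<in> tdeg q" "z \<in> tdeg (p + m)"
  shows "mul Om (W 0 0 c) (W p m z) = (-1) ^ (q * p) *\<^sub>C W p m (app (cr 0 q (p + m)) (tmul c z))"
  using W_mul[of c 0 0 q z p m 0] assms by simp

lemma W_00: "W 0 0 w = (qL (tword []) \<otimes> qB (tword [])) \<otimes> qL w"
  using W_tmul3[of "tword []" 0 "tword []" 0 w] tword_tdeg[of "[] :: 'v list" 0] by simp

lemma W_no_right: "z \<in> tdeg (p + m) \<Longrightarrow> W p m z = W2 p z \<otimes> qL (tword [])"
  using W_tmul[of z p m "tword []"] by simp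

lemma wedge_iso_right: "wedge_is_bimodule_iso Om (P p 0) (P 0 q) (P p q)"
proof (rule wedge_isoI[OF bideg_total bideg_total bideg_eq bideg_eq])
  let ?I = "balanced_relations Om (P p 0) (P 0 q)"
  let ?e = "qL (tword [])" and ?u = "qB (tword [])"
  \<comment> \<open>The inverse sends \<omega> \<otimes> b \<otimes> \<eta> to (\<omega> \<otimes> 1
    \<otimes> 1) \<otimes> (1 \<otimes> b \<otimes> \<eta>), with all of \<open>B\<close> placed in
    the second factor.\<close>
  let ?g = "\<lambda>z \<eta>. tlift (\<lambda>\<omega> x. ((\<omega> \<otimes> ?u) \<otimes> ?e) \<otimes> ((?e \<otimes> x) \<otimes> \<eta>)) z"
  define \<Phi> :: "'v forms \<Rightarrow> _" where "\<Phi> t = qcls ?I (tlift ?g t)" for t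
  show \<Phi>: "clinear \<Phi>" unfolding \<Phi>_def by (intro clin)
  have \<Phi>_tens: "\<Phi> ((\<omega> \<otimes> x) \<otimes> \<eta>) = qcls ?I (((\<omega> \<otimes> ?u) \<otimes> ?e) \<otimes> ((?e \<otimes> x) \<otimes> \<eta>))" for \<omega> x \<eta>
    unfolding \<Phi>_def by (subst tlift_eq) (intro clin | simp add: clin)+
  have \<Phi>_W: "\<Phi> (W p m (tmul u z)) = qcls ?I (W p 0 u \<otimes> W 0 m z)" if u: "u \<in> tdeg p" and z: "z \<in> tdeg (m + q)" for u z m
  proof -
    have "\<forall>z\<in>tdeg (m + q). \<Phi> (W p m (tmul u z)) = qcls ?I (W p 0 u \<otimes> W 0 m z)"
    proof (rule tdeg_ext)
      show "clinear (\<lambda>z. \<Phi> (W p m (tmul u z)))" by (intro clinear_compose[OF \<Phi>] clin clinear_tmul_right)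
      show "clinear (\<lambda>z. qcls ?I (W p 0 u \<otimes> W 0 m z))" by (intro clin clinear_W)
      fix xs :: "'v list" assume "length xs = m + q"
      then obtain vs ws where xs: "xs = vs @ ws" "length vs = m" using append_take_drop_id[of m xs] by (metis length_take le_add1 min.absorb2)
      have v: "tword vs \<in> tdeg m" using xs by (simp add: tword_tdeg)
      have e: "tword [] \<in> tdeg 0" by (simp add: tword_tdeg)
      have t: "tword xs = tmul (tword vs) (tword ws)" by (simp add: xs)
      show "\<Phi> (W p m (tmul u (tword xs))) = qcls ?I (W p 0 u \<otimes> W 0 m (tword xs))"
        using W_tmul3[OF u v, of "tword ws"] W_tmul3[OF e v, of "tword ws"] W_tmul3[OF u e, of "tword []"]
        unfolding t by (simp add: \<Phi>_tens del: tmul_tword)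
    qed
    with z show ?thesis by blast
  qed
  show "\<Phi> (mul Om x y) = qcls ?I (x \<otimes> y)" if x: "x \<in> PG p 0" and y: "y \<in> PG 0 q" for x y
  proof -
    obtain m z m' z' where z: "z \<in> tdeg (p + m)" "x = W p m z" and z': "z' \<in> tdeg (m' + q)" "y = W 0 m' z'"
      using x y by (auto elim!: PG_E)
    have "\<forall>z\<in>tdeg (p + m). \<Phi> (mul Om (W p m z) y) = qcls ?I (W p m z \<otimes> y)"
    proof (rule tdeg_ext)
      show "clinear (\<lambda>z. \<Phi> (mul Om (W p m z) y))" "clinear (\<lambda>z. qcls ?I (W p m z \<otimes> y))"
        by (intro clinear_compose[OF \<Phi>] clin clinear_W)+
      fix xs :: "'v list" assume "length xs = p + m"
      then obtain us vs where xs: "xs = us @ vs" "length us = p" "length vs = m"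
        using append_take_drop_id[of p xs] by (metis add_diff_cancel_left' length_drop length_take le_add1 min.absorb2)
      have d: "tword us \<in> tdeg p" "tword vs \<in> tdeg m" "tword us \<in> tdeg (p + 0 + 0)" "tword vs \<in> tdeg (0 + m + 0)"
        "tword us \<in> tdeg (p + 0)" "tword vs \<in> tdeg (m + 0)" "tword vs \<in> tdeg (0 + m)" using xs by (simp_all add: tword_tdeg)
      have t: "tword xs = tmul (tword us) (tword vs)" by (simp add: xs)
      have i: "W p 0 (tword us) \<in> P p 0" "W 0 m (tword vs) \<in> deg Om 0"
        unfolding deg_0 bideg_eq by (rule cvec.span_base, rule PG_I, rule d)+
      have y': "y \<in> P 0 q" using y by (simp add: bideg_eq cvec.span_base)
      have zz: "tmul (tword vs) z' \<in> tdeg (m + m' + q)" using tmul_tdeg[OF d(2) z'(1)] by (simp add: add_ac)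
      \<comment> \<open>The middle part of x is a factor from \<open>B\<close> on its right, which
        \<open>balance\<close> carries over to y.\<close>
      have X: "W p m (tword xs) = mul Om (W p 0 (tword us)) (W 0 m (tword vs))"
        using W_mul_right[OF d(5,6)] by (simp add: t)
      have "mul Om (W p m (tword xs)) y = W p (m + m') (tmul (tword us) (tmul (tword vs) z'))"
        using W_mul_right[OF tmul_tdeg[OF d(1,2)] z'(1)] by (simp add: t z'(2) tmul_assoc del: tmul_tword)
      then have "\<Phi> (mul Om (W p m (tword xs)) y) = qcls ?I (W p 0 (tword us) \<otimes> W 0 (m + m') (tmul (tword vs) z'))"
        by (simp add: \<Phi>_W[OF d(1) zz])
      also have "W 0 (m + m') (tmul (tword vs) z') = mul Om (W 0 m (tword vs)) y"
        using W_mul_right[OF d(7) z'(1)] by (simp add: z'(2))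
      also have "qcls ?I (W p 0 (tword us) \<otimes> mul Om (W 0 m (tword vs)) y) = qcls ?I (W p m (tword xs) \<otimes> y)"
        unfolding X by (rule balance[OF i y', symmetric])
      finally show "\<Phi> (mul Om (W p m (tword xs)) y) = qcls ?I (W p m (tword xs) \<otimes> y)" .
    qed
    with z show ?thesis by blast
  qed
  show "P p q = cvec.span {mul Om x y |x y. x \<in> P p 0 \<and> y \<in> P 0 q}"
  proof (rule antisym)
    show "cvec.span {mul Om x y |x y. x \<in> P p 0 \<and> y \<in> P 0 q} \<subseteq> P p q"
    proof (subst bideg_eq[of p q], intro cvec.span_minimal cvec.subspace_span subsetI)
      fix t assume "t \<in> {mul Om x y |x y. x \<in> P p 0 \<and> y \<in> P 0 q}"
      then obtain x y where "t = mul Om x y" "x \<in> P p 0" "y \<in> P 0 q" by blast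
      with bideg_mul[OF this(2,3)] show "t \<in> cvec.span (PG p q)" by (simp add: bideg_eq)
    qed
    show "P p q \<subseteq> cvec.span {mul Om x y |x y. x \<in> P p 0 \<and> y \<in> P 0 q}"
    proof (subst bideg_eq[of p q], intro cvec.span_minimal cvec.subspace_span subsetI)
      fix t assume "t \<in> PG p q"
      then obtain m z where z: "z \<in> tdeg (p + m + q)" "t = W p m z" by (rule PG_E)
      show "t \<in> cvec.span {mul Om x y |x y. x \<in> P p 0 \<and> y \<in> P 0 q}" unfolding z(2)
      proof (rule clinear_span_into[OF clinear_W _ z(1)[unfolded tdeg_def]])
        fix x :: "'v tensor_algebra" assume "x \<in> {tword xs |xs. length xs = p + m + q}"
        then obtain us vs ws where x: "x = tword (us @ vs @ ws)" "length us = p" "length vs = m" "length ws = q"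
          using tword_split3 by blast
        have d: "tword us \<in> tdeg p" "tword (vs @ ws) \<in> tdeg (m + q)" "tword us \<in> tdeg (p + 0)"
          "tword us \<in> tdeg (p + 0 + 0)" "tword (vs @ ws) \<in> tdeg (0 + m + q)" using x by (simp_all add: tword_tdeg)
        have "W p m x = mul Om (W p 0 (tword us)) (W 0 m (tword (vs @ ws)))"
          using W_mul_right[OF d(3,2)] by (simp add: x(1))
        moreover have "W p 0 (tword us) \<in> P p 0" "W 0 m (tword (vs @ ws)) \<in> P 0 q"
          unfolding bideg_eq by (rule cvec.span_base, rule PG_I, rule d)+
        ultimately show "W p m x \<in> cvec.span {mul Om x y |x y. x \<in> P p 0 \<and> y \<in> P 0 q}"
          by (intro cvec.span_base) blast
      qed
    qed
  qed
qed

text \<open>The crossing of q strands to the right end is surjective, so every representative comes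
  from one in which those strands stand in front.\<close>

lemma W_left_span:
  assumes "z \<in> tdeg (p + m + q)"
  shows "W p m z \<in> cvec.span {mul Om (W 0 0 c) (W p m y) | c y. c \<in> tdeg q \<and> y \<in> tdeg (p + m)}"
proof -
  have "z \<in> tdeg (q + (p + m))" using assms by (simp add: add_ac)
  then obtain x where x: "x \<in> tdeg (q + (p + m))" "app (cr 0 q (p + m)) x = z"
    using cr_surj[of 0 q "p + m" "q + (p + m)" z] by auto
  have "W p m (app (cr 0 q (p + m)) x) \<in> cvec.span {mul Om (W 0 0 c) (W p m y) | c y. c \<in> tdeg q \<and> y \<in> tdeg (p + m)}"
  proof (rule clinear_span_into[OF clinear_compose[OF clinear_W clinear_app] _ x(1)[unfolded tdeg_def]])
    fix t :: "'v tensor_algebra" assume "t \<in> {tword xs |xs. length xs = q + (p + m)}"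
    then obtain xs :: "'v list" where t: "t = tword xs" "length xs = q + (p + m)" by blast
    define c where "c = take q xs"
    define y where "y = drop q xs"
    have d: "tword c \<in> tdeg q" "tword y \<in> tdeg (p + m)" using t by (simp_all add: c_def y_def tword_tdeg)
    have "W p m (app (cr 0 q (p + m)) t) = (-1) ^ (q * p) *\<^sub>C mul Om (W 0 0 (tword c)) (W p m (tword y))"
      unfolding W_mul_left[OF d] by (simp add: scaleC_scaleC scaleC_one c_def y_def t flip: power_add)
    with d show "W p m (app (cr 0 q (p + m)) t) \<in> cvec.span {mul Om (W 0 0 c) (W p m y) | c y. c \<in> tdeg q \<and> y \<in> tdeg (p + m)}"
      by (simp only:) (intro cvec.span_scale cvec.span_base, blast)
  qed
  then show ?thesis by (simp add: x(2))
qed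

lemma wedge_iso_left: "wedge_is_bimodule_iso Om (P 0 q) (P p 0) (P p q)"
proof (rule wedge_isoI[OF bideg_total bideg_total _ bideg_eq])
  let ?I = "balanced_relations Om (P 0 q) (P p 0)"
  let ?e = "qL (tword [])" and ?u = "qB (tword [])"
  \<comment> \<open>Here P 0 q is spanned by products of a pure exterior form with an element of
    \<open>B\<close> on its right. That element can be carried over to y, so only products of pure
    exterior forms with P p 0 have to be inverted.\<close>
  let ?A = "{mul Om (W 0 0 c) (W 0 m y) | c m y. c \<in> tdeg q \<and> y \<in> tdeg m}"
  have i: "W 0 0 c \<in> P 0 q" if "c \<in> tdeg q" for c
    unfolding bideg_eq by (intro cvec.span_base PG_I) (use that in simp)
  have i0: "W 0 m y \<in> P 0 0" if "y \<in> tdeg m" for m y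
    unfolding bideg_eq by (intro cvec.span_base PG_I) (use that in simp)
  have ip: "W p m y \<in> P p 0" if "y \<in> tdeg (p + m)" for m y
    unfolding bideg_eq by (intro cvec.span_base PG_I) (use that in simp)
  show "P 0 q = cvec.span ?A"
  proof (rule antisym)
    show "P 0 q \<subseteq> cvec.span ?A"
    proof (subst bideg_eq, intro cvec.span_minimal cvec.subspace_span subsetI)
      fix t assume "t \<in> PG 0 q"
      then obtain m z where z: "z \<in> tdeg (0 + m + q)" "t = W 0 m z" by (rule PG_E)
      have "{mul Om (W 0 0 c) (W 0 m y) |c y. c \<in> tdeg q \<and> y \<in> tdeg (0 + m)} \<subseteq> ?A" by auto
      from W_left_span[OF z(1)] cvec.span_mono[OF this] show "t \<in> cvec.span ?A" unfolding z(2) by blast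
    qed
    show "cvec.span ?A \<subseteq> P 0 q"
    proof (subst bideg_eq, intro cvec.span_minimal cvec.subspace_span subsetI)
      fix t assume "t \<in> ?A"
      then obtain c m y where "t = mul Om (W 0 0 c) (W 0 m y)" "c \<in> tdeg q" "y \<in> tdeg m" by blast
      with bideg_mul[OF i i0, of c y m] show "t \<in> cvec.span (PG 0 q)" by (simp add: bideg_eq)
    qed
  qed
  define G where "G = tlift (\<lambda>(\<eta> :: 'v tensor_algebra quotients) (z :: 'v tensor_algebra quotients \<otimes> 'v tensor_algebra quotients).
    ((?e \<otimes> ?u) \<otimes> \<eta>) \<otimes> (z \<otimes> ?e))"
  \<comment> \<open>Undoes \<open>W_mul_left\<close>: the inverse braiding takes the right exterior
    factor back to the front, and the sign is its own inverse.\<close>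
  define \<Phi> :: "'v forms \<Rightarrow> _" where
    "\<Phi> t = (-1) ^ (q * p) *\<^sub>C qcls ?I (G (inv_braiding (coact Ext) (coact LB) t))" for t
  have G: "clinear G" "G (\<eta> \<otimes> z) = ((?e \<otimes> ?u) \<otimes> \<eta>) \<otimes> (z \<otimes> ?e)" for \<eta> z
    unfolding G_def by (intro clin_tlift_arg[OF _ _ clin_id] clin tlift_eq)+
  note ib = clinear_inv_braiding[OF Ext_coact(1) LB_coact(1)]
  show \<Phi>: "clinear \<Phi>" unfolding \<Phi>_def by (intro clin clinear_compose[OF G(1)] ib)
  have \<Phi>_W: "\<Phi> (mul Om (W 0 0 c) (W p m z)) = qcls ?I (W 0 0 c \<otimes> W p m z)"
    if c: "c \<in> tdeg q" and z: "z \<in> tdeg (p + m)" for c m z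
  proof -
    have "\<forall>z\<in>tdeg (p + m). inv_braiding (coact Ext) (coact LB) (braiding R (coact Ext) (coact LB) (qL c \<otimes> W2 p z)) = qL c \<otimes> W2 p z"
    proof (rule tdeg_ext)
      show "clinear (\<lambda>z. inv_braiding (coact Ext) (coact LB) (braiding R (coact Ext) (coact LB) (qL c \<otimes> W2 p z)))"
        by (intro clinear_compose[OF ib] clinear_compose[OF clinear_braiding(1)[OF R_linear Ext_coact(1) LB_coact(1)]] clin clinear_W2)
      show "clinear (\<lambda>z. qL c \<otimes> W2 p z)" by (intro clin clinear_W2)
      fix xs :: "'v list" assume l: "length xs = p + m"
      define us where "us = take p xs"
      define vs where "vs = drop p xs"
      have u: "tword us \<in> tdeg p" using l by (simp add: us_def tword_tdeg)
      have w: "W2 p (tword xs) = qL (tword us) \<otimes> qB (tword vs)"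
        using W2_tmul[OF u, of "tword vs"] by (simp add: us_def vs_def)
      have lb: "coact LB = tensor_coaction (coact Ext) (coact Nic)" by simp
      show "inv_braiding (coact Ext) (coact LB) (braiding R (coact Ext) (coact LB) (qL c \<otimes> W2 p (tword xs))) = qL c \<otimes> W2 p (tword xs)"
        by (rule inv_braiding_braiding[OF Ext_coact(1) LB_coact(1) Ext_coact(3,4)])
          (unfold w lb, (intro coassoc_at_tensor counit_at_tensor Ext_coact Nic_coact)+)
    qed
    with z have inv: "inv_braiding (coact Ext) (coact LB) (braiding R (coact Ext) (coact LB) (qL c \<otimes> W2 p z)) = qL c \<otimes> W2 p z"
      by blast
    have "\<Phi> (mul Om (W 0 0 c) (W p m z)) = (-1) ^ (q * p) *\<^sub>C \<Phi> (braiding R (coact Ext) (coact LB) (qL c \<otimes> W2 p z))"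
      unfolding W_mul_left[OF c z] braiding_W2[OF c z] clinear_scale[OF \<Phi>] ..
    also have "\<dots> = qcls ?I (G (qL c \<otimes> W2 p z))"
      unfolding \<Phi>_def inv by (simp add: scaleC_scaleC scaleC_one flip: power_add)
    finally show ?thesis by (simp add: G W_00 W_no_right[OF z])
  qed
  show "\<Phi> (mul Om x y) = qcls ?I (x \<otimes> y)" if x: "x \<in> ?A" and y: "y \<in> PG p 0" for x y
  proof -
    obtain c m a where c: "c \<in> tdeg q" and a: "a \<in> tdeg m" and x: "x = mul Om (W 0 0 c) (W 0 m a)" using x by blast
    obtain m' z' where z': "z' \<in> tdeg (p + m')" and y': "y = W p m' z'" using y by (auto elim!: PG_E)
    have yP: "y \<in> P p 0" unfolding y' by (rule ip[OF z'])
    have w: "app (cr 0 m p) (tmul a z') \<in> tdeg (p + (m + m'))"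
      using gen_tdeg[OF gen_cr tmul_tdeg[OF a z'], of 0 m p] by (simp add: add_ac)
    have M: "mul Om (W 0 m a) y = W p (m + m') (app (cr 0 m p) (tmul a z'))"
      unfolding y' by (rule W_mul_zero[OF a z'])
    have "mul Om x y = mul Om (W 0 0 c) (mul Om (W 0 m a) y)"
      unfolding x by (rule Om_assoc) (use i[OF c] i0[OF a] yP bideg_total in blast)+
    then have "\<Phi> (mul Om x y) = qcls ?I (W 0 0 c \<otimes> mul Om (W 0 m a) y)"
      unfolding M by (simp add: \<Phi>_W[OF c w])
    also have "\<dots> = qcls ?I (x \<otimes> y)"
      unfolding x by (rule balance[symmetric, OF i[OF c] _ yP]) (simp add: deg_0 i0[OF a])
    finally show ?thesis .
  qed
  show "P p q = cvec.span {mul Om x y |x y. x \<in> P 0 q \<and> y \<in> P p 0}"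
  proof (rule antisym)
    show "cvec.span {mul Om x y |x y. x \<in> P 0 q \<and> y \<in> P p 0} \<subseteq> P p q"
    proof (subst bideg_eq[of p q], intro cvec.span_minimal cvec.subspace_span subsetI)
      fix t assume "t \<in> {mul Om x y |x y. x \<in> P 0 q \<and> y \<in> P p 0}"
      then obtain x y where "t = mul Om x y" "x \<in> P 0 q" "y \<in> P p 0" by blast
      with bideg_mul[OF this(2,3)] show "t \<in> cvec.span (PG p q)" by (simp add: bideg_eq)
    qed
    show "P p q \<subseteq> cvec.span {mul Om x y |x y. x \<in> P 0 q \<and> y \<in> P p 0}"
    proof (subst bideg_eq[of p q], intro cvec.span_minimal cvec.subspace_span subsetI)
      fix t assume "t \<in> PG p q"
      then obtain m z where z: "z \<in> tdeg (p + m + q)" "t = W p m z" by (rule PG_E)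
      have "{mul Om (W 0 0 c) (W p m y) | c y. c \<in> tdeg q \<and> y \<in> tdeg (p + m)} \<subseteq> {mul Om x y |x y. x \<in> P 0 q \<and> y \<in> P p 0}"
        using i ip by blast
      from W_left_span[OF z(1)] cvec.span_mono[OF this]
      show "t \<in> cvec.span {mul Om x y |x y. x \<in> P 0 q \<and> y \<in> P p 0}" unfolding z(2) by blast
    qed
  qed
qed

lemma factorisable_Om: "factorisable Om P"
  unfolding factorisable_def using wedge_iso_right wedge_iso_left by blast

end

theorem theorem3p3:
  fixes comult :: "'h::complex_algebra_1 \<Rightarrow> 'h \<otimes> 'h"
    and counit :: "'h \<Rightarrow> complex"
    and antipode :: "'h \<Rightarrow> 'h"
    and starH :: "'h \<Rightarrow> 'h"
    and R :: "'h \<otimes> 'h \<Rightarrow> complex"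
    and \<delta> :: "'v::complex_vector \<Rightarrow> 'v \<otimes> 'h"
    and starV :: "'v \<Rightarrow> 'v"
  assumes "real_coquasitriangular_hopf_star_algebra comult counit antipode starH R"
    and "unitary_comodule comult counit starH \<delta> starV"
  shows "star_algebra (nichols_algebra R \<delta>) (nichols_star R \<delta> starV) \<and>
    star_differential_calculus (nichols_algebra R \<delta>) (nichols_star R \<delta> starV) (Omega_incl R \<delta>)
      (Omega R \<delta>) (Omega_d R \<delta>) (Omega_star R \<delta> starV) \<and>
    dolbeault_double_complex (Omega R \<delta>) (Omega_bideg R \<delta>)
      (Omega_d R \<delta>) (del R \<delta>) (delbar R \<delta>) (Omega_star R \<delta> starV) \<and>
    factorisable (Omega R \<delta>) (Omega_bideg R \<delta>)"
proof -
  interpret H: real_coquasitriangular_hopf_star_algebra comult counit antipode starH R by (rule assms(1))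
  interpret V: unitary_braided_comodule comult counit antipode starH R \<delta> starV
    by unfold_locales (use assms(2) in \<open>simp_all add: unitary_comodule_def\<close>)
  show ?thesis using V.star_algebra_Nic V.star_calculus V.dolbeault V.factorisable_Om by blast
qed

end
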